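(* Let $p$ be a prime, $G$ a profinite group, $N$ a closed normal subgroup with $H=G/N\cong\mathbb{F}_p^r$ for some $r\ge1$, $1\le n<p$, $R=\mathbb{F}_p$, $\Omega=\mathbb{F}_p[H]$ with augmentation ideal $I$, and $T$ a compact $\mathbb{F}_p[[G]]$-module finitely generated over $\mathbb{F}_p$. Then there exist $N'\ge1$ and $\chi_1,\dots,\chi_{N'}\in H^\vee$ such that $(p_{\chi_i,n})_{i=1}^{N'}$ is an ordered $\mathbb{F}_p$-basis of $(I^n/I^{n+1})^\vee$. For any such $(\chi_i)$, let $(y_i)_{i=1}^{N'}$ be the basis of $I^n/I^{n+1}$ dual to $(p_{\chi_i,n})$. Then for any $f\in Z^1(G,T\otimes_{\mathbb{F}_p}\Omega/I^n)$, $$\Psi^{(n)}(f)=\sum_{i=1}^{N'}(\chi_i^{(n)},\lambda)_{\rho_i}\cdot y_i,$$ where $\rho_i$ is the proper defining system relative to $\binom{\chi_i}{n}^{\mathrm{mat}}$ attached to $f$ and $\lambda$ is the image of $f$ in $Z^1(G,T)$.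
   Context: $V^\vee=\mathrm{Hom}(V,\mathbb{F}_p)$; characters of $H$ are viewed on $G$ via $G\to H$. $G$ acts on $\Omega$ through $H$ by left multiplication and on tensor products diagonally. $\Psi^{(n)}\colon H^1(G,T\otimes\Omega/I^n)\to H^2(G,T)\otimes I^n/I^{n+1}$ is the connecting map of $0\to T\otimes I^n/I^{n+1}\to T\otimes\Omega/I^{n+1}\to T\otimes\Omega/I^n\to0$, with $H^2(G,T\otimes I^n/I^{n+1})\cong H^2(G,T)\otimes I^n/I^{n+1}$. For $\chi\in H^\vee$, $\binom{\chi}{n}^{\mathrm{mat}}\colon H\to\mathrm{U}_{n+1}(\mathbb{F}_p)$ sends $h$ to the upper-triangular matrix with $(i,j)$-entry $\binom{\chi(h)}{j-i}$ (a homomorphism since $n<p$). The $\mathbb{F}_p[G]$-linear map $\Omega/I^{n+1}\to\mathbb{F}_p^{n+1}$ (columns), $[h]\mapsto\binom{\chi(h)}{n}^{\mathrm{mat}}e_{n+1}$ ($e_{n+1}$ the last standard basis vector; $G$ acting on columns by left multiplication by $\binom{\chi}{n}^{\mathrm{mat}}$), carries $I^n/I^{n+1}$ into the first coordinate; $p_{\chi,n}\in(I^n/I^{n+1})^\vee$ is the resulting map to that coordinate. Tensoring with $T$ gives $p_{\chi,n}\colon T\otimes\Omega/I^n\to T^{n+1}/T$ (quotient by the first coordinate). Let $\mathcal U$ be the group of $(n+2)\times(n+2)$ matrices $\begin{pmatrix}P&v\\0&1\end{pmatrix}$, $P\in\mathrm U_{n+1}(\mathbb F_p)$, $v\in T^{n+1}$,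 $G$ acting on $v$, and $\mathcal U'$ its quotient by matrices with $P=1$ and $v$ zero except its first entry. The proper defining system relative to $\binom{\chi}{n}^{\mathrm{mat}}$ attached to $f$ is the $1$-cocycle $\rho=\begin{pmatrix}\binom{\chi}{n}^{\mathrm{mat}}&p_{\chi,n}\circ f\\0&1\end{pmatrix}\colon G\to\mathcal U'$. With $\tilde\rho$ its lift with $(1,n+2)$-entry $0$ and entries $\rho_{i,j}$, $(\chi^{(n)},\lambda)_\rho\in H^2(G,T)$ is the class of $(g,h)\mapsto\sum_{i=2}^{n+1}\rho_{1,i}(g)\,g\rho_{i,n+2}(h)$. *)

theory Defs
  imports
    "HOL-Algebra.Ideal_Product"
    "HOL-Algebra.Product_Groups"
    "HOL-Analysis.T1_Spaces"
    "Jordan_Normal_Form.VS_Connect"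
    "Berlekamp_Zassenhaus.Finite_Field"
begin

hide_const (open) Modules.module Modules.module.span Polynomial.smult Multiset.mult

text \<open>
  The field \<open>\<bbbF>\<^sub>p\<close> is the type \<open>'p mod_ring\<close> with \<open>'p :: prime_card\<close>, so that \<open>p = CARD('p)\<close>;
  vector spaces over it are modules over \<open>class_ring\<close>. Unused record fields
  \<open>mult\<close>, \<open>one\<close> of a module are \<open>undefined\<close>.
\<close>

section \<open>Topological groups and modules\<close>

record 'g topgroup = "'g monoid" +
  gtop :: "'g topology"

record ('k, 'g, 'm) gmodule = "('k, 'm) module" +
  mtop :: "'m topology"
  gact :: "'g \<Rightarrow> 'm \<Rightarrow> 'm"

definition profinite_group :: "'g topgroup \<Rightarrow> bool" where
  "profinite_group G \<longleftrightarrow>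
     group G \<and> topspace (gtop G) = carrier G \<and>
     continuous_map (prod_topology (gtop G) (gtop G)) (gtop G) (\<lambda>(x, y). x \<otimes>\<^bsub>G\<^esub> y) \<and>
     continuous_map (gtop G) (gtop G) (\<lambda>x. inv\<^bsub>G\<^esub> x) \<and>
     compact_space (gtop G) \<and> Hausdorff_space (gtop G) \<and>
     (\<forall>x\<in>carrier G. connected_component_of_set (gtop G) x = {x})"

text \<open>
  A compact module over the completed group algebra of \<open>G\<close>, given by its continuous linear
  \<open>G\<close>-action; the (finite) scalar field carries the discrete topology.
\<close>

definition compact_gmodule :: "'g topgroup \<Rightarrow> ('k::field, 'g, 'm) gmodule \<Rightarrow> bool" where
  "compact_gmodule G M \<longleftrightarrow>
     module class_ring M \<and> topspace (mtop M) = carrier M \<and>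
     continuous_map (prod_topology (mtop M) (mtop M)) (mtop M) (\<lambda>(x, y). x \<oplus>\<^bsub>M\<^esub> y) \<and>
     continuous_map (prod_topology (discrete_topology UNIV) (mtop M)) (mtop M)
       (\<lambda>(c, x). c \<odot>\<^bsub>M\<^esub> x) \<and>
     compact_space (mtop M) \<and> Hausdorff_space (mtop M) \<and>
     (\<forall>g\<in>carrier G. gact M g \<in> module_hom class_ring M M) \<and>
     (\<forall>x\<in>carrier M. gact M \<one>\<^bsub>G\<^esub> x = x) \<and>
     (\<forall>g\<in>carrier G. \<forall>h\<in>carrier G. \<forall>x\<in>carrier M.
        gact M (g \<otimes>\<^bsub>G\<^esub> h) x = gact M g (gact M h x)) \<and>
     continuous_map (prod_topology (gtop G) (mtop M)) (mtop M) (\<lambda>(g, x). gact M g x)"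

text \<open>
  Used only for finite modules (quotients of \<open>\<Omega>\<close> and their tensor products with \<open>T\<close>), where the
  discrete topology is the only Hausdorff one.
\<close>

definition discrete_gmodule ::
    "('k, 'm) module \<Rightarrow> ('g \<Rightarrow> 'm \<Rightarrow> 'm) \<Rightarrow> ('k, 'g, 'm) gmodule" where
  "discrete_gmodule M a =
     \<lparr>carrier = carrier M, mult = mult M, one = one M, zero = zero M, add = add M,
      smult = smult M, mtop = discrete_topology (carrier M), gact = a\<rparr>"

section \<open>Linear algebra\<close>

definition quot_mod :: "('k, 'm, 'z) module_scheme \<Rightarrow> 'm set \<Rightarrow> ('k, 'm set) module" where
  "quot_mod M S =
     \<lparr>carrier = a_rcosets\<^bsub>M\<^esub> S, mult = undefined, one = undefined, zero = S, add = set_add M,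
      smult = (\<lambda>c A. S <+>\<^bsub>M\<^esub> ((\<lambda>x. c \<odot>\<^bsub>M\<^esub> x) ` A))\<rparr>"

text \<open>The map on cosets induced by a map \<open>\<phi>\<close> that is constant on each coset.\<close>

definition quot_lift :: "('m \<Rightarrow> 'w) \<Rightarrow> 'm set \<Rightarrow> 'w" where
  "quot_lift \<phi> A = the_elem (\<phi> ` A)"

definition free_mod :: "'s set \<Rightarrow> ('k::field, 's \<Rightarrow> 'k) module" where
  "free_mod S =
     \<lparr>carrier = {x. finite {s. x s \<noteq> 0} \<and> {s. x s \<noteq> 0} \<subseteq> S}, mult = undefined, one = undefined,
      zero = (\<lambda>s. 0), add = (\<lambda>x y s. x s + y s), smult = (\<lambda>c x s. c * x s)\<rparr>"

definition delta :: "'s \<Rightarrow> 's \<Rightarrow> 'k::field" where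
  "delta s = (\<lambda>u. if u = s then 1 else 0)"

definition free_lift ::
    "('k::field, 'm, 'z) module_scheme \<Rightarrow> ('s \<Rightarrow> 'm) \<Rightarrow> ('s \<Rightarrow> 'k) \<Rightarrow> 'm" where
  "free_lift M \<phi> x = (\<Oplus>\<^bsub>M\<^esub>s\<in>{s. x s \<noteq> 0}. x s \<odot>\<^bsub>M\<^esub> \<phi> s)"

definition tensor_rels ::
    "('k::field, 'v, 'y) module_scheme \<Rightarrow> ('k, 'w, 'z) module_scheme \<Rightarrow> ('v \<times> 'w \<Rightarrow> 'k) set" where
  "tensor_rels V W =
     (let F = free_mod (carrier V \<times> carrier W) in
       {delta (v \<oplus>\<^bsub>V\<^esub> v', w) \<ominus>\<^bsub>F\<^esub> (delta (v, w) \<oplus>\<^bsub>F\<^esub> delta (v', w)) | v v' w.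
          v \<in> carrier V \<and> v' \<in> carrier V \<and> w \<in> carrier W} \<union>
       {delta (v, w \<oplus>\<^bsub>W\<^esub> w') \<ominus>\<^bsub>F\<^esub> (delta (v, w) \<oplus>\<^bsub>F\<^esub> delta (v, w')) | v w w'.
          v \<in> carrier V \<and> w \<in> carrier W \<and> w' \<in> carrier W} \<union>
       {delta (c \<odot>\<^bsub>V\<^esub> v, w) \<ominus>\<^bsub>F\<^esub> c \<odot>\<^bsub>F\<^esub> delta (v, w) | c v w.
          v \<in> carrier V \<and> w \<in> carrier W} \<union>
       {delta (v, c \<odot>\<^bsub>W\<^esub> w) \<ominus>\<^bsub>F\<^esub> c \<odot>\<^bsub>F\<^esub> delta (v, w) | c v w.
          v \<in> carrier V \<and> w \<in> carrier W})"

definition tensor_null ::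
    "('k::field, 'v, 'y) module_scheme \<Rightarrow> ('k, 'w, 'z) module_scheme \<Rightarrow> ('v \<times> 'w \<Rightarrow> 'k) set" where
  "tensor_null V W =
     LinearCombinations.module.span class_ring (free_mod (carrier V \<times> carrier W)) (tensor_rels V W)"

definition tensor ::
    "('k::field, 'v, 'y) module_scheme \<Rightarrow> ('k, 'w, 'z) module_scheme
       \<Rightarrow> ('k, ('v \<times> 'w \<Rightarrow> 'k) set) module" where
  "tensor V W = quot_mod (free_mod (carrier V \<times> carrier W)) (tensor_null V W)"

definition tens ::
    "('k::field, 'v, 'y) module_scheme \<Rightarrow> ('k, 'w, 'z) module_scheme
       \<Rightarrow> 'v \<Rightarrow> 'w \<Rightarrow> ('v \<times> 'w \<Rightarrow> 'k) set" where
  "tens V W v w = tensor_null V W +>\<^bsub>free_mod (carrier V \<times> carrier W)\<^esub> delta (v, w)"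

text \<open>The linear map out of the tensor product induced by a bilinear map \<open>b\<close> with values in \<open>Z\<close>.\<close>

definition tensor_lift ::
    "('k::field, 'u, 'x) module_scheme \<Rightarrow> ('v \<Rightarrow> 'w \<Rightarrow> 'u) \<Rightarrow> ('v \<times> 'w \<Rightarrow> 'k) set \<Rightarrow> 'u" where
  "tensor_lift Z b = quot_lift (free_lift Z (\<lambda>(v, w). b v w))"

definition tensor_gmod ::
    "('k::field, 'g, 'v) gmodule \<Rightarrow> ('k, 'g, 'w) gmodule
       \<Rightarrow> ('k, 'g, ('v \<times> 'w \<Rightarrow> 'k) set) gmodule" where
  "tensor_gmod V W = discrete_gmodule (tensor V W)
     (\<lambda>g. tensor_lift (tensor V W) (\<lambda>v w. tens V W (gact V g v) (gact W g w)))"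

definition dual_mod :: "('k::field, 'v, 'z) module_scheme \<Rightarrow> ('k, 'v \<Rightarrow> 'k) module" where
  "dual_mod V =
     \<lparr>carrier = {\<phi> \<in> extensional (carrier V).
        (\<forall>v\<in>carrier V. \<forall>w\<in>carrier V. \<phi> (v \<oplus>\<^bsub>V\<^esub> w) = \<phi> v + \<phi> w) \<and>
        (\<forall>c. \<forall>v\<in>carrier V. \<phi> (c \<odot>\<^bsub>V\<^esub> v) = c * \<phi> v)},
      mult = undefined, one = undefined,
      zero = (\<lambda>v\<in>carrier V. 0),
      add = (\<lambda>\<phi> \<psi>. \<lambda>v\<in>carrier V. \<phi> v + \<psi> v),
      smult = (\<lambda>c \<phi>. \<lambda>v\<in>carrier V. c * \<phi> v)\<rparr>"

definition ordered_basis :: "('k::field, 'v, 'z) module_scheme \<Rightarrow> 'v list \<Rightarrow> bool" where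
  "ordered_basis V vs \<longleftrightarrow> distinct vs \<and> vectorspace.basis class_ring V (set vs)"

definition is_dual_basis ::
    "('k::field, 'v, 'z) module_scheme \<Rightarrow> ('v \<Rightarrow> 'k) list \<Rightarrow> 'v list \<Rightarrow> bool" where
  "is_dual_basis V \<phi>s vs \<longleftrightarrow>
     ordered_basis V vs \<and> length vs = length \<phi>s \<and>
     (\<forall>i<length \<phi>s. \<forall>j<length \<phi>s. (\<phi>s ! i) (vs ! j) = (if i = j then 1 else 0))"

section \<open>Continuous cohomology in degrees one and two\<close>

definition fun_mod :: "'s set \<Rightarrow> ('k, 'm, 'z) module_scheme \<Rightarrow> ('k, 's \<Rightarrow> 'm) module" where
  "fun_mod D M =
     \<lparr>carrier = D \<rightarrow>\<^sub>E carrier M, mult = undefined, one = undefined,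
      zero = (\<lambda>s\<in>D. \<zero>\<^bsub>M\<^esub>),
      add = (\<lambda>x y. \<lambda>s\<in>D. x s \<oplus>\<^bsub>M\<^esub> y s),
      smult = (\<lambda>c x. \<lambda>s\<in>D. c \<odot>\<^bsub>M\<^esub> x s)\<rparr>"

definition C1 :: "'g topgroup \<Rightarrow> ('k, 'g, 'm) gmodule \<Rightarrow> ('g \<Rightarrow> 'm) set" where
  "C1 G M = {f \<in> carrier G \<rightarrow>\<^sub>E carrier M. continuous_map (gtop G) (mtop M) f}"

definition C2 :: "'g topgroup \<Rightarrow> ('k, 'g, 'm) gmodule \<Rightarrow> ('g \<times> 'g \<Rightarrow> 'm) set" where
  "C2 G M = {c \<in> carrier G \<times> carrier G \<rightarrow>\<^sub>E carrier M.
     continuous_map (prod_topology (gtop G) (gtop G)) (mtop M) c}"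

definition d0 :: "'g topgroup \<Rightarrow> ('k, 'g, 'm) gmodule \<Rightarrow> 'm \<Rightarrow> 'g \<Rightarrow> 'm" where
  "d0 G M x = (\<lambda>g\<in>carrier G. gact M g x \<ominus>\<^bsub>M\<^esub> x)"

definition d1 :: "'g topgroup \<Rightarrow> ('k, 'g, 'm) gmodule \<Rightarrow> ('g \<Rightarrow> 'm) \<Rightarrow> 'g \<times> 'g \<Rightarrow> 'm" where
  "d1 G M f = (\<lambda>(g, h)\<in>carrier G \<times> carrier G.
     (gact M g (f h) \<ominus>\<^bsub>M\<^esub> f (g \<otimes>\<^bsub>G\<^esub> h)) \<oplus>\<^bsub>M\<^esub> f g)"

definition Z1 :: "'g topgroup \<Rightarrow> ('k, 'g, 'm) gmodule \<Rightarrow> ('g \<Rightarrow> 'm) set" where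
  "Z1 G M = {f \<in> C1 G M. \<forall>g\<in>carrier G. \<forall>h\<in>carrier G.
     f (g \<otimes>\<^bsub>G\<^esub> h) = f g \<oplus>\<^bsub>M\<^esub> gact M g (f h)}"

definition B1 :: "'g topgroup \<Rightarrow> ('k, 'g, 'm) gmodule \<Rightarrow> ('g \<Rightarrow> 'm) set" where
  "B1 G M = d0 G M ` carrier M"

definition Z2 :: "'g topgroup \<Rightarrow> ('k, 'g, 'm) gmodule \<Rightarrow> ('g \<times> 'g \<Rightarrow> 'm) set" where
  "Z2 G M = {c \<in> C2 G M. \<forall>g\<in>carrier G. \<forall>h\<in>carrier G. \<forall>k\<in>carrier G.
     gact M g (c (h, k)) \<oplus>\<^bsub>M\<^esub> c (g, h \<otimes>\<^bsub>G\<^esub> k) = c (g \<otimes>\<^bsub>G\<^esub> h, k) \<oplus>\<^bsub>M\<^esub> c (g, h)}"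

definition B2 :: "'g topgroup \<Rightarrow> ('k, 'g, 'm) gmodule \<Rightarrow> ('g \<times> 'g \<Rightarrow> 'm) set" where
  "B2 G M = d1 G M ` C1 G M"

definition H1 :: "'g topgroup \<Rightarrow> ('k, 'g, 'm) gmodule \<Rightarrow> ('k, ('g \<Rightarrow> 'm) set) module" where
  "H1 G M = quot_mod ((fun_mod (carrier G) M)\<lparr>carrier := Z1 G M\<rparr>) (B1 G M)"

definition H2 :: "'g topgroup \<Rightarrow> ('k, 'g, 'm) gmodule \<Rightarrow> ('k, ('g \<times> 'g \<Rightarrow> 'm) set) module" where
  "H2 G M = quot_mod ((fun_mod (carrier G \<times> carrier G) M)\<lparr>carrier := Z2 G M\<rparr>) (B2 G M)"

definition class1 :: "'g topgroup \<Rightarrow> ('k, 'g, 'm) gmodule \<Rightarrow> ('g \<Rightarrow> 'm) \<Rightarrow> ('g \<Rightarrow> 'm) set" where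
  "class1 G M f = B1 G M +>\<^bsub>fun_mod (carrier G) M\<^esub> f"

definition class2 ::
    "'g topgroup \<Rightarrow> ('k, 'g, 'm) gmodule \<Rightarrow> ('g \<times> 'g \<Rightarrow> 'm) \<Rightarrow> ('g \<times> 'g \<Rightarrow> 'm) set" where
  "class2 G M c = B2 G M +>\<^bsub>fun_mod (carrier G \<times> carrier G) M\<^esub> c"

text \<open>
  The connecting map \<open>H\<^sup>1(G, M'') \<rightarrow> H\<^sup>2(G, M')\<close> of a short exact sequence
  \<open>0 \<rightarrow> M' \<rightarrow> M \<rightarrow> M'' \<rightarrow> 0\<close> with maps \<open>\<iota>\<close> and \<open>\<pi>\<close>.
\<close>

definition connecting ::
    "'g topgroup \<Rightarrow> ('k, 'g, 'a) gmodule \<Rightarrow> ('k, 'g, 'b) gmodule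
       \<Rightarrow> ('a \<Rightarrow> 'b) \<Rightarrow> ('b \<Rightarrow> 'c) \<Rightarrow> ('g \<Rightarrow> 'c) set \<Rightarrow> ('g \<times> 'g \<Rightarrow> 'a) set" where
  "connecting G M' M \<iota> \<pi> A =
     (THE B. \<exists>f\<in>A. \<exists>F\<in>C1 G M. \<exists>c\<in>Z2 G M'.
        (\<forall>g\<in>carrier G. \<pi> (F g) = f g) \<and>
        (\<forall>g\<in>carrier G. \<forall>h\<in>carrier G. \<iota> (c (g, h)) = d1 G M F (g, h)) \<and>
        B = class2 G M' c)"

text \<open>The natural map \<open>H\<^sup>2(G, M) \<otimes> W \<rightarrow> H\<^sup>2(G, M \<otimes> W)\<close> for \<open>W\<close> with trivial action.\<close>

definition H2_tensor_map ::
    "'g topgroup \<Rightarrow> ('k::field, 'g, 'm) gmodule \<Rightarrow> ('k, 'g, 'w) gmodule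
       \<Rightarrow> (('g \<times> 'g \<Rightarrow> 'm) set \<times> 'w \<Rightarrow> 'k) set \<Rightarrow> ('g \<times> 'g \<Rightarrow> ('m \<times> 'w \<Rightarrow> 'k) set) set" where
  "H2_tensor_map G M W =
     tensor_lift (H2 G (tensor_gmod M W))
       (\<lambda>A w. quot_lift (\<lambda>c. class2 G (tensor_gmod M W)
                  (\<lambda>s\<in>carrier G \<times> carrier G. tens M W (c s) w)) A)"

section \<open>The group algebra of \<open>H = G/N\<close> and its augmentation filtration\<close>

definition group_algebra :: "('h, 'z) monoid_scheme \<Rightarrow> ('k::field, 'h \<Rightarrow> 'k) module" where
  "group_algebra H =
     (free_mod (carrier H))\<lparr>
       mult := (\<lambda>x y h. if h \<in> carrier H
                        then \<Sum>k\<in>{k. x k \<noteq> 0}. x k * y (inv\<^bsub>H\<^esub> k \<otimes>\<^bsub>H\<^esub> h) else 0),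
       one := delta \<one>\<^bsub>H\<^esub>\<rparr>"

definition augmentation :: "('h \<Rightarrow> 'k::field) \<Rightarrow> 'k" where
  "augmentation x = (\<Sum>h\<in>{h. x h \<noteq> 0}. x h)"

definition omega :: "'g topgroup \<Rightarrow> 'g set \<Rightarrow> ('k::field, 'g set \<Rightarrow> 'k) module" where
  "omega G N = group_algebra (G Mod N)"

definition aug_ideal :: "'g topgroup \<Rightarrow> 'g set \<Rightarrow> ('g set \<Rightarrow> 'k::field) set" where
  "aug_ideal G N = {x \<in> carrier (omega G N). augmentation x = 0}"

definition aug_pow :: "'g topgroup \<Rightarrow> 'g set \<Rightarrow> nat \<Rightarrow> ('g set \<Rightarrow> 'k::field) set" where
  "aug_pow G N m = aug_ideal G N [^]\<^bsub>ideals_set (omega G N)\<^esub> m"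

definition omega_act ::
    "'g topgroup \<Rightarrow> 'g set \<Rightarrow> nat \<Rightarrow> 'g \<Rightarrow> ('g set \<Rightarrow> 'k::field) set \<Rightarrow> ('g set \<Rightarrow> 'k) set" where
  "omega_act G N m g =
     quot_lift (\<lambda>x. aug_pow G N m +>\<^bsub>omega G N\<^esub> (delta (N #>\<^bsub>G\<^esub> g) \<otimes>\<^bsub>omega G N\<^esub> x))"

text \<open>\<open>omega_quot G N m\<close> is \<open>\<Omega>/I\<^sup>m\<close>; \<open>omega_gr G N n\<close> is \<open>I\<^sup>n/I\<^sup>n\<^sup>+\<^sup>1\<close>, whose elements are
  literally elements of \<open>\<Omega>/I\<^sup>n\<^sup>+\<^sup>1\<close>.\<close>

definition omega_quot ::
    "'g topgroup \<Rightarrow> 'g set \<Rightarrow> nat \<Rightarrow> ('k::field, 'g, ('g set \<Rightarrow> 'k) set) gmodule" where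
  "omega_quot G N m = discrete_gmodule (quot_mod (omega G N) (aug_pow G N m)) (omega_act G N m)"

definition omega_gr ::
    "'g topgroup \<Rightarrow> 'g set \<Rightarrow> nat \<Rightarrow> ('k::field, 'g, ('g set \<Rightarrow> 'k) set) gmodule" where
  "omega_gr G N n =
     discrete_gmodule (quot_mod ((omega G N)\<lparr>carrier := aug_pow G N n\<rparr>) (aug_pow G N (n + 1)))
       (omega_act G N (n + 1))"

definition Psi ::
    "'g topgroup \<Rightarrow> 'g set \<Rightarrow> ('k::field, 'g, 't) gmodule \<Rightarrow> nat
       \<Rightarrow> ('g \<Rightarrow> ('t \<times> ('g set \<Rightarrow> 'k) set \<Rightarrow> 'k) set) set
       \<Rightarrow> (('g \<times> 'g \<Rightarrow> 't) set \<times> ('g set \<Rightarrow> 'k) set \<Rightarrow> 'k) set" where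
  "Psi G N T n A =
     (let W = omega_gr G N n; Q' = omega_quot G N (n + 1); Q = omega_quot G N n;
          \<iota> = tensor_lift (tensor T Q') (\<lambda>t w. tens T Q' t w);
          \<pi> = tensor_lift (tensor T Q)
                (\<lambda>t q. tens T Q t (quot_lift (\<lambda>x. aug_pow G N n +>\<^bsub>omega G N\<^esub> x) q))
      in inv_into (carrier (tensor (H2 G T) W)) (H2_tensor_map G T W)
           (connecting G (tensor_gmod T W) (tensor_gmod T Q') \<iota> \<pi> A))"

section \<open>Unipotent binomial matrices and proper defining systems\<close>

definition character_group :: "('h, 'z) monoid_scheme \<Rightarrow> ('h \<Rightarrow> 'k::field) set" where
  "character_group H = hom H (add_monoid class_ring) \<inter> extensional (carrier H)"

text \<open>Matrix and vector indices start at \<open>0\<close>. For \<open>k < p\<close> the residue class of \<open>a choose k\<close>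
  depends only on that of \<open>a\<close>, so the representative in \<open>{0..<p}\<close> computes the binomial
  coefficient.\<close>

definition binom_mat :: "nat \<Rightarrow> 'p::prime_card mod_ring \<Rightarrow> 'p mod_ring mat" where
  "binom_mat n a = mat (n + 1) (n + 1)
     (\<lambda>(i, j). if i \<le> j then of_nat (nat (to_int_mod_ring a) choose (j - i)) else 0)"

definition binom_col ::
    "nat \<Rightarrow> ('h \<Rightarrow> 'p::prime_card mod_ring) \<Rightarrow> ('h \<Rightarrow> 'p mod_ring) \<Rightarrow> 'p mod_ring vec" where
  "binom_col n \<chi> x = vec (n + 1)
     (\<lambda>i. \<Sum>h\<in>{h. x h \<noteq> 0}. x h * (binom_mat n (\<chi> h) *\<^sub>v unit_vec (n + 1) n) $ i)"

definition p_gr ::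
    "'g topgroup \<Rightarrow> 'g set \<Rightarrow> nat \<Rightarrow> ('g set \<Rightarrow> 'p::prime_card mod_ring)
       \<Rightarrow> ('g set \<Rightarrow> 'p mod_ring) set \<Rightarrow> 'p mod_ring" where
  "p_gr G N n \<chi> =
     (\<lambda>A\<in>carrier (omega_gr G N n :: ('p mod_ring, 'g, _) gmodule). quot_lift (binom_col n \<chi>) A $ 0)"

definition pow_mod :: "('k, 't, 'z) module_scheme \<Rightarrow> nat \<Rightarrow> ('k, 't vec) module" where
  "pow_mod T m =
     \<lparr>carrier = {v. dim_vec v = m \<and> (\<forall>i<m. v $ i \<in> carrier T)}, mult = undefined, one = undefined,
      zero = vec m (\<lambda>i. \<zero>\<^bsub>T\<^esub>),
      add = (\<lambda>v w. vec m (\<lambda>i. v $ i \<oplus>\<^bsub>T\<^esub> w $ i)),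
      smult = (\<lambda>c v. vec m (\<lambda>i. c \<odot>\<^bsub>T\<^esub> v $ i))\<rparr>"

definition first_coord :: "('k, 't, 'z) module_scheme \<Rightarrow> nat \<Rightarrow> 't vec set" where
  "first_coord T m = {v \<in> carrier (pow_mod T m). \<forall>i<m. i \<noteq> 0 \<longrightarrow> v $ i = \<zero>\<^bsub>T\<^esub>}"

text \<open>The map \<open>T \<otimes> \<Omega>/I\<^sup>n \<rightarrow> T\<^sup>n\<^sup>+\<^sup>1/T\<close>.\<close>

definition p_tensor ::
    "('p::prime_card mod_ring, 'g, 't) gmodule \<Rightarrow> nat \<Rightarrow> ('g set \<Rightarrow> 'p mod_ring)
       \<Rightarrow> ('t \<times> ('g set \<Rightarrow> 'p mod_ring) set \<Rightarrow> 'p mod_ring) set \<Rightarrow> 't vec set" where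
  "p_tensor T n \<chi> =
     tensor_lift (quot_mod (pow_mod T (n + 1)) (first_coord T (n + 1)))
       (\<lambda>t. quot_lift (\<lambda>x. first_coord T (n + 1) +>\<^bsub>pow_mod T (n + 1)\<^esub>
                           vec (n + 1) (\<lambda>i. binom_col n \<chi> x $ i \<odot>\<^bsub>T\<^esub> t)))"

definition unitriangular :: "nat \<Rightarrow> 'k::field mat set" where
  "unitriangular m = {P \<in> carrier_mat m m. upper_triangular P \<and> (\<forall>i<m. P $$ (i, i) = 1)}"

definition mat_act :: "('k, 't, 'z) module_scheme \<Rightarrow> 'k mat \<Rightarrow> 't vec \<Rightarrow> 't vec" where
  "mat_act T P v = vec (dim_row P) (\<lambda>i. \<Oplus>\<^bsub>T\<^esub>j\<in>{..<dim_vec v}. P $$ (i, j) \<odot>\<^bsub>T\<^esub> v $ j)"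

text \<open>A pair \<open>(P, v)\<close> stands for the block matrix with rows \<open>(P v)\<close> and \<open>(0 1)\<close>.\<close>

definition block_group :: "('k::field, 't, 'z) module_scheme \<Rightarrow> nat \<Rightarrow> ('k mat \<times> 't vec) monoid" where
  "block_group T n =
     \<lparr>carrier = unitriangular (n + 1) \<times> carrier (pow_mod T (n + 1)),
      mult = (\<lambda>(P, v) (P', v'). (P * P', v \<oplus>\<^bsub>pow_mod T (n + 1)\<^esub> mat_act T P v')),
      one = (1\<^sub>m (n + 1), \<zero>\<^bsub>pow_mod T (n + 1)\<^esub>)\<rparr>"

definition block_quot ::
    "('k::field, 't, 'z) module_scheme \<Rightarrow> nat \<Rightarrow> ('k mat \<times> 't vec) set monoid" where
  "block_quot T n = block_group T n Mod ({1\<^sub>m (n + 1)} \<times> first_coord T (n + 1))"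

definition block_act ::
    "('k, 'g, 't) gmodule \<Rightarrow> 'g \<Rightarrow> ('k mat \<times> 't vec) set \<Rightarrow> ('k mat \<times> 't vec) set" where
  "block_act T g A = (\<lambda>(P, v). (P, map_vec (gact T g) v)) ` A"

text \<open>
  A continuous 1-cocycle with values in the quotient group whose upper left block is the binomial
  matrix of \<open>\<chi>\<close> and whose entry just above the lower right corner is \<open>lam\<close>.
\<close>

definition proper_defining_system ::
    "'g topgroup \<Rightarrow> 'g set \<Rightarrow> ('p::prime_card mod_ring, 'g, 't) gmodule \<Rightarrow> nat
       \<Rightarrow> ('g set \<Rightarrow> 'p mod_ring) \<Rightarrow> ('g \<Rightarrow> 't) \<Rightarrow> ('g \<Rightarrow> ('p mod_ring mat \<times> 't vec) set) \<Rightarrow> bool" where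
  "proper_defining_system G N T n \<chi> lam \<rho> \<longleftrightarrow>
     continuous_map (gtop G) (discrete_topology (carrier (block_quot T n))) \<rho> \<and>
     (\<forall>g\<in>carrier G. \<forall>h\<in>carrier G.
        \<rho> (g \<otimes>\<^bsub>G\<^esub> h) = \<rho> g \<otimes>\<^bsub>block_quot T n\<^esub> block_act T g (\<rho> h)) \<and>
     (\<forall>g\<in>carrier G. \<forall>(P, v)\<in>\<rho> g. P = binom_mat n (\<chi> (N #>\<^bsub>G\<^esub> g)) \<and> v $ n = lam g)"

definition attached_system ::
    "'g topgroup \<Rightarrow> 'g set \<Rightarrow> ('p::prime_card mod_ring, 'g, 't) gmodule \<Rightarrow> nat
       \<Rightarrow> ('g set \<Rightarrow> 'p mod_ring) \<Rightarrow> ('g \<Rightarrow> ('t \<times> ('g set \<Rightarrow> 'p mod_ring) set \<Rightarrow> 'p mod_ring) set)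
       \<Rightarrow> 'g \<Rightarrow> ('p mod_ring mat \<times> 't vec) set" where
  "attached_system G N T n \<chi> f =
     (\<lambda>g\<in>carrier G. {binom_mat n (\<chi> (N #>\<^bsub>G\<^esub> g))} \<times> p_tensor T n \<chi> (f g))"

definition zero_lift ::
    "('k, 't, 'z) module_scheme \<Rightarrow> ('k mat \<times> 't vec) set \<Rightarrow> 'k mat \<times> 't vec" where
  "zero_lift T A = (THE u. u \<in> A \<and> snd u $ 0 = \<zero>\<^bsub>T\<^esub>)"

definition massey ::
    "'g topgroup \<Rightarrow> ('k::field, 'g, 't) gmodule \<Rightarrow> nat
       \<Rightarrow> ('g \<Rightarrow> ('k mat \<times> 't vec) set) \<Rightarrow> ('g \<times> 'g \<Rightarrow> 't) set" where
  "massey G T n \<rho> = class2 G T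
     (\<lambda>(g, h)\<in>carrier G \<times> carrier G.
        \<Oplus>\<^bsub>T\<^esub>i\<in>{1..n}. fst (zero_lift T (\<rho> g)) $$ (0, i) \<odot>\<^bsub>T\<^esub> gact T g (snd (zero_lift T (\<rho> h)) $ i))"

text \<open>The map \<open>Z\<^sup>1(G, T \<otimes> \<Omega>/I\<^sup>n) \<rightarrow> Z\<^sup>1(G, T)\<close> induced by the augmentation.\<close>

definition cocycle_image ::
    "'g topgroup \<Rightarrow> ('k::field, 'g, 't) gmodule
       \<Rightarrow> ('g \<Rightarrow> ('t \<times> ('g set \<Rightarrow> 'k) set \<Rightarrow> 'k) set) \<Rightarrow> 'g \<Rightarrow> 't" where
  "cocycle_image G T f =
     (\<lambda>g\<in>carrier G. tensor_lift T (\<lambda>t q. quot_lift augmentation q \<odot>\<^bsub>T\<^esub> t) (f g))"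

end

theory Submission
  imports Defs
begin

text \<open>
  Write \<open>B\<^sub>j(x) = \<Sum>\<^sub>h x(h) (\<chi>(h) choose j)\<close> for the binomial functionals of a character \<open>\<chi>\<close> on \<open>\<Omega>\<close>. By
  Vandermonde's identity, valid modulo \<open>p\<close> for \<open>j < p\<close>, \<open>B\<^sub>j(xy) = \<Sum>\<^sub>i B\<^sub>i(x) B\<^sub>j\<^sub>-\<^sub>i(y)\<close>; hence \<open>B\<^sub>j\<close> vanishes on
  \<open>I\<^sup>m\<close> for \<open>j < m\<close>, and on a product of \<open>n\<close> elements of \<open>I\<close> the functional \<open>B\<^sub>n\<close> is the product of the values of
  \<open>B\<^sub>1\<close>. On monomials in \<open>[e\<^sub>i] - 1\<close>, which span \<open>I\<^sup>n/I\<^sup>n\<^sup>+\<^sup>1\<close>, it is the \<open>n\<close>-th power of a linear form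
  in dual coordinates, and interpolation over \<open>\<bbbF>\<^sub>p\<close> (each exponent is less than \<open>p\<close>) produces the dual basis of the
  monomials from such powers.

  For the connecting map, lift \<open>f\<close> to a cochain \<open>F\<close> with values in \<open>T \<otimes> \<Omega>/I\<^sup>n\<^sup>+\<^sup>1\<close>. The product formula for
  \<open>B\<^sub>n\<close> turns the image of \<open>dF\<close> under \<open>id \<otimes> B\<^sub>n\<close> into \<open>d(B\<^sub>n \<circ> F)\<close> plus the Massey cochain of the defining
  system, so \<open>dF\<close>, expanded in the basis dual to the \<open>p\<^bsub>\<chi>\<^sub>i,n\<^esub>\<close>, has the asserted class.
\<close>

section \<open>Vector spaces as modules over a field type\<close>

text \<open>A module finitely generated over a finite field is finite, hence discrete when
  Hausdorff. Continuous cochains are therefore the locally constant ones, and an arbitrary choice of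
  preimages of their values is again continuous. What remains delicate are the objects given by
  description: \<open>connecting\<close> is a definite description and \<open>Psi\<close> applies
  \<open>inv_into\<close>. The former requires that all lifts of all representatives of the class of
  f yield one class, the latter that the natural map from the tensor product of H^2(G,T) and
  I^n/I^(n+1) be injective. The dual basis settles both. Each p_i extends to B_n on Omega/I^(n+1),
  which yields a linear splitting, in general not equivariant, and with it exactness after tensoring
  with T; applied to cocycles, the p_i yield a left inverse of the natural map. The failure of B_n
  to be equivariant is what the Massey cochain records. The bound n < p serves Vandermonde modulo p
  and also interpolation: t^0, ..., t^(p-1) are linearly independent functions on the field.\<close>

locale kmod = module "class_ring :: 'k::field ring" M for M (structure)

abbreviation lin_maps ::
    "('k::field, 'a, 'y) module_scheme \<Rightarrow> ('k, 'b, 'z) module_scheme \<Rightarrow> ('a \<Rightarrow> 'b) set" where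
  "lin_maps M N \<equiv> module_hom class_ring M N"

text \<open>The assumption on the scalar 0 takes the place of an axiom on negatives: with it, (-1)
  times v is an additive inverse of v.\<close>

lemma kmodI:
  fixes M :: "('k::field, 'm, 'z) module_scheme" (structure)
  assumes "\<zero> \<in> carrier M"
    and "\<And>x y. \<lbrakk>x \<in> carrier M; y \<in> carrier M\<rbrakk> \<Longrightarrow> x \<oplus> y \<in> carrier M"
    and "\<And>c x. x \<in> carrier M \<Longrightarrow> c \<odot> x \<in> carrier M"
    and "\<And>x y z. \<lbrakk>x \<in> carrier M; y \<in> carrier M; z \<in> carrier M\<rbrakk> \<Longrightarrow> (x \<oplus> y) \<oplus> z = x \<oplus> (y \<oplus> z)"
    and "\<And>x y. \<lbrakk>x \<in> carrier M; y \<in> carrier M\<rbrakk> \<Longrightarrow> x \<oplus> y = y \<oplus> x"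
    and "\<And>x. x \<in> carrier M \<Longrightarrow> x \<oplus> \<zero> = x"
    and "\<And>a b x. x \<in> carrier M \<Longrightarrow> (a + b) \<odot> x = a \<odot> x \<oplus> b \<odot> x"
    and "\<And>c x y. \<lbrakk>x \<in> carrier M; y \<in> carrier M\<rbrakk> \<Longrightarrow> c \<odot> (x \<oplus> y) = c \<odot> x \<oplus> c \<odot> y"
    and "\<And>a b x. x \<in> carrier M \<Longrightarrow> (a * b) \<odot> x = a \<odot> (b \<odot> x)"
    and "\<And>x. x \<in> carrier M \<Longrightarrow> 1 \<odot> x = x"
    and "\<And>x. x \<in> carrier M \<Longrightarrow> 0 \<odot> x = \<zero>"
  shows "kmod M"
  unfolding kmod_def
proof (rule module_criteria)
  show "cring (class_ring :: 'k ring)" by (rule class_cring.cring_axioms)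
  show "\<forall>v\<in>carrier M. \<exists>w\<in>carrier M. v \<oplus> w = \<zero>"
  proof
    fix v assume v: "v \<in> carrier M"
    have "v \<oplus> (-1) \<odot> v = (1 + (-1)) \<odot> v" using assms(7)[OF v, of 1 "-1"] assms(10)[OF v] by simp
    then have "v \<oplus> (-1) \<odot> v = \<zero>" using assms(11)[OF v] by simp
    then show "\<exists>w\<in>carrier M. v \<oplus> w = \<zero>" using assms(3)[OF v] by blast
  qed
qed (use assms in auto)

context kmod
begin

lemma kmod_axioms': "kmod M" by unfold_locales

lemma sm_closed [simp, intro]: "x \<in> carrier M \<Longrightarrow> c \<odot> x \<in> carrier M"
  using smult_closed[of c x] by simp

lemma sm_add_left: "x \<in> carrier M \<Longrightarrow> (a + b) \<odot> x = a \<odot> x \<oplus> b \<odot> x"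
  using smult_l_distr[of a b x] by simp

lemma sm_add_right: "\<lbrakk>x \<in> carrier M; y \<in> carrier M\<rbrakk> \<Longrightarrow> c \<odot> (x \<oplus> y) = c \<odot> x \<oplus> c \<odot> y"
  using smult_r_distr[of c x y] by simp

lemma sm_assoc: "x \<in> carrier M \<Longrightarrow> (a * b) \<odot> x = a \<odot> (b \<odot> x)"
  using smult_assoc1[of a b x] by simp

lemma sm_one [simp]: "x \<in> carrier M \<Longrightarrow> 1 \<odot> x = x"
  using smult_one[of x] by simp

lemma sm_zero [simp]: "x \<in> carrier M \<Longrightarrow> 0 \<odot> x = \<zero>"
  using smult_l_null[of x] by simp

lemma sm_zero_right [simp]: "c \<odot> \<zero> = \<zero>"
  using smult_r_null[of c] by simp

lemma sm_minus_one: "x \<in> carrier M \<Longrightarrow> (-1) \<odot> x = \<ominus> x"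
proof -
  assume x: "x \<in> carrier M"
  have "(-1) \<odot> x \<oplus> x = ((-1) + 1) \<odot> x" using sm_add_left[OF x, of "-1" 1] x by simp
  then have "(-1) \<odot> x \<oplus> x = \<zero>" using x by simp
  then show ?thesis using x by (metis minus_equality sm_closed)
qed

lemma minus_eq_sm: "\<lbrakk>x \<in> carrier M; y \<in> carrier M\<rbrakk> \<Longrightarrow> x \<ominus> y = x \<oplus> (-1) \<odot> y"
  by (simp add: sm_minus_one a_minus_def)

lemma sm_minus_right: "\<lbrakk>x \<in> carrier M; y \<in> carrier M\<rbrakk> \<Longrightarrow> c \<odot> (x \<ominus> y) = c \<odot> x \<ominus> c \<odot> y"
  by (simp add: minus_eq_sm sm_add_right sm_assoc[symmetric] mult.commute)

lemma minus_add_cancel: "\<lbrakk>x \<in> carrier M; y \<in> carrier M\<rbrakk> \<Longrightarrow> (x \<ominus> y) \<oplus> y = x"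
  by (simp add: a_minus_def a_assoc l_neg)

lemma eq_minus_iff: "\<lbrakk>x \<in> carrier M; y \<in> carrier M; z \<in> carrier M\<rbrakk> \<Longrightarrow> x = y \<ominus> z \<longleftrightarrow> x \<oplus> z = y"
  by (metis add.inv_solve_right' a_minus_def)

lemma sm_finsum: "f \<in> A \<rightarrow> carrier M \<Longrightarrow> c \<odot> (\<Oplus>i\<in>A. f i) = (\<Oplus>i\<in>A. c \<odot> f i)"
proof (induction A rule: infinite_finite_induct)
  case (insert x F)
  then have "(\<lambda>i. c \<odot> f i) \<in> F \<rightarrow> carrier M" "f \<in> F \<rightarrow> carrier M" "f x \<in> carrier M" by auto
  with insert show ?case by (simp add: finsum_insert sm_add_right)
qed auto

lemma finsum_sm_sum: "\<lbrakk>finite A; x \<in> carrier M\<rbrakk> \<Longrightarrow> (\<Oplus>i\<in>A. c i \<odot> x) = (\<Sum>i\<in>A. c i) \<odot> x"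
proof (induction A rule: finite_induct)
  case (insert a F)
  then have "(\<lambda>i. c i \<odot> x) \<in> F \<rightarrow> carrier M" by auto
  with insert show ?case by (simp add: finsum_insert sm_add_left)
qed auto

lemma submoduleI:
  assumes "S \<subseteq> carrier M" "\<zero> \<in> S" "\<And>x y. \<lbrakk>x \<in> S; y \<in> S\<rbrakk> \<Longrightarrow> x \<oplus> y \<in> S"
    "\<And>c x. x \<in> S \<Longrightarrow> c \<odot> x \<in> S"
  shows "submodule class_ring S M"
  using assms module_axioms by (auto intro!: LinearCombinations.submodule.intro)

lemma sub_kmod:
  assumes "submodule class_ring S M"
  shows "kmod (M\<lparr>carrier := S\<rparr>)"
  unfolding kmod_def using submodule_is_module[OF assms] .

end

lemma subset_of_sub: "submodule class_ring S M \<Longrightarrow> S \<subseteq> carrier M"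
  by (rule LinearCombinations.submodule.subset)
lemma zero_in_sub: "submodule class_ring S M \<Longrightarrow> \<zero>\<^bsub>M\<^esub> \<in> S"
  by (rule LinearCombinations.submodule.zero_closed)
lemma add_in_sub: "\<lbrakk>submodule class_ring S M; x \<in> S; y \<in> S\<rbrakk> \<Longrightarrow> x \<oplus>\<^bsub>M\<^esub> y \<in> S"
  by (rule LinearCombinations.submodule.m_closed)
lemma sm_in_sub: "\<lbrakk>submodule (class_ring :: 'k::field ring) S M; x \<in> S\<rbrakk> \<Longrightarrow> (c::'k) \<odot>\<^bsub>M\<^esub> x \<in> S"
  using LinearCombinations.submodule.smult_closed[of class_ring S M c x] by simp
lemma kmod_of_sub: "submodule class_ring S M \<Longrightarrow> kmod M"
  by (simp add: kmod_def LinearCombinations.submodule.module)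
lemma minus_in_sub:
  assumes "submodule (class_ring :: 'k::field ring) S M" "x \<in> S" "y \<in> S" shows "x \<ominus>\<^bsub>M\<^esub> y \<in> S"
proof -
  have "x \<in> carrier M" "y \<in> carrier M" using assms subset_of_sub[OF assms(1)] by auto
  then have "x \<ominus>\<^bsub>M\<^esub> y = x \<oplus>\<^bsub>M\<^esub> (- 1 :: 'k) \<odot>\<^bsub>M\<^esub> y"
    by (rule kmod.minus_eq_sm[OF kmod_of_sub[OF assms(1)]])
  then show ?thesis using add_in_sub[OF assms(1,2) sm_in_sub[OF assms(1,3)]] by simp
qed

lemma lin_mapsI:
  assumes "\<And>x. x \<in> carrier M \<Longrightarrow> f x \<in> carrier N"
    and "\<And>x y. \<lbrakk>x \<in> carrier M; y \<in> carrier M\<rbrakk> \<Longrightarrow> f (x \<oplus>\<^bsub>M\<^esub> y) = f x \<oplus>\<^bsub>N\<^esub> f y"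
    and "\<And>c x. x \<in> carrier M \<Longrightarrow> f (c \<odot>\<^bsub>M\<^esub> x) = c \<odot>\<^bsub>N\<^esub> f x"
  shows "f \<in> lin_maps M N"
  using assms unfolding module_hom_def by auto

lemma lin_closed: "\<lbrakk>f \<in> lin_maps M N; x \<in> carrier M\<rbrakk> \<Longrightarrow> f x \<in> carrier N"
  using module_hom_closed by fastforce

lemma lin_add: "\<lbrakk>f \<in> lin_maps M N; x \<in> carrier M; y \<in> carrier M\<rbrakk> \<Longrightarrow> f (x \<oplus>\<^bsub>M\<^esub> y) = f x \<oplus>\<^bsub>N\<^esub> f y"
  by (rule module_hom_add)

lemma lin_smult: "\<lbrakk>f \<in> lin_maps M N; x \<in> carrier M\<rbrakk> \<Longrightarrow> f (c \<odot>\<^bsub>M\<^esub> x) = c \<odot>\<^bsub>N\<^esub> f x"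
  using module_hom_smult[of f class_ring M N c x] by simp

lemma lin_zero:
  assumes "kmod M" "kmod N" "f \<in> lin_maps M N" shows "f \<zero>\<^bsub>M\<^esub> = \<zero>\<^bsub>N\<^esub>"
proof -
  interpret M: kmod M by fact
  interpret N: kmod N by fact
  show ?thesis using lin_smult[OF assms(3), of "\<zero>\<^bsub>M\<^esub>" 0] lin_closed[OF assms(3)] by simp
qed

lemma lin_minus:
  assumes "kmod M" "kmod N" "f \<in> lin_maps M N" "x \<in> carrier M" "y \<in> carrier M"
  shows "f (x \<ominus>\<^bsub>M\<^esub> y) = f x \<ominus>\<^bsub>N\<^esub> f y"
proof -
  interpret M: kmod M by fact
  interpret N: kmod N by fact
  show ?thesis using assms lin_closed[OF assms(3)]
    by (simp add: M.minus_eq_sm N.minus_eq_sm lin_add lin_smult)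
qed

text \<open>Over an infinite index set \<open>finsum\<close> is zero by convention, hence the extra
  case of the induction; there the claim is preservation of zero.\<close>

lemma lin_finsum:
  assumes "kmod M" "kmod N" "f \<in> lin_maps M N" "g \<in> A \<rightarrow> carrier M"
  shows "f (\<Oplus>\<^bsub>M\<^esub>i\<in>A. g i) = (\<Oplus>\<^bsub>N\<^esub>i\<in>A. f (g i))"
proof -
  interpret M: kmod M by fact
  interpret N: kmod N by fact
  show ?thesis using assms(4)
  proof (induction A rule: infinite_finite_induct)
    case (insert x F)
    then have "g \<in> F \<rightarrow> carrier M" "g x \<in> carrier M" "(\<lambda>i. f (g i)) \<in> F \<rightarrow> carrier N"
      "f (g x) \<in> carrier N"
      using lin_closed[OF assms(3)] by auto
    with insert show ?case by (simp add: M.finsum_insert N.finsum_insert lin_add[OF assms(3)])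
  qed (auto simp: lin_zero[OF assms(1,2,3)])
qed

lemma lin_comp: "\<lbrakk>f \<in> lin_maps M N; g \<in> lin_maps N P\<rbrakk> \<Longrightarrow> (\<lambda>x. g (f x)) \<in> lin_maps M P"
  by (intro lin_mapsI) (simp_all add: lin_add lin_smult lin_closed)

lemma (in kmod) span_subset_sub:
  "\<lbrakk>A \<subseteq> S; submodule class_ring S M\<rbrakk> \<Longrightarrow> span A \<subseteq> S"
  by (rule span_is_subset)

text \<open>Together with \<open>span_subset_sub\<close> this reduces an identity between linear
  maps to its verification on a generating set.\<close>

lemma (in kmod) eq_on_sub:
  assumes "f \<in> lin_maps M N" "g \<in> lin_maps M N" "kmod N"
  shows "submodule class_ring {x \<in> carrier M. f x = g x} M"
  using assms(1,2) lin_zero[OF kmod_axioms' assms(3,1)] lin_zero[OF kmod_axioms' assms(3,2)]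
  by (intro submoduleI) (simp_all add: subset_iff lin_add lin_smult)

subsection \<open>Quotients\<close>

lemma coset_def: "S +>\<^bsub>M\<^esub> x = {s \<oplus>\<^bsub>M\<^esub> x | s. s \<in> S}"
  by (auto simp: a_r_coset_def')

text \<open>Cosets depend on the addition only. Hence a coset formed inside I^n is the same set as
  the coset formed in the whole group algebra, and elements of I^n/I^(n+1) can be treated as
  elements of Omega/I^(n+1).\<close>

lemma coset_carrier_update [simp]: "S +>\<^bsub>M\<lparr>carrier := C\<rparr>\<^esub> x = S +>\<^bsub>M\<^esub> x"
  by (simp add: coset_def)

locale kquot = kmod M for M :: "('k::field, 'm, 'z) module_scheme" (structure) +
  fixes S assumes sub: "submodule class_ring S M"
begin

lemma S_carrier: "s \<in> S \<Longrightarrow> s \<in> carrier M"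
  using subset_of_sub[OF sub] by blast

lemma in_coset_self: "x \<in> carrier M \<Longrightarrow> x \<in> S +> x"
  unfolding coset_def using zero_in_sub[OF sub] by force

lemma coset_carrier: "\<lbrakk>x \<in> carrier M; y \<in> S +> x\<rbrakk> \<Longrightarrow> y \<in> carrier M"
  unfolding coset_def using S_carrier by auto

lemma in_coset_iff:
  assumes "x \<in> carrier M" "y \<in> carrier M" shows "y \<in> S +> x \<longleftrightarrow> y \<ominus> x \<in> S"
proof
  assume "y \<in> S +> x"
  then obtain s where s: "s \<in> S" "y = s \<oplus> x" unfolding coset_def by blast
  then have "y \<ominus> x = s" using assms S_carrier[of s] by (metis eq_minus_iff)
  then show "y \<ominus> x \<in> S" using s by simp
next
  assume "y \<ominus> x \<in> S"
  moreover have "(y \<ominus> x) \<oplus> x = y" using assms by (simp add: minus_add_cancel)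
  ultimately show "y \<in> S +> x" unfolding coset_def by force
qed

lemma coset_eqI:
  assumes "s \<in> S" "x \<in> carrier M" shows "S +> (s \<oplus> x) = S +> x"
proof -
  have sc: "s \<in> carrier M" using assms S_carrier by blast
  have "S +> (s \<oplus> x) \<subseteq> S +> x"
  proof
    fix y assume "y \<in> S +> (s \<oplus> x)"
    then obtain t where t: "t \<in> S" "y = t \<oplus> (s \<oplus> x)" unfolding coset_def by blast
    then have "y = (t \<oplus> s) \<oplus> x" using assms sc S_carrier by (simp add: a_assoc)
    then show "y \<in> S +> x" unfolding coset_def using add_in_sub[OF sub t(1) assms(1)] by blast
  qed
  moreover have "S +> x \<subseteq> S +> (s \<oplus> x)"
  proof
    fix y assume "y \<in> S +> x"
    then obtain t where t: "t \<in> S" "y = t \<oplus> x" unfolding coset_def by blast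
    then have "y = (t \<ominus> s) \<oplus> (s \<oplus> x)"
      using assms sc S_carrier by (simp add: a_assoc[symmetric] minus_add_cancel)
    then show "y \<in> S +> (s \<oplus> x)" unfolding coset_def using minus_in_sub[OF sub t(1) assms(1)] by blast
  qed
  ultimately show ?thesis by blast
qed

lemma coset_eq_iff:
  assumes "x \<in> carrier M" "y \<in> carrier M" shows "S +> y = S +> x \<longleftrightarrow> y \<ominus> x \<in> S"
proof
  assume "S +> y = S +> x"
  then have "y \<in> S +> x" using in_coset_self[OF assms(2)] by blast
  then show "y \<ominus> x \<in> S" using in_coset_iff assms by blast
next
  assume "y \<ominus> x \<in> S"
  then have "S +> ((y \<ominus> x) \<oplus> x) = S +> x" by (rule coset_eqI) fact
  then show "S +> y = S +> x" using assms by (simp add: minus_add_cancel)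
qed

lemma coset_zero: "S +> \<zero> = S"
  unfolding coset_def using S_carrier by force

lemma coset_of_mem: "s \<in> S \<Longrightarrow> S +> s = S"
  using coset_eqI[of s \<zero>] S_carrier by (simp add: coset_zero)

lemma quot_carrier: "carrier (quot_mod M S) = {S +> x | x. x \<in> carrier M}"
  by (auto simp: quot_mod_def A_RCOSETS_def')

lemma coset_in_quot [simp, intro]: "x \<in> carrier M \<Longrightarrow> S +> x \<in> carrier (quot_mod M S)"
  by (auto simp: quot_carrier)

lemma quotE:
  assumes "A \<in> carrier (quot_mod M S)" obtains x where "x \<in> carrier M" "A = S +> x"
  using assms unfolding quot_carrier by blast

lemma quot_zero: "\<zero>\<^bsub>quot_mod M S\<^esub> = S +> \<zero>"
  by (simp add: coset_zero quot_mod_def)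

lemma quot_add:
  assumes "x \<in> carrier M" "y \<in> carrier M"
  shows "(S +> x) \<oplus>\<^bsub>quot_mod M S\<^esub> (S +> y) = S +> (x \<oplus> y)"
proof -
  have "(S +> x) <+>\<^bsub>M\<^esub> (S +> y) = S +> (x \<oplus> y)"
  proof (intro Set.set_eqI iffI)
    fix z assume "z \<in> (S +> x) <+>\<^bsub>M\<^esub> (S +> y)"
    then obtain s t where st: "s \<in> S" "t \<in> S" "z = (s \<oplus> x) \<oplus> (t \<oplus> y)"
      unfolding coset_def set_add_def' by blast
    then have "z = (s \<oplus> t) \<oplus> (x \<oplus> y)" using assms S_carrier by (simp add: a_ac)
    then show "z \<in> S +> (x \<oplus> y)" unfolding coset_def using add_in_sub[OF sub st(1,2)] by blast
  next
    fix z assume "z \<in> S +> (x \<oplus> y)"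
    then obtain s where s: "s \<in> S" "z = s \<oplus> (x \<oplus> y)" unfolding coset_def by blast
    then have "z = (s \<oplus> x) \<oplus> (\<zero> \<oplus> y)" using assms S_carrier by (simp add: a_ac)
    then show "z \<in> (S +> x) <+>\<^bsub>M\<^esub> (S +> y)"
      unfolding coset_def set_add_def' using s(1) zero_in_sub[OF sub] by blast
  qed
  then show ?thesis by (simp add: quot_mod_def)
qed

lemma quot_smult:
  assumes "x \<in> carrier M"
  shows "c \<odot>\<^bsub>quot_mod M S\<^esub> (S +> x) = S +> (c \<odot> x)"
proof -
  have "S <+>\<^bsub>M\<^esub> ((\<lambda>x. c \<odot> x) ` (S +> x)) = S +> (c \<odot> x)"
  proof (intro Set.set_eqI iffI)
    fix z assume "z \<in> S <+>\<^bsub>M\<^esub> ((\<lambda>x. c \<odot> x) ` (S +> x))"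
    then obtain s t where st: "s \<in> S" "t \<in> S" "z = s \<oplus> c \<odot> (t \<oplus> x)"
      unfolding coset_def set_add_def' by blast
    then have "z = (s \<oplus> c \<odot> t) \<oplus> (c \<odot> x)" using assms S_carrier by (simp add: a_ac sm_add_right)
    then show "z \<in> S +> (c \<odot> x)"
      unfolding coset_def using add_in_sub[OF sub st(1) sm_in_sub[OF sub st(2)]] by blast
  next
    fix z assume "z \<in> S +> (c \<odot> x)"
    then obtain s where s: "s \<in> S" "z = s \<oplus> (c \<odot> x)" unfolding coset_def by blast
    then have "z = s \<oplus> (c \<odot> (\<zero> \<oplus> x))" using assms by simp
    then show "z \<in> S <+>\<^bsub>M\<^esub> ((\<lambda>x. c \<odot> x) ` (S +> x))"
      unfolding coset_def set_add_def' using s(1) zero_in_sub[OF sub] by blast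
  qed
  then show ?thesis by (simp add: quot_mod_def)
qed

lemma quot_kmod: "kmod (quot_mod M S)"
proof (rule kmodI)
qed (auto simp: quot_add quot_smult quot_zero sm_add_left sm_add_right sm_assoc a_ac elim!: quotE)

lemma quot_proj_lin: "(\<lambda>x. S +> x) \<in> lin_maps M (quot_mod M S)"
  by (intro lin_mapsI) (simp_all add: quot_add quot_smult)

text \<open>Invariance under \<open>S\<close> makes the image of the coset a singleton, which is
  what \<open>the_elem\<close> in \<open>quot_lift\<close> needs. The hypothesis concerns a single
  coset and no target module, so the rule also serves for vector-valued and coset-valued
  maps.\<close>

lemma quot_lift_coset:
  assumes "\<And>s. s \<in> S \<Longrightarrow> \<phi> (s \<oplus> x) = \<phi> x" "x \<in> carrier M"
  shows "quot_lift \<phi> (S +> x) = \<phi> x"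
proof -
  have "\<phi> ` (S +> x) = {\<phi> x}"
    using assms(1) in_coset_self[OF assms(2)] unfolding coset_def by (auto simp: image_iff)
  then show ?thesis by (simp add: quot_lift_def)
qed

lemma quot_lift_lin:
  assumes "\<phi> \<in> lin_maps M N" "kmod N" "\<And>s. s \<in> S \<Longrightarrow> \<phi> s = \<zero>\<^bsub>N\<^esub>"
  shows quot_lift_lin_coset: "x \<in> carrier M \<Longrightarrow> quot_lift \<phi> (S +> x) = \<phi> x"
    and quot_lift_lin_maps: "quot_lift \<phi> \<in> lin_maps (quot_mod M S) N"
proof -
  interpret N: kmod N by fact
  show *: "quot_lift \<phi> (S +> x) = \<phi> x" if "x \<in> carrier M" for x
    using that assms S_carrier by (intro quot_lift_coset) (auto simp: lin_add lin_closed)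
  show "quot_lift \<phi> \<in> lin_maps (quot_mod M S) N"
    by (intro lin_mapsI)
      (auto elim!: quotE simp: * quot_add quot_smult lin_add[OF assms(1)] lin_smult[OF assms(1)]
        lin_closed[OF assms(1)])
qed

end

subsection \<open>Free modules and tensor products\<close>

lemma free_mod_simps:
  "carrier (free_mod S) = {x. finite {s. x s \<noteq> 0} \<and> {s. x s \<noteq> 0} \<subseteq> S}"
  "\<zero>\<^bsub>free_mod S\<^esub> = (\<lambda>s. 0)" "x \<oplus>\<^bsub>free_mod S\<^esub> y = (\<lambda>s. x s + y s)"
  "c \<odot>\<^bsub>free_mod S\<^esub> x = (\<lambda>s. c * x s)"
  by (simp_all add: free_mod_def)

lemma free_kmod: "kmod (free_mod S :: ('k::field, 's \<Rightarrow> 'k) module)"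
proof (rule kmodI)
  fix x y :: "'s \<Rightarrow> 'k" assume xy: "x \<in> carrier (free_mod S)" "y \<in> carrier (free_mod S)"
  have "{s. x s + y s \<noteq> 0} \<subseteq> {s. x s \<noteq> 0} \<union> {s. y s \<noteq> 0}" by auto
  with xy show "x \<oplus>\<^bsub>free_mod S\<^esub> y \<in> carrier (free_mod S)"
    by (auto simp: free_mod_simps intro: finite_subset)
next
  fix x :: "'s \<Rightarrow> 'k" and c assume xy: "x \<in> carrier (free_mod S)"
  have "{s. c * x s \<noteq> 0} \<subseteq> {s. x s \<noteq> 0}" by auto
  with xy show "c \<odot>\<^bsub>free_mod S\<^esub> x \<in> carrier (free_mod S)"
    by (auto simp: free_mod_simps intro: finite_subset)
qed (auto simp: free_mod_simps fun_eq_iff algebra_simps)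

lemma delta_in_free: "s \<in> S \<Longrightarrow> (delta s :: 's \<Rightarrow> 'k::field) \<in> carrier (free_mod S)"
proof -
  assume "s \<in> S"
  moreover have "{u. (delta s :: 's \<Rightarrow> 'k) u \<noteq> 0} = {s}" by (auto simp: delta_def)
  ultimately show ?thesis by (simp add: free_mod_simps)
qed

text \<open>By induction on a finite set containing the support: the value at one point is split off
  as a multiple of \<open>delta\<close> at that point.\<close>

lemma free_induct:
  fixes x :: "'s \<Rightarrow> 'k::field"
  assumes "x \<in> carrier (free_mod S)" "P (\<lambda>s. 0)" "\<And>c s. s \<in> S \<Longrightarrow> P (\<lambda>u. c * delta s u)"
    and "\<And>x y. \<lbrakk>x \<in> carrier (free_mod S); y \<in> carrier (free_mod S); P x; P y\<rbrakk> \<Longrightarrow> P (\<lambda>s. x s + y s)"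
  shows "P x"
proof -
  have "P x" if "finite A" "A \<subseteq> S" "{s. x s \<noteq> 0} \<subseteq> A" for A and x :: "'s \<Rightarrow> 'k"
    using that
  proof (induction A arbitrary: x rule: finite_induct)
    case empty
    then have "x = (\<lambda>s. 0)" by auto
    then show ?case using assms(2) by simp
  next
    case (insert a A)
    let ?y = "x(a := 0)"
    have y: "{s. ?y s \<noteq> 0} \<subseteq> A" using insert.prems by auto
    have "P ?y" using insert.IH[of ?y] y insert.prems by blast
    moreover have "?y \<in> carrier (free_mod S)"
      using y insert finite_subset[OF y] by (auto simp: free_mod_simps)
    moreover have "(\<lambda>u. x a * delta a u) \<in> carrier (free_mod S)"
      using kmod.sm_closed[OF free_kmod delta_in_free, of a S "x a"] insert.prems
      by (simp add: free_mod_simps)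
    moreover have "x = (\<lambda>s. ?y s + x a * delta a s)" by (auto simp: delta_def fun_eq_iff)
    ultimately show ?case using assms(3)[of a "x a"] assms(4) insert.prems
      by (metis insert_subset)
  qed
  then show ?thesis using assms(1) unfolding free_mod_simps by blast
qed

context kmod
begin

text \<open>Enlarging the support to any finite set \<open>A\<close> allows the sums for x, y and x
  + y to run over one common index set.\<close>

lemma free_lift_eq:
  fixes x :: "'s \<Rightarrow> 'k"
  assumes "finite A" "{s. x s \<noteq> 0} \<subseteq> A" "\<And>s. s \<in> A \<Longrightarrow> \<phi> s \<in> carrier M"
  shows "free_lift M \<phi> x = (\<Oplus>s\<in>A. x s \<odot> \<phi> s)"
  unfolding free_lift_def
  by (rule add.finprod_mono_neutral_cong_left) (use assms in auto)

lemma free_lift_lin: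
  fixes S :: "'s set"
  assumes "\<And>s. s \<in> S \<Longrightarrow> \<phi> s \<in> carrier M"
  shows "free_lift M \<phi> \<in> lin_maps (free_mod S) M"
proof (rule lin_mapsI)
  fix x :: "'s \<Rightarrow> 'k" assume x: "x \<in> carrier (free_mod S)"
  then have "finite {s. x s \<noteq> 0}" "{s. x s \<noteq> 0} \<subseteq> S" by (auto simp: free_mod_simps)
  then show "free_lift M \<phi> x \<in> carrier M" unfolding free_lift_def using assms
    by (intro finsum_closed) auto
  fix c
  show "free_lift M \<phi> (c \<odot>\<^bsub>free_mod S\<^esub> x) = c \<odot> free_lift M \<phi> x"
  proof -
    let ?A = "{s. x s \<noteq> 0}"
    have A: "finite ?A" "\<And>s. s \<in> ?A \<Longrightarrow> \<phi> s \<in> carrier M" using x assms by (auto simp: free_mod_simps)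
    have "free_lift M \<phi> (c \<odot>\<^bsub>free_mod S\<^esub> x) = (\<Oplus>s\<in>?A. (c * x s) \<odot> \<phi> s)"
      using A by (subst free_lift_eq[OF A(1)]) (auto simp: free_mod_simps)
    also have "\<dots> = (\<Oplus>s\<in>?A. c \<odot> (x s \<odot> \<phi> s))"
      using A by (intro finsum_cong') (auto simp: sm_assoc)
    also have "\<dots> = c \<odot> (\<Oplus>s\<in>?A. x s \<odot> \<phi> s)" using A by (subst sm_finsum) auto
    finally show ?thesis by (simp add: free_lift_def)
  qed
next
  fix x y :: "'s \<Rightarrow> 'k" assume x: "x \<in> carrier (free_mod S)" and y: "y \<in> carrier (free_mod S)"
  let ?A = "{s. x s \<noteq> 0} \<union> {s. y s \<noteq> 0}"
  have A: "finite ?A" "\<And>s. s \<in> ?A \<Longrightarrow> \<phi> s \<in> carrier M" using x y assms by (auto simp: free_mod_simps)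
  have "free_lift M \<phi> (x \<oplus>\<^bsub>free_mod S\<^esub> y) = (\<Oplus>s\<in>?A. (x s + y s) \<odot> \<phi> s)"
    using A by (subst free_lift_eq[OF A(1)]) (auto simp: free_mod_simps)
  also have "\<dots> = (\<Oplus>s\<in>?A. x s \<odot> \<phi> s \<oplus> y s \<odot> \<phi> s)"
    using A by (intro finsum_cong') (auto simp: sm_add_left)
  also have "\<dots> = (\<Oplus>s\<in>?A. x s \<odot> \<phi> s) \<oplus> (\<Oplus>s\<in>?A. y s \<odot> \<phi> s)"
    using A by (subst finsum_addf) auto
  also have "(\<Oplus>s\<in>?A. x s \<odot> \<phi> s) = free_lift M \<phi> x"
    using A by (subst free_lift_eq[OF A(1)]) auto
  also have "(\<Oplus>s\<in>?A. y s \<odot> \<phi> s) = free_lift M \<phi> y"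
    using A by (subst free_lift_eq[OF A(1)]) auto
  finally show "free_lift M \<phi> (x \<oplus>\<^bsub>free_mod S\<^esub> y) = free_lift M \<phi> x \<oplus> free_lift M \<phi> y" .
qed

lemma free_lift_delta: "\<phi> s \<in> carrier M \<Longrightarrow> free_lift M \<phi> (delta s) = \<phi> s"
  by (subst free_lift_eq[of "{s}"]) (auto simp: delta_def)

end

definition bilinear_map ::
    "('k::field, 'v, 'x) module_scheme \<Rightarrow> ('k, 'w, 'y) module_scheme \<Rightarrow> ('k, 'u, 'z) module_scheme
       \<Rightarrow> ('v \<Rightarrow> 'w \<Rightarrow> 'u) \<Rightarrow> bool" where
  "bilinear_map V W Z b \<longleftrightarrow>
     (\<forall>v\<in>carrier V. b v \<in> lin_maps W Z) \<and> (\<forall>w\<in>carrier W. (\<lambda>v. b v w) \<in> lin_maps V Z)"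

lemma bilinear_mapI:
  "\<lbrakk>\<And>v. v \<in> carrier V \<Longrightarrow> b v \<in> lin_maps W Z; \<And>w. w \<in> carrier W \<Longrightarrow> (\<lambda>v. b v w) \<in> lin_maps V Z\<rbrakk>
    \<Longrightarrow> bilinear_map V W Z b"
  by (simp add: bilinear_map_def)

locale ktensor = V: kmod V + W: kmod W
  for V :: "('k::field, 'v, 'y) module_scheme" and W :: "('k, 'w, 'z) module_scheme"
begin

abbreviation (input) "F \<equiv> free_mod (carrier V \<times> carrier W) :: ('k, 'v \<times> 'w \<Rightarrow> 'k) module"

sublocale F: kmod F by (rule free_kmod)

lemma rels_carrier: "tensor_rels V W \<subseteq> carrier F"
  unfolding tensor_rels_def Let_def
  by (auto simp del: mem_Collect_eq intro!: F.minus_closed F.add.m_closed F.sm_closed delta_in_free)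

lemma null_sub: "submodule class_ring (tensor_null V W) F"
  unfolding tensor_null_def by (rule F.span_is_submodule[OF rels_carrier])

lemma rels_null: "tensor_rels V W \<subseteq> tensor_null V W"
  unfolding tensor_null_def by (rule F.in_own_span[OF rels_carrier])

sublocale Q: kquot F "tensor_null V W"
  by (intro kquot.intro kquot_axioms.intro free_kmod null_sub)

lemma tensor_kmod: "kmod (tensor V W)"
  unfolding tensor_def by (rule Q.quot_kmod)

sublocale T: kmod "tensor V W" by (rule tensor_kmod)

lemma tens_closed [simp, intro]:
  "\<lbrakk>v \<in> carrier V; w \<in> carrier W\<rbrakk> \<Longrightarrow> tens V W v w \<in> carrier (tensor V W)"
  unfolding tens_def tensor_def by (intro Q.coset_in_quot delta_in_free) simp

lemma delta_closed: "\<lbrakk>v \<in> carrier V; w \<in> carrier W\<rbrakk> \<Longrightarrow> delta (v, w) \<in> carrier F"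
  by (intro delta_in_free) simp

lemma tens_bilinear: "bilinear_map V W (tensor V W) (tens V W)"
proof (intro bilinear_mapI lin_mapsI)
  fix v w w' assume *: "v \<in> carrier V" "w \<in> carrier W" "w' \<in> carrier W"
  have "delta (v, w \<oplus>\<^bsub>W\<^esub> w') \<ominus>\<^bsub>F\<^esub> (delta (v, w) \<oplus>\<^bsub>F\<^esub> delta (v, w')) \<in> tensor_null V W"
    by (rule subsetD[OF rels_null]) (use * in \<open>unfold tensor_rels_def Let_def, blast\<close>)
  then show "tens V W v (w \<oplus>\<^bsub>W\<^esub> w') = tens V W v w \<oplus>\<^bsub>tensor V W\<^esub> tens V W v w'"
    unfolding tens_def tensor_def using * by (simp add: Q.quot_add delta_closed Q.coset_eq_iff)
next
  fix v c w assume *: "v \<in> carrier V" "w \<in> carrier W"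
  have "delta (v, c \<odot>\<^bsub>W\<^esub> w) \<ominus>\<^bsub>F\<^esub> c \<odot>\<^bsub>F\<^esub> delta (v, w) \<in> tensor_null V W"
    by (rule subsetD[OF rels_null]) (use * in \<open>unfold tensor_rels_def Let_def, blast\<close>)
  then show "tens V W v (c \<odot>\<^bsub>W\<^esub> w) = c \<odot>\<^bsub>tensor V W\<^esub> tens V W v w"
    unfolding tens_def tensor_def using * by (simp add: Q.quot_smult delta_closed Q.coset_eq_iff)
next
  fix v v' w assume *: "w \<in> carrier W" "v \<in> carrier V" "v' \<in> carrier V"
  have "delta (v \<oplus>\<^bsub>V\<^esub> v', w) \<ominus>\<^bsub>F\<^esub> (delta (v, w) \<oplus>\<^bsub>F\<^esub> delta (v', w)) \<in> tensor_null V W"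
    by (rule subsetD[OF rels_null]) (use * in \<open>unfold tensor_rels_def Let_def, blast\<close>)
  then show "tens V W (v \<oplus>\<^bsub>V\<^esub> v') w = tens V W v w \<oplus>\<^bsub>tensor V W\<^esub> tens V W v' w"
    unfolding tens_def tensor_def using * by (simp add: Q.quot_add delta_closed Q.coset_eq_iff)
next
  fix v c w assume *: "w \<in> carrier W" "v \<in> carrier V"
  have "delta (c \<odot>\<^bsub>V\<^esub> v, w) \<ominus>\<^bsub>F\<^esub> c \<odot>\<^bsub>F\<^esub> delta (v, w) \<in> tensor_null V W"
    by (rule subsetD[OF rels_null]) (use * in \<open>unfold tensor_rels_def Let_def, blast\<close>)
  then show "tens V W (c \<odot>\<^bsub>V\<^esub> v) w = c \<odot>\<^bsub>tensor V W\<^esub> tens V W v w"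
    unfolding tens_def tensor_def using * by (simp add: Q.quot_smult delta_closed Q.coset_eq_iff)
qed auto

lemma tens_lin_right: "v \<in> carrier V \<Longrightarrow> tens V W v \<in> lin_maps W (tensor V W)"
  and tens_lin_left: "w \<in> carrier W \<Longrightarrow> (\<lambda>v. tens V W v w) \<in> lin_maps V (tensor V W)"
  using tens_bilinear by (auto simp: bilinear_map_def)

text \<open>The cases for zero and for scalar multiples are absorbed by the one for pure tensors:
  zero is the tensor of two zeros, and a scalar can be moved into the left factor.\<close>

lemma tensor_induct:
  assumes "x \<in> carrier (tensor V W)"
    and tens: "\<And>v w. \<lbrakk>v \<in> carrier V; w \<in> carrier W\<rbrakk> \<Longrightarrow> P (tens V W v w)"
    and add: "\<And>x y. \<lbrakk>x \<in> carrier (tensor V W); y \<in> carrier (tensor V W); P x; P y\<rbrakk>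
      \<Longrightarrow> P (x \<oplus>\<^bsub>tensor V W\<^esub> y)"
  shows "P x"
proof -
  obtain y where y: "y \<in> carrier F" "x = tensor_null V W +>\<^bsub>F\<^esub> y"
    using assms(1) unfolding tensor_def by (rule Q.quotE)
  have 0: "P (\<zero>\<^bsub>tensor V W\<^esub>)"
  proof -
    have "tens V W \<zero>\<^bsub>V\<^esub> \<zero>\<^bsub>W\<^esub> = \<zero>\<^bsub>tensor V W\<^esub>"
      by (rule lin_zero[OF V.kmod_axioms' T.kmod_axioms' tens_lin_left]) simp
    then show ?thesis using tens[of "\<zero>\<^bsub>V\<^esub>" "\<zero>\<^bsub>W\<^esub>"] by simp
  qed
  have "P (tensor_null V W +>\<^bsub>F\<^esub> y)" 
  proof (rule free_induct[where P = "\<lambda>y. P (tensor_null V W +>\<^bsub>F\<^esub> y)", OF y(1)])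
    show "P (tensor_null V W +>\<^bsub>F\<^esub> (\<lambda>s. 0))" using 0 unfolding tensor_def Q.quot_zero by (simp only: free_mod_simps(2))
  next
    fix c s assume 2: "s \<in> carrier V \<times> carrier W"
    obtain v w where s: "s = (v, w)" "v \<in> carrier V" "w \<in> carrier W" using 2 by auto
    have "tensor_null V W +>\<^bsub>F\<^esub> (c \<odot>\<^bsub>F\<^esub> delta s) = c \<odot>\<^bsub>tensor V W\<^esub> tens V W v w"
      unfolding tens_def tensor_def s using s by (simp add: Q.quot_smult delta_closed)
    also have "\<dots> = tens V W (c \<odot>\<^bsub>V\<^esub> v) w" using s by (simp add: lin_smult[OF tens_lin_left])
    finally have "tensor_null V W +>\<^bsub>F\<^esub> (\<lambda>u. c * delta s u) = tens V W (c \<odot>\<^bsub>V\<^esub> v) w"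
      by (simp only: free_mod_simps(4))
    then show "P (tensor_null V W +>\<^bsub>F\<^esub> (\<lambda>u. c * delta s u))" using tens[of "c \<odot>\<^bsub>V\<^esub> v" w] s by simp
  next
    fix x y assume 3: "x \<in> carrier F" "y \<in> carrier F" "P (tensor_null V W +>\<^bsub>F\<^esub> x)"
      "P (tensor_null V W +>\<^bsub>F\<^esub> y)"
    have "tensor_null V W +>\<^bsub>F\<^esub> (x \<oplus>\<^bsub>F\<^esub> y) =
        (tensor_null V W +>\<^bsub>F\<^esub> x) \<oplus>\<^bsub>tensor V W\<^esub> (tensor_null V W +>\<^bsub>F\<^esub> y)"
      unfolding tensor_def using 3 by (simp add: Q.quot_add)
    moreover have "tensor_null V W +>\<^bsub>F\<^esub> x \<in> carrier (tensor V W)"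
        "tensor_null V W +>\<^bsub>F\<^esub> y \<in> carrier (tensor V W)"
      unfolding tensor_def using 3 by (simp_all only: Q.coset_in_quot)
    ultimately show "P (tensor_null V W +>\<^bsub>F\<^esub> (\<lambda>s. x s + y s))" using add 3(3,4) by (simp only: free_mod_simps(3))
  qed
  then show ?thesis using y by simp
qed

lemma tensor_lift:
  assumes b: "bilinear_map V W Z b" and Z: "kmod Z"
  shows tensor_lift_lin: "tensor_lift Z b \<in> lin_maps (tensor V W) Z"
    and tensor_lift_tens:
      "\<lbrakk>v \<in> carrier V; w \<in> carrier W\<rbrakk> \<Longrightarrow> tensor_lift Z b (tens V W v w) = b v w"
proof -
  interpret Z: kmod Z by fact
  let ?\<phi> = "free_lift Z (\<lambda>(v, w). b v w)"
  have bc: "b v w \<in> carrier Z" if "v \<in> carrier V" "w \<in> carrier W" for v w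
    using that b by (auto simp: bilinear_map_def intro: lin_closed)
  have lin: "?\<phi> \<in> lin_maps F Z" by (rule Z.free_lift_lin) (auto intro: bc)
  have del: "?\<phi> (delta (v, w)) = b v w" if "v \<in> carrier V" "w \<in> carrier W" for v w
    using that by (subst Z.free_lift_delta) (auto intro: bc)
  let ?K = "{x \<in> carrier F. ?\<phi> x = \<zero>\<^bsub>Z\<^esub>}"
  have K: "submodule class_ring ?K F"
    using lin lin_zero[OF F.kmod_axioms' Z lin]
    by (intro F.submoduleI) (auto simp: lin_add lin_smult)
  have r: "b v \<in> lin_maps W Z" if "v \<in> carrier V" for v using that b by (simp add: bilinear_map_def)
  have l: "(\<lambda>v. b v w) \<in> lin_maps V Z" if "w \<in> carrier W" for w using that b by (simp add: bilinear_map_def)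
  \<comment> \<open>Bilinearity of \<open>b\<close> is exactly the statement that each of the four
    kinds of relations is sent to zero; the kernel is a submodule, so it then contains the whole
    span.\<close>
  have z: "?\<phi> x = \<zero>\<^bsub>Z\<^esub>" if "x \<in> tensor_rels V W" for x
    using that unfolding tensor_rels_def Let_def
    by (auto simp: lin_minus[OF F.kmod_axioms' Z lin] delta_closed lin_add[OF lin] lin_smult[OF lin]
      del bc lin_add[OF r] lin_smult[OF r] lin_add[OF l] lin_smult[OF l] Z.r_neg Z.minus_eq)
  have "tensor_rels V W \<subseteq> ?K" using z rels_carrier by blast
  then have "tensor_null V W \<subseteq> ?K" unfolding tensor_null_def using K by (rule F.span_subset_sub)
  then have nul: "?\<phi> x = \<zero>\<^bsub>Z\<^esub>" if "x \<in> tensor_null V W" for x using that by blast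
  show "tensor_lift Z b \<in> lin_maps (tensor V W) Z"
    unfolding tensor_lift_def tensor_def by (rule Q.quot_lift_lin_maps[OF lin Z nul])
  show "tensor_lift Z b (tens V W v w) = b v w" if "v \<in> carrier V" "w \<in> carrier W"
    unfolding tensor_lift_def tens_def
    using Q.quot_lift_lin_coset[OF lin Z nul delta_closed[OF that]] del[OF that] by simp
qed

lemma tensor_lin_eqI:
  assumes "f \<in> lin_maps (tensor V W) Z" "g \<in> lin_maps (tensor V W) Z"
    and "\<And>v w. \<lbrakk>v \<in> carrier V; w \<in> carrier W\<rbrakk> \<Longrightarrow> f (tens V W v w) = g (tens V W v w)"
    and "x \<in> carrier (tensor V W)"
  shows "f x = g x"
  by (rule tensor_induct[where P = "\<lambda>x. f x = g x", OF assms(4)])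
    (simp_all add: assms(3) lin_add[OF assms(1)] lin_add[OF assms(2)])

end

section \<open>Locally constant functions\<close>

text \<open>Continuity into a discrete space without naming that space, so that functions with
  values in any type, including cosets and modules, are covered.\<close>

definition loc_const :: "'a topology \<Rightarrow> ('a \<Rightarrow> 'b) \<Rightarrow> bool" where
  "loc_const X f \<longleftrightarrow> (\<forall>x\<in>topspace X. \<exists>U. openin X U \<and> x \<in> U \<and> (\<forall>y\<in>U. f y = f x))"

lemma loc_constD:
  "\<lbrakk>loc_const X f; x \<in> topspace X\<rbrakk> \<Longrightarrow> \<exists>U. openin X U \<and> x \<in> U \<and> (\<forall>y\<in>U. f y = f x)"
  by (simp add: loc_const_def)

lemma continuous_map_discrete_iff:
  "continuous_map X (discrete_topology S) f \<longleftrightarrow> f \<in> topspace X \<rightarrow> S \<and> loc_const X f"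
proof
  assume c: "continuous_map X (discrete_topology S) f"
  have "\<exists>U. openin X U \<and> x \<in> U \<and> (\<forall>y\<in>U. f y = f x)" if x: "x \<in> topspace X" for x
  proof -
    have "f x \<in> S" using continuous_map_image_subset_topspace[OF c] x by auto
    then have "openin X {y \<in> topspace X. f y \<in> {f x}}"
      by (intro openin_continuous_map_preimage[OF c]) auto
    then show ?thesis using x by (intro exI[of _ "{y \<in> topspace X. f y \<in> {f x}}"]) auto
  qed
  then show "f \<in> topspace X \<rightarrow> S \<and> loc_const X f"
    using continuous_map_image_subset_topspace[OF c] by (auto simp: loc_const_def)
next
  assume *: "f \<in> topspace X \<rightarrow> S \<and> loc_const X f"
  have "openin X {x \<in> topspace X. f x \<in> U}" for U
  proof (subst openin_subopen, intro ballI)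
    fix x assume x: "x \<in> {x \<in> topspace X. f x \<in> U}"
    have x': "x \<in> topspace X" and lc: "loc_const X f" using x * by simp_all
    obtain V where V: "openin X V" "x \<in> V" "\<forall>y\<in>V. f y = f x"
      using loc_constD[OF lc x'] by blast
    then have "V \<subseteq> {x \<in> topspace X. f x \<in> U}" 
    proof (intro subsetI CollectI conjI)
      fix y assume y: "y \<in> V"
      show "y \<in> topspace X" using y openin_subset[OF V(1)] by blast
      have "f y = f x" using V(3) y by (rule bspec)
      then show "f y \<in> U" using x by simp
    qed
    then show "\<exists>T. openin X T \<and> x \<in> T \<and> T \<subseteq> {x \<in> topspace X. f x \<in> U}" using V by blast
  qed
  then show "continuous_map X (discrete_topology S) f" using * by (auto simp: continuous_map_def)
qed

lemma loc_const_const: "loc_const X (\<lambda>x. c)"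
  unfolding loc_const_def by (intro ballI exI[of _ "topspace X"]) auto

lemma loc_const_cong:
  assumes "loc_const X f" "\<And>x. x \<in> topspace X \<Longrightarrow> g x = f x" shows "loc_const X g"
  unfolding loc_const_def
proof
  fix x assume x: "x \<in> topspace X"
  obtain U where U: "openin X U" "x \<in> U" "\<forall>y\<in>U. f y = f x"
    using loc_constD[OF assms(1) x] by blast
  then have "\<forall>y\<in>U. g y = g x" using assms(2) x openin_subset[OF U(1)] by (metis subsetD)
  then show "\<exists>U. openin X U \<and> x \<in> U \<and> (\<forall>y\<in>U. g y = g x)" using U by blast
qed

text \<open>With \<open>b\<close> depending on both arguments, this covers \<open>(g, h) \<mapsto> g \<cdot> f h\<close> for a discrete module.\<close>

lemma loc_const_bind:
  assumes "loc_const X f" "\<And>x. x \<in> topspace X \<Longrightarrow> loc_const X (\<lambda>y. b y (f x))"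
  shows "loc_const X (\<lambda>x. b x (f x))"
  unfolding loc_const_def
proof
  fix x assume x: "x \<in> topspace X"
  obtain U where U: "openin X U" "x \<in> U" "\<forall>y\<in>U. f y = f x"
    using loc_constD[OF assms(1) x] by blast
  obtain V where V: "openin X V" "x \<in> V" "\<forall>y\<in>V. b y (f x) = b x (f x)"
    using loc_constD[OF assms(2)[OF x] x] by blast
  show "\<exists>U. openin X U \<and> x \<in> U \<and> (\<forall>y\<in>U. b y (f y) = b x (f x))"

  proof (intro exI[of _ "U \<inter> V"] conjI ballI)
    fix y assume y: "y \<in> U \<inter> V"
    have e: "f y = f x" using U(3) y by blast
    have "b y (f x) = b x (f x)" using V(3) y by blast
    then show "b y (f y) = b x (f x)" unfolding e .
  qed (use U(1,2) V(1,2) in \<open>simp_all add: openin_Int\<close>)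
qed

text \<open>The outer function is arbitrary. This is what makes cochains built from set-theoretic
  choices continuous later on.\<close>

lemma loc_const_comp: "loc_const X f \<Longrightarrow> loc_const X (\<lambda>x. \<phi> (f x))"
  by (rule loc_const_bind[where b = "\<lambda>x. \<phi>"]) (auto intro: loc_const_const)

lemma loc_const_comp2: "\<lbrakk>loc_const X f; loc_const X g\<rbrakk> \<Longrightarrow> loc_const X (\<lambda>x. \<phi> (f x) (g x))"
  by (rule loc_const_bind[where b = "\<lambda>x a. \<phi> a (g x)"]) (auto intro: loc_const_comp)

lemma loc_const_pullback:
  assumes "continuous_map X Y h" "loc_const Y f" shows "loc_const X (\<lambda>x. f (h x))"
  unfolding loc_const_def
proof
  fix x assume x: "x \<in> topspace X"
  then have hx: "h x \<in> topspace Y" using continuous_map_image_subset_topspace[OF assms(1)] by auto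
  obtain U where U: "openin Y U" "h x \<in> U" "\<forall>y\<in>U. f y = f (h x)"
    using loc_constD[OF assms(2) hx] by blast
  show "\<exists>U. openin X U \<and> x \<in> U \<and> (\<forall>y\<in>U. f (h y) = f (h x))"

  proof (intro exI[of _ "{x \<in> topspace X. h x \<in> U}"] conjI ballI)
    show "openin X {x \<in> topspace X. h x \<in> U}" by (rule openin_continuous_map_preimage[OF assms(1) U(1)])
    fix y assume "y \<in> {x \<in> topspace X. h x \<in> U}"
    then show "f (h y) = f (h x)" using U(3) by blast
  qed (use U(2) x in simp)
qed

section \<open>Discrete modules and their cohomology\<close>

locale tgroup = group G for G :: "'g topgroup" (structure) +
  assumes top: "topspace (gtop G) = carrier G"
    and cont_mult: "continuous_map (prod_topology (gtop G) (gtop G)) (gtop G) (\<lambda>(x, y). x \<otimes> y)"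
begin

abbreviation (input) "G2 \<equiv> prod_topology (gtop G) (gtop G)"

lemma loc_const_fst: "loc_const (gtop G) f \<Longrightarrow> loc_const G2 (\<lambda>p. f (fst p))"
  by (rule loc_const_pullback[OF continuous_map_fst])

lemma loc_const_snd: "loc_const (gtop G) f \<Longrightarrow> loc_const G2 (\<lambda>p. f (snd p))"
  by (rule loc_const_pullback[OF continuous_map_snd])

lemma loc_const_mult: "loc_const (gtop G) f \<Longrightarrow> loc_const G2 (\<lambda>p. f (fst p \<otimes> snd p))"
  using loc_const_pullback[OF cont_mult] by (simp add: case_prod_unfold)

end

lemma discrete_gmodule_simps [simp]:
  "carrier (discrete_gmodule M a) = carrier M" "zero (discrete_gmodule M a) = zero M"
  "add (discrete_gmodule M a) = add M" "smult (discrete_gmodule M a) = smult M"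
  "mtop (discrete_gmodule M a) = discrete_topology (carrier M)" "gact (discrete_gmodule M a) = a"
  by (simp_all add: discrete_gmodule_def)

text \<open>The module axioms mention only these fields, so they carry over to records that add a
  topology and an action or replace the multiplication.\<close>

lemma kmod_cong:
  assumes "kmod M" "carrier M' = carrier M" "zero M' = zero M" "add M' = add M" "smult M' = smult M"
  shows "kmod M'"
proof -
  interpret kmod M by fact
  show ?thesis
    by (rule kmodI) (auto simp: assms sm_add_left sm_add_right sm_assoc a_ac)
qed

lemma discrete_gmodule_kmod: "kmod M \<Longrightarrow> kmod (discrete_gmodule M a)"
  by (erule kmod_cong) simp_all

lemma fun_mod_simps:
  "carrier (fun_mod D M) = D \<rightarrow>\<^sub>E carrier M" "\<zero>\<^bsub>fun_mod D M\<^esub> = (\<lambda>s\<in>D. \<zero>\<^bsub>M\<^esub>)"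
  "x \<oplus>\<^bsub>fun_mod D M\<^esub> y = (\<lambda>s\<in>D. x s \<oplus>\<^bsub>M\<^esub> y s)" "c \<odot>\<^bsub>fun_mod D M\<^esub> x = (\<lambda>s\<in>D. c \<odot>\<^bsub>M\<^esub> x s)"
  by (simp_all add: fun_mod_def)

lemma (in kmod) fun_mod_kmod:
  fixes D :: "'s set" shows "kmod (fun_mod D M)"
proof -
  have mem: "x s \<in> carrier M" if "x \<in> D \<rightarrow>\<^sub>E carrier M" "s \<in> D" for x s using that by (rule PiE_mem)
  have id: "(\<lambda>s\<in>D. h s) = x" if "x \<in> D \<rightarrow>\<^sub>E carrier M" "\<And>s. s \<in> D \<Longrightarrow> h s = x s" for x h
  proof (rule extensionalityI[of _ D])
    show "x \<in> extensional D" using that(1) by (simp add: PiE_iff)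
  qed (simp_all add: that(2))
  show ?thesis
    unfolding fun_mod_def
  proof (rule kmodI, simp_all only: module.simps ring.simps monoid.simps partial_object.simps)
    show "(\<lambda>s\<in>D. \<zero>) \<in> D \<rightarrow>\<^sub>E carrier M" by simp
    fix x y z :: "'s \<Rightarrow> 'a" and a b :: 'k
    assume x: "x \<in> D \<rightarrow>\<^sub>E carrier M"
    show "(\<lambda>s\<in>D. a \<odot> x s) \<in> D \<rightarrow>\<^sub>E carrier M" using mem[OF x] by simp
    show "(\<lambda>s\<in>D. x s \<oplus> (\<lambda>s\<in>D. \<zero>) s) = x" by (rule id[OF x]) (simp add: mem[OF x])
    show "(\<lambda>s\<in>D. (a + b) \<odot> x s) = (\<lambda>s\<in>D. (\<lambda>s\<in>D. a \<odot> x s) s \<oplus> (\<lambda>s\<in>D. b \<odot> x s) s)"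
      by (rule restrict_ext) (simp add: mem[OF x] sm_add_left)
    show "(\<lambda>s\<in>D. (a * b) \<odot> x s) = (\<lambda>s\<in>D. a \<odot> (\<lambda>s\<in>D. b \<odot> x s) s)"
      by (rule restrict_ext) (simp add: mem[OF x] sm_assoc)
    show "(\<lambda>s\<in>D. 1 \<odot> x s) = x" by (rule id[OF x]) (simp add: mem[OF x])
    show "(\<lambda>s\<in>D. 0 \<odot> x s) = (\<lambda>s\<in>D. \<zero>)" by (rule restrict_ext) (simp add: mem[OF x])
    assume y: "y \<in> D \<rightarrow>\<^sub>E carrier M"
    show "(\<lambda>s\<in>D. x s \<oplus> y s) \<in> D \<rightarrow>\<^sub>E carrier M" using mem[OF x] mem[OF y] by simp
    show "(\<lambda>s\<in>D. x s \<oplus> y s) = (\<lambda>s\<in>D. y s \<oplus> x s)"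
      by (rule restrict_ext) (simp add: mem[OF x] mem[OF y] a_comm)
    show "(\<lambda>s\<in>D. a \<odot> (\<lambda>s\<in>D. x s \<oplus> y s) s) = (\<lambda>s\<in>D. (\<lambda>s\<in>D. a \<odot> x s) s \<oplus> (\<lambda>s\<in>D. a \<odot> y s) s)"
      by (rule restrict_ext) (simp add: mem[OF x] mem[OF y] sm_add_right)
    assume z: "z \<in> D \<rightarrow>\<^sub>E carrier M"
    show "(\<lambda>s\<in>D. (\<lambda>s\<in>D. x s \<oplus> y s) s \<oplus> z s) = (\<lambda>s\<in>D. x s \<oplus> (\<lambda>s\<in>D. y s \<oplus> z s) s)"
      by (rule restrict_ext) (simp add: mem[OF x] mem[OF y] mem[OF z] a_assoc)
  qed
qed

text \<open>For a discrete module, joint continuity of the action amounts to local constancy of each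
  orbit map separately, which is the form of \<open>act_loc_const\<close>;
  \<open>loc_const_act\<close> turns it back into a statement about two group variables.\<close>

locale dgmod = G?: tgroup G + M?: kmod M
  for G :: "'g topgroup" and M :: "('k::field, 'g, 'm) gmodule" +
  assumes discrete: "mtop M = discrete_topology (carrier M)"
    and act_lin: "g \<in> carrier G \<Longrightarrow> gact M g \<in> lin_maps M M"
    and act_one: "x \<in> carrier M \<Longrightarrow> gact M \<one>\<^bsub>G\<^esub> x = x"
    and act_mult: "\<lbrakk>g \<in> carrier G; h \<in> carrier G; x \<in> carrier M\<rbrakk>
      \<Longrightarrow> gact M (g \<otimes>\<^bsub>G\<^esub> h) x = gact M g (gact M h x)"
    and act_loc_const: "x \<in> carrier M \<Longrightarrow> loc_const (gtop G) (\<lambda>g. gact M g x)"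
begin

lemma act_closed [simp, intro]: "\<lbrakk>g \<in> carrier G; x \<in> carrier M\<rbrakk> \<Longrightarrow> gact M g x \<in> carrier M"
  by (rule lin_closed[OF act_lin])

lemma act_add: "\<lbrakk>g \<in> carrier G; x \<in> carrier M; y \<in> carrier M\<rbrakk>
    \<Longrightarrow> gact M g (x \<oplus>\<^bsub>M\<^esub> y) = gact M g x \<oplus>\<^bsub>M\<^esub> gact M g y"
  by (rule lin_add[OF act_lin])

lemma act_smult: "\<lbrakk>g \<in> carrier G; x \<in> carrier M\<rbrakk> \<Longrightarrow> gact M g (c \<odot>\<^bsub>M\<^esub> x) = c \<odot>\<^bsub>M\<^esub> gact M g x"
  by (rule lin_smult[OF act_lin])

lemma act_minus: "\<lbrakk>g \<in> carrier G; x \<in> carrier M; y \<in> carrier M\<rbrakk>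
    \<Longrightarrow> gact M g (x \<ominus>\<^bsub>M\<^esub> y) = gact M g x \<ominus>\<^bsub>M\<^esub> gact M g y"
  by (rule lin_minus[OF M.kmod_axioms' M.kmod_axioms' act_lin])

lemma act_zero: "g \<in> carrier G \<Longrightarrow> gact M g \<zero>\<^bsub>M\<^esub> = \<zero>\<^bsub>M\<^esub>"
  by (rule lin_zero[OF M.kmod_axioms' M.kmod_axioms' act_lin])

lemma C1_iff: "f \<in> C1 G M \<longleftrightarrow> f \<in> carrier G \<rightarrow>\<^sub>E carrier M \<and> loc_const (gtop G) f"
  unfolding C1_def discrete continuous_map_discrete_iff top by auto

lemma C2_iff: "c \<in> C2 G M \<longleftrightarrow> c \<in> carrier G \<times> carrier G \<rightarrow>\<^sub>E carrier M \<and> loc_const G2 c"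
  unfolding C2_def discrete continuous_map_discrete_iff topspace_prod_topology top by auto

lemma C1_closed: "\<lbrakk>f \<in> C1 G M; g \<in> carrier G\<rbrakk> \<Longrightarrow> f g \<in> carrier M"
  by (auto simp: C1_iff)

lemma Z2_closed: "\<lbrakk>c \<in> Z2 G M; g \<in> carrier G; h \<in> carrier G\<rbrakk> \<Longrightarrow> c (g, h) \<in> carrier M"
  by (auto simp: Z2_def C2_iff)

lemma Z2_cocycle: "\<lbrakk>c \<in> Z2 G M; g \<in> carrier G; h \<in> carrier G; k \<in> carrier G\<rbrakk> \<Longrightarrow>
    gact M g (c (h, k)) \<oplus>\<^bsub>M\<^esub> c (g, h \<otimes>\<^bsub>G\<^esub> k) = c (g \<otimes>\<^bsub>G\<^esub> h, k) \<oplus>\<^bsub>M\<^esub> c (g, h)"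
  by (simp add: Z2_def)

lemma d1_apply: "\<lbrakk>g \<in> carrier G; h \<in> carrier G\<rbrakk>
    \<Longrightarrow> d1 G M f (g, h) = (gact M g (f h) \<ominus>\<^bsub>M\<^esub> f (g \<otimes>\<^bsub>G\<^esub> h)) \<oplus>\<^bsub>M\<^esub> f g"
  by (simp add: d1_def)

lemma loc_const_act: "loc_const (gtop G) f \<Longrightarrow> f \<in> carrier G \<rightarrow> carrier M
    \<Longrightarrow> loc_const G2 (\<lambda>p. gact M (fst p) (f (snd p)))"
  by (rule loc_const_bind[where b = "\<lambda>p. gact M (fst p)", OF loc_const_snd])
    (auto intro!: loc_const_fst act_loc_const simp: top)

lemma d1_C2: assumes "f \<in> C1 G M" shows "d1 G M f \<in> C2 G M"
proof -
  have f: "f \<in> carrier G \<rightarrow> carrier M" "loc_const (gtop G) f" using assms by (auto simp: C1_iff)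
  have "loc_const G2 (\<lambda>p. (gact M (fst p) (f (snd p)) \<ominus>\<^bsub>M\<^esub> f (fst p \<otimes>\<^bsub>G\<^esub> snd p)) \<oplus>\<^bsub>M\<^esub> f (fst p))"
    by (rule loc_const_comp2[where \<phi> = "add M"], rule loc_const_comp2[where \<phi> = "a_minus M"],
        rule loc_const_act[OF f(2,1)], rule loc_const_mult[OF f(2)], rule loc_const_fst[OF f(2)])
  then have "loc_const G2 (d1 G M f)"
    by (rule loc_const_cong) (auto simp: top d1_def)
  moreover have "d1 G M f \<in> carrier G \<times> carrier G \<rightarrow>\<^sub>E carrier M"
    using f(1) by (auto simp: d1_def Pi_iff)
  ultimately show ?thesis by (simp add: C2_iff)
qed

text \<open>The identity d d = 0 in degree one, with the six values abstracted: b cancels on the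
  left and f on the right, and what is left agrees.\<close>

lemma cancel_cocycle:
  assumes "a \<in> carrier M" "b \<in> carrier M" "c \<in> carrier M" "d \<in> carrier M" "e \<in> carrier M" "f \<in> carrier M"
  shows "((a \<ominus>\<^bsub>M\<^esub> b) \<oplus>\<^bsub>M\<^esub> c) \<oplus>\<^bsub>M\<^esub> ((b \<ominus>\<^bsub>M\<^esub> d) \<oplus>\<^bsub>M\<^esub> e) = ((a \<ominus>\<^bsub>M\<^esub> d) \<oplus>\<^bsub>M\<^esub> f) \<oplus>\<^bsub>M\<^esub> ((c \<ominus>\<^bsub>M\<^esub> f) \<oplus>\<^bsub>M\<^esub> e)"
proof -
  note cl = assms M.add.m_closed M.a_inv_closed
  have "((a \<ominus>\<^bsub>M\<^esub> b) \<oplus>\<^bsub>M\<^esub> c) \<oplus>\<^bsub>M\<^esub> ((b \<ominus>\<^bsub>M\<^esub> d) \<oplus>\<^bsub>M\<^esub> e) =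
      (b \<oplus>\<^bsub>M\<^esub> \<ominus>\<^bsub>M\<^esub> b) \<oplus>\<^bsub>M\<^esub> (a \<oplus>\<^bsub>M\<^esub> c \<oplus>\<^bsub>M\<^esub> \<ominus>\<^bsub>M\<^esub> d \<oplus>\<^bsub>M\<^esub> e)"
    by (simp only: a_minus_def M.a_ac cl)
  moreover have "((a \<ominus>\<^bsub>M\<^esub> d) \<oplus>\<^bsub>M\<^esub> f) \<oplus>\<^bsub>M\<^esub> ((c \<ominus>\<^bsub>M\<^esub> f) \<oplus>\<^bsub>M\<^esub> e) =
      (f \<oplus>\<^bsub>M\<^esub> \<ominus>\<^bsub>M\<^esub> f) \<oplus>\<^bsub>M\<^esub> (a \<oplus>\<^bsub>M\<^esub> c \<oplus>\<^bsub>M\<^esub> \<ominus>\<^bsub>M\<^esub> d \<oplus>\<^bsub>M\<^esub> e)"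
    by (simp only: a_minus_def M.a_ac cl)
  ultimately show ?thesis by (simp only: M.r_neg cl)
qed

lemma d1_Z2: assumes f: "f \<in> C1 G M" shows "d1 G M f \<in> Z2 G M"
  unfolding Z2_def
proof (intro CollectI conjI ballI)
  show "d1 G M f \<in> C2 G M" by (rule d1_C2[OF f])
  fix g h k assume *: "g \<in> carrier G" "h \<in> carrier G" "k \<in> carrier G"
  note fc = C1_closed[OF f]
  show "gact M g (d1 G M f (h, k)) \<oplus>\<^bsub>M\<^esub> d1 G M f (g, h \<otimes>\<^bsub>G\<^esub> k) =
      d1 G M f (g \<otimes>\<^bsub>G\<^esub> h, k) \<oplus>\<^bsub>M\<^esub> d1 G M f (g, h)"
    using * cancel_cocycle[of "gact M g (gact M h (f k))" "gact M g (f (h \<otimes>\<^bsub>G\<^esub> k))" "gact M g (f h)"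
        "f (g \<otimes>\<^bsub>G\<^esub> h \<otimes>\<^bsub>G\<^esub> k)" "f g" "f (g \<otimes>\<^bsub>G\<^esub> h)"]
    by (simp add: d1_apply fc act_add act_minus act_mult G.m_assoc)
qed

lemma d1_add:
  assumes "f \<in> C1 G M" "f' \<in> C1 G M"
  shows "(\<lambda>s\<in>carrier G. f s \<oplus>\<^bsub>M\<^esub> f' s) \<in> C1 G M"
    and "d1 G M (\<lambda>s\<in>carrier G. f s \<oplus>\<^bsub>M\<^esub> f' s) =
      (\<lambda>s\<in>carrier G \<times> carrier G. d1 G M f s \<oplus>\<^bsub>M\<^esub> d1 G M f' s)"
proof -
  have f: "f \<in> carrier G \<rightarrow> carrier M" "loc_const (gtop G) f"
    and f': "f' \<in> carrier G \<rightarrow> carrier M" "loc_const (gtop G) f'" using assms by (auto simp: C1_iff)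
  have "loc_const (gtop G) (\<lambda>s. f s \<oplus>\<^bsub>M\<^esub> f' s)" by (rule loc_const_comp2[OF f(2) f'(2)])
  then have "loc_const (gtop G) (\<lambda>s\<in>carrier G. f s \<oplus>\<^bsub>M\<^esub> f' s)"
    by (rule loc_const_cong) (simp add: top)
  then show "(\<lambda>s\<in>carrier G. f s \<oplus>\<^bsub>M\<^esub> f' s) \<in> C1 G M" using f f' by (auto simp: C1_iff)
  have e: "((a \<oplus>\<^bsub>M\<^esub> a') \<ominus>\<^bsub>M\<^esub> (b \<oplus>\<^bsub>M\<^esub> b')) \<oplus>\<^bsub>M\<^esub> (c \<oplus>\<^bsub>M\<^esub> c') = ((a \<ominus>\<^bsub>M\<^esub> b) \<oplus>\<^bsub>M\<^esub> c) \<oplus>\<^bsub>M\<^esub> ((a' \<ominus>\<^bsub>M\<^esub> b') \<oplus>\<^bsub>M\<^esub> c')"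
    if "a \<in> carrier M" "b \<in> carrier M" "c \<in> carrier M" "a' \<in> carrier M" "b' \<in> carrier M" "c' \<in> carrier M"
    for a b c a' b' c' using that by (simp add: M.minus_eq_sm M.sm_add_right M.a_ac)
  show "d1 G M (\<lambda>s\<in>carrier G. f s \<oplus>\<^bsub>M\<^esub> f' s) =
      (\<lambda>s\<in>carrier G \<times> carrier G. d1 G M f s \<oplus>\<^bsub>M\<^esub> d1 G M f' s)"
    unfolding d1_def
    by (rule restrict_ext) (clarsimp simp: C1_closed[OF assms(1)] C1_closed[OF assms(2)] act_add e)
qed

lemma d1_smult:
  assumes "f \<in> C1 G M"
  shows "(\<lambda>s\<in>carrier G. c \<odot>\<^bsub>M\<^esub> f s) \<in> C1 G M"
    and "d1 G M (\<lambda>s\<in>carrier G. c \<odot>\<^bsub>M\<^esub> f s) = (\<lambda>s\<in>carrier G \<times> carrier G. c \<odot>\<^bsub>M\<^esub> d1 G M f s)"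
proof -
  have f: "f \<in> carrier G \<rightarrow> carrier M" "loc_const (gtop G) f" using assms by (auto simp: C1_iff)
  have "loc_const (gtop G) (\<lambda>s. c \<odot>\<^bsub>M\<^esub> f s)" by (rule loc_const_comp[OF f(2)])
  then have "loc_const (gtop G) (\<lambda>s\<in>carrier G. c \<odot>\<^bsub>M\<^esub> f s)"
    by (rule loc_const_cong) (simp add: top)
  then show "(\<lambda>s\<in>carrier G. c \<odot>\<^bsub>M\<^esub> f s) \<in> C1 G M" using f by (auto simp: C1_iff)
  show "d1 G M (\<lambda>s\<in>carrier G. c \<odot>\<^bsub>M\<^esub> f s) = (\<lambda>s\<in>carrier G \<times> carrier G. c \<odot>\<^bsub>M\<^esub> d1 G M f s)"
    unfolding d1_def
    by (rule restrict_ext) (clarsimp simp: C1_closed[OF assms(1)] act_smult M.sm_add_right M.sm_minus_right)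
qed

text \<open>The module whose quotient by \<open>B2\<close> is \<open>H2\<close>; having a name for
  it makes the quotient lemmas of \<open>kquot\<close> applicable to cohomology classes.\<close>

definition "Z2mod = (fun_mod (carrier G \<times> carrier G) M)\<lparr>carrier := Z2 G M\<rparr>"

lemma Z2mod_simps:
  "carrier Z2mod = Z2 G M" "\<zero>\<^bsub>Z2mod\<^esub> = (\<lambda>s\<in>carrier G \<times> carrier G. \<zero>\<^bsub>M\<^esub>)"
  "x \<oplus>\<^bsub>Z2mod\<^esub> y = (\<lambda>s\<in>carrier G \<times> carrier G. x s \<oplus>\<^bsub>M\<^esub> y s)"
  "c \<odot>\<^bsub>Z2mod\<^esub> x = (\<lambda>s\<in>carrier G \<times> carrier G. c \<odot>\<^bsub>M\<^esub> x s)"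
  by (simp_all add: Z2mod_def fun_mod_def)

lemma Z2I:
  assumes "\<And>g h. \<lbrakk>g \<in> carrier G; h \<in> carrier G\<rbrakk> \<Longrightarrow> c (g, h) \<in> carrier M"
    and "loc_const G2 c"
    and "\<And>g h k. \<lbrakk>g \<in> carrier G; h \<in> carrier G; k \<in> carrier G\<rbrakk> \<Longrightarrow>
      gact M g (c (h, k)) \<oplus>\<^bsub>M\<^esub> c (g, h \<otimes>\<^bsub>G\<^esub> k) = c (g \<otimes>\<^bsub>G\<^esub> h, k) \<oplus>\<^bsub>M\<^esub> c (g, h)"
  shows "(\<lambda>s\<in>carrier G \<times> carrier G. c s) \<in> Z2 G M"
proof -
  have "loc_const G2 (\<lambda>s\<in>carrier G \<times> carrier G. c s)"
    by (rule loc_const_cong[OF assms(2)]) (auto simp: top)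
  then show ?thesis using assms by (auto simp: Z2_def C2_iff)
qed

lemma Z2_lc: "c \<in> Z2 G M \<Longrightarrow> loc_const G2 c"
  by (simp add: Z2_def C2_iff)

lemma Z2_sub: "submodule class_ring (Z2 G M) (fun_mod (carrier G \<times> carrier G) M)"
proof (rule kmod.submoduleI[OF M.fun_mod_kmod])
  let ?F = "fun_mod (carrier G \<times> carrier G) M"
  show "Z2 G M \<subseteq> carrier ?F" by (auto simp: Z2_def C2_iff fun_mod_def)
  show "\<zero>\<^bsub>?F\<^esub> \<in> Z2 G M"
    unfolding fun_mod_def by (simp, rule Z2I) (auto simp: loc_const_const act_zero)
  fix x y assume xy: "x \<in> Z2 G M" "y \<in> Z2 G M"
  show "x \<oplus>\<^bsub>?F\<^esub> y \<in> Z2 G M"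
    unfolding fun_mod_def
  proof (simp, rule Z2I)
    show "loc_const G2 (\<lambda>s. x s \<oplus>\<^bsub>M\<^esub> y s)" by (rule loc_const_comp2[OF Z2_lc Z2_lc]) fact+
    fix g h k assume *: "g \<in> carrier G" "h \<in> carrier G" "k \<in> carrier G"
    note cl = * Z2_closed[OF xy(1)] Z2_closed[OF xy(2)] act_closed G.m_closed M.add.m_closed
    have "gact M g (x (h, k) \<oplus>\<^bsub>M\<^esub> y (h, k)) \<oplus>\<^bsub>M\<^esub> (x (g, h \<otimes>\<^bsub>G\<^esub> k) \<oplus>\<^bsub>M\<^esub> y (g, h \<otimes>\<^bsub>G\<^esub> k)) =
      (gact M g (x (h, k)) \<oplus>\<^bsub>M\<^esub> x (g, h \<otimes>\<^bsub>G\<^esub> k)) \<oplus>\<^bsub>M\<^esub> (gact M g (y (h, k)) \<oplus>\<^bsub>M\<^esub> y (g, h \<otimes>\<^bsub>G\<^esub> k))"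
      by (simp only: act_add M.a_ac cl)
    also have "\<dots> = (x (g \<otimes>\<^bsub>G\<^esub> h, k) \<oplus>\<^bsub>M\<^esub> x (g, h)) \<oplus>\<^bsub>M\<^esub> (y (g \<otimes>\<^bsub>G\<^esub> h, k) \<oplus>\<^bsub>M\<^esub> y (g, h))"
      using * xy by (simp only: Z2_cocycle)
    also have "\<dots> = (x (g \<otimes>\<^bsub>G\<^esub> h, k) \<oplus>\<^bsub>M\<^esub> y (g \<otimes>\<^bsub>G\<^esub> h, k)) \<oplus>\<^bsub>M\<^esub> (x (g, h) \<oplus>\<^bsub>M\<^esub> y (g, h))"
      by (simp only: M.a_ac cl)
    finally show "gact M g (x (h, k) \<oplus>\<^bsub>M\<^esub> y (h, k)) \<oplus>\<^bsub>M\<^esub> (x (g, h \<otimes>\<^bsub>G\<^esub> k) \<oplus>\<^bsub>M\<^esub> y (g, h \<otimes>\<^bsub>G\<^esub> k)) =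
      (x (g \<otimes>\<^bsub>G\<^esub> h, k) \<oplus>\<^bsub>M\<^esub> y (g \<otimes>\<^bsub>G\<^esub> h, k)) \<oplus>\<^bsub>M\<^esub> (x (g, h) \<oplus>\<^bsub>M\<^esub> y (g, h))" .
  qed (auto simp: Z2_closed[OF xy(1)] Z2_closed[OF xy(2)])
next
  fix c x assume x: "x \<in> Z2 G M"
  show "c \<odot>\<^bsub>fun_mod (carrier G \<times> carrier G) M\<^esub> x \<in> Z2 G M"
    unfolding fun_mod_def
  proof (simp, rule Z2I)
    show "loc_const G2 (\<lambda>s. c \<odot>\<^bsub>M\<^esub> x s)" by (rule loc_const_comp[OF Z2_lc]) fact
  qed (auto simp: Z2_closed[OF x] act_smult M.sm_add_right[symmetric] Z2_cocycle[OF x])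
qed

lemma Z2mod_kmod: "kmod Z2mod"
  unfolding Z2mod_def by (rule kmod.sub_kmod[OF M.fun_mod_kmod Z2_sub])

lemma B2_sub: "submodule class_ring (B2 G M) Z2mod"
proof (rule kmod.submoduleI[OF Z2mod_kmod])
  show "B2 G M \<subseteq> carrier Z2mod" by (auto simp: B2_def Z2mod_simps d1_Z2)
  have 0: "(\<lambda>s\<in>carrier G. \<zero>\<^bsub>M\<^esub>) \<in> C1 G M"
    using loc_const_cong[OF loc_const_const[of "gtop G" "\<zero>\<^bsub>M\<^esub>"], of "\<lambda>s\<in>carrier G. \<zero>\<^bsub>M\<^esub>"] by (auto simp: C1_iff top)
  have e: "\<zero>\<^bsub>Z2mod\<^esub> = d1 G M (\<lambda>s\<in>carrier G. \<zero>\<^bsub>M\<^esub>)"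
    unfolding d1_def Z2mod_simps by (rule restrict_ext) (clarsimp simp: act_zero M.minus_eq_sm)
  show "\<zero>\<^bsub>Z2mod\<^esub> \<in> B2 G M" unfolding B2_def e by (rule imageI[OF 0])
  fix x y assume "x \<in> B2 G M" "y \<in> B2 G M"
  then obtain f f' where f: "f \<in> C1 G M" "x = d1 G M f" "f' \<in> C1 G M" "y = d1 G M f'" by (auto simp: B2_def)
  have e: "x \<oplus>\<^bsub>Z2mod\<^esub> y = d1 G M (\<lambda>s\<in>carrier G. f s \<oplus>\<^bsub>M\<^esub> f' s)"
    unfolding f(2,4) Z2mod_simps d1_add(2)[OF f(1,3)] ..
  show "x \<oplus>\<^bsub>Z2mod\<^esub> y \<in> B2 G M" unfolding B2_def e by (rule imageI[OF d1_add(1)[OF f(1,3)]])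
next
  fix c x assume "x \<in> B2 G M"
  then obtain f where f: "f \<in> C1 G M" "x = d1 G M f" by (auto simp: B2_def)
  have e: "c \<odot>\<^bsub>Z2mod\<^esub> x = d1 G M (\<lambda>s\<in>carrier G. c \<odot>\<^bsub>M\<^esub> f s)"
    unfolding f(2) Z2mod_simps d1_smult(2)[OF f(1)] ..
  show "c \<odot>\<^bsub>Z2mod\<^esub> x \<in> B2 G M" unfolding B2_def e by (rule imageI[OF d1_smult(1)[OF f(1)]])
qed

lemma H2_kquot: "kquot Z2mod (B2 G M)"
  by (intro kquot.intro kquot_axioms.intro Z2mod_kmod B2_sub)

lemma H2_eq: "H2 G M = quot_mod Z2mod (B2 G M)"
  by (simp add: H2_def Z2mod_def)

lemma class2_eq: "class2 G M c = B2 G M +>\<^bsub>Z2mod\<^esub> c"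
  by (simp add: class2_def Z2mod_def)

lemma H2_kmod: "kmod (H2 G M)"
  unfolding H2_eq by (rule kquot.quot_kmod[OF H2_kquot])

lemma class2_closed: "c \<in> Z2 G M \<Longrightarrow> class2 G M c \<in> carrier (H2 G M)"
  unfolding H2_eq class2_eq by (rule kquot.coset_in_quot[OF H2_kquot]) (simp add: Z2mod_simps)

lemma H2E:
  assumes "A \<in> carrier (H2 G M)" obtains c where "c \<in> Z2 G M" "A = class2 G M c"
proof -
  obtain c where "c \<in> carrier Z2mod" "A = B2 G M +>\<^bsub>Z2mod\<^esub> c"
    using assms unfolding H2_eq by (rule kquot.quotE[OF H2_kquot])
  then show thesis using that[of c] by (simp add: class2_eq Z2mod_simps(1))
qed

lemma class2_lin: "class2 G M \<in> lin_maps Z2mod (H2 G M)"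
  using kquot.quot_proj_lin[OF H2_kquot] unfolding H2_eq class2_eq[abs_def] .

text \<open>That \<open>c'\<close> is a cocycle is a conclusion here, because \<open>c'\<close> is
  the sum of two elements of \<open>Z2mod\<close>. So the Massey cochain never has to be tested
  against the cocycle identity by hand.\<close>

lemma class2_cobound:
  assumes "c \<in> Z2 G M" "f \<in> C1 G M"
    and "\<And>g h. \<lbrakk>g \<in> carrier G; h \<in> carrier G\<rbrakk> \<Longrightarrow> c' (g, h) = d1 G M f (g, h) \<oplus>\<^bsub>M\<^esub> c (g, h)"
    and "c' \<in> extensional (carrier G \<times> carrier G)"
  shows "c' \<in> Z2 G M" "class2 G M c' = class2 G M c"
proof -
  have "c' = d1 G M f \<oplus>\<^bsub>Z2mod\<^esub> c"
    unfolding Z2mod_simps by (rule extensionalityI[OF assms(4)]) (auto simp: assms(3))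
  moreover have "d1 G M f \<oplus>\<^bsub>Z2mod\<^esub> c \<in> carrier Z2mod"
    using add_in_sub[OF Z2_sub d1_Z2[OF assms(2)] assms(1)] by (simp add: Z2mod_simps fun_mod_simps)
  ultimately show "c' \<in> Z2 G M" "class2 G M c' = class2 G M c"
    using kquot.coset_eqI[OF H2_kquot, of "d1 G M f" c] assms(1,2)
    by (simp_all add: class2_eq B2_def Z2mod_simps(1))
qed

end

section \<open>Functoriality of H^2 under equivariant linear maps\<close>

locale dghom = A: dgmod G M + B: dgmod G M'
  for G :: "'g topgroup" and M :: "('k::field, 'g, 'm) gmodule" and M' :: "('k, 'g, 'n) gmodule" +
  fixes \<phi>
  assumes lin: "\<phi> \<in> lin_maps M M'"
    and equi: "\<lbrakk>g \<in> carrier G; x \<in> carrier M\<rbrakk> \<Longrightarrow> \<phi> (gact M g x) = gact M' g (\<phi> x)"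
begin

lemma d1_natural:
  assumes "f \<in> carrier G \<rightarrow> carrier M" "g \<in> carrier G" "h \<in> carrier G"
  shows "d1 G M' (\<lambda>s\<in>carrier G. \<phi> (f s)) (g, h) = \<phi> (d1 G M f (g, h))"
proof -
  have fc: "f s \<in> carrier M" if "s \<in> carrier G" for s using assms(1) that by auto
  show ?thesis using assms(2,3)
    by (simp add: A.d1_apply B.d1_apply fc lin_add[OF lin] equi
      lin_minus[OF A.kmod_axioms' B.kmod_axioms' lin])
qed

lemma map_C1:
  assumes "f \<in> C1 G M" shows "(\<lambda>s\<in>carrier G. \<phi> (f s)) \<in> C1 G M'"
proof -
  have f: "f \<in> carrier G \<rightarrow> carrier M" "loc_const (gtop G) f" using assms by (auto simp: A.C1_iff)
  have "loc_const (gtop G) (\<lambda>s\<in>carrier G. \<phi> (f s))"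
    by (rule loc_const_cong[OF loc_const_comp[OF f(2), of \<phi>]]) (simp add: A.top)
  then show ?thesis using f lin_closed[OF lin] by (auto simp: B.C1_iff)
qed

lemma map_Z2:
  assumes c: "c \<in> Z2 G M" shows "(\<lambda>s\<in>carrier G \<times> carrier G. \<phi> (c s)) \<in> Z2 G M'"
proof (rule B.Z2I)
  show "loc_const A.G2 (\<lambda>s. \<phi> (c s))" by (rule loc_const_comp[OF A.Z2_lc[OF c]])
  fix g h k assume *: "g \<in> carrier G" "h \<in> carrier G" "k \<in> carrier G"
  show "gact M' g (\<phi> (c (h, k))) \<oplus>\<^bsub>M'\<^esub> \<phi> (c (g, h \<otimes>\<^bsub>G\<^esub> k)) = \<phi> (c (g \<otimes>\<^bsub>G\<^esub> h, k)) \<oplus>\<^bsub>M'\<^esub> \<phi> (c (g, h))"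
    using * A.Z2_closed[OF c] by (simp add: equi[symmetric] lin_add[OF lin, symmetric] A.Z2_cocycle[OF c])
qed (auto intro: lin_closed[OF lin] A.Z2_closed[OF c])

text \<open>For \<open>\<phi>\<close> tensoring with a fixed w this is literally the expression
  inside \<open>H2_tensor_map\<close>, which is how the latter is shown to be well defined.\<close>

definition "H2map = quot_lift (\<lambda>c. class2 G M' (\<lambda>s\<in>carrier G \<times> carrier G. \<phi> (c s)))"

lemma H2map_pre_lin:
  "(\<lambda>c. class2 G M' (\<lambda>s\<in>carrier G \<times> carrier G. \<phi> (c s))) \<in> lin_maps A.Z2mod (H2 G M')"
proof (rule lin_comp[OF lin_mapsI B.class2_lin])
  fix x y assume xy: "x \<in> carrier A.Z2mod" "y \<in> carrier A.Z2mod"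
  then show "(\<lambda>s\<in>carrier G \<times> carrier G. \<phi> ((x \<oplus>\<^bsub>A.Z2mod\<^esub> y) s)) =
      (\<lambda>s\<in>carrier G \<times> carrier G. \<phi> (x s)) \<oplus>\<^bsub>B.Z2mod\<^esub> (\<lambda>s\<in>carrier G \<times> carrier G. \<phi> (y s))"
    unfolding A.Z2mod_simps B.Z2mod_simps
    by (intro restrict_ext) (clarsimp simp: lin_add[OF lin] A.Z2_closed)
next
  fix c x assume "x \<in> carrier A.Z2mod"
  then show "(\<lambda>s\<in>carrier G \<times> carrier G. \<phi> ((c \<odot>\<^bsub>A.Z2mod\<^esub> x) s)) =
      c \<odot>\<^bsub>B.Z2mod\<^esub> (\<lambda>s\<in>carrier G \<times> carrier G. \<phi> (x s))"
    unfolding A.Z2mod_simps B.Z2mod_simps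
    by (intro restrict_ext) (clarsimp simp: lin_smult[OF lin] A.Z2_closed)
qed (simp add: A.Z2mod_simps B.Z2mod_simps map_Z2)

lemma H2map_pre_null:
  assumes "b \<in> B2 G M"
  shows "class2 G M' (\<lambda>s\<in>carrier G \<times> carrier G. \<phi> (b s)) = \<zero>\<^bsub>H2 G M'\<^esub>"
proof -
  obtain f where f: "f \<in> C1 G M" "b = d1 G M f" using assms by (auto simp: B2_def)
  have "f \<in> carrier G \<rightarrow> carrier M" using f(1) by (auto simp: A.C1_iff)
  then have "(\<lambda>s\<in>carrier G \<times> carrier G. \<phi> (b s)) = d1 G M' (\<lambda>s\<in>carrier G. \<phi> (f s))"
    by (intro extensionalityI[of _ "carrier G \<times> carrier G"])
      (auto simp: f(2) d1_natural[of f] simp del: restrict_apply, simp_all add: d1_def[of G M'])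
  then have "(\<lambda>s\<in>carrier G \<times> carrier G. \<phi> (b s)) \<in> B2 G M'"
    using map_C1[OF f(1)] by (simp add: B2_def)
  then show ?thesis unfolding B.class2_eq B.H2_eq
    by (simp add: kquot.coset_of_mem[OF B.H2_kquot] quot_mod_def)
qed

lemma H2map_lin: "H2map \<in> lin_maps (H2 G M) (H2 G M')"
  unfolding H2map_def A.H2_eq
  by (rule kquot.quot_lift_lin_maps[OF A.H2_kquot H2map_pre_lin B.H2_kmod H2map_pre_null])

lemma H2map_class2:
  "c \<in> Z2 G M \<Longrightarrow> H2map (class2 G M c) = class2 G M' (\<lambda>s\<in>carrier G \<times> carrier G. \<phi> (c s))"
  unfolding H2map_def A.class2_eq
  by (rule kquot.quot_lift_lin_coset[OF A.H2_kquot H2map_pre_lin B.H2_kmod H2map_pre_null])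
    (simp_all add: A.Z2mod_simps)

end

section \<open>Binomial coefficients modulo \<open>p\<close>\<close>

text \<open>The entries of \<open>binom_mat\<close> as a function on the field. For j < p the value
  does not change when the representative is shifted by p, and only in that range does the addition
  law below hold.\<close>

definition binom :: "nat \<Rightarrow> 'p::prime_card mod_ring \<Rightarrow> 'p mod_ring" where
  "binom j a = of_nat (nat (to_int_mod_ring a) choose j)"

text \<open>In the Vandermonde expansion of (m + p choose j) every term with k < j contains (p
  choose j-k) with 0 < j-k < p, which is divisible by p; only the term k = j survives.\<close>

lemma of_nat_choose_add_prime:
  assumes "j < CARD('p::prime_card)"
  shows "(of_nat ((m + CARD('p)) choose j) :: 'p mod_ring) = of_nat (m choose j)"
proof -
  have z: "(of_nat (CARD('p) choose i) :: 'p mod_ring) = 0" if "0 < i" "i < CARD('p)" for i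
  proof -
    have "prime (CARD('p))" by (rule prime_card)
    then have "CARD('p) dvd (CARD('p) choose i)" using that by (intro dvd_choose_prime) auto
    then obtain q where "CARD('p) choose i = CARD('p) * q" by (rule dvdE)
    then show ?thesis by (simp only: of_nat_mult of_nat_card_eq_0 mult_zero_left)
  qed
  have "(of_nat ((m + CARD('p)) choose j) :: 'p mod_ring) =
      (\<Sum>k\<le>j. of_nat (m choose k) * of_nat (CARD('p) choose (j - k)))"
    by (simp only: vandermonde[symmetric] of_nat_sum of_nat_mult)
  also have "\<dots> = (\<Sum>k\<in>{j}. of_nat (m choose k) * of_nat (CARD('p) choose (j - k)))"
    using assms by (intro sum.mono_neutral_right) (auto simp: z)
  finally show ?thesis by simp
qed

lemma of_nat_choose_mod_prime:
  assumes "j < CARD('p::prime_card)"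
  shows "(of_nat ((m mod CARD('p)) choose j) :: 'p mod_ring) = of_nat (m choose j)"
proof -
  have "(of_nat ((m + q * CARD('p)) choose j) :: 'p mod_ring) = of_nat (m choose j)" for q m
  proof (induction q)
    case (Suc q)
    have e: "m + Suc q * CARD('p) = (m + q * CARD('p)) + CARD('p)" by simp
    show ?case unfolding e of_nat_choose_add_prime[OF assms] by (rule Suc)
  qed simp
  from this[of "m mod CARD('p)" "m div CARD('p)"] show ?thesis by simp
qed

text \<open>The representative of a + b is the sum of the representatives reduced modulo p. The
  reduction does not affect the binomial coefficient for j < p, and the rest is Vandermonde over the
  naturals.\<close>

lemma binom_add:
  assumes "j < CARD('p::prime_card)"
  shows "binom j (a + b :: 'p mod_ring) = (\<Sum>i\<le>j. binom i a * binom (j - i) b)"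
proof -
  let ?n = "\<lambda>a :: 'p mod_ring. nat (to_int_mod_ring a)"
  have nn: "0 \<le> to_int_mod_ring a" for a :: "'p mod_ring"
    using range_to_int_mod_ring[where ?'a = 'p] by (metis atLeastLessThan_iff rangeI)
  have "?n (a + b) = (?n a + ?n b) mod CARD('p)"
    unfolding to_int_mod_ring_add using nn[of a] nn[of b]
    by (simp add: nat_mod_distrib nat_add_distrib)
  then have "binom j (a + b) = of_nat ((?n a + ?n b) choose j)"
    unfolding binom_def using of_nat_choose_mod_prime[OF assms] by simp
  then show ?thesis
    unfolding binom_def by (simp only: vandermonde[symmetric] of_nat_sum of_nat_mult)
qed

lemma binom_0 [simp]: "binom 0 a = 1"
  by (simp add: binom_def)

lemma binom_1 [simp]: "binom (Suc 0) a = a"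
proof -
  have "0 \<le> to_int_mod_ring a"
    using range_to_int_mod_ring[where ?'a = 'a] by (metis atLeastLessThan_iff rangeI)
  then show ?thesis unfolding binom_def by (simp add: of_nat_of_int_mod_ring)
qed

section \<open>The group algebra of a finite abelian group\<close>

locale fin_ab_group = comm_group H for H (structure) +
  assumes fin: "finite (carrier H)"
begin

abbreviation \<Omega> :: "('k::field, 'a \<Rightarrow> 'k) module" where "\<Omega> \<equiv> group_algebra H"

text \<open>Finiteness of \<open>H\<close> turns the support condition of \<open>free_mod\<close>
  into vanishing off the carrier, so that sums over supports may be replaced by sums over all of
  \<open>H\<close>.\<close>

lemma ga_simps:
  "carrier (\<Omega> :: ('k::field, 'a \<Rightarrow> 'k) module) = {x. \<forall>h. h \<notin> carrier H \<longrightarrow> x h = 0}"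
  "\<zero>\<^bsub>\<Omega>\<^esub> = (\<lambda>s. 0 :: 'k)" "x \<oplus>\<^bsub>\<Omega>\<^esub> y = (\<lambda>s. x s + y s :: 'k)"
  "c \<odot>\<^bsub>\<Omega>\<^esub> x = (\<lambda>s. c * x s :: 'k)" "\<one>\<^bsub>\<Omega>\<^esub> = (delta \<one> :: 'a \<Rightarrow> 'k)"
proof -
  have "finite {s. x s \<noteq> 0} \<and> {s. x s \<noteq> 0} \<subseteq> carrier H \<longleftrightarrow> (\<forall>h. h \<notin> carrier H \<longrightarrow> x h = 0)"
    for x :: "'a \<Rightarrow> 'k"
  proof
    assume *: "\<forall>h. h \<notin> carrier H \<longrightarrow> x h = 0"
    then have "{s. x s \<noteq> 0} \<subseteq> carrier H" by blast
    then show "finite {s. x s \<noteq> 0} \<and> {s. x s \<noteq> 0} \<subseteq> carrier H" using fin finite_subset by blast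
  qed blast
  then show "carrier (\<Omega> :: ('k, 'a \<Rightarrow> 'k) module) = {x. \<forall>h. h \<notin> carrier H \<longrightarrow> x h = 0}"
    by (simp add: group_algebra_def free_mod_simps)
qed (simp_all add: group_algebra_def free_mod_simps)

lemma ga_sum_supp:
  fixes x :: "'a \<Rightarrow> 'k::field"
  assumes "x \<in> carrier \<Omega>" shows "(\<Sum>k\<in>{k. x k \<noteq> 0}. x k * w k) = (\<Sum>k\<in>carrier H. x k * w k)"
proof (rule sum.mono_neutral_left)
  show "{k. x k \<noteq> 0} \<subseteq> carrier H" using assms by (auto simp: ga_simps(1))
qed (auto simp: fin)

lemma ga_mult:
  fixes x y :: "'a \<Rightarrow> 'k::field"
  assumes "x \<in> carrier \<Omega>"
  shows "(x \<otimes>\<^bsub>\<Omega>\<^esub> y) h = (if h \<in> carrier H then \<Sum>k\<in>carrier H. x k * y (inv k \<otimes> h) else 0)"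
  using ga_sum_supp[OF assms] by (simp add: group_algebra_def)

lemma ga_mult_closed:
  fixes x y :: "'a \<Rightarrow> 'k::field"
  shows "x \<in> carrier \<Omega> \<Longrightarrow> x \<otimes>\<^bsub>\<Omega>\<^esub> y \<in> carrier \<Omega>"
  by (simp add: ga_simps(1) ga_mult)

lemma ga_outside: "\<lbrakk>x \<in> carrier (\<Omega> :: ('k::field, 'a \<Rightarrow> 'k) module); h \<notin> carrier H\<rbrakk> \<Longrightarrow> x h = 0"
  by (simp add: ga_simps(1))

lemma sum_shift:
  assumes "j \<in> carrier H"
  shows "(\<Sum>h\<in>carrier H. f h) = (\<Sum>l\<in>carrier H. f (j \<otimes> l))"
  by (rule sum.reindex_bij_witness[where i = "\<lambda>l. j \<otimes> l" and j = "\<lambda>h. inv j \<otimes> h"])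
    (use assms in \<open>simp_all add: m_assoc[symmetric]\<close>)

text \<open>Substitution of h = k l in the convolution. The weight \<open>w\<close> is kept general:
  w = 1 gives multiplicativity of the augmentation, a translate of the third factor gives
  associativity, and a binomial coefficient of a character gives the product formula
  \<open>bfun_mult\<close>.\<close>

lemma conv_sum:
  fixes x y :: "'a \<Rightarrow> 'k::field"
  assumes "x \<in> carrier \<Omega>"
  shows "(\<Sum>h\<in>carrier H. (x \<otimes>\<^bsub>\<Omega>\<^esub> y) h * w h) =
    (\<Sum>k\<in>carrier H. \<Sum>l\<in>carrier H. x k * y l * w (k \<otimes> l))"
proof -
  have "(\<Sum>h\<in>carrier H. (x \<otimes>\<^bsub>\<Omega>\<^esub> y) h * w h) =
      (\<Sum>h\<in>carrier H. \<Sum>k\<in>carrier H. x k * y (inv k \<otimes> h) * w h)"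
    by (intro sum.cong refl) (simp add: ga_mult[OF assms] sum_distrib_right)
  also have "\<dots> = (\<Sum>k\<in>carrier H. \<Sum>h\<in>carrier H. x k * y (inv k \<otimes> h) * w h)"
    by (rule sum.swap)
  also have "\<dots> = (\<Sum>k\<in>carrier H. \<Sum>l\<in>carrier H. x k * y l * w (k \<otimes> l))"
  proof (rule sum.cong[OF refl])
    fix k assume k: "k \<in> carrier H"
    show "(\<Sum>h\<in>carrier H. x k * y (inv k \<otimes> h) * w h) = (\<Sum>l\<in>carrier H. x k * y l * w (k \<otimes> l))"
      unfolding sum_shift[OF k, of "\<lambda>h. x k * y (inv k \<otimes> h) * w h"]
      by (intro sum.cong refl) (simp add: k m_assoc[symmetric])
  qed
  finally show ?thesis .
qed

lemma ga_kmod: "kmod (\<Omega> :: ('k::field, 'a \<Rightarrow> 'k) module)"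
  by (rule kmod_cong[OF free_kmod[of "carrier H"]]) (simp_all add: group_algebra_def)

lemma ga_mult_comm:
  fixes x y :: "'a \<Rightarrow> 'k::field"
  assumes "x \<in> carrier \<Omega>" "y \<in> carrier \<Omega>"
  shows "x \<otimes>\<^bsub>\<Omega>\<^esub> y = y \<otimes>\<^bsub>\<Omega>\<^esub> x"
proof
  fix h
  show "(x \<otimes>\<^bsub>\<Omega>\<^esub> y) h = (y \<otimes>\<^bsub>\<Omega>\<^esub> x) h"
  proof (cases "h \<in> carrier H")
    case True
    have i: "inv (inv k \<otimes> h) \<otimes> h = k" if "k \<in> carrier H" for k
      using that True by (simp add: inv_mult m_assoc)
    have "(\<Sum>k\<in>carrier H. x k * y (inv k \<otimes> h)) = (\<Sum>k\<in>carrier H. y k * x (inv k \<otimes> h))"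
      by (rule sum.reindex_bij_witness[where i = "\<lambda>l. inv l \<otimes> h" and j = "\<lambda>l. inv l \<otimes> h"])
        (use True in \<open>simp_all add: i mult.commute\<close>)
    then show ?thesis using True by (simp add: ga_mult[OF assms(1)] ga_mult[OF assms(2)])
  qed (simp add: ga_mult[OF assms(1)] ga_mult[OF assms(2)])
qed

lemma ga_mult_assoc:
  fixes x y z :: "'a \<Rightarrow> 'k::field"
  assumes "x \<in> carrier \<Omega>" "y \<in> carrier \<Omega>" "z \<in> carrier \<Omega>"
  shows "(x \<otimes>\<^bsub>\<Omega>\<^esub> y) \<otimes>\<^bsub>\<Omega>\<^esub> z = x \<otimes>\<^bsub>\<Omega>\<^esub> (y \<otimes>\<^bsub>\<Omega>\<^esub> z)"
proof
  fix h
  note m = ga_mult[OF assms(1)] ga_mult[OF assms(2)] ga_mult[OF ga_mult_closed[OF assms(1)]]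
  show "((x \<otimes>\<^bsub>\<Omega>\<^esub> y) \<otimes>\<^bsub>\<Omega>\<^esub> z) h = (x \<otimes>\<^bsub>\<Omega>\<^esub> (y \<otimes>\<^bsub>\<Omega>\<^esub> z)) h"
  proof (cases "h \<in> carrier H")
    case h: True
    have "((x \<otimes>\<^bsub>\<Omega>\<^esub> y) \<otimes>\<^bsub>\<Omega>\<^esub> z) h = (\<Sum>k\<in>carrier H. (x \<otimes>\<^bsub>\<Omega>\<^esub> y) k * z (inv k \<otimes> h))"
      using h by (simp only: ga_mult[OF ga_mult_closed[OF assms(1)]] if_True)
    also have "\<dots> = (\<Sum>k\<in>carrier H. \<Sum>l\<in>carrier H. x k * y l * z (inv (k \<otimes> l) \<otimes> h))"
      by (rule conv_sum[OF assms(1)])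
    also have "\<dots> = (\<Sum>k\<in>carrier H. x k * (\<Sum>l\<in>carrier H. y l * z (inv l \<otimes> (inv k \<otimes> h))))"
      by (intro sum.cong refl) (simp add: sum_distrib_left h inv_mult m_ac mult.assoc)
    also have "\<dots> = (x \<otimes>\<^bsub>\<Omega>\<^esub> (y \<otimes>\<^bsub>\<Omega>\<^esub> z)) h"
      unfolding ga_mult[OF assms(1), of _ h] using h
      by (simp add: ga_mult[OF assms(2)])
    finally show ?thesis .
  qed (simp add: m)
qed

lemma delta_closed: "h \<in> carrier H \<Longrightarrow> (delta h :: 'a \<Rightarrow> 'k::field) \<in> carrier \<Omega>"
  by (auto simp: ga_simps(1) delta_def)

lemma ga_one_mult:
  fixes x :: "'a \<Rightarrow> 'k::field"
  assumes "x \<in> carrier \<Omega>" shows "\<one>\<^bsub>\<Omega>\<^esub> \<otimes>\<^bsub>\<Omega>\<^esub> x = x"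
proof
  fix h
  have "(\<Sum>k\<in>carrier H. (if k = \<one> then 1 else 0) * x (inv k \<otimes> h)) = x h" if "h \<in> carrier H"
    using that fin by (subst sum.remove[of _ "\<one>"]) auto
  then show "(\<one>\<^bsub>\<Omega>\<^esub> \<otimes>\<^bsub>\<Omega>\<^esub> x) h = x h"
    unfolding ga_simps(5) ga_mult[OF delta_closed[OF one_closed]]
    using ga_outside[OF assms, of h] by (auto simp: delta_def)
qed

lemma ga_cring: "cring (\<Omega> :: ('k::field, 'a \<Rightarrow> 'k) module)"
proof (rule cringI)
  interpret M: kmod "\<Omega> :: ('k, 'a \<Rightarrow> 'k) module" by (rule ga_kmod)
  show "abelian_group (\<Omega> :: ('k, 'a \<Rightarrow> 'k) module)" by (rule M.abelian_group_axioms)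
  show "comm_monoid (\<Omega> :: ('k, 'a \<Rightarrow> 'k) module)"
  proof (rule comm_monoidI)
    show "\<one>\<^bsub>\<Omega>\<^esub> \<in> carrier (\<Omega> :: ('k, 'a \<Rightarrow> 'k) module)"
      unfolding ga_simps(5) by (rule delta_closed[OF one_closed])
  qed (erule ga_mult_closed, erule ga_mult_assoc, assumption+, erule ga_one_mult, erule ga_mult_comm, assumption)
  fix x y z :: "'a \<Rightarrow> 'k"
  assume x: "x \<in> carrier \<Omega>" and y: "y \<in> carrier \<Omega>" and z: "z \<in> carrier \<Omega>"
  show "(x \<oplus>\<^bsub>\<Omega>\<^esub> y) \<otimes>\<^bsub>\<Omega>\<^esub> z = x \<otimes>\<^bsub>\<Omega>\<^esub> z \<oplus>\<^bsub>\<Omega>\<^esub> y \<otimes>\<^bsub>\<Omega>\<^esub> z"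
  proof
    fix h
    show "((x \<oplus>\<^bsub>\<Omega>\<^esub> y) \<otimes>\<^bsub>\<Omega>\<^esub> z) h = (x \<otimes>\<^bsub>\<Omega>\<^esub> z \<oplus>\<^bsub>\<Omega>\<^esub> y \<otimes>\<^bsub>\<Omega>\<^esub> z) h"
    proof (cases "h \<in> carrier H")
      case True
      then show ?thesis
        by (subst ga_mult[OF M.a_closed[OF x y]])
          (simp only: ga_simps(3) ga_mult[OF x] ga_mult[OF y] if_True distrib_right sum.distrib)
    next
      case False
      then show ?thesis
        by (subst ga_mult[OF M.a_closed[OF x y]])
          (simp only: ga_simps(3) ga_mult[OF x] ga_mult[OF y] if_False add_0_right)
    qed
  qed
qed

lemma ga_mult_smult:
  fixes x y :: "'a \<Rightarrow> 'k::field"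
  assumes x: "x \<in> carrier \<Omega>"
  shows "(c \<odot>\<^bsub>\<Omega>\<^esub> x) \<otimes>\<^bsub>\<Omega>\<^esub> y = c \<odot>\<^bsub>\<Omega>\<^esub> (x \<otimes>\<^bsub>\<Omega>\<^esub> y)"
proof
  interpret M: kmod "\<Omega> :: ('k, 'a \<Rightarrow> 'k) module" by (rule ga_kmod)
  fix h
  show "((c \<odot>\<^bsub>\<Omega>\<^esub> x) \<otimes>\<^bsub>\<Omega>\<^esub> y) h = (c \<odot>\<^bsub>\<Omega>\<^esub> (x \<otimes>\<^bsub>\<Omega>\<^esub> y)) h"
    by (subst ga_mult[OF M.sm_closed[OF x]])
      (simp add: ga_simps(4) ga_mult[OF x] sum_distrib_left mult.assoc)
qed

lemma delta_mult:
  assumes "g \<in> carrier H" "h \<in> carrier H"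
  shows "(delta g :: 'a \<Rightarrow> 'k::field) \<otimes>\<^bsub>\<Omega>\<^esub> delta h = delta (g \<otimes> h)"
proof
  fix u
  have e: "inv g \<otimes> u = h \<longleftrightarrow> u = g \<otimes> h" if "u \<in> carrier H"
    using that assms by (metis inv_solve_left)
  have s: "(\<Sum>k\<in>carrier H. (if k = g then 1 else 0) * (if inv k \<otimes> u = h then 1 else 0)) =
      (if u = g \<otimes> h then 1 else 0 :: 'k)" if "u \<in> carrier H"
    using that fin assms by (subst sum.remove[of _ g]) (simp_all add: e)
  show "((delta g :: 'a \<Rightarrow> 'k) \<otimes>\<^bsub>\<Omega>\<^esub> delta h) u = delta (g \<otimes> h) u"
  proof (cases "u \<in> carrier H")
    case True
    show ?thesis unfolding ga_mult[OF delta_closed[OF assms(1)]]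
      by (simp only: delta_def True if_True s[OF True])
  next
    case False
    then have "u \<noteq> g \<otimes> h" using assms by auto
    then show ?thesis unfolding ga_mult[OF delta_closed[OF assms(1)]] using False by (simp add: delta_def)
  qed
qed

subsection \<open>Powers of the augmentation ideal\<close>

text \<open>The augmentation ideal in terms of \<open>H\<close> alone, so that the algebra can be
  done for any finite abelian group; \<open>aug_pow_eq\<close> identifies its powers with those
  attached to \<open>G\<close> and \<open>N\<close>.\<close>

definition aug_id :: "('a \<Rightarrow> 'k::field) set" where
  "aug_id = {x \<in> carrier \<Omega>. augmentation x = 0}"

definition aug_id_pow :: "nat \<Rightarrow> ('a \<Rightarrow> 'k::field) set" where
  "aug_id_pow m = aug_id [^]\<^bsub>ideals_set \<Omega>\<^esub> m"

lemma augmentation_eq: "x \<in> carrier \<Omega> \<Longrightarrow> augmentation x = (\<Sum>h\<in>carrier H. x h)"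
  using ga_sum_supp[of x "\<lambda>_. 1"] by (simp add: augmentation_def)

lemma augmentation_mult:
  fixes x y :: "'a \<Rightarrow> 'k::field"
  assumes "x \<in> carrier \<Omega>" "y \<in> carrier \<Omega>"
  shows "augmentation (x \<otimes>\<^bsub>\<Omega>\<^esub> y) = augmentation x * augmentation y"
  using conv_sum[OF assms(1), of y "\<lambda>_. 1"] assms
  by (simp add: augmentation_eq ga_mult_closed sum_product)

text \<open>Scalar multiplication by c is ring multiplication by c times the unit, so ideals are
  stable under it.\<close>

lemma sub_ideal:
  fixes I :: "('a \<Rightarrow> 'k::field) set"
  assumes I: "ideal I \<Omega>" shows "submodule class_ring I \<Omega>"
proof -
  interpret R: cring "\<Omega> :: ('k, 'a \<Rightarrow> 'k) module" by (rule ga_cring)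
  interpret M: kmod "\<Omega> :: ('k, 'a \<Rightarrow> 'k) module" by (rule ga_kmod)
  interpret I: ideal I \<Omega> by fact
  show ?thesis
  proof (rule M.submoduleI)
    show "I \<subseteq> carrier \<Omega>" using I.Icarr by blast
    show "\<zero>\<^bsub>\<Omega>\<^esub> \<in> I" by (rule I.zero_closed)
    show "x \<oplus>\<^bsub>\<Omega>\<^esub> y \<in> I" if "x \<in> I" "y \<in> I" for x y using that by (rule I.a_closed)
    fix c x assume x: "x \<in> I"
    then have xc: "x \<in> carrier \<Omega>" by (rule I.Icarr)
    have "c \<odot>\<^bsub>\<Omega>\<^esub> x = (c \<odot>\<^bsub>\<Omega>\<^esub> \<one>\<^bsub>\<Omega>\<^esub>) \<otimes>\<^bsub>\<Omega>\<^esub> x"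
      using ga_mult_smult[OF R.one_closed, of c x] R.l_one[OF xc] by simp
    then show "c \<odot>\<^bsub>\<Omega>\<^esub> x \<in> I" using I.I_l_closed[OF x M.sm_closed[OF R.one_closed]] by simp
  qed
qed

lemma aug_id_ideal: "ideal (aug_id :: ('a \<Rightarrow> 'k::field) set) \<Omega>"
proof -
  interpret R: cring "\<Omega> :: ('k, 'a \<Rightarrow> 'k) module" by (rule ga_cring)
  interpret M: kmod "\<Omega> :: ('k, 'a \<Rightarrow> 'k) module" by (rule ga_kmod)
  have add: "augmentation (x \<oplus>\<^bsub>\<Omega>\<^esub> y) = augmentation x + augmentation y"
    if "x \<in> carrier \<Omega>" "y \<in> carrier \<Omega>" for x y :: "'a \<Rightarrow> 'k"
    using that R.a_closed[OF that] by (simp only: augmentation_eq ga_simps(3) sum.distrib)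
  have z: "augmentation (\<zero>\<^bsub>\<Omega>\<^esub> :: 'a \<Rightarrow> 'k) = 0" by (simp add: augmentation_eq) (simp add: ga_simps(2))
  show ?thesis
  proof (rule idealI)
    show "ring (\<Omega> :: ('k, 'a \<Rightarrow> 'k) module)" by (rule R.ring_axioms)
    show "subgroup (aug_id :: ('a \<Rightarrow> 'k) set) (add_monoid \<Omega>)"
    proof (rule R.add.subgroupI)
      show "(aug_id :: ('a \<Rightarrow> 'k) set) \<subseteq> carrier \<Omega>" by (auto simp: aug_id_def)
      show "(aug_id :: ('a \<Rightarrow> 'k) set) \<noteq> {}" using z R.zero_closed by (auto simp: aug_id_def)
      fix x :: "'a \<Rightarrow> 'k" assume "x \<in> aug_id"
      then have x: "x \<in> carrier \<Omega>" "augmentation x = 0" by (auto simp: aug_id_def)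
      have "augmentation (\<ominus>\<^bsub>\<Omega>\<^esub> x \<oplus>\<^bsub>\<Omega>\<^esub> x) = 0" using x z by (simp add: R.l_neg)
      then show "\<ominus>\<^bsub>\<Omega>\<^esub> x \<in> aug_id" using x by (simp add: add aug_id_def)
      fix y :: "'a \<Rightarrow> 'k" assume "y \<in> aug_id"
      then show "x \<oplus>\<^bsub>\<Omega>\<^esub> y \<in> aug_id" using x by (simp add: aug_id_def add)
    qed
  qed (simp_all add: aug_id_def augmentation_mult)
qed

lemma aug_id_pow_0: "aug_id_pow 0 = carrier \<Omega>"
  by (simp add: aug_id_pow_def nat_pow_def ideals_set_def)

lemma aug_id_pow_Suc: "aug_id_pow (Suc m) = ideal_prod \<Omega> (aug_id_pow m) aug_id"
  by (simp add: aug_id_pow_def nat_pow_def ideals_set_def)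

lemma aug_id_pow_ideal: "ideal (aug_id_pow m :: ('a \<Rightarrow> 'k::field) set) \<Omega>"
proof -
  interpret R: cring "\<Omega> :: ('k, 'a \<Rightarrow> 'k) module" by (rule ga_cring)
  show ?thesis
  proof (induction m)
    case 0
    show ?case unfolding aug_id_pow_0 by (rule R.oneideal)
  next
    case (Suc m)
    then show ?case unfolding aug_id_pow_Suc by (intro R.ideal_prod_is_ideal aug_id_ideal)
  qed
qed

lemma aug_id_pow_sub: "submodule class_ring (aug_id_pow m :: ('a \<Rightarrow> 'k::field) set) \<Omega>"
  by (rule sub_ideal[OF aug_id_pow_ideal])

lemma aug_id_pow_carrier: "x \<in> aug_id_pow m \<Longrightarrow> x \<in> carrier \<Omega>"
  using subset_of_sub[OF aug_id_pow_sub] by blast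

lemma aug_id_pow_Suc_subset: "(aug_id_pow (Suc m) :: ('a \<Rightarrow> 'k::field) set) \<subseteq> aug_id_pow m"
proof -
  interpret R: cring "\<Omega> :: ('k, 'a \<Rightarrow> 'k) module" by (rule ga_cring)
  show ?thesis unfolding aug_id_pow_Suc
    using R.ideal_prod_inter[OF aug_id_pow_ideal aug_id_ideal] by blast
qed

lemma aug_id_pow_mult:
  fixes x y :: "'a \<Rightarrow> 'k::field"
  assumes x: "x \<in> aug_id_pow a"
  shows "y \<in> aug_id_pow b \<Longrightarrow> x \<otimes>\<^bsub>\<Omega>\<^esub> y \<in> aug_id_pow (a + b)"
proof (induction b arbitrary: y)
  case 0
  interpret I: ideal "aug_id_pow a" "\<Omega> :: ('k, 'a \<Rightarrow> 'k) module" by (rule aug_id_pow_ideal)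
  show ?case using I.I_r_closed[OF x] 0 by (simp add: aug_id_pow_0)
next
  case (Suc b)
  interpret R: cring "\<Omega> :: ('k, 'a \<Rightarrow> 'k) module" by (rule ga_cring)
  have xc: "x \<in> carrier \<Omega>" using x by (rule aug_id_pow_carrier)
  from Suc.prems have "y \<in> ideal_prod \<Omega> (aug_id_pow b) aug_id" by (simp only: aug_id_pow_Suc)
  then show ?case
  proof (induction y rule: ideal_prod.induct)
    case (prod i j)
    have ij: "i \<in> carrier \<Omega>" "j \<in> carrier \<Omega>"
      using prod aug_id_pow_carrier by (auto simp: aug_id_def)
    have "(x \<otimes>\<^bsub>\<Omega>\<^esub> i) \<otimes>\<^bsub>\<Omega>\<^esub> j \<in> aug_id_pow (Suc (a + b))"
      unfolding aug_id_pow_Suc by (intro ideal_prod.prod Suc.IH prod)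
    then show ?case using R.m_assoc[OF xc ij] by simp
  next
    case (sum s t)
    have "s \<in> carrier \<Omega>" "t \<in> carrier \<Omega>"
      using sum aug_id_pow_carrier[of _ "Suc b"] by (auto simp: aug_id_pow_Suc)
    then show ?case using sum.IH add_in_sub[OF aug_id_pow_sub] xc by (simp add: R.r_distr)
  qed
qed

lemma aug_id_pow_1: "(aug_id_pow (Suc 0) :: ('a \<Rightarrow> 'k::field) set) = aug_id"
proof
  interpret R: cring "\<Omega> :: ('k, 'a \<Rightarrow> 'k) module" by (rule ga_cring)
  show "(aug_id_pow (Suc 0) :: ('a \<Rightarrow> 'k::field) set) \<subseteq> aug_id"
    unfolding aug_id_pow_Suc using R.ideal_prod_inter[OF aug_id_pow_ideal aug_id_ideal] by blast
  show "aug_id \<subseteq> (aug_id_pow (Suc 0) :: ('a \<Rightarrow> 'k::field) set)"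
  proof
    fix x :: "'a \<Rightarrow> 'k" assume x: "x \<in> aug_id"
    then have "\<one>\<^bsub>\<Omega>\<^esub> \<otimes>\<^bsub>\<Omega>\<^esub> x \<in> aug_id_pow (Suc 0)"
      unfolding aug_id_pow_Suc aug_id_pow_0 by (intro ideal_prod.prod) auto
    then show "x \<in> aug_id_pow (Suc 0)" using x by (simp add: aug_id_def)
  qed
qed

lemma delta_minus_one:
  "h \<in> carrier H \<Longrightarrow> delta h \<ominus>\<^bsub>\<Omega>\<^esub> \<one>\<^bsub>\<Omega>\<^esub> \<in> (aug_id :: ('a \<Rightarrow> 'k::field) set)"
proof -
  assume h: "h \<in> carrier H"
  interpret R: cring "\<Omega> :: ('k, 'a \<Rightarrow> 'k) module" by (rule ga_cring)
  interpret M: kmod "\<Omega> :: ('k, 'a \<Rightarrow> 'k) module" by (rule ga_kmod)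
  have d: "(\<Sum>k\<in>carrier H. delta g k :: 'k) = 1" if "g \<in> carrier H" for g
    using that fin by (simp add: delta_def)
  have c: "(delta h :: 'a \<Rightarrow> 'k) \<in> carrier \<Omega>" by (rule delta_closed[OF h])
  have cc: "(delta h :: 'a \<Rightarrow> 'k) \<ominus>\<^bsub>\<Omega>\<^esub> \<one>\<^bsub>\<Omega>\<^esub> \<in> carrier \<Omega>" by (rule R.minus_closed[OF c R.one_closed])
  have e: "(delta h :: 'a \<Rightarrow> 'k) \<ominus>\<^bsub>\<Omega>\<^esub> \<one>\<^bsub>\<Omega>\<^esub> = (\<lambda>s. delta h s + (- 1) * delta \<one> s)"
    unfolding M.minus_eq_sm[OF c R.one_closed] by (simp only: ga_simps(3,4,5))
  have "augmentation ((delta h :: 'a \<Rightarrow> 'k) \<ominus>\<^bsub>\<Omega>\<^esub> \<one>\<^bsub>\<Omega>\<^esub>) = 0"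
    unfolding augmentation_eq[OF cc] unfolding e sum.distrib sum_distrib_left[symmetric] d[OF h] d[OF one_closed]
    by simp
  then show ?thesis using cc by (simp add: aug_id_def)
qed

end

subsection \<open>Binomial functionals on the group algebra\<close>

locale character = fin_ab_group H for H (structure) +
  fixes \<chi> :: "'a \<Rightarrow> 'p::prime_card mod_ring"
  assumes char: "\<chi> \<in> character_group H"
begin

lemma char_mult: "\<lbrakk>g \<in> carrier H; h \<in> carrier H\<rbrakk> \<Longrightarrow> \<chi> (g \<otimes> h) = \<chi> g + \<chi> h"
  using char by (auto simp: character_group_def hom_def)

lemma char_one: "\<chi> \<one> = 0"
  using char_mult[of "\<one>" "\<one>"] by (metis one_closed l_one add_0_right add_left_cancel)

definition bfun :: "nat \<Rightarrow> ('a \<Rightarrow> 'p mod_ring) \<Rightarrow> 'p mod_ring" where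
  "bfun j x = (\<Sum>h\<in>carrier H. x h * binom j (\<chi> h))"

lemma bfun_add: "bfun j (x \<oplus>\<^bsub>\<Omega>\<^esub> y) = bfun j x + bfun j y"
  by (simp only: bfun_def ga_simps(3) sum.distrib distrib_right)

lemma bfun_smult: "bfun j (c \<odot>\<^bsub>\<Omega>\<^esub> x) = c * bfun j x"
  by (simp add: bfun_def ga_simps(4) sum_distrib_left mult.assoc)

lemma bfun_delta: "h \<in> carrier H \<Longrightarrow> bfun j (delta h) = binom j (\<chi> h)"
  unfolding bfun_def by (subst sum.remove[of _ h]) (simp_all add: delta_def fin)

lemma bfun_0: "x \<in> carrier \<Omega> \<Longrightarrow> bfun 0 x = augmentation x"
  by (simp add: bfun_def augmentation_eq)

lemma bfun_mult:
  assumes "x \<in> carrier \<Omega>" "j < CARD('p)"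
  shows "bfun j (x \<otimes>\<^bsub>\<Omega>\<^esub> y) = (\<Sum>i\<le>j. bfun i x * bfun (j - i) y)"
proof -
  have "bfun j (x \<otimes>\<^bsub>\<Omega>\<^esub> y) = (\<Sum>k\<in>carrier H. \<Sum>l\<in>carrier H. x k * y l * binom j (\<chi> (k \<otimes> l)))"
    unfolding bfun_def by (rule conv_sum[OF assms(1)])
  also have "\<dots> = (\<Sum>k\<in>carrier H. \<Sum>l\<in>carrier H. \<Sum>i\<le>j. (x k * binom i (\<chi> k)) * (y l * binom (j - i) (\<chi> l)))"
    by (intro sum.cong refl) (simp add: char_mult binom_add[OF assms(2)] sum_distrib_left mult_ac)
  also have "\<dots> = (\<Sum>k\<in>carrier H. \<Sum>i\<le>j. \<Sum>l\<in>carrier H. (x k * binom i (\<chi> k)) * (y l * binom (j - i) (\<chi> l)))"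
    by (intro sum.cong refl sum.swap)
  also have "\<dots> = (\<Sum>i\<le>j. \<Sum>k\<in>carrier H. \<Sum>l\<in>carrier H. (x k * binom i (\<chi> k)) * (y l * binom (j - i) (\<chi> l)))"
    by (rule sum.swap)
  finally show ?thesis by (simp add: bfun_def sum_product)
qed

lemma bfun_aug_pow:
  "\<lbrakk>x \<in> aug_id_pow m; j < m; j < CARD('p)\<rbrakk> \<Longrightarrow> bfun j x = 0"
proof (induction m arbitrary: x j)
  case (Suc m)
  from Suc.prems(1) have "x \<in> ideal_prod \<Omega> (aug_id_pow m) aug_id" by (simp only: aug_id_pow_Suc)
  then show ?case
  proof (induction x rule: ideal_prod.induct)
    case (prod a b)
    have ab: "a \<in> carrier \<Omega>" "b \<in> carrier \<Omega>" "augmentation b = 0"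
      using prod aug_id_pow_carrier by (auto simp: aug_id_def)
    \<comment> \<open>For i < m the first factor vanishes by induction. Otherwise i = j = m, and the
      second factor is B_0(b), the augmentation of b, which is zero.\<close>
    have z: "bfun i a * bfun (j - i) b = 0" if "i \<le> j" for i
    proof (cases "i < m")
      case True
      then show ?thesis using Suc.IH[OF prod(1), of i] that Suc.prems by simp
    next
      case False
      then have "j - i = 0" using that Suc.prems by simp
      then show ?thesis using bfun_0[OF ab(2)] ab(3) by simp
    qed
    show ?case unfolding bfun_mult[OF ab(1) Suc.prems(3)]
      by (intro sum.neutral ballI) (rule z, simp)
  next
    case (sum s t)
    then show ?case by (simp add: bfun_add)
  qed
qed simp

text \<open>Of the product formula only the term i = a survives: for i < a the first factor vanishes
  on I^a, and for i > a the second has index below b and vanishes on I^b. So the leading functionals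
  are multiplicative on the graded pieces.\<close>

lemma bfun_lead:
  assumes "x \<in> aug_id_pow a" "y \<in> aug_id_pow b" "a + b < CARD('p)"
  shows "bfun (a + b) (x \<otimes>\<^bsub>\<Omega>\<^esub> y) = bfun a x * bfun b y"
proof -
  have "(\<Sum>i\<le>a + b. bfun i x * bfun (a + b - i) y) = (\<Sum>i\<in>{a}. bfun i x * bfun (a + b - i) y)"
  proof (rule sum.mono_neutral_right)
    show "\<forall>i\<in>{..a + b} - {a}. bfun i x * bfun (a + b - i) y = 0"
    proof
      fix i assume i: "i \<in> {..a + b} - {a}"
      show "bfun i x * bfun (a + b - i) y = 0"
      proof (cases "i < a")
        case True
        then show ?thesis using bfun_aug_pow[OF assms(1), of i] assms(3) by simp
      next
        case False
        then have "a + b - i < b" using i by auto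
        then show ?thesis using bfun_aug_pow[OF assms(2), of "a + b - i"] assms(3) by simp
      qed
    qed
  qed auto
  then show ?thesis using bfun_mult[OF aug_id_pow_carrier[OF assms(1)] assms(3)] by simp
qed

end

section \<open>Linear forms span the dual of \<open>I\<^sup>n/I\<^sup>n\<^sup>+\<^sup>1\<close>\<close>

text \<open>The weights are the coefficients of the Lagrange interpolation polynomials of all points of the field.\<close>

lemma interpolation_weights:
  "\<exists>w :: nat \<Rightarrow> 'p::prime_card mod_ring \<Rightarrow> 'p mod_ring. \<forall>j m. j < CARD('p) \<longrightarrow> m < CARD('p) \<longrightarrow>
    (\<Sum>t\<in>UNIV. w j t * t ^ m) = (if j = m then 1 else 0)"
proof -
  define q :: "'p mod_ring \<Rightarrow> 'p mod_ring poly" where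
    "q t = (\<Prod>s\<in>UNIV - {t}. Polynomial.smult (inverse (t - s)) [:- s, 1:])" for t
  have card: "card (UNIV :: 'p mod_ring set) = CARD('p)" by simp
  have p0: "0 < CARD('p)" using prime_card[where ?'a = 'p] by (simp add: prime_gt_0_nat)
  have qe: "poly (q t) u = (if u = t then 1 else 0)" for t u
  proof (cases "u = t")
    case True
    have "poly (q t) u = (\<Prod>s\<in>UNIV - {t}. 1)"
      unfolding q_def poly_prod True
    proof (rule prod.cong[OF refl])
      fix s assume "s \<in> UNIV - {t}"
      then have "t - s \<noteq> 0" by simp
      then have "inverse (t - s) * (t - s) = 1" by (rule left_inverse)
      then show "poly (Polynomial.smult (inverse (t - s)) [:- s, 1:]) t = 1" by (simp add: algebra_simps)
    qed
    then show ?thesis using True by simp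
  next
    case False
    have "poly (q t) u = 0" unfolding q_def poly_prod by (rule prod_zero) (use False in auto)
    then show ?thesis using False by simp
  qed
  have qd: "degree (q t) < CARD('p)" for t
  proof -
    have "degree (q t) \<le> sum (degree \<circ> (\<lambda>s. Polynomial.smult (inverse (t - s)) [:- s, 1:])) (UNIV - {t})"
      unfolding q_def by (rule degree_prod_sum_le) simp
    also have "\<dots> \<le> sum (\<lambda>_. 1) (UNIV - {t})" by (rule sum_mono) simp
    also have "\<dots> < CARD('p)" using card p0 by (simp add: card_Diff_singleton)
    finally show ?thesis .
  qed
  \<comment> \<open>Both sides have degree below p and agree at all p points of the field, so a
    nonzero difference would have too many roots. Comparing coefficients of X^j shows that the j-th
    coefficient of \<open>q t\<close> is the required weight.\<close>
  have main: "(\<Sum>t\<in>UNIV. Polynomial.smult (t ^ m) (q t)) = Polynomial.monom 1 m" if m: "m < CARD('p)" for m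
  proof (rule ccontr)
    let ?P = "(\<Sum>t\<in>UNIV. Polynomial.smult (t ^ m) (q t)) - Polynomial.monom 1 m"
    assume "(\<Sum>t\<in>UNIV. Polynomial.smult (t ^ m) (q t)) \<noteq> Polynomial.monom 1 m"
    then have P: "?P \<noteq> 0" by simp
    have "poly ?P u = 0" for u
      by (simp add: poly_sum qe poly_monom if_distrib[of "\<lambda>c. _ * c"] sum.delta cong: if_cong)
    then have "{u. poly ?P u = 0} = UNIV" by auto
    then have "CARD('p) \<le> degree ?P" using card_poly_roots_bound[OF P] card by simp
    moreover have "degree (Polynomial.smult (t ^ m) (q t)) \<le> CARD('p) - 1" for t
      using degree_smult_le[of "t ^ m" "q t"] qd[of t] by linarith
    then have "degree (\<Sum>t\<in>UNIV. Polynomial.smult (t ^ m) (q t)) \<le> CARD('p) - 1"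
      by (intro degree_sum_le) simp_all
    then have "degree ?P \<le> CARD('p) - 1"
      using m degree_monom_le[of "1 :: 'p mod_ring" m] by (intro degree_diff_le) auto
    ultimately show False using p0 by linarith
  qed
  show ?thesis
  proof (intro exI[of _ "\<lambda>j t. Polynomial.coeff (q t) j"] allI impI)
    fix j m assume "j < CARD('p)" "m < CARD('p)"
    have "(\<Sum>t\<in>UNIV. Polynomial.coeff (q t) j * t ^ m) = Polynomial.coeff (\<Sum>t\<in>UNIV. Polynomial.smult (t ^ m) (q t)) j"
      by (simp add: coeff_sum mult.commute)
    also have "\<dots> = (if j = m then 1 else 0)" using main[OF \<open>m < CARD('p)\<close>] by simp
    finally show "(\<Sum>t\<in>UNIV. Polynomial.coeff (q t) j * t ^ m) = (if j = m then 1 else 0)" .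
  qed
qed

text \<open>The last assumption says that the elements \<open>e i\<close> generate \<open>H\<close>.\<close>

locale elem_ab_group = fin_ab_group H for H (structure) +
  fixes r :: nat and e :: "nat \<Rightarrow> 'a" and x :: "nat \<Rightarrow> 'a \<Rightarrow> 'p::prime_card mod_ring"
  assumes e_closed: "i < r \<Longrightarrow> e i \<in> carrier H"
    and x_char: "i < r \<Longrightarrow> x i \<in> character_group H"
    and x_e: "\<lbrakk>i < r; j < r\<rbrakk> \<Longrightarrow> x i (e j) = (if i = j then 1 else 0)"
    and e_gen: "\<lbrakk>\<one> \<in> S; \<And>i. i < r \<Longrightarrow> e i \<in> S; \<And>g h. \<lbrakk>g \<in> S; h \<in> S; g \<in> carrier H; h \<in> carrier H\<rbrakk> \<Longrightarrow> g \<otimes> h \<in> S\<rbrakk>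
      \<Longrightarrow> carrier H \<subseteq> S"
begin

abbreviation \<Omega>p :: "('p mod_ring, 'a \<Rightarrow> 'p mod_ring) module" where "\<Omega>p \<equiv> \<Omega>"

sublocale R: cring \<Omega>p by (rule ga_cring)
sublocale M: kmod \<Omega>p by (rule ga_kmod)

definition lf :: "(nat \<Rightarrow> 'p mod_ring) \<Rightarrow> 'a \<Rightarrow> 'p mod_ring" where
  "lf a = (\<lambda>h\<in>carrier H. \<Sum>i<r. a i * x i h)"

lemma lf_char: "lf a \<in> character_group H"
proof -
  have add: "(\<Sum>i<r. a i * x i (g \<otimes> h)) = (\<Sum>i<r. a i * x i g) + (\<Sum>i<r. a i * x i h)"
    if gh: "g \<in> carrier H" "h \<in> carrier H" for g h
  proof -
    have "x i (g \<otimes> h) = x i g + x i h" if "i < r" for i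
      using x_char[OF that] gh unfolding character_group_def hom_def by simp
    then have "(\<Sum>i<r. a i * x i (g \<otimes> h)) = (\<Sum>i<r. a i * x i g + a i * x i h)"
      by (intro sum.cong refl) (simp add: distrib_left)
    then show ?thesis by (simp only: sum.distrib)
  qed
  show ?thesis
    unfolding character_group_def hom_def lf_def by (simp add: add)
qed

lemma lf_e: "i < r \<Longrightarrow> lf a (e i) = a i"
proof -
  assume i: "i < r"
  have "(\<Sum>j<r. a j * x j (e i)) = (\<Sum>j\<in>{i}. a j * x j (e i))"
    by (rule sum.mono_neutral_right) (use i in \<open>auto simp: x_e\<close>)
  then show ?thesis using i by (simp add: lf_def e_closed x_e)
qed

lemma lf_locale: "character H (lf a)"
  by (intro character.intro character_axioms.intro fin_ab_group_axioms lf_char)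

abbreviation "bf a \<equiv> character.bfun H (lf a)"

definition z :: "nat \<Rightarrow> 'a \<Rightarrow> 'p mod_ring" where
  "z i = delta (e i) \<ominus>\<^bsub>\<Omega>\<^esub> \<one>\<^bsub>\<Omega>\<^esub>"

lemma z_aug: "i < r \<Longrightarrow> z i \<in> aug_id"
  unfolding z_def by (rule delta_minus_one[OF e_closed])

lemma z_closed: "i < r \<Longrightarrow> z i \<in> carrier \<Omega>p"
  using z_aug by (simp add: aug_id_def)

lemma bf_z: "i < r \<Longrightarrow> bf a (Suc 0) (z i) = a i"
proof -
  assume i: "i < r"
  interpret c: character H "lf a" by (rule lf_locale)
  have "z i = delta (e i) \<oplus>\<^bsub>\<Omega>\<^esub> (-1) \<odot>\<^bsub>\<Omega>\<^esub> delta \<one>"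
    unfolding z_def using M.minus_eq_sm[OF delta_closed[OF e_closed[OF i]] R.one_closed] by (simp only: ga_simps(5))
  then have "bf a (Suc 0) (z i) = lf a (e i) + (-1) * lf a \<one>"
    by (simp only: c.bfun_add c.bfun_smult c.bfun_delta e_closed[OF i] one_closed binom_1)
  then show ?thesis using i by (simp add: lf_e c.char_one)
qed

text \<open>The second argument counts the variables used so far, which lets \<open>mon_pow\<close>
  proceed by induction on it; the monomials that matter have k = r.\<close>

definition mon :: "(nat \<Rightarrow> nat) \<Rightarrow> nat \<Rightarrow> 'a \<Rightarrow> 'p mod_ring" where
  "mon \<alpha> k = (\<Otimes>\<^bsub>\<Omega>\<^esub>i\<in>{..<k}. z i [^]\<^bsub>\<Omega>\<^esub> \<alpha> i)"

lemma mon_closed: "k \<le> r \<Longrightarrow> mon \<alpha> k \<in> carrier \<Omega>p"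
  unfolding mon_def by (rule R.finprod_closed) (auto simp: z_closed)

lemma mon_Suc: "Suc k \<le> r \<Longrightarrow> mon \<alpha> (Suc k) = (z k [^]\<^bsub>\<Omega>\<^esub> \<alpha> k) \<otimes>\<^bsub>\<Omega>\<^esub> mon \<alpha> k"
  unfolding mon_def lessThan_Suc by (subst R.finprod_insert) (auto simp: z_closed)

lemma z_pow:
  assumes "i < r" "m < CARD('p)"
  shows "z i [^]\<^bsub>\<Omega>\<^esub> m \<in> aug_id_pow m" "bf a m (z i [^]\<^bsub>\<Omega>\<^esub> m) = a i ^ m"
proof -
  interpret c: character H "lf a" by (rule lf_locale)
  have "z i [^]\<^bsub>\<Omega>\<^esub> m \<in> aug_id_pow m \<and> (m < CARD('p) \<longrightarrow> bf a m (z i [^]\<^bsub>\<Omega>\<^esub> m) = a i ^ m)" for m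
  proof (induction m)
    case 0
    have "bf a 0 \<one>\<^bsub>\<Omega>\<^esub> = 1" unfolding ga_simps(5) c.bfun_delta[OF one_closed] by simp
    then show ?case using R.one_closed by (simp add: aug_id_pow_0)
  next
    case (Suc m)
    have zi: "z i \<in> aug_id_pow (Suc 0)" using z_aug[OF assms(1)] by (simp add: aug_id_pow_1)
    have "bf a (Suc m) (z i [^]\<^bsub>\<Omega>\<^esub> m \<otimes>\<^bsub>\<Omega>\<^esub> z i) = a i ^ m * a i" if "Suc m < CARD('p)"
      using c.bfun_lead[OF conjunct1[OF Suc] zi] that Suc bf_z[OF assms(1)] by simp
    moreover have "z i [^]\<^bsub>\<Omega>\<^esub> m \<otimes>\<^bsub>\<Omega>\<^esub> z i \<in> aug_id_pow (Suc m)"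
      using aug_id_pow_mult[OF conjunct1[OF Suc] zi] by simp
    ultimately show ?case by (simp add: mult.commute)
  qed
  then show "z i [^]\<^bsub>\<Omega>\<^esub> m \<in> aug_id_pow m" "bf a m (z i [^]\<^bsub>\<Omega>\<^esub> m) = a i ^ m" using assms(2) by auto
qed

text \<open>One variable is added at a time by \<open>bfun_lead\<close>. The outcome is that B_n of
  the character \<open>lf a\<close> evaluates a monomial of degree n at the point a, so varying a
  gives enough functionals to interpolate.\<close>

lemma mon_pow:
  assumes "k \<le> r" "sum \<alpha> {..<k} < CARD('p)"
  shows "mon \<alpha> k \<in> aug_id_pow (sum \<alpha> {..<k}) \<and> bf a (sum \<alpha> {..<k}) (mon \<alpha> k) = (\<Prod>i<k. a i ^ \<alpha> i)"
  using assms
proof (induction k)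
  case 0
  interpret c: character H "lf a" by (rule lf_locale)
  have "bf a 0 \<one>\<^bsub>\<Omega>\<^esub> = 1" unfolding ga_simps(5) c.bfun_delta[OF one_closed] by simp
  then show ?case using R.one_closed by (simp add: mon_def aug_id_pow_0)
next
  case (Suc k)
  interpret c: character H "lf a" by (rule lf_locale)
  have IH: "mon \<alpha> k \<in> aug_id_pow (sum \<alpha> {..<k})" "bf a (sum \<alpha> {..<k}) (mon \<alpha> k) = (\<Prod>i<k. a i ^ \<alpha> i)"
    using Suc by auto
  have k: "k < r" "\<alpha> k < CARD('p)" using Suc.prems by auto
  have s: "sum \<alpha> {..<Suc k} = \<alpha> k + sum \<alpha> {..<k}" by simp
  show ?case unfolding mon_Suc[OF Suc.prems(1)] s
    using aug_id_pow_mult[OF z_pow(1)[OF k] IH(1)] c.bfun_lead[OF z_pow(1)[OF k] IH(1)]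
      Suc.prems(2) z_pow(2)[OF k, of a] IH(2) s by (simp add: mult.commute)
qed

lemma mon_inc:
  assumes i: "i < r"
  shows "mon \<alpha> r \<otimes>\<^bsub>\<Omega>\<^esub> z i = mon (\<alpha>(i := Suc (\<alpha> i))) r"
proof -
  let ?\<beta> = "\<alpha>(i := Suc (\<alpha> i))" and ?A = "{..<r} - {i}"
  have A: "{..<r} = insert i ?A" using i by auto
  have cl: "(\<lambda>j. z j [^]\<^bsub>\<Omega>\<^esub> \<gamma> j) \<in> ?A \<rightarrow> carrier \<Omega>p" "z i [^]\<^bsub>\<Omega>\<^esub> \<gamma> i \<in> carrier \<Omega>p" for \<gamma> :: "nat \<Rightarrow> nat"
    using z_closed i by auto
  have m: "mon \<gamma> r = z i [^]\<^bsub>\<Omega>\<^esub> \<gamma> i \<otimes>\<^bsub>\<Omega>\<^esub> (\<Otimes>\<^bsub>\<Omega>\<^esub>j\<in>?A. z j [^]\<^bsub>\<Omega>\<^esub> \<gamma> j)" for \<gamma>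
    unfolding mon_def by (subst A, subst R.finprod_insert) (use cl in auto)
  have "(\<Otimes>\<^bsub>\<Omega>\<^esub>j\<in>?A. z j [^]\<^bsub>\<Omega>\<^esub> ?\<beta> j) = (\<Otimes>\<^bsub>\<Omega>\<^esub>j\<in>?A. z j [^]\<^bsub>\<Omega>\<^esub> \<alpha> j)"
    by (rule R.finprod_cong') (use cl in auto)
  then show ?thesis unfolding m using R.finprod_closed[OF cl(1)] cl(2) z_closed[OF i]
    by (simp add: R.m_ac)
qed

text \<open>Modulo I^2 the map h -> [h] - 1 turns products into sums, so the h with [h] - 1 in
  \<open>L\<close> are closed under multiplication and \<open>e_gen\<close> shows that they exhaust
  \<open>H\<close>. Phrasing this for a submodule \<open>L\<close> above I^2 avoids any
  quotient.\<close>

lemma aug_id_subset: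
  assumes L: "submodule class_ring L \<Omega>p" and sq: "aug_id_pow (Suc (Suc 0)) \<subseteq> L"
    and zL: "\<And>i. i < r \<Longrightarrow> z i \<in> L"
  shows "aug_id \<subseteq> L"
proof -
  note Lc = subsetD[OF subset_of_sub[OF L]]
  let ?S = "{h \<in> carrier H. delta h \<ominus>\<^bsub>\<Omega>p\<^esub> \<one>\<^bsub>\<Omega>p\<^esub> \<in> L}"
  have "carrier H \<subseteq> ?S"
  proof (rule e_gen)
    have "delta \<one> \<ominus>\<^bsub>\<Omega>p\<^esub> \<one>\<^bsub>\<Omega>p\<^esub> = \<zero>\<^bsub>\<Omega>p\<^esub>" unfolding ga_simps(5)[symmetric] by (simp add: R.minus_eq R.r_neg)
    then show "\<one> \<in> ?S" using zero_in_sub[OF L] by simp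
    show "e i \<in> ?S" if "i < r" for i using zL[OF that] e_closed[OF that] by (simp add: z_def)
    fix g h assume gh: "g \<in> ?S" "h \<in> ?S" "g \<in> carrier H" "h \<in> carrier H"
    let ?g = "delta g :: 'a \<Rightarrow> 'p mod_ring" and ?h = "delta h :: 'a \<Rightarrow> 'p mod_ring"
    have c: "?g \<in> carrier \<Omega>p" "?h \<in> carrier \<Omega>p" using gh by (simp_all add: delta_closed)
    have a: "?g \<ominus>\<^bsub>\<Omega>p\<^esub> \<one>\<^bsub>\<Omega>p\<^esub> \<in> aug_id" "?h \<ominus>\<^bsub>\<Omega>p\<^esub> \<one>\<^bsub>\<Omega>p\<^esub> \<in> aug_id"
      by (rule delta_minus_one, fact)+
    have 1: "(?g \<ominus>\<^bsub>\<Omega>p\<^esub> \<one>\<^bsub>\<Omega>p\<^esub>) \<otimes>\<^bsub>\<Omega>p\<^esub> (?h \<ominus>\<^bsub>\<Omega>p\<^esub> \<one>\<^bsub>\<Omega>p\<^esub>) \<in> L"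
      using aug_id_pow_mult[of "?g \<ominus>\<^bsub>\<Omega>p\<^esub> \<one>\<^bsub>\<Omega>p\<^esub>" "Suc 0" "?h \<ominus>\<^bsub>\<Omega>p\<^esub> \<one>\<^bsub>\<Omega>p\<^esub>" "Suc 0"]
        a sq by (simp add: aug_id_pow_1 subset_iff)
    have idn: "u \<otimes>\<^bsub>\<Omega>p\<^esub> v \<ominus>\<^bsub>\<Omega>p\<^esub> \<one>\<^bsub>\<Omega>p\<^esub> = ((u \<ominus>\<^bsub>\<Omega>p\<^esub> \<one>\<^bsub>\<Omega>p\<^esub>) \<otimes>\<^bsub>\<Omega>p\<^esub> (v \<ominus>\<^bsub>\<Omega>p\<^esub> \<one>\<^bsub>\<Omega>p\<^esub>) \<oplus>\<^bsub>\<Omega>p\<^esub> (u \<ominus>\<^bsub>\<Omega>p\<^esub> \<one>\<^bsub>\<Omega>p\<^esub>)) \<oplus>\<^bsub>\<Omega>p\<^esub> (v \<ominus>\<^bsub>\<Omega>p\<^esub> \<one>\<^bsub>\<Omega>p\<^esub>)"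
      if "u \<in> carrier \<Omega>p" "v \<in> carrier \<Omega>p" for u v
    proof -
      let ?u = "u \<ominus>\<^bsub>\<Omega>p\<^esub> \<one>\<^bsub>\<Omega>p\<^esub>" and ?v = "v \<ominus>\<^bsub>\<Omega>p\<^esub> \<one>\<^bsub>\<Omega>p\<^esub>"
      have uv: "?u \<in> carrier \<Omega>p" "?v \<in> carrier \<Omega>p" using that by auto
      have "u = ?u \<oplus>\<^bsub>\<Omega>p\<^esub> \<one>\<^bsub>\<Omega>p\<^esub>" "v = ?v \<oplus>\<^bsub>\<Omega>p\<^esub> \<one>\<^bsub>\<Omega>p\<^esub>" using that by (simp_all add: M.minus_add_cancel)
      then have "u \<otimes>\<^bsub>\<Omega>p\<^esub> v = (?u \<oplus>\<^bsub>\<Omega>p\<^esub> \<one>\<^bsub>\<Omega>p\<^esub>) \<otimes>\<^bsub>\<Omega>p\<^esub> (?v \<oplus>\<^bsub>\<Omega>p\<^esub> \<one>\<^bsub>\<Omega>p\<^esub>)" by simp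
      also have "\<dots> = ((?u \<otimes>\<^bsub>\<Omega>p\<^esub> ?v \<oplus>\<^bsub>\<Omega>p\<^esub> ?u) \<oplus>\<^bsub>\<Omega>p\<^esub> ?v) \<oplus>\<^bsub>\<Omega>p\<^esub> \<one>\<^bsub>\<Omega>p\<^esub>"
        using uv R.one_closed by (simp add: R.l_distr R.r_distr R.a_ac del: R.minus_closed)
      finally show ?thesis using uv that by (subst eq_commute, subst M.eq_minus_iff) simp_all
    qed
    have "delta (g \<otimes> h) \<ominus>\<^bsub>\<Omega>p\<^esub> \<one>\<^bsub>\<Omega>p\<^esub> \<in> L"
      unfolding delta_mult[OF gh(3,4), symmetric] idn[OF c]
      using gh 1 by (auto intro!: add_in_sub[OF L])
    then show "g \<otimes> h \<in> ?S" using gh by simp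
  qed
  then have del: "delta h \<ominus>\<^bsub>\<Omega>p\<^esub> \<one>\<^bsub>\<Omega>p\<^esub> \<in> L" if "h \<in> carrier H" for h using that by blast
  have cf: "carrier \<Omega>p = carrier (free_mod (carrier H))" by (simp add: group_algebra_def)
  \<comment> \<open>An element minus its augmentation times the unit is a combination of the [h] -
    1, hence lies in \<open>L\<close>; on the augmentation ideal the correction term
    vanishes.\<close>
  have P: "y \<oplus>\<^bsub>\<Omega>p\<^esub> (- (\<Sum>h\<in>carrier H. y h)) \<odot>\<^bsub>\<Omega>p\<^esub> \<one>\<^bsub>\<Omega>p\<^esub> \<in> L" if "y \<in> carrier \<Omega>p" for y
  proof -
    have "y \<in> carrier (free_mod (carrier H))" using that by (simp add: cf)
    then show ?thesis
    proof (rule free_induct[where P = "\<lambda>y. y \<oplus>\<^bsub>\<Omega>p\<^esub> (- (\<Sum>h\<in>carrier H. y h)) \<odot>\<^bsub>\<Omega>p\<^esub> \<one>\<^bsub>\<Omega>p\<^esub> \<in> L"])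
      show "(\<lambda>s. 0) \<oplus>\<^bsub>\<Omega>p\<^esub> (- (\<Sum>h\<in>carrier H. 0)) \<odot>\<^bsub>\<Omega>p\<^esub> \<one>\<^bsub>\<Omega>p\<^esub> \<in> L"
        using zero_in_sub[OF L] by (simp add: ga_simps)
    next
      fix c :: "'p mod_ring" and s assume s: "s \<in> carrier H"
      have "(\<Sum>h\<in>carrier H. c * delta s h) = c" using s fin by (subst sum.remove[of _ s]) (auto simp: delta_def)
      then have "(\<lambda>u. c * delta s u) \<oplus>\<^bsub>\<Omega>p\<^esub> (- (\<Sum>h\<in>carrier H. c * delta s h)) \<odot>\<^bsub>\<Omega>p\<^esub> \<one>\<^bsub>\<Omega>p\<^esub> =
          c \<odot>\<^bsub>\<Omega>p\<^esub> (delta s \<ominus>\<^bsub>\<Omega>p\<^esub> \<one>\<^bsub>\<Omega>p\<^esub>)"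
        unfolding M.minus_eq_sm[OF delta_closed[OF s] R.one_closed] by (simp add: ga_simps algebra_simps)
      then show "(\<lambda>u. c * delta s u) \<oplus>\<^bsub>\<Omega>p\<^esub> (- (\<Sum>h\<in>carrier H. c * delta s h)) \<odot>\<^bsub>\<Omega>p\<^esub> \<one>\<^bsub>\<Omega>p\<^esub> \<in> L"
        using sm_in_sub[OF L del[OF s]] by simp
    next
      fix y y' :: "'a \<Rightarrow> 'p mod_ring"
      assume "y \<oplus>\<^bsub>\<Omega>p\<^esub> (- (\<Sum>h\<in>carrier H. y h)) \<odot>\<^bsub>\<Omega>p\<^esub> \<one>\<^bsub>\<Omega>p\<^esub> \<in> L"
        and "y' \<oplus>\<^bsub>\<Omega>p\<^esub> (- (\<Sum>h\<in>carrier H. y' h)) \<odot>\<^bsub>\<Omega>p\<^esub> \<one>\<^bsub>\<Omega>p\<^esub> \<in> L"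
      from add_in_sub[OF L this]
      show "(\<lambda>s. y s + y' s) \<oplus>\<^bsub>\<Omega>p\<^esub> (- (\<Sum>h\<in>carrier H. y h + y' h)) \<odot>\<^bsub>\<Omega>p\<^esub> \<one>\<^bsub>\<Omega>p\<^esub> \<in> L"
        by (simp add: ga_simps sum.distrib algebra_simps)
    qed
  qed
  show ?thesis
  proof
    fix y :: "'a \<Rightarrow> 'p mod_ring" assume "y \<in> aug_id"
    then have "y \<in> carrier \<Omega>p" "(\<Sum>h\<in>carrier H. y h) = 0" by (auto simp: aug_id_def augmentation_eq)
    then show "y \<in> L" using P[of y] by simp
  qed
qed

lemma one_decomp:
  assumes "submodule class_ring L \<Omega>p" "aug_id \<subseteq> L" "\<one>\<^bsub>\<Omega>p\<^esub> \<in> L" "y \<in> carrier \<Omega>p"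
  shows "y \<in> L"
proof -
  let ?c = "augmentation y"
  have c: "?c \<odot>\<^bsub>\<Omega>p\<^esub> \<one>\<^bsub>\<Omega>p\<^esub> \<in> carrier \<Omega>p" "y \<ominus>\<^bsub>\<Omega>p\<^esub> ?c \<odot>\<^bsub>\<Omega>p\<^esub> \<one>\<^bsub>\<Omega>p\<^esub> \<in> carrier \<Omega>p"
    using assms(4) by auto
  have "(\<Sum>h\<in>carrier H. delta \<one> h :: 'p mod_ring) = 1" using fin by (simp add: delta_def)
  then have "(\<Sum>h\<in>carrier H. y h + (-1) * (?c * delta \<one> h)) = 0"
    unfolding sum.distrib sum_distrib_left[symmetric] by (simp add: augmentation_eq[OF assms(4)])
  moreover have "y \<ominus>\<^bsub>\<Omega>p\<^esub> ?c \<odot>\<^bsub>\<Omega>p\<^esub> \<one>\<^bsub>\<Omega>p\<^esub> = (\<lambda>h. y h + (-1) * (?c * delta \<one> h))"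
    unfolding M.minus_eq_sm[OF assms(4) c(1)] by (simp only: ga_simps(3,4,5))
  ultimately have "augmentation (y \<ominus>\<^bsub>\<Omega>p\<^esub> ?c \<odot>\<^bsub>\<Omega>p\<^esub> \<one>\<^bsub>\<Omega>p\<^esub>) = 0"
    unfolding augmentation_eq[OF c(2)] by (simp only:)
  then have "y \<ominus>\<^bsub>\<Omega>p\<^esub> ?c \<odot>\<^bsub>\<Omega>p\<^esub> \<one>\<^bsub>\<Omega>p\<^esub> \<in> aug_id"
    unfolding aug_id_def using c(2) by simp
  then have "(y \<ominus>\<^bsub>\<Omega>p\<^esub> ?c \<odot>\<^bsub>\<Omega>p\<^esub> \<one>\<^bsub>\<Omega>p\<^esub>) \<oplus>\<^bsub>\<Omega>p\<^esub> ?c \<odot>\<^bsub>\<Omega>p\<^esub> \<one>\<^bsub>\<Omega>p\<^esub> \<in> L"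
    using assms by (intro add_in_sub[OF assms(1)] sm_in_sub[OF assms(1)]) auto
  then show ?thesis using c assms(4) by (simp add: M.minus_add_cancel)
qed

text \<open>Says that monomials of degree m span I^m modulo I^(m+1). It is stated for an arbitrary
  submodule \<open>L\<close> because the induction applies it to a different one, namely a colon
  submodule of \<open>L\<close>.\<close>

lemma aug_pow_subset:
  assumes "submodule class_ring L \<Omega>p" "aug_id_pow (Suc m) \<subseteq> L" "m < CARD('p)"
    and "\<And>\<alpha>. sum \<alpha> {..<r} = m \<Longrightarrow> mon \<alpha> r \<in> L"
  shows "aug_id_pow m \<subseteq> L"
  using assms
proof (induction m arbitrary: L)
  case 0
  have "mon (\<lambda>_. 0) r = \<one>\<^bsub>\<Omega>p\<^esub>" by (simp add: mon_def)
  then have "\<one>\<^bsub>\<Omega>p\<^esub> \<in> L" using "0.prems"(4)[of "\<lambda>_. 0"] by simp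
  then show ?case using one_decomp[OF "0.prems"(1)] "0.prems"(2) by (auto simp: aug_id_pow_0 aug_id_pow_1)
next
  case (Suc m)
  note L = Suc.prems(1)
  \<comment> \<open>The colon of \<open>L\<close> by the augmentation ideal. Once the induction
    hypothesis puts I^m inside it, the product of I^m and I lies in \<open>L\<close>, which is the
    claim for the next power.\<close>
  let ?L' = "{a \<in> carrier \<Omega>p. \<forall>b\<in>aug_id. a \<otimes>\<^bsub>\<Omega>p\<^esub> b \<in> L}"
  have bc: "b \<in> carrier \<Omega>p" if "b \<in> aug_id" for b using that by (simp add: aug_id_def)
  have L': "submodule class_ring ?L' \<Omega>p"
  proof (rule M.submoduleI)
    show "\<zero>\<^bsub>\<Omega>p\<^esub> \<in> ?L'" using zero_in_sub[OF L] bc by (simp add: R.l_null)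
    show "u \<oplus>\<^bsub>\<Omega>p\<^esub> v \<in> ?L'" if "u \<in> ?L'" "v \<in> ?L'" for u v
      using that bc add_in_sub[OF L] by (simp add: R.l_distr)
    show "c \<odot>\<^bsub>\<Omega>p\<^esub> u \<in> ?L'" if "u \<in> ?L'" for c u
      using that sm_in_sub[OF L] by (simp add: ga_mult_smult)
  qed auto
  have "aug_id_pow m \<subseteq> ?L'"
  proof (rule Suc.IH[OF L'])
    show "aug_id_pow (Suc m) \<subseteq> ?L'"
    proof
      fix a :: "'a \<Rightarrow> 'p mod_ring" assume a: "a \<in> aug_id_pow (Suc m)"
      have "a \<otimes>\<^bsub>\<Omega>p\<^esub> b \<in> L" if "b \<in> aug_id" for b
        using aug_id_pow_mult[OF a, of b "Suc 0"] that Suc.prems(2) by (auto simp: aug_id_pow_1)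
      then show "a \<in> ?L'" using aug_id_pow_carrier[OF a] by simp
    qed
    show "m < CARD('p)" using Suc.prems by simp
    fix \<alpha> :: "nat \<Rightarrow> nat" assume s: "sum \<alpha> {..<r} = m"
    have mI: "mon \<alpha> r \<in> aug_id_pow m" using mon_pow[of r \<alpha>] s Suc.prems(3) by simp
    have mc: "mon \<alpha> r \<in> carrier \<Omega>p" by (rule mon_closed) simp
    \<comment> \<open>To see that a monomial of degree m lies in the colon submodule, its other
      factor is varied: multiplying the monomial by I^2 lands in I^(m+2), and by z_i gives a
      monomial of degree m + 1, so \<open>aug_id_subset\<close> applies.\<close>
    let ?L'' = "{b \<in> carrier \<Omega>p. mon \<alpha> r \<otimes>\<^bsub>\<Omega>p\<^esub> b \<in> L}"
    have "aug_id \<subseteq> ?L''"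
    proof (rule aug_id_subset)
      show "submodule class_ring ?L'' \<Omega>p"
      proof (rule M.submoduleI)
        show "\<zero>\<^bsub>\<Omega>p\<^esub> \<in> ?L''" using zero_in_sub[OF L] mc by (simp add: R.r_null)
        show "u \<oplus>\<^bsub>\<Omega>p\<^esub> v \<in> ?L''" if "u \<in> ?L''" "v \<in> ?L''" for u v
          using that mc add_in_sub[OF L] by (simp add: R.r_distr)
        fix c u assume u: "u \<in> ?L''"
        have "mon \<alpha> r \<otimes>\<^bsub>\<Omega>p\<^esub> (c \<odot>\<^bsub>\<Omega>p\<^esub> u) = c \<odot>\<^bsub>\<Omega>p\<^esub> (mon \<alpha> r \<otimes>\<^bsub>\<Omega>p\<^esub> u)"
          using u mc ga_mult_smult[of u c "mon \<alpha> r"] by (simp add: R.m_comm)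
        then show "c \<odot>\<^bsub>\<Omega>p\<^esub> u \<in> ?L''" using u sm_in_sub[OF L] by simp
      qed auto
      show "aug_id_pow (Suc (Suc 0)) \<subseteq> ?L''"
      proof
        fix b :: "'a \<Rightarrow> 'p mod_ring" assume b: "b \<in> aug_id_pow (Suc (Suc 0))"
        show "b \<in> ?L''" using aug_id_pow_mult[OF mI b] Suc.prems(2) aug_id_pow_carrier[OF b] by auto
      qed
      fix i assume i: "i < r"
      have "sum (\<alpha>(i := Suc (\<alpha> i))) {..<r} = Suc m"
        using i s by (simp add: sum.remove[of _ i])
      then show "z i \<in> ?L''" using Suc.prems(4) z_closed[OF i] by (simp add: mon_inc[OF i])
    qed
    then show "mon \<alpha> r \<in> ?L'" using mc by blast
  qed
  then have sub: "a \<otimes>\<^bsub>\<Omega>p\<^esub> b \<in> L" if "a \<in> aug_id_pow m" "b \<in> aug_id" for a b using that by blast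
  show ?case
  proof
    fix y :: "'a \<Rightarrow> 'p mod_ring" assume "y \<in> aug_id_pow (Suc m)"
    then have "y \<in> ideal_prod \<Omega> (aug_id_pow m) aug_id" by (simp only: aug_id_pow_Suc)
    then show "y \<in> L" by (induction y rule: ideal_prod.induct) (auto intro: sub add_in_sub[OF L])
  qed
qed

end

section \<open>Dual spaces and the graded pieces I^n/I^(n+1)\<close>

lemma (in kmod) sub_of_sub:
  assumes "submodule class_ring S M" "submodule class_ring S' M" "S' \<subseteq> S"
  shows "submodule class_ring S' (M\<lparr>carrier := S\<rparr>)"
  by (rule kmod.submoduleI[OF sub_kmod[OF assms(1)]])
    (simp_all add: assms(3) zero_in_sub[OF assms(2)] add_in_sub[OF assms(2)] sm_in_sub[OF assms(2)])

lemma dual_mod_simps: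
  "carrier (dual_mod V) = {\<phi> \<in> extensional (carrier V).
        (\<forall>v\<in>carrier V. \<forall>w\<in>carrier V. \<phi> (v \<oplus>\<^bsub>V\<^esub> w) = \<phi> v + \<phi> w) \<and>
        (\<forall>c. \<forall>v\<in>carrier V. \<phi> (c \<odot>\<^bsub>V\<^esub> v) = c * \<phi> v)}"
  "\<zero>\<^bsub>dual_mod V\<^esub> = (\<lambda>v\<in>carrier V. 0)"
  "\<phi> \<oplus>\<^bsub>dual_mod V\<^esub> \<psi> = (\<lambda>v\<in>carrier V. \<phi> v + \<psi> v)"
  "c \<odot>\<^bsub>dual_mod V\<^esub> \<phi> = (\<lambda>v\<in>carrier V. c * \<phi> v)"
  by (simp_all add: dual_mod_def)

lemma (in kmod) dual_kmod: "kmod (dual_mod M)"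
proof -
  have ext: "(\<lambda>v\<in>carrier M. h v) = \<phi>" if "\<phi> \<in> carrier (dual_mod M)" "\<And>v. v \<in> carrier M \<Longrightarrow> h v = \<phi> v" for h \<phi>
  proof (rule extensionalityI[of _ "carrier M"])
    show "\<phi> \<in> extensional (carrier M)" using that(1) unfolding dual_mod_simps by simp
  qed (simp_all add: that(2))
  show ?thesis
  proof (rule kmodI)
    show "\<zero>\<^bsub>dual_mod M\<^esub> \<in> carrier (dual_mod M)" unfolding dual_mod_simps by simp
    fix f g h a b
    assume f: "f \<in> carrier (dual_mod M)"
    show "a \<odot>\<^bsub>dual_mod M\<^esub> f \<in> carrier (dual_mod M)"
      using f unfolding dual_mod_simps by (simp add: algebra_simps)
    show "f \<oplus>\<^bsub>dual_mod M\<^esub> \<zero>\<^bsub>dual_mod M\<^esub> = f"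
      unfolding dual_mod_simps(2-) by (rule ext[OF f]) simp
    show "(a + b) \<odot>\<^bsub>dual_mod M\<^esub> f = a \<odot>\<^bsub>dual_mod M\<^esub> f \<oplus>\<^bsub>dual_mod M\<^esub> b \<odot>\<^bsub>dual_mod M\<^esub> f"
      unfolding dual_mod_simps(2-) by (rule restrict_ext) (simp add: algebra_simps)
    show "(a * b) \<odot>\<^bsub>dual_mod M\<^esub> f = a \<odot>\<^bsub>dual_mod M\<^esub> (b \<odot>\<^bsub>dual_mod M\<^esub> f)"
      unfolding dual_mod_simps(2-) by (rule restrict_ext) (simp add: algebra_simps)
    show "1 \<odot>\<^bsub>dual_mod M\<^esub> f = f" unfolding dual_mod_simps(2-) by (rule ext[OF f]) simp
    show "0 \<odot>\<^bsub>dual_mod M\<^esub> f = \<zero>\<^bsub>dual_mod M\<^esub>" unfolding dual_mod_simps(2-) by (rule restrict_ext) simp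
    assume g: "g \<in> carrier (dual_mod M)"
    show "f \<oplus>\<^bsub>dual_mod M\<^esub> g \<in> carrier (dual_mod M)"
      using f g unfolding dual_mod_simps by (simp add: algebra_simps)
    show "f \<oplus>\<^bsub>dual_mod M\<^esub> g = g \<oplus>\<^bsub>dual_mod M\<^esub> f"
      unfolding dual_mod_simps(2-) by (rule restrict_ext) (simp add: algebra_simps)
    show "a \<odot>\<^bsub>dual_mod M\<^esub> (f \<oplus>\<^bsub>dual_mod M\<^esub> g) = a \<odot>\<^bsub>dual_mod M\<^esub> f \<oplus>\<^bsub>dual_mod M\<^esub> a \<odot>\<^bsub>dual_mod M\<^esub> g"
      unfolding dual_mod_simps(2-) by (rule restrict_ext) (simp add: algebra_simps)
    assume h: "h \<in> carrier (dual_mod M)"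
    show "(f \<oplus>\<^bsub>dual_mod M\<^esub> g) \<oplus>\<^bsub>dual_mod M\<^esub> h = f \<oplus>\<^bsub>dual_mod M\<^esub> (g \<oplus>\<^bsub>dual_mod M\<^esub> h)"
      unfolding dual_mod_simps(2-) by (rule restrict_ext) (simp add: algebra_simps)
  qed
qed

lemma (in kmod) dual_combination_in_sub:
  assumes L: "submodule class_ring L (dual_mod M)" and "\<And>s. s \<in> F \<Longrightarrow> \<phi> s \<in> L" "finite F"
  shows "(\<lambda>v\<in>carrier M. \<Sum>s\<in>F. c s * \<phi> s v) \<in> L"
  using assms(3,2)
proof (induction F rule: finite_induct)
  case empty
  show ?case using zero_in_sub[OF L] by (simp only: sum.empty dual_mod_simps(2))
next
  case (insert s F)
  have IH: "(\<lambda>v\<in>carrier M. \<Sum>s\<in>F. c s * \<phi> s v) \<in> L" by (rule insert.IH) (rule insert.prems, simp)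
  have s: "\<phi> s \<in> L" by (rule insert.prems) simp
  have e: "(\<lambda>v\<in>carrier M. \<Sum>s\<in>insert s F. c s * \<phi> s v) =
      c s \<odot>\<^bsub>dual_mod M\<^esub> \<phi> s \<oplus>\<^bsub>dual_mod M\<^esub> (\<lambda>v\<in>carrier M. \<Sum>s\<in>F. c s * \<phi> s v)"
    unfolding dual_mod_simps(3,4) using insert.hyps by (intro restrict_ext) simp
  show ?case unfolding e by (rule add_in_sub[OF L sm_in_sub[OF L s] IH])
qed

context fin_ab_group
begin

text \<open>The linear structure underlying \<open>omega_gr\<close>, expressed through
  \<open>H\<close> alone.\<close>

definition gr :: "nat \<Rightarrow> ('k::field, ('a \<Rightarrow> 'k) set) module" where
  "gr n = quot_mod (\<Omega>\<lparr>carrier := aug_id_pow n\<rparr>) (aug_id_pow (Suc n))"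

lemma gr_kquot: "kquot ((\<Omega> :: ('k::field, 'a \<Rightarrow> 'k) module)\<lparr>carrier := aug_id_pow n\<rparr>) (aug_id_pow (Suc n))"
  by (intro kquot.intro kquot_axioms.intro kmod.sub_kmod[OF ga_kmod] kmod.sub_of_sub[OF ga_kmod]
      aug_id_pow_sub aug_id_pow_Suc_subset)

lemma gr_kmod: "kmod (gr n :: ('k::field, ('a \<Rightarrow> 'k) set) module)"
  unfolding gr_def by (rule kquot.quot_kmod[OF gr_kquot])

lemma gr_coset_closed:
  fixes y :: "'a \<Rightarrow> 'k::field"
  shows "y \<in> aug_id_pow n \<Longrightarrow> aug_id_pow (Suc n) +>\<^bsub>\<Omega>\<^esub> y \<in> carrier (gr n)"
  unfolding gr_def using kquot.coset_in_quot[OF gr_kquot, of y n] by simp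

lemma grE:
  fixes A :: "('a \<Rightarrow> 'k::field) set"
  assumes "A \<in> carrier (gr n)"
  obtains y where "y \<in> aug_id_pow n" "A = aug_id_pow (Suc n) +>\<^bsub>\<Omega>\<^esub> y"
  by (rule kquot.quotE[OF gr_kquot assms[unfolded gr_def]]) (rule that, simp_all)

lemma gr_ops:
  fixes y y' :: "'a \<Rightarrow> 'k::field"
  assumes "y \<in> aug_id_pow n"
  shows gr_smult: "c \<odot>\<^bsub>gr n\<^esub> (aug_id_pow (Suc n) +>\<^bsub>\<Omega>\<^esub> y) = aug_id_pow (Suc n) +>\<^bsub>\<Omega>\<^esub> (c \<odot>\<^bsub>\<Omega>\<^esub> y)"
    and gr_add: "y' \<in> aug_id_pow n \<Longrightarrow>
      (aug_id_pow (Suc n) +>\<^bsub>\<Omega>\<^esub> y) \<oplus>\<^bsub>gr n\<^esub> (aug_id_pow (Suc n) +>\<^bsub>\<Omega>\<^esub> y') = aug_id_pow (Suc n) +>\<^bsub>\<Omega>\<^esub> (y \<oplus>\<^bsub>\<Omega>\<^esub> y')"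
  using kquot.quot_smult[OF gr_kquot, of y n c] kquot.quot_add[OF gr_kquot, of y n y'] assms
  by (simp_all add: gr_def)

lemma gr_zero: "\<zero>\<^bsub>gr n\<^esub> = (aug_id_pow (Suc n) :: ('a \<Rightarrow> 'k::field) set)"
  by (simp add: gr_def quot_mod_def)

end

context character
begin

text \<open>This will turn out to be p_{chi,n} itself (\<open>p_gr_eq\<close>): the first coordinate
  of the binomial column is B_n.\<close>

definition gr_fun :: "nat \<Rightarrow> ('a \<Rightarrow> 'p mod_ring) set \<Rightarrow> 'p mod_ring" where
  "gr_fun n = (\<lambda>A\<in>carrier (gr n). quot_lift (bfun n) A)"

lemma gr_fun_coset:
  assumes "y \<in> aug_id_pow n" "n < CARD('p)"
  shows "gr_fun n (aug_id_pow (Suc n) +>\<^bsub>\<Omega>\<^esub> y) = bfun n y"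
proof -
  have "quot_lift (bfun n) (aug_id_pow (Suc n) +>\<^bsub>\<Omega>\<lparr>carrier := aug_id_pow n\<rparr>\<^esub> y) = bfun n y"
  proof (rule kquot.quot_lift_coset[OF gr_kquot])
    fix s :: "'a \<Rightarrow> 'p mod_ring" assume "s \<in> aug_id_pow (Suc n)"
    then show "bfun n (s \<oplus>\<^bsub>\<Omega>\<lparr>carrier := aug_id_pow n\<rparr>\<^esub> y) = bfun n y"
      using bfun_aug_pow[of s "Suc n" n] assms(2) by (simp add: bfun_add)
  qed (simp add: assms)
  then show ?thesis using gr_coset_closed[OF assms(1)] by (simp add: gr_fun_def)
qed

lemma gr_fun_dual:
  assumes "n < CARD('p)" shows "gr_fun n \<in> carrier (dual_mod (gr n))"
proof -
  have 1: "gr_fun n (v \<oplus>\<^bsub>gr n\<^esub> w) = gr_fun n v + gr_fun n w" if vw: "v \<in> carrier (gr n)" "w \<in> carrier (gr n)" for v w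
  proof -
    obtain y where y: "y \<in> aug_id_pow n" "v = aug_id_pow (Suc n) +>\<^bsub>\<Omega>\<^esub> y" using vw(1) by (rule grE)
    obtain y' where y': "y' \<in> aug_id_pow n" "w = aug_id_pow (Suc n) +>\<^bsub>\<Omega>\<^esub> y'" using vw(2) by (rule grE)
    show ?thesis using y y' add_in_sub[OF aug_id_pow_sub y(1) y'(1)] assms
      by (simp add: gr_add gr_fun_coset bfun_add)
  qed
  have 2: "gr_fun n (c \<odot>\<^bsub>gr n\<^esub> v) = c * gr_fun n v" if v: "v \<in> carrier (gr n)" for c v
  proof -
    obtain y where y: "y \<in> aug_id_pow n" "v = aug_id_pow (Suc n) +>\<^bsub>\<Omega>\<^esub> y" using v by (rule grE)
    show ?thesis using y sm_in_sub[OF aug_id_pow_sub y(1)] assms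
      by (simp add: gr_smult gr_fun_coset bfun_smult)
  qed
  show ?thesis unfolding dual_mod_simps using 1 2 by (simp add: gr_fun_def)
qed

end

context elem_ab_group
begin

abbreviation "grf a \<equiv> character.gr_fun H (lf a)"

text \<open>Interpolation on the grid of all points of F_p^r. A functional is determined by its
  values on monomials of degree n, all exponents there are at most n < p, and \<open>mon_pow\<close>
  makes the available functionals point evaluations; so a suitable weighted sum of them reproduces
  \<open>lam\<close>.\<close>

lemma dual_subset:
  assumes n: "n < CARD('p)" and L: "submodule class_ring L (dual_mod (gr n))"
    and grL: "\<And>a. grf a n \<in> L" and lam: "lam \<in> carrier (dual_mod (gr n :: ('p mod_ring, _) module))"
  shows "lam \<in> L"
proof -
  interpret W: kmod "gr n :: ('p mod_ring, ('a \<Rightarrow> 'p mod_ring) set) module" by (rule gr_kmod)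
  obtain w :: "nat \<Rightarrow> 'p mod_ring \<Rightarrow> 'p mod_ring"
    where w': "\<forall>j m. j < CARD('p) \<longrightarrow> m < CARD('p) \<longrightarrow> (\<Sum>t\<in>UNIV. w j t * t ^ m) = (if j = m then 1 else 0)"
    using interpolation_weights[where ?'p = 'p] by (rule exE)
  have w: "(\<Sum>t\<in>UNIV. w j t * t ^ m) = (if j = m then 1 else 0)" if "j < CARD('p)" "m < CARD('p)" for j m
    using w' that by (simp only:)
  let ?co = "\<lambda>y. aug_id_pow (Suc n) +>\<^bsub>\<Omega>p\<^esub> y"
  define A where "A = {\<alpha> \<in> {..<r} \<rightarrow>\<^sub>E {..n}. sum \<alpha> {..<r} = n}"
  define P where "P = {..<r} \<rightarrow>\<^sub>E (UNIV :: 'p mod_ring set)"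
  have finA: "finite A" unfolding A_def by (intro finite_subset[OF _ finite_PiE[of "{..<r}" "\<lambda>_. {..n}"]]) auto
  have finP: "finite P" unfolding P_def by (intro finite_PiE) auto
  \<comment> \<open>The value of \<open>lam\<close> at the monomial with exponents alpha, times the
    r-fold product of one-variable weights that extract the coefficient of alpha from values at the
    points a.\<close>
  define c where "c = (\<lambda>(\<alpha>, a). lam (?co (mon \<alpha> r)) * (\<Prod>i<r. w (\<alpha> i) (a i)))"
  define f where "f y = (\<Sum>s\<in>A \<times> P. c s * bf (snd s) n y)" for y
  have monI: "mon \<alpha> r \<in> aug_id_pow n" if "sum \<alpha> {..<r} = n" for \<alpha> using mon_pow[of r \<alpha>] that n by simp
  have fmon: "f (mon \<beta> r) = lam (?co (mon \<beta> r))" if \<beta>: "sum \<beta> {..<r} = n" for \<beta>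
  proof -
    have le: "\<alpha> i \<le> n" if "sum \<alpha> {..<r} = n" "i < r" for \<alpha> :: "nat \<Rightarrow> nat" and i
      using member_le_sum[of i "{..<r}" \<alpha>] that by simp
    let ?\<beta> = "restrict \<beta> {..<r}"
    have \<beta>A: "?\<beta> \<in> A" using le[OF \<beta>] \<beta> by (auto simp: A_def)
    have m\<beta>: "mon ?\<beta> r = mon \<beta> r"
      unfolding mon_def by (rule R.finprod_cong') (auto simp: z_closed)
    \<comment> \<open>The sum over the grid of a product in separate variables is the product of the
      one-variable sums, each a Kronecker delta. The restriction of beta is needed because exponents
      in \<open>A\<close> are extensional.\<close>
    have inner: "(\<Sum>a\<in>P. (\<Prod>i<r. w (\<alpha> i) (a i)) * bf a n (mon \<beta> r)) = (if \<alpha> = ?\<beta> then 1 else 0)"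
      if \<alpha>: "\<alpha> \<in> A" for \<alpha>
    proof -
      have "(\<Sum>a\<in>P. (\<Prod>i<r. w (\<alpha> i) (a i)) * bf a n (mon \<beta> r)) = (\<Sum>a\<in>P. \<Prod>i<r. w (\<alpha> i) (a i) * a i ^ \<beta> i)"
        using mon_pow[of r \<beta>] \<beta> n by (simp add: prod.distrib)
      also have "\<dots> = (\<Prod>i<r. \<Sum>t\<in>UNIV. w (\<alpha> i) t * t ^ \<beta> i)"
        unfolding P_def by (rule prod_sum_PiE[symmetric]) auto
      also have "\<dots> = (\<Prod>i<r. if \<alpha> i = \<beta> i then 1 else 0)"
      proof (rule prod.cong[OF refl])
        fix i assume i: "i \<in> {..<r}"
        have "\<alpha> \<in> {..<r} \<rightarrow>\<^sub>E {..n}" using \<alpha> by (simp add: A_def)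
        then have "\<alpha> i \<le> n" using PiE_mem[OF _ i] by fastforce
        moreover have "\<beta> i \<le> n" using le[OF \<beta>] i by simp
        ultimately have "\<alpha> i < CARD('p)" "\<beta> i < CARD('p)" using n by linarith+
        then show "(\<Sum>t\<in>UNIV. w (\<alpha> i) t * t ^ \<beta> i) = (if \<alpha> i = \<beta> i then 1 else 0)" by (rule w)
      qed
      also have "\<dots> = (if \<alpha> = ?\<beta> then 1 else 0)"
      proof (cases "\<alpha> = ?\<beta>")
        case False
        moreover have "\<alpha> \<in> extensional {..<r}" using \<alpha> by (auto simp: A_def PiE_iff)
        ultimately obtain i where "i < r" "\<alpha> i \<noteq> \<beta> i"
          using extensionalityI[of \<alpha> "{..<r}" ?\<beta>] by auto
        then have "(\<Prod>i<r. if \<alpha> i = \<beta> i then 1 else 0 :: 'p mod_ring) = 0" by (intro prod_zero) auto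
        then show ?thesis using False by simp
      qed simp
      finally show ?thesis .
    qed
    have "f (mon \<beta> r) = (\<Sum>\<alpha>\<in>A. \<Sum>a\<in>P. c (\<alpha>, a) * bf a n (mon \<beta> r))"
      unfolding f_def by (simp add: sum.cartesian_product case_prod_unfold)
    also have "\<dots> = (\<Sum>\<alpha>\<in>A. lam (?co (mon \<alpha> r)) * (if \<alpha> = ?\<beta> then 1 else 0))"
      by (rule sum.cong[OF refl]) (simp add: c_def inner[symmetric] sum_distrib_left mult.assoc)
    also have "\<dots> = lam (?co (mon ?\<beta> r))" using \<beta>A finA by (subst sum.remove[of _ ?\<beta>]) auto
    finally show ?thesis by (simp only: m\<beta>)
  qed
  have lamadd: "lam (v \<oplus>\<^bsub>gr n\<^esub> v') = lam v + lam v'" if "v \<in> carrier (gr n)" "v' \<in> carrier (gr n)" for v v'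
    using lam that unfolding dual_mod_simps by simp
  have lamsm: "lam (c \<odot>\<^bsub>gr n\<^esub> v) = c * lam v" if "v \<in> carrier (gr n)" for c v
    using lam that unfolding dual_mod_simps by simp
  have fadd: "f (y \<oplus>\<^bsub>\<Omega>p\<^esub> y') = f y + f y'" for y y'
    unfolding f_def by (simp add: character.bfun_add[OF lf_locale] distrib_left sum.distrib)
  have fsm: "f (k \<odot>\<^bsub>\<Omega>p\<^esub> y) = k * f y" for k y
    unfolding f_def by (simp add: character.bfun_smult[OF lf_locale] sum_distrib_left mult_ac)
  have lam0: "lam (aug_id_pow (Suc n)) = 0"
  proof -
    have "lam \<zero>\<^bsub>gr n\<^esub> = 0" using lamsm[OF W.zero_closed, of 0] unfolding W.sm_zero_right by simp
    then show ?thesis unfolding gr_zero .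
  qed
  \<comment> \<open>Where the two functionals agree on I^n. Both vanish on I^(n+1), and they agree
    on monomials, so \<open>aug_pow_subset\<close> shows that this is everything.\<close>
  let ?K = "{y \<in> aug_id_pow n. lam (?co y) = f y}"
  have K: "submodule class_ring ?K \<Omega>p"
  proof (rule M.submoduleI)
    show "?K \<subseteq> carrier \<Omega>p" using aug_id_pow_carrier by blast
    have "f \<zero>\<^bsub>\<Omega>p\<^esub> = 0" using fsm[of 0 "\<zero>\<^bsub>\<Omega>p\<^esub>"] by simp
    moreover have "?co \<zero>\<^bsub>\<Omega>p\<^esub> = aug_id_pow (Suc n)"
      using kquot.coset_zero[OF gr_kquot] by simp
    ultimately show "\<zero>\<^bsub>\<Omega>p\<^esub> \<in> ?K" using zero_in_sub[OF aug_id_pow_sub] lam0 by simp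
    show "y \<oplus>\<^bsub>\<Omega>p\<^esub> y' \<in> ?K" if "y \<in> ?K" "y' \<in> ?K" for y y'
      using that add_in_sub[OF aug_id_pow_sub, of y n y'] lamadd[of "?co y" "?co y'"]
      by (simp add: gr_add fadd gr_coset_closed)
    show "k \<odot>\<^bsub>\<Omega>p\<^esub> y \<in> ?K" if "y \<in> ?K" for k y
      using that sm_in_sub[OF aug_id_pow_sub, of y n k] lamsm[of "?co y" k]
      by (simp add: gr_smult fsm gr_coset_closed)
  qed
  have "aug_id_pow n \<subseteq> ?K"
  proof (rule aug_pow_subset[OF K _ n])
    show "aug_id_pow (Suc n) \<subseteq> ?K"
    proof
      fix y :: "'a \<Rightarrow> 'p mod_ring" assume y: "y \<in> aug_id_pow (Suc n)"
      have "f y = 0" unfolding f_def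
        using character.bfun_aug_pow[OF lf_locale y] n by simp
      moreover have "?co y = aug_id_pow (Suc n)"
        using kquot.coset_of_mem[OF gr_kquot y] by simp
      ultimately show "y \<in> ?K" using aug_id_pow_Suc_subset y lam0 by auto
    qed
    show "mon \<alpha> r \<in> ?K" if "sum \<alpha> {..<r} = n" for \<alpha> using fmon[OF that] monI[OF that] by simp
  qed
  then have eq: "lam (?co y) = f y" if "y \<in> aug_id_pow n" for y using that by blast
  have "lam = (\<lambda>v\<in>carrier (gr n). \<Sum>s\<in>A \<times> P. c s * grf (snd s) n v)"
  proof (rule extensionalityI[of _ "carrier (gr n)"])
    show "lam \<in> extensional (carrier (gr n))" using lam unfolding dual_mod_simps by simp
    fix v assume v: "v \<in> carrier (gr n :: ('p mod_ring, ('a \<Rightarrow> 'p mod_ring) set) module)"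
    then obtain y where y: "y \<in> aug_id_pow n" "v = ?co y" by (rule grE)
    show "lam v = (\<lambda>v\<in>carrier (gr n). \<Sum>s\<in>A \<times> P. c s * grf (snd s) n v) v"
      using v eq[OF y(1)] by (simp add: y(2) f_def character.gr_fun_coset[OF lf_locale y(1) n])
  qed simp
  also have "\<dots> \<in> L" by (rule W.dual_combination_in_sub[OF L]) (simp_all add: grL finA finP)
  finally show ?thesis .
qed

text \<open>The functionals of linear forms span by \<open>dual_subset\<close>, and a minimal
  spanning subset of a finite spanning set is a basis.\<close>

lemma exists_dual_basis:
  assumes n: "n < CARD('p)" and r: "1 \<le> r"
  shows "\<exists>\<chi>s :: ('a \<Rightarrow> 'p mod_ring) list. length \<chi>s \<ge> 1 \<and> set \<chi>s \<subseteq> character_group H \<and>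
    ordered_basis (dual_mod (gr n)) (map (\<lambda>\<chi>. character.gr_fun H \<chi> n) \<chi>s)"
proof -
  interpret W: kmod "gr n :: ('p mod_ring, ('a \<Rightarrow> 'p mod_ring) set) module" by (rule gr_kmod)
  let ?D = "dual_mod (gr n :: ('p mod_ring, ('a \<Rightarrow> 'p mod_ring) set) module)"
  interpret D: kmod ?D by (rule W.dual_kmod)
  interpret D: vectorspace class_ring ?D
    by (intro vectorspace.intro D.module_axioms class_field)
  let ?\<phi> = "\<lambda>\<chi>. character.gr_fun H \<chi> n"
  define P where "P = {..<r} \<rightarrow>\<^sub>E (UNIV :: 'p mod_ring set)"
  define S where "S = ?\<phi> ` lf ` P"
  have finS: "finite S" unfolding S_def P_def by (intro finite_imageI finite_PiE) auto
  have SD: "S \<subseteq> carrier ?D"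
    unfolding S_def using character.gr_fun_dual[OF lf_locale n] by blast
  \<comment> \<open>Only the first r coefficients matter, so all linear forms come from the finite
    set \<open>P\<close> and the spanning set is finite.\<close>
  have "lf a = lf (restrict a {..<r})" for a
    unfolding lf_def by (intro restrict_ext sum.cong) auto
  then have grS: "grf a n \<in> S" for a
    unfolding S_def P_def by (metis imageI restrict_PiE_iff UNIV_I)
  have "D.span S = carrier ?D"
  proof
    show "D.span S \<subseteq> carrier ?D" by (rule D.span_is_subset2[OF SD])
    show "carrier ?D \<subseteq> D.span S"
      using dual_subset[OF n D.span_is_submodule[OF SD]] grS D.in_own_span[OF SD] by blast
  qed
  then obtain B where B: "B \<subseteq> S" "minimal B (\<lambda>S. S \<subseteq> carrier ?D \<and> D.gen_set S)"
    using minimal_exists[of S "\<lambda>S. S \<subseteq> carrier ?D \<and> D.gen_set S"] finS SD by auto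
  have basis: "D.basis B" by (rule D.min_gen_is_basis[OF B(2)])
  have "finite B" using B(1) finS finite_subset by blast
  then obtain bs where bs: "set bs = B" "distinct bs" using finite_distinct_list by blast
  \<comment> \<open>Different characters may induce the same functional. The list is therefore
    formed from the functionals first, and one character is then chosen for each.\<close>
  have "\<forall>b\<in>set bs. \<exists>\<chi>. \<chi> \<in> character_group H \<and> ?\<phi> \<chi> = b"
    using B(1) bs(1) lf_char unfolding S_def by blast
  then obtain g where g: "\<And>b. b \<in> set bs \<Longrightarrow> g b \<in> character_group H \<and> ?\<phi> (g b) = b" by metis
  have map: "map ?\<phi> (map g bs) = bs" using g by (simp add: map_idI)
  \<comment> \<open>The dual space is not zero: since r is at least 1 there is a generator e_0, and
    the functional with all coefficients 1 takes the value 1 on the n-th power of [e_0] - 1.\<close>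
  have "bs \<noteq> []"
  proof
    assume "bs = []"
    then have "D.span {} = carrier ?D" using basis bs(1) by (simp add: D.basis_def)
    moreover have "submodule class_ring {\<zero>\<^bsub>?D\<^esub>} ?D" by (rule D.submoduleI) auto
    then have "D.span {} \<subseteq> {\<zero>\<^bsub>?D\<^esub>}" by (intro D.span_subset_sub) auto
    ultimately have z: "grf (\<lambda>_. 1) n = \<zero>\<^bsub>?D\<^esub>" using grS SD by blast
    define \<alpha> where "\<alpha> = (\<lambda>i::nat. if i = 0 then n else 0)"
    have s: "sum \<alpha> {..<r} = n" using r by (subst sum.remove[of _ 0]) (auto simp: \<alpha>_def)
    have m: "mon \<alpha> r \<in> aug_id_pow n" "bf (\<lambda>_. 1) n (mon \<alpha> r) = 1"
      using mon_pow[of r \<alpha> "\<lambda>_. 1"] s n by auto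
    have "grf (\<lambda>_. 1) n (aug_id_pow (Suc n) +>\<^bsub>\<Omega>p\<^esub> mon \<alpha> r) = 1"
      using character.gr_fun_coset[OF lf_locale m(1) n] m(2) by simp
    then show False using gr_coset_closed[OF m(1)] unfolding z dual_mod_simps(2) by simp
  qed
  then show ?thesis
    using g basis bs map
    by (intro exI[of _ "map g bs"]) (auto simp: ordered_basis_def Suc_le_eq)
qed

end

section \<open>Discrete modules attached to the group algebra\<close>

locale dgtensor = V: dgmod G V + W: dgmod G W
  for G :: "'g topgroup" and V :: "('k::field, 'g, 'v) gmodule" and W :: "('k, 'g, 'w) gmodule"
begin

sublocale K: ktensor V W by (intro ktensor.intro V.M.kmod_axioms' W.M.kmod_axioms')

lemma tensor_gmod_simps [simp]:
  "carrier (tensor_gmod V W) = carrier (tensor V W)" "add (tensor_gmod V W) = add (tensor V W)"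
  "smult (tensor_gmod V W) = smult (tensor V W)" "zero (tensor_gmod V W) = zero (tensor V W)"
  "mtop (tensor_gmod V W) = discrete_topology (carrier (tensor V W))"
  by (simp_all add: tensor_gmod_def)

lemma act_bilinear:
  assumes g: "g \<in> carrier G"
  shows "bilinear_map V W (tensor V W) (\<lambda>v w. tens V W (gact V g v) (gact W g w))"
  using g K.tens_lin_left K.tens_lin_right
  by (intro bilinear_mapI lin_comp[OF W.act_lin[OF g]] lin_comp[OF V.act_lin[OF g]]) simp_all

lemma act_lin: "g \<in> carrier G \<Longrightarrow> gact (tensor_gmod V W) g \<in> lin_maps (tensor V W) (tensor V W)"
  unfolding tensor_gmod_def discrete_gmodule_simps
  by (rule K.tensor_lift_lin[OF act_bilinear K.tensor_kmod])

lemma act_tens: "\<lbrakk>g \<in> carrier G; v \<in> carrier V; w \<in> carrier W\<rbrakk>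
    \<Longrightarrow> gact (tensor_gmod V W) g (tens V W v w) = tens V W (gact V g v) (gact W g w)"
  unfolding tensor_gmod_def discrete_gmodule_simps
  by (rule K.tensor_lift_tens[OF act_bilinear K.tensor_kmod])

lemma lin_tensor_gmod: "lin_maps (tensor_gmod V W) N = lin_maps (tensor V W) N"
  "lin_maps N (tensor_gmod V W) = lin_maps N (tensor V W)"
  by (simp_all add: module_hom_def)

lemma id_lin: "(\<lambda>x. x) \<in> lin_maps M M"
  by (intro lin_mapsI) simp_all

lemma tensor_dgmod: "dgmod G (tensor_gmod V W)"
proof (intro dgmod.intro dgmod_axioms.intro)
  show "tgroup G" by (rule V.tgroup_axioms)
  show "kmod (tensor_gmod V W)"
    unfolding tensor_gmod_def by (rule discrete_gmodule_kmod[OF K.tensor_kmod])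
  show "mtop (tensor_gmod V W) = discrete_topology (carrier (tensor_gmod V W))" by simp
  show "gact (tensor_gmod V W) g \<in> lin_maps (tensor_gmod V W) (tensor_gmod V W)" if "g \<in> carrier G" for g
    using act_lin[OF that] by (simp add: module_hom_def)
  show "gact (tensor_gmod V W) \<one>\<^bsub>G\<^esub> x = x" if "x \<in> carrier (tensor_gmod V W)" for x
    by (rule K.tensor_lin_eqI[OF act_lin[OF V.G.one_closed] id_lin])
      (use that in \<open>simp_all add: act_tens V.act_one W.act_one\<close>)
  show "gact (tensor_gmod V W) (g \<otimes>\<^bsub>G\<^esub> h) x = gact (tensor_gmod V W) g (gact (tensor_gmod V W) h x)"
    if "g \<in> carrier G" "h \<in> carrier G" "x \<in> carrier (tensor_gmod V W)" for g h x
    by (rule K.tensor_lin_eqI[OF act_lin[OF V.G.m_closed[OF that(1,2)]] lin_comp[OF act_lin[OF that(2)] act_lin[OF that(1)]]])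
      (use that in \<open>simp_all add: act_tens V.act_mult W.act_mult\<close>)
  fix x assume "x \<in> carrier (tensor_gmod V W)"
  then have "x \<in> carrier (tensor V W)" by simp
  then show "loc_const (gtop G) (\<lambda>g. gact (tensor_gmod V W) g x)"
  \<comment> \<open>A general tensor is a finite sum of pure ones, so its orbit map is obtained from
    finitely many locally constant maps by addition.\<close>
  proof (rule K.tensor_induct[where P = "\<lambda>x. loc_const (gtop G) (\<lambda>g. gact (tensor_gmod V W) g x)"])
    fix v w assume vw: "v \<in> carrier V" "w \<in> carrier W"
    show "loc_const (gtop G) (\<lambda>g. gact (tensor_gmod V W) g (tens V W v w))"
      by (rule loc_const_cong[OF loc_const_comp2[where \<phi> = "tens V W", OF V.act_loc_const[OF vw(1)] W.act_loc_const[OF vw(2)]]])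
        (simp add: V.top act_tens vw)
  next
    fix x y assume xy: "x \<in> carrier (tensor V W)" "y \<in> carrier (tensor V W)"
      "loc_const (gtop G) (\<lambda>g. gact (tensor_gmod V W) g x)" "loc_const (gtop G) (\<lambda>g. gact (tensor_gmod V W) g y)"
    show "loc_const (gtop G) (\<lambda>g. gact (tensor_gmod V W) g (x \<oplus>\<^bsub>tensor V W\<^esub> y))"
      by (rule loc_const_cong[OF loc_const_comp2[where \<phi> = "add (tensor V W)", OF xy(3,4)]])
        (simp add: V.top lin_add[OF act_lin] xy(1,2))
  qed
qed

end

text \<open>The parameter \<open>dummy\<close> only fixes the prime \<open>p = CARD('p)\<close>, which no other parameter mentions.\<close>

locale omega_setting = G: tgroup G for G :: "'g topgroup" +
  fixes N :: "'g set" and dummy :: "'p::prime_card itself"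
  assumes normal: "N \<lhd> G" and quot_fin_ab: "fin_ab_group (G Mod N)"
    and coset_loc_const: "loc_const (gtop G) (\<lambda>g. N #>\<^bsub>G\<^esub> g)"
begin

sublocale H: fin_ab_group "G Mod N" by (rule quot_fin_ab)

abbreviation Om :: "('p mod_ring, 'g set \<Rightarrow> 'p mod_ring) module" where "Om \<equiv> group_algebra (G Mod N)"
abbreviation Ipow :: "nat \<Rightarrow> ('g set \<Rightarrow> 'p mod_ring) set" where "Ipow \<equiv> H.aug_id_pow"
abbreviation Q :: "nat \<Rightarrow> ('p mod_ring, 'g, ('g set \<Rightarrow> 'p mod_ring) set) gmodule" where "Q \<equiv> omega_quot G N"
abbreviation W :: "nat \<Rightarrow> ('p mod_ring, 'g, ('g set \<Rightarrow> 'p mod_ring) set) gmodule" where "W \<equiv> omega_gr G N"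
abbreviation pr :: "'g \<Rightarrow> 'g set" where "pr g \<equiv> N #>\<^bsub>G\<^esub> g"

sublocale R: cring Om by (rule H.ga_cring)
sublocale O: kmod Om by (rule H.ga_kmod)

lemma aug_pow_eq: "aug_pow G N m = Ipow m"
  by (simp add: aug_pow_def H.aug_id_pow_def aug_ideal_def H.aug_id_def omega_def)

lemma pr_closed [simp]: "g \<in> carrier G \<Longrightarrow> pr g \<in> carrier (G Mod N)"
  using normal.r_coset_hom_Mod[OF normal] by (auto simp: hom_def)

lemma pr_mult: "\<lbrakk>g \<in> carrier G; h \<in> carrier G\<rbrakk> \<Longrightarrow> pr (g \<otimes>\<^bsub>G\<^esub> h) = pr g \<otimes>\<^bsub>G Mod N\<^esub> pr h"
  using normal.r_coset_hom_Mod[OF normal] by (auto simp: hom_def)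

lemma pr_one: "pr \<one>\<^bsub>G\<^esub> = \<one>\<^bsub>G Mod N\<^esub>"
proof -
  have "N \<subseteq> carrier G" using normal by (simp add: normal_imp_subgroup subgroup.subset)
  then show ?thesis by (simp add: G.coset_mult_one FactGroup_def)
qed

lemma Om_kquot: "kquot Om (Ipow m)"
  by (intro kquot.intro kquot_axioms.intro H.ga_kmod H.aug_id_pow_sub)

lemma Q_simps [simp]:
  "carrier (Q m) = carrier (quot_mod Om (Ipow m))" "add (Q m) = add (quot_mod Om (Ipow m))"
  "smult (Q m) = smult (quot_mod Om (Ipow m))" "zero (Q m) = zero (quot_mod Om (Ipow m))"
  "gact (Q m) = omega_act G N m" "mtop (Q m) = discrete_topology (carrier (quot_mod Om (Ipow m)))"
  by (simp_all add: omega_quot_def aug_pow_eq omega_def)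

lemma W_simps [simp]:
  "carrier (W m) = carrier (H.gr m)" "add (W m) = add (H.gr m)"
  "smult (W m) = smult (H.gr m)" "zero (W m) = zero (H.gr m)"
  "gact (W m) = omega_act G N (Suc m)" "mtop (W m) = discrete_topology (carrier (H.gr m))"
  by (simp_all add: omega_gr_def H.gr_def aug_pow_eq omega_def)

abbreviation cs :: "nat \<Rightarrow> ('g set \<Rightarrow> 'p mod_ring) \<Rightarrow> ('g set \<Rightarrow> 'p mod_ring) set" where
  "cs m y \<equiv> Ipow m +>\<^bsub>Om\<^esub> y"

lemma Q_kmod: "kmod (Q m)"
  by (rule kmod_cong[OF kquot.quot_kmod[OF Om_kquot[of m]]]) simp_all

lemma W_kmod: "kmod (W m)"
  by (rule kmod_cong[OF H.gr_kmod[of m]]) simp_all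

lemma cs_closed [simp]: "y \<in> carrier Om \<Longrightarrow> cs m y \<in> carrier (quot_mod Om (Ipow m))"
  by (rule kquot.coset_in_quot[OF Om_kquot])

lemma cs_lin: "cs m \<in> lin_maps Om (Q m)"
  using kquot.quot_proj_lin[OF Om_kquot[of m]] by (simp add: module_hom_def)

lemma cs_eqI:
  assumes "s \<in> Ipow m" "y \<in> carrier Om" shows "cs m (s \<oplus>\<^bsub>Om\<^esub> y) = cs m y"
  using kquot.coset_eqI[OF Om_kquot assms] .

lemma omega_act_coset:
  assumes "g \<in> carrier G" "y \<in> carrier Om"
  shows "omega_act G N m g (cs m y) = cs m (delta (pr g) \<otimes>\<^bsub>Om\<^esub> y)"
proof -
  have d: "(delta (pr g) :: 'g set \<Rightarrow> 'p mod_ring) \<in> carrier Om" using assms by (intro H.delta_closed) simp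
  interpret I: ideal "Ipow m" Om by (rule H.aug_id_pow_ideal)
  have "quot_lift (\<lambda>x. cs m (delta (pr g) \<otimes>\<^bsub>Om\<^esub> x)) (cs m y) = cs m (delta (pr g) \<otimes>\<^bsub>Om\<^esub> y)"
  proof (rule kquot.quot_lift_coset[OF Om_kquot _ assms(2)])
    fix s assume s: "s \<in> Ipow m"
    have "delta (pr g) \<otimes>\<^bsub>Om\<^esub> (s \<oplus>\<^bsub>Om\<^esub> y) = delta (pr g) \<otimes>\<^bsub>Om\<^esub> s \<oplus>\<^bsub>Om\<^esub> delta (pr g) \<otimes>\<^bsub>Om\<^esub> y"
      by (rule R.r_distr[OF H.aug_id_pow_carrier[OF s] assms(2) d])
    then show "cs m (delta (pr g) \<otimes>\<^bsub>Om\<^esub> (s \<oplus>\<^bsub>Om\<^esub> y)) = cs m (delta (pr g) \<otimes>\<^bsub>Om\<^esub> y)"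
      using cs_eqI[OF I.I_l_closed[OF s d] R.m_closed[OF d assms(2)]] by simp
  qed
  then show ?thesis by (simp add: omega_act_def aug_pow_eq omega_def)
qed

lemma QE:
  assumes "q \<in> carrier (Q m)" obtains y where "y \<in> carrier Om" "q = cs m y"
  using assms unfolding Q_simps by (rule kquot.quotE[OF Om_kquot])

lemma delta_pr_closed: "g \<in> carrier G \<Longrightarrow> (delta (pr g) :: 'g set \<Rightarrow> 'p mod_ring) \<in> carrier Om"
  by (rule H.delta_closed[OF pr_closed])

lemma Q_dgmod: "dgmod G (Q m)"
proof (intro dgmod.intro dgmod_axioms.intro)
  show "tgroup G" by (rule G.tgroup_axioms)
  show "kmod (Q m)" by (rule Q_kmod)
  show "mtop (Q m) = discrete_topology (carrier (Q m))" by simp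
  note add = lin_add[OF cs_lin, symmetric] and sm = lin_smult[OF cs_lin, symmetric]
  show "gact (Q m) g \<in> lin_maps (Q m) (Q m)" if g: "g \<in> carrier G" for g
  proof (rule lin_mapsI)
    note d = delta_pr_closed[OF g]
    show "gact (Q m) g q \<in> carrier (Q m)" if q: "q \<in> carrier (Q m)" for q
    proof -
      obtain y where "y \<in> carrier Om" "q = cs m y" using q by (rule QE)
      then show ?thesis using g d by (simp add: omega_act_coset)
    qed
    show "gact (Q m) g (q \<oplus>\<^bsub>Q m\<^esub> q') = gact (Q m) g q \<oplus>\<^bsub>Q m\<^esub> gact (Q m) g q'"
      if q: "q \<in> carrier (Q m)" and q': "q' \<in> carrier (Q m)" for q q'
    proof -
      obtain y where y: "y \<in> carrier Om" "q = cs m y" using q by (rule QE)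
      obtain y' where y': "y' \<in> carrier Om" "q' = cs m y'" using q' by (rule QE)
      show ?thesis unfolding y(2) y'(2) add[OF y(1) y'(1)] Q_simps(5)
        omega_act_coset[OF g y(1)] omega_act_coset[OF g y'(1)] omega_act_coset[OF g R.a_closed[OF y(1) y'(1)]]
        R.r_distr[OF y(1) y'(1) d] by (rule lin_add[OF cs_lin R.m_closed[OF d y(1)] R.m_closed[OF d y'(1)]])
    qed
    show "gact (Q m) g (c \<odot>\<^bsub>Q m\<^esub> q) = c \<odot>\<^bsub>Q m\<^esub> gact (Q m) g q" if q: "q \<in> carrier (Q m)" for c q
    proof -
      obtain y where y: "y \<in> carrier Om" "q = cs m y" using q by (rule QE)
      have "delta (pr g) \<otimes>\<^bsub>Om\<^esub> (c \<odot>\<^bsub>Om\<^esub> y) = c \<odot>\<^bsub>Om\<^esub> (delta (pr g) \<otimes>\<^bsub>Om\<^esub> y)"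
        using H.ga_mult_smult[OF y(1), of c "delta (pr g)"] R.m_comm[OF d y(1)] R.m_comm[OF d O.sm_closed[OF y(1)]]
        by simp
      then show ?thesis unfolding y(2) sm[OF y(1)] Q_simps(5)
        omega_act_coset[OF g y(1)] omega_act_coset[OF g O.sm_closed[OF y(1)]]
        using lin_smult[OF cs_lin R.m_closed[OF d y(1)]] by simp
    qed
  qed
  show "gact (Q m) \<one>\<^bsub>G\<^esub> q = q" if q: "q \<in> carrier (Q m)" for q
  proof -
    obtain y where y: "y \<in> carrier Om" "q = cs m y" using q by (rule QE)
    show ?thesis unfolding y(2) Q_simps(5) omega_act_coset[OF G.one_closed y(1)] pr_one
      H.ga_simps(5)[symmetric] R.l_one[OF y(1)] ..
  qed
  show "gact (Q m) (g \<otimes>\<^bsub>G\<^esub> h) q = gact (Q m) g (gact (Q m) h q)"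
    if g: "g \<in> carrier G" and h: "h \<in> carrier G" and q: "q \<in> carrier (Q m)" for g h q
  proof -
    obtain y where y: "y \<in> carrier Om" "q = cs m y" using q by (rule QE)
    show ?thesis unfolding y(2) Q_simps(5) omega_act_coset[OF h y(1)] omega_act_coset[OF G.m_closed[OF g h] y(1)]
      omega_act_coset[OF g R.m_closed[OF delta_pr_closed[OF h] y(1)]] pr_mult[OF g h]
      H.delta_mult[OF pr_closed[OF g] pr_closed[OF h], symmetric]
      R.m_assoc[OF delta_pr_closed[OF g] delta_pr_closed[OF h] y(1)] ..
  qed
  show "loc_const (gtop G) (\<lambda>g. gact (Q m) g q)" if q: "q \<in> carrier (Q m)" for q
  proof -
    obtain y where y: "y \<in> carrier Om" "q = cs m y" using q by (rule QE)
    show ?thesis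
      by (rule loc_const_cong[OF loc_const_comp[OF coset_loc_const, of "\<lambda>k. cs m (delta k \<otimes>\<^bsub>Om\<^esub> y)"]])
        (simp add: y(2) G.top omega_act_coset y(1))
  qed
qed

lemma WE:
  assumes "w \<in> carrier (W m)" obtains y where "y \<in> Ipow m" "w = cs (Suc m) y"
  using assms unfolding W_simps by (rule H.grE)

lemma W_sub_Q: "w \<in> carrier (W m) \<Longrightarrow> w \<in> carrier (Q (Suc m))"
proof -
  assume "w \<in> carrier (W m)"
  then obtain y where "y \<in> Ipow m" "w = cs (Suc m) y" by (rule WE)
  then show ?thesis using cs_closed[OF H.aug_id_pow_carrier, of y m "Suc m"] by simp
qed

lemma W_ops:
  assumes "w \<in> carrier (W m)"
  shows W_smult: "c \<odot>\<^bsub>W m\<^esub> w = c \<odot>\<^bsub>Q (Suc m)\<^esub> w"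
    and W_add: "w' \<in> carrier (W m) \<Longrightarrow> w \<oplus>\<^bsub>W m\<^esub> w' = w \<oplus>\<^bsub>Q (Suc m)\<^esub> w'"
proof -
  obtain y where y: "y \<in> Ipow m" "w = cs (Suc m) y" using assms by (rule WE)
  note yc = H.aug_id_pow_carrier[OF y(1)]
  show "c \<odot>\<^bsub>W m\<^esub> w = c \<odot>\<^bsub>Q (Suc m)\<^esub> w"
    unfolding y(2) lin_smult[OF cs_lin yc, symmetric] W_simps by (rule H.gr_smult[OF y(1)])
  show "w \<oplus>\<^bsub>W m\<^esub> w' = w \<oplus>\<^bsub>Q (Suc m)\<^esub> w'" if w': "w' \<in> carrier (W m)"
  proof -
    obtain y' where y': "y' \<in> Ipow m" "w' = cs (Suc m) y'" using w' by (rule WE)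
    show ?thesis unfolding y(2) y'(2) lin_add[OF cs_lin yc H.aug_id_pow_carrier[OF y'(1)], symmetric] W_simps
      by (rule H.gr_add[OF y(1) y'(1)])
  qed
qed

lemma W_incl_lin: "(\<lambda>w. w) \<in> lin_maps (W m) (Q (Suc m))"
  by (rule lin_mapsI) (simp_all only: W_sub_Q W_ops)

text \<open>[g] - 1 lies in the augmentation ideal, so it maps I^m into I^(m+1) and acts as zero on
  the quotient.\<close>

lemma W_act:
  assumes g: "g \<in> carrier G" and w: "w \<in> carrier (W m)" shows "gact (W m) g w = w"
proof -
  obtain y where y: "y \<in> Ipow m" "w = cs (Suc m) y" using w by (rule WE)
  note yc = H.aug_id_pow_carrier[OF y(1)] and d = delta_pr_closed[OF g]
  let ?d = "delta (pr g) \<ominus>\<^bsub>Om\<^esub> \<one>\<^bsub>Om\<^esub>"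
  have dI: "?d \<in> Ipow (Suc 0)" unfolding H.aug_id_pow_1 by (rule H.delta_minus_one[OF pr_closed[OF g]])
  have dc: "?d \<in> carrier Om" using d by simp
  have "delta (pr g) = ?d \<oplus>\<^bsub>Om\<^esub> \<one>\<^bsub>Om\<^esub>" using O.minus_add_cancel[OF d R.one_closed] by simp
  then have "delta (pr g) \<otimes>\<^bsub>Om\<^esub> y = (?d \<oplus>\<^bsub>Om\<^esub> \<one>\<^bsub>Om\<^esub>) \<otimes>\<^bsub>Om\<^esub> y" by (rule arg_cong)
  also have "\<dots> = ?d \<otimes>\<^bsub>Om\<^esub> y \<oplus>\<^bsub>Om\<^esub> y" unfolding R.l_distr[OF dc R.one_closed yc] R.l_one[OF yc] ..
  finally have e: "delta (pr g) \<otimes>\<^bsub>Om\<^esub> y = ?d \<otimes>\<^bsub>Om\<^esub> y \<oplus>\<^bsub>Om\<^esub> y" .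
  have "?d \<otimes>\<^bsub>Om\<^esub> y \<in> Ipow (Suc m)" using H.aug_id_pow_mult[OF dI y(1)] by simp
  then show ?thesis unfolding y(2) W_simps(5) omega_act_coset[OF g yc] e by (rule cs_eqI[OF _ yc])
qed

lemma W_dgmod: "dgmod G (W m)"
proof (intro dgmod.intro dgmod_axioms.intro)
  show "tgroup G" by (rule G.tgroup_axioms)
  show "kmod (W m)" by (rule W_kmod)
  then interpret K: kmod "W m" .
  show "mtop (W m) = discrete_topology (carrier (W m))" by simp
  show "gact (W m) g \<in> lin_maps (W m) (W m)" if g: "g \<in> carrier G" for g
    by (rule lin_mapsI) (simp_all only: W_act[OF g] K.a_closed K.sm_closed)
  show "loc_const (gtop G) (\<lambda>g. gact (W m) g w)" if "w \<in> carrier (W m)" for w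
    by (rule loc_const_cong[OF loc_const_const[of _ w]]) (simp only: G.top W_act[OF _ that])
qed (simp_all only: W_act G.one_closed G.m_closed)

end

section \<open>The functionals attached to a character and the proper defining systems\<close>

text \<open>Bilinearity of \<open>b\<close> is deduced from its agreement with a linear map on pure
  tensors. So a \<open>tensor_lift\<close> in a definition can be evaluated by guessing the
  resulting linear map.\<close>

lemma (in ktensor) tensor_lift_eq:
  assumes L: "L \<in> lin_maps (tensor V W) Z" and Z: "kmod Z"
    and b: "\<And>v w. \<lbrakk>v \<in> carrier V; w \<in> carrier W\<rbrakk> \<Longrightarrow> b v w = L (tens V W v w)"
    and z: "z \<in> carrier (tensor V W)"
  shows "tensor_lift Z b z = L z"
proof -
  have bil: "bilinear_map V W Z b"
  proof (intro bilinear_mapI lin_mapsI)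
    fix v w w' c assume *: "v \<in> carrier V" "w \<in> carrier W"
    show "b v w \<in> carrier Z" using * by (simp add: b lin_closed[OF L])
    show "b v (c \<odot>\<^bsub>W\<^esub> w) = c \<odot>\<^bsub>Z\<^esub> b v w"
      using * by (simp add: b lin_smult[OF tens_lin_right] lin_smult[OF L])
    assume "w' \<in> carrier W"
    then show "b v (w \<oplus>\<^bsub>W\<^esub> w') = b v w \<oplus>\<^bsub>Z\<^esub> b v w'"
      using * by (simp add: b lin_add[OF tens_lin_right] lin_add[OF L])
  next
    fix v v' w c assume *: "w \<in> carrier W" "v \<in> carrier V"
    show "b v w \<in> carrier Z" using * by (simp add: b lin_closed[OF L])
    show "b (c \<odot>\<^bsub>V\<^esub> v) w = c \<odot>\<^bsub>Z\<^esub> b v w"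
      using * by (simp add: b lin_smult[OF tens_lin_left] lin_smult[OF L])
    assume "v' \<in> carrier V"
    then show "b (v \<oplus>\<^bsub>V\<^esub> v') w = b v w \<oplus>\<^bsub>Z\<^esub> b v' w"
      using * by (simp add: b lin_add[OF tens_lin_left] lin_add[OF L])
  qed
  show ?thesis
    by (rule tensor_lin_eqI[OF tensor_lift_lin[OF bil Z] L _ z]) (simp add: tensor_lift_tens[OF bil Z] b)
qed

lemma lin_finsum_map:
  assumes "kmod M" "kmod N" "\<And>i. i \<in> A \<Longrightarrow> f i \<in> lin_maps M N" "finite A"
  shows "(\<lambda>x. \<Oplus>\<^bsub>N\<^esub>i\<in>A. f i x) \<in> lin_maps M N"
proof -
  interpret N: kmod N by fact
  show ?thesis
  proof (rule lin_mapsI)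
    fix x assume x: "x \<in> carrier M"
    have fx: "(\<lambda>i. f i x) \<in> A \<rightarrow> carrier N" using assms(3) x by (auto intro: lin_closed)
    then show "(\<Oplus>\<^bsub>N\<^esub>i\<in>A. f i x) \<in> carrier N" by (rule N.finsum_closed)
    show "(\<Oplus>\<^bsub>N\<^esub>i\<in>A. f i (c \<odot>\<^bsub>M\<^esub> x)) = c \<odot>\<^bsub>N\<^esub> (\<Oplus>\<^bsub>N\<^esub>i\<in>A. f i x)" for c
      unfolding N.sm_finsum[OF fx]
      by (rule N.finsum_cong') (use fx in \<open>auto simp: lin_smult[OF assms(3) x]\<close>)
    fix y assume y: "y \<in> carrier M"
    have fy: "(\<lambda>i. f i y) \<in> A \<rightarrow> carrier N" using assms(3) y by (auto intro: lin_closed)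
    show "(\<Oplus>\<^bsub>N\<^esub>i\<in>A. f i (x \<oplus>\<^bsub>M\<^esub> y)) = (\<Oplus>\<^bsub>N\<^esub>i\<in>A. f i x) \<oplus>\<^bsub>N\<^esub> (\<Oplus>\<^bsub>N\<^esub>i\<in>A. f i y)"
      unfolding N.finsum_addf[OF fx fy, symmetric]
      by (rule N.finsum_cong') (use fx fy in \<open>auto simp: lin_add[OF assms(3) x y]\<close>)
  qed
qed

lemma (in kmod) smult_lin: "(\<lambda>x. c \<odot> x) \<in> lin_maps M M"
  by (rule lin_mapsI) (simp_all add: sm_add_right sm_assoc[symmetric] mult.commute)

locale massey_setting = omega_setting G N dummy + T: dgmod G T
  for G :: "'g topgroup" and N and dummy :: "'p::prime_card itself"
    and T :: "('p mod_ring, 'g, 't) gmodule" +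
  fixes n :: nat
  assumes n1: "1 \<le> n" and np: "n < CARD('p)"
begin

lemma TQ: "dgtensor G T (Q m)"
  by (intro dgtensor.intro T.dgmod_axioms Q_dgmod)

lemma TQ_ktensor: "ktensor T (Q m)"
  by (intro ktensor.intro T.M.kmod_axioms' Q_kmod)

lemma TW: "dgtensor G T (W m)"
  by (intro dgtensor.intro T.dgmod_axioms W_dgmod)

lemma TW_ktensor: "ktensor T (W m)"
  by (intro ktensor.intro T.M.kmod_axioms' W_kmod)

end

locale char_setting = massey_setting G N dummy T n
  for G :: "'g topgroup" and N and dummy :: "'p::prime_card itself"
    and T :: "('p mod_ring, 'g, 't) gmodule" and n +
  fixes \<chi> :: "'g set \<Rightarrow> 'p mod_ring"
  assumes chi: "\<chi> \<in> character_group (G Mod N)"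
begin

sublocale X: character "G Mod N" \<chi>
  by (intro character.intro character_axioms.intro quot_fin_ab chi)

text \<open>B_j on cosets. No modulus appears because \<open>quot_lift\<close> works on the coset as
  a set; the value is meaningful on Omega/I^m for every m > j.\<close>

definition bq :: "nat \<Rightarrow> ('g set \<Rightarrow> 'p mod_ring) set \<Rightarrow> 'p mod_ring" where
  "bq j = quot_lift (X.bfun j)"

lemma bq_cs:
  assumes "j < m" "j < CARD('p)" "y \<in> carrier Om" shows "bq j (cs m y) = X.bfun j y"
  unfolding bq_def
proof (rule kquot.quot_lift_coset[OF Om_kquot _ assms(3)])
  show "X.bfun j (s \<oplus>\<^bsub>Om\<^esub> y) = X.bfun j y" if "s \<in> Ipow m" for s
    using X.bfun_aug_pow[OF that assms(1,2)] by (simp add: X.bfun_add)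
qed

text \<open>The identity of T tensored with B_j. One and the same function serves on T tensor
  Omega/I^n and on T tensor Omega/I^(n+1), as long as j is below the exponent.\<close>

definition ev :: "nat \<Rightarrow> ('t \<times> ('g set \<Rightarrow> 'p mod_ring) set \<Rightarrow> 'p mod_ring) set \<Rightarrow> 't" where
  "ev j = tensor_lift T (\<lambda>t q. bq j q \<odot>\<^bsub>T\<^esub> t)"

lemma bq_bilinear:
  assumes "j < m" "j < CARD('p)" shows "bilinear_map T (Q m) T (\<lambda>t q. bq j q \<odot>\<^bsub>T\<^esub> t)"
proof (intro bilinear_mapI)
  fix t assume t: "t \<in> carrier T"
  show "(\<lambda>q. bq j q \<odot>\<^bsub>T\<^esub> t) \<in> lin_maps (Q m) T"
  proof (rule lin_mapsI)
    show "bq j q \<odot>\<^bsub>T\<^esub> t \<in> carrier T" for q by (rule T.M.sm_closed[OF t])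
    show "bq j (c \<odot>\<^bsub>Q m\<^esub> q) \<odot>\<^bsub>T\<^esub> t = c \<odot>\<^bsub>T\<^esub> (bq j q \<odot>\<^bsub>T\<^esub> t)" if q: "q \<in> carrier (Q m)" for c q
    proof -
      obtain y where y: "y \<in> carrier Om" "q = cs m y" using q by (rule QE)
      show ?thesis unfolding y(2) lin_smult[OF cs_lin y(1), symmetric]
          bq_cs[OF assms y(1)] bq_cs[OF assms O.sm_closed[OF y(1)]] X.bfun_smult by (rule T.M.sm_assoc[OF t])
    qed
    show "bq j (q \<oplus>\<^bsub>Q m\<^esub> q') \<odot>\<^bsub>T\<^esub> t = bq j q \<odot>\<^bsub>T\<^esub> t \<oplus>\<^bsub>T\<^esub> bq j q' \<odot>\<^bsub>T\<^esub> t"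
      if q: "q \<in> carrier (Q m)" and q': "q' \<in> carrier (Q m)" for q q'
    proof -
      obtain y where y: "y \<in> carrier Om" "q = cs m y" using q by (rule QE)
      obtain y' where y': "y' \<in> carrier Om" "q' = cs m y'" using q' by (rule QE)
      show ?thesis unfolding y(2) y'(2) lin_add[OF cs_lin y(1) y'(1), symmetric]
          bq_cs[OF assms y(1)] bq_cs[OF assms y'(1)] bq_cs[OF assms R.a_closed[OF y(1) y'(1)]] X.bfun_add
        by (rule T.M.sm_add_left[OF t])
    qed
  qed
next
  show "(\<lambda>t. bq j q \<odot>\<^bsub>T\<^esub> t) \<in> lin_maps T T" for q by (rule T.M.smult_lin)
qed

lemma ev_lin: "\<lbrakk>j < m; j < CARD('p)\<rbrakk> \<Longrightarrow> ev j \<in> lin_maps (tensor T (Q m)) T"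
  unfolding ev_def by (rule ktensor.tensor_lift_lin[OF TQ_ktensor bq_bilinear T.M.kmod_axioms'])

lemma ev_tens: "\<lbrakk>j < m; j < CARD('p); t \<in> carrier T; q \<in> carrier (Q m)\<rbrakk>
    \<Longrightarrow> ev j (tens T (Q m) t q) = bq j q \<odot>\<^bsub>T\<^esub> t"
  unfolding ev_def by (rule ktensor.tensor_lift_tens[OF TQ_ktensor bq_bilinear T.M.kmod_axioms'])

text \<open>The product formula for B_j with first factor [g]. The terms with i > 0 measure the
  failure of equivariance: for j < n they yield the cocycle relation of the defining system, for j =
  n the Massey sum.\<close>

lemma ev_equiv:
  assumes j: "j < m" "j < CARD('p)" and g: "g \<in> carrier G" and z: "z \<in> carrier (tensor T (Q m))"
  shows "ev j (gact (tensor_gmod T (Q m)) g z) =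
    (\<Oplus>\<^bsub>T\<^esub>i\<in>{..j}. binom i (\<chi> (pr g)) \<odot>\<^bsub>T\<^esub> gact T g (ev (j - i) z))"
proof (rule ktensor.tensor_lin_eqI[OF TQ_ktensor _ _ _ z])
  interpret TQ: dgtensor G T "Q m" by (rule TQ)
  show "(\<lambda>z. ev j (gact (tensor_gmod T (Q m)) g z)) \<in> lin_maps (tensor T (Q m)) T"
    by (rule lin_comp[OF TQ.act_lin[OF g] ev_lin[OF j]])
  show "(\<lambda>z. \<Oplus>\<^bsub>T\<^esub>i\<in>{..j}. binom i (\<chi> (pr g)) \<odot>\<^bsub>T\<^esub> gact T g (ev (j - i) z)) \<in> lin_maps (tensor T (Q m)) T"
  proof (rule lin_finsum_map[OF ktensor.tensor_kmod[OF TQ_ktensor] T.M.kmod_axioms'])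
    fix i assume "i \<in> {..j}"
    have "ev (j - i) \<in> lin_maps (tensor T (Q m)) T" using j by (intro ev_lin) auto
    then show "(\<lambda>z. binom i (\<chi> (pr g)) \<odot>\<^bsub>T\<^esub> gact T g (ev (j - i) z)) \<in> lin_maps (tensor T (Q m)) T"
      by (rule lin_comp[OF lin_comp[OF _ T.act_lin[OF g]] T.M.smult_lin])
  qed simp
  fix t q assume t: "t \<in> carrier T" and q: "q \<in> carrier (Q m)"
  obtain y where y: "y \<in> carrier Om" "q = cs m y" using q by (rule QE)
  note d = delta_pr_closed[OF g]
  have gq: "gact (Q m) g q = cs m (delta (pr g) \<otimes>\<^bsub>Om\<^esub> y)"
    unfolding y(2) Q_simps(5) by (rule omega_act_coset[OF g y(1)])
  have gqc: "cs m (delta (pr g) \<otimes>\<^bsub>Om\<^esub> y) \<in> carrier (Q m)" using d y(1) by simp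
  have "ev j (gact (tensor_gmod T (Q m)) g (tens T (Q m) t q)) = bq j (cs m (delta (pr g) \<otimes>\<^bsub>Om\<^esub> y)) \<odot>\<^bsub>T\<^esub> gact T g t"
    unfolding TQ.act_tens[OF g t q] gq by (rule ev_tens[OF j T.act_closed[OF g t] gqc])
  also have "bq j (cs m (delta (pr g) \<otimes>\<^bsub>Om\<^esub> y)) = (\<Sum>i\<le>j. binom i (\<chi> (pr g)) * X.bfun (j - i) y)"
    unfolding bq_cs[OF j R.m_closed[OF d y(1)]] X.bfun_mult[OF d j(2)] X.bfun_delta[OF pr_closed[OF g]] ..
  also have "\<dots> \<odot>\<^bsub>T\<^esub> gact T g t = (\<Oplus>\<^bsub>T\<^esub>i\<in>{..j}. (binom i (\<chi> (pr g)) * X.bfun (j - i) y) \<odot>\<^bsub>T\<^esub> gact T g t)"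
    by (rule T.M.finsum_sm_sum[symmetric]) (use T.act_closed[OF g t] in simp_all)
  also have "\<dots> = (\<Oplus>\<^bsub>T\<^esub>i\<in>{..j}. binom i (\<chi> (pr g)) \<odot>\<^bsub>T\<^esub> gact T g (ev (j - i) (tens T (Q m) t q)))"
  proof (rule T.M.finsum_cong')
    fix i assume i: "i \<in> {..j}"
    have ji: "j - i < m" "j - i < CARD('p)" using j by auto
    have "ev (j - i) (tens T (Q m) t q) = X.bfun (j - i) y \<odot>\<^bsub>T\<^esub> t"
      using ev_tens[OF ji t q] unfolding y(2) bq_cs[OF ji y(1)] .
    then show "(binom i (\<chi> (pr g)) * X.bfun (j - i) y) \<odot>\<^bsub>T\<^esub> gact T g t =
        binom i (\<chi> (pr g)) \<odot>\<^bsub>T\<^esub> gact T g (ev (j - i) (tens T (Q m) t q))"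
      by (simp only: T.act_smult[OF g t] T.M.sm_assoc[OF T.act_closed[OF g t]])
  next
    show "(\<lambda>i. binom i (\<chi> (pr g)) \<odot>\<^bsub>T\<^esub> gact T g (ev (j - i) (tens T (Q m) t q))) \<in> {..j} \<rightarrow> carrier T"
    proof
      fix i assume i: "i \<in> {..j}"
      have "ev (j - i) \<in> lin_maps (tensor T (Q m)) T" using j by (intro ev_lin) auto
      from lin_closed[OF this ktensor.tens_closed[OF TQ_ktensor t q]]
      show "binom i (\<chi> (pr g)) \<odot>\<^bsub>T\<^esub> gact T g (ev (j - i) (tens T (Q m) t q)) \<in> carrier T"
        using g by simp
    qed
  qed simp
  finally show "ev j (gact (tensor_gmod T (Q m)) g (tens T (Q m) t q)) =
    (\<Oplus>\<^bsub>T\<^esub>i\<in>{..j}. binom i (\<chi> (pr g)) \<odot>\<^bsub>T\<^esub> gact T g (ev (j - i) (tens T (Q m) t q)))" .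
qed

text \<open>Multiplication by the last unit vector picks the last column, whose i-th entry has lower
  index n - i. This is why coordinates and binomial indices run in opposite directions from here
  on.\<close>

lemma binom_col_eq:
  assumes "i \<le> n" "y \<in> carrier Om" shows "binom_col n \<chi> y $ i = X.bfun (n - i) y"
proof -
  have e: "(binom_mat n a *\<^sub>v unit_vec (n + 1) n) $ i = binom (n - i) a" for a :: "'p mod_ring"
  proof -
    have "(binom_mat n a *\<^sub>v unit_vec (n + 1) n) $ i = row (binom_mat n a) i \<bullet> unit_vec (n + 1) n"
      using assms(1) by (simp add: binom_mat_def)
    also have "\<dots> = row (binom_mat n a) i $ n"
      by (rule scalar_prod_right_unit) simp
    finally show ?thesis using assms(1) by (simp add: binom_mat_def binom_def)
  qed
  have "i < n + 1" using assms(1) by simp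
  then have "binom_col n \<chi> y $ i = (\<Sum>h\<in>{h. y h \<noteq> 0}. y h * binom (n - i) (\<chi> h))"
    unfolding binom_col_def by (simp only: index_vec e)
  also have "\<dots> = X.bfun (n - i) y" unfolding X.bfun_def by (rule H.ga_sum_supp[OF assms(2)])
  finally show ?thesis .
qed

lemma p_gr_eq: "p_gr G N n \<chi> = X.gr_fun n"
proof (rule extensionalityI[of _ "carrier (H.gr n)"])
  show "p_gr G N n \<chi> \<in> extensional (carrier (H.gr n))" by (simp add: p_gr_def)
  show "X.gr_fun n \<in> extensional (carrier (H.gr n))" by (simp add: X.gr_fun_def)
  fix A assume A: "A \<in> carrier (H.gr n :: ('p mod_ring, _) module)"
  then obtain y where y: "y \<in> Ipow n" "A = cs (Suc n) y" by (rule H.grE)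
  note yc = H.aug_id_pow_carrier[OF y(1)]
  have "quot_lift (binom_col n \<chi>) (cs (Suc n) y) = binom_col n \<chi> y"
  proof (rule kquot.quot_lift_coset[OF Om_kquot _ yc])
    fix s assume s: "s \<in> Ipow (Suc n)"
    note sc = H.aug_id_pow_carrier[OF s]
    show "binom_col n \<chi> (s \<oplus>\<^bsub>Om\<^esub> y) = binom_col n \<chi> y"
    proof (rule eq_vecI)
      fix i assume "i < dim_vec (binom_col n \<chi> y)"
      then have i: "i \<le> n" by (simp add: binom_col_def)
      show "binom_col n \<chi> (s \<oplus>\<^bsub>Om\<^esub> y) $ i = binom_col n \<chi> y $ i"
        unfolding binom_col_eq[OF i yc] binom_col_eq[OF i R.a_closed[OF sc yc]] X.bfun_add
        using X.bfun_aug_pow[OF s, of "n - i"] np i by simp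
    qed (simp add: binom_col_def)
  qed
  then show "p_gr G N n \<chi> A = X.gr_fun n A"
    using A unfolding p_gr_def y(2) by (simp add: X.gr_fun_coset[OF y(1) np] binom_col_eq[OF _ yc])
qed

end

section \<open>Vectors over a module and the action of binomial matrices on them\<close>

lemma pow_mod_simps:
  "carrier (pow_mod T m) = {v. dim_vec v = m \<and> (\<forall>i<m. v $ i \<in> carrier T)}"
  "\<zero>\<^bsub>pow_mod T m\<^esub> = vec m (\<lambda>i. \<zero>\<^bsub>T\<^esub>)"
  "v \<oplus>\<^bsub>pow_mod T m\<^esub> w = vec m (\<lambda>i. v $ i \<oplus>\<^bsub>T\<^esub> w $ i)"
  "c \<odot>\<^bsub>pow_mod T m\<^esub> v = vec m (\<lambda>i. c \<odot>\<^bsub>T\<^esub> v $ i)"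
  by (simp_all add: pow_mod_def)

context kmod
begin

lemma pow_kmod: "kmod (pow_mod M m)"
  by (rule kmodI; simp only: pow_mod_simps mem_Collect_eq; (elim conjE)?)
    (auto intro!: eq_vecI simp: sm_add_left sm_add_right sm_assoc a_ac)

lemma first_coord_sub: "submodule class_ring (first_coord M m) (pow_mod M m)"
  by (rule kmod.submoduleI[OF pow_kmod]; simp only: pow_mod_simps first_coord_def mem_Collect_eq subset_iff)
    auto

lemma first_coord_kquot: "kquot (pow_mod M m) (first_coord M m)"
  by (intro kquot.intro kquot_axioms.intro pow_kmod first_coord_sub)

lemma first_coord_coset:
  assumes v: "v \<in> carrier (pow_mod M m)"
  shows "first_coord M m +>\<^bsub>pow_mod M m\<^esub> v = {u \<in> carrier (pow_mod M m). \<forall>i<m. i \<noteq> 0 \<longrightarrow> u $ i = v $ i}"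
proof (rule subset_antisym; rule subsetI)
  fix u assume "u \<in> first_coord M m +>\<^bsub>pow_mod M m\<^esub> v"
  then obtain s where s: "s \<in> first_coord M m" "u = s \<oplus>\<^bsub>pow_mod M m\<^esub> v" unfolding coset_def by blast
  then show "u \<in> {u \<in> carrier (pow_mod M m). \<forall>i<m. i \<noteq> 0 \<longrightarrow> u $ i = v $ i}"
    using v unfolding pow_mod_simps first_coord_def by simp
next
  fix u assume u: "u \<in> {u \<in> carrier (pow_mod M m). \<forall>i<m. i \<noteq> 0 \<longrightarrow> u $ i = v $ i}"
  define s where "s = vec m (\<lambda>i. if i = 0 then u $ i \<ominus> v $ i else \<zero>)"
  have "s \<in> first_coord M m" using u v unfolding s_def first_coord_def pow_mod_simps by simp
  moreover have "u = s \<oplus>\<^bsub>pow_mod M m\<^esub> v"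
  proof (rule eq_vecI)
    fix i assume "i < dim_vec (s \<oplus>\<^bsub>pow_mod M m\<^esub> v)"
    then have i: "i < m" by (simp add: pow_mod_simps)
    then have c: "u $ i \<in> carrier M" "v $ i \<in> carrier M" using u v by (simp_all add: pow_mod_simps)
    show "u $ i = (s \<oplus>\<^bsub>pow_mod M m\<^esub> v) $ i"
    proof (cases "i = 0")
      case True
      then show ?thesis using i c by (simp add: s_def pow_mod_simps(3) minus_add_cancel)
    next
      case False
      then have "u $ i = v $ i" using u i by simp
      then show ?thesis using i c False by (simp add: s_def pow_mod_simps(3))
    qed
  qed (use u in \<open>simp add: pow_mod_simps\<close>)
  ultimately show "u \<in> first_coord M m +>\<^bsub>pow_mod M m\<^esub> v" unfolding coset_def by blast
qed

lemma first_coord_coset_eqI: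
  assumes "v \<in> carrier (pow_mod M m)" "v' \<in> carrier (pow_mod M m)" "\<And>i. \<lbrakk>i < m; i \<noteq> 0\<rbrakk> \<Longrightarrow> v $ i = v' $ i"
  shows "first_coord M m +>\<^bsub>pow_mod M m\<^esub> v = first_coord M m +>\<^bsub>pow_mod M m\<^esub> v'"
  unfolding first_coord_coset[OF assms(1)] first_coord_coset[OF assms(2)] using assms(3) by simp

end

lemma binom_mat_dims [simp]:
  "dim_row (binom_mat n a) = n + 1" "dim_col (binom_mat n a) = n + 1" "binom_mat n a \<in> carrier_mat (n + 1) (n + 1)"
  by (simp_all add: binom_mat_def)

lemma binom_mat_index:
  "\<lbrakk>i \<le> n; j \<le> n\<rbrakk> \<Longrightarrow> binom_mat n a $$ (i, j) = (if i \<le> j then binom (j - i) a else 0)"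
  by (simp add: binom_mat_def binom_def)

lemma binom_mat_unitriangular: "binom_mat n a \<in> unitriangular (n + 1)"
  unfolding unitriangular_def by (auto simp: upper_triangular_def binom_mat_index)

text \<open>Entry (i, j) of the product is the Vandermonde sum for lower index j - i; the bound on n
  keeps all these indices below p.\<close>

lemma binom_mat_mult:
  assumes n: "n < CARD('p::prime_card)"
  shows "binom_mat n (a :: 'p mod_ring) * binom_mat n b = binom_mat n (a + b)"
proof (rule eq_matI)
  fix i j assume "i < dim_row (binom_mat n (a + b))" "j < dim_col (binom_mat n (a + b))"
  then have ij: "i \<le> n" "j \<le> n" by simp_all
  have "(binom_mat n a * binom_mat n b) $$ (i, j) = (\<Sum>k\<in>{0..<n + 1}. binom_mat n a $$ (i, k) * binom_mat n b $$ (k, j))"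
    using ij by (simp add: scalar_prod_def)
  also have "\<dots> = (\<Sum>k\<in>{0..<n + 1}. if i \<le> k \<and> k \<le> j then binom (k - i) a * binom (j - k) b else 0)"
    by (rule sum.cong[OF refl]) (use ij in \<open>auto simp: binom_mat_index\<close>)
  also have "\<dots> = (\<Sum>k\<in>{i..j}. binom (k - i) a * binom (j - k) b)"
    by (rule sum.mono_neutral_cong_right) (use ij in auto)
  also have "\<dots> = binom_mat n (a + b) $$ (i, j)"
  proof (cases "i \<le> j")
    case True
    have "(\<Sum>k\<in>{i..j}. binom (k - i) a * binom (j - k) b) = (\<Sum>l\<in>{..j - i}. binom l a * binom (j - i - l) b)"
      by (rule sum.reindex_bij_witness[where i = "\<lambda>l. i + l" and j = "\<lambda>k. k - i"]) (use True in auto)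
    then show ?thesis using ij True n by (simp add: binom_mat_index binom_add)
  qed (use ij in \<open>simp add: binom_mat_index\<close>)
  finally show "(binom_mat n a * binom_mat n b) $$ (i, j) = binom_mat n (a + b) $$ (i, j)" .
qed simp_all

text \<open>The matrix is constant along diagonals, so row i may be indexed by l = j - i. In this
  form it matches the sum in \<open>ev_equiv\<close>.\<close>

lemma mat_act_binom:
  fixes M :: "('p::prime_card mod_ring, 'm, 'z) module_scheme" (structure)
  assumes "kmod M"
  assumes u: "u \<in> carrier (pow_mod M (n + 1))" and i: "i \<le> n"
  shows "mat_act M (binom_mat n a) u $ i = (\<Oplus>l\<in>{..n - i}. binom l a \<odot> u $ (i + l))"
proof -
  interpret kmod M by fact
  have uc: "u $ j \<in> carrier M" if "j \<le> n" for j using u that by (simp add: pow_mod_simps)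
  have d: "dim_vec u = n + 1" using u by (simp add: pow_mod_simps)
  have "mat_act M (binom_mat n a) u $ i = (\<Oplus>j\<in>{..<n + 1}. binom_mat n a $$ (i, j) \<odot> u $ j)"
    using i by (simp add: mat_act_def d)
  also have "\<dots> = (\<Oplus>j\<in>{i..n}. binom (j - i) a \<odot> u $ j)"
    by (rule add.finprod_mono_neutral_cong_right) (use i in \<open>auto simp: binom_mat_index uc\<close>)
  also have "{i..n} = (+) i ` {..n - i}"
  proof (rule subset_antisym; rule subsetI)
    fix k assume "k \<in> {i..n}"
    then have "k = i + (k - i)" "k - i \<in> {..n - i}" by auto
    then show "k \<in> (+) i ` {..n - i}" by (rule image_eqI)
  qed (use i in auto)
  also have "(\<Oplus>j\<in>(+) i ` {..n - i}. binom (j - i) a \<odot> u $ j) = (\<Oplus>l\<in>{..n - i}. binom (i + l - i) a \<odot> u $ (i + l))"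
    by (rule finsum_reindex) (use i in \<open>auto simp: uc\<close>)
  finally show ?thesis by simp
qed

lemma (in kmod) mat_act_one:
  assumes "u \<in> carrier (pow_mod M m)" shows "mat_act M (1\<^sub>m m) u = u"
proof (rule eq_vecI)
  have d: "dim_vec u = m" using assms by (simp add: pow_mod_simps)
  show "dim_vec (mat_act M (1\<^sub>m m) u) = dim_vec u" by (simp add: mat_act_def d)
  fix i assume "i < dim_vec u"
  then have i: "i < m" using d by simp
  have uc: "u $ j \<in> carrier M" if "j < m" for j using assms that by (simp add: pow_mod_simps)
  have "mat_act M (1\<^sub>m m) u $ i = (\<Oplus>j\<in>{..<m}. 1\<^sub>m m $$ (i, j) \<odot> u $ j)" using i by (simp add: mat_act_def d)
  also have "\<dots> = (\<Oplus>j\<in>{..<m}. if i = j then u $ j else \<zero>)"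
    by (rule finsum_cong') (use i uc in auto)
  also have "\<dots> = u $ i" by (rule add.finprod_singleton) (use i uc in auto)
  finally show "mat_act M (1\<^sub>m m) u $ i = u $ i" .
qed

context char_setting
begin

abbreviation "PT \<equiv> pow_mod T (n + 1)"
abbreviation "FC \<equiv> first_coord T (n + 1)"

text \<open>The representative of the image of p_{chi,n} whose first coordinate is zero, as
  \<open>zero_lift\<close> prescribes. That coordinate would be B_n, which does not descend to
  Omega/I^n; the others involve only B_j with j < n.\<close>

definition vv :: "('t \<times> ('g set \<Rightarrow> 'p mod_ring) set \<Rightarrow> 'p mod_ring) set \<Rightarrow> 't vec" where
  "vv z = vec (n + 1) (\<lambda>i. if i = 0 then \<zero>\<^bsub>T\<^esub> else ev (n - i) z)"

lemma ev_closed: "\<lbrakk>j < m; j < CARD('p); z \<in> carrier (tensor T (Q m))\<rbrakk> \<Longrightarrow> ev j z \<in> carrier T"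
  by (rule lin_closed[OF ev_lin])

lemma vv_lin: "vv \<in> lin_maps (tensor T (Q n)) PT"
proof (rule lin_mapsI)
  have L: "ev (n - i) \<in> lin_maps (tensor T (Q n)) T" if "i \<noteq> 0" for i
    using that n1 np by (intro ev_lin) auto
  fix x y c assume x: "x \<in> carrier (tensor T (Q n))"
  show "vv x \<in> carrier PT" using lin_closed[OF L x] by (simp add: vv_def pow_mod_simps)
  show "vv (c \<odot>\<^bsub>tensor T (Q n)\<^esub> x) = c \<odot>\<^bsub>PT\<^esub> vv x"
    unfolding vv_def pow_mod_simps by (rule eq_vecI) (simp_all add: lin_smult[OF L x])
  assume y: "y \<in> carrier (tensor T (Q n))"
  show "vv (x \<oplus>\<^bsub>tensor T (Q n)\<^esub> y) = vv x \<oplus>\<^bsub>PT\<^esub> vv y"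
    unfolding vv_def pow_mod_simps by (rule eq_vecI) (simp_all add: lin_add[OF L x y])
qed

lemma p_tensor_eq:
  assumes z: "z \<in> carrier (tensor T (Q n))"
  shows "p_tensor T n \<chi> z = FC +>\<^bsub>PT\<^esub> vv z"
  unfolding p_tensor_def
proof (rule ktensor.tensor_lift_eq[OF TQ_ktensor _ _ _ z])
  show "(\<lambda>z. FC +>\<^bsub>PT\<^esub> vv z) \<in> lin_maps (tensor T (Q n)) (quot_mod PT FC)"
    by (rule lin_comp[OF vv_lin kquot.quot_proj_lin[OF T.M.first_coord_kquot]])
  show "kmod (quot_mod PT FC)" by (rule kquot.quot_kmod[OF T.M.first_coord_kquot])
  fix t q assume t: "t \<in> carrier T" and q: "q \<in> carrier (Q n)"
  obtain y where y: "y \<in> carrier Om" "q = cs n y" using q by (rule QE)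
  let ?v = "\<lambda>x. vec (n + 1) (\<lambda>i. binom_col n \<chi> x $ i \<odot>\<^bsub>T\<^esub> t)"
  have vc: "?v x \<in> carrier PT" for x using t by (simp add: pow_mod_simps)
  have vi: "?v x $ i = X.bfun (n - i) x \<odot>\<^bsub>T\<^esub> t" if "i < n + 1" "x \<in> carrier Om" for i x
    using that by (simp add: binom_col_eq)
  have "quot_lift (\<lambda>x. FC +>\<^bsub>PT\<^esub> ?v x) (cs n y) = FC +>\<^bsub>PT\<^esub> ?v y"
  proof (rule kquot.quot_lift_coset[OF Om_kquot _ y(1)])
    fix s assume s: "s \<in> Ipow n"
    note sc = H.aug_id_pow_carrier[OF s]
    show "FC +>\<^bsub>PT\<^esub> ?v (s \<oplus>\<^bsub>Om\<^esub> y) = FC +>\<^bsub>PT\<^esub> ?v y"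
    proof (rule T.M.first_coord_coset_eqI[OF vc vc])
      fix i assume i: "i < n + 1" "i \<noteq> 0"
      \<comment> \<open>For i different from 0 the index n - i is below n, so B_{n-i} kills I^n.
        Coordinate 0 may change, but it is invisible modulo \<open>FC\<close>.\<close>
      have "X.bfun (n - i) s = 0" using X.bfun_aug_pow[OF s, of "n - i"] i n1 np by simp
      then show "?v (s \<oplus>\<^bsub>Om\<^esub> y) $ i = ?v y $ i"
        unfolding vi[OF i(1) R.a_closed[OF sc y(1)]] vi[OF i(1) y(1)] X.bfun_add by simp
    qed
  qed
  also have "FC +>\<^bsub>PT\<^esub> ?v y = FC +>\<^bsub>PT\<^esub> vv (tens T (Q n) t q)"
  proof (rule T.M.first_coord_coset_eqI[OF vc lin_closed[OF vv_lin ktensor.tens_closed[OF TQ_ktensor t q]]])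
    fix i assume i: "i < n + 1" "i \<noteq> 0"
    have ni: "n - i < n" "n - i < CARD('p)" using i n1 np by auto
    have "vv (tens T (Q n) t q) $ i = ev (n - i) (tens T (Q n) t q)" using i by (simp add: vv_def)
    also have "\<dots> = X.bfun (n - i) y \<odot>\<^bsub>T\<^esub> t" using ev_tens[OF ni t q] unfolding y(2) bq_cs[OF ni y(1)] .
    finally show "?v y $ i = vv (tens T (Q n) t q) $ i" unfolding vi[OF i(1) y(1)] by simp
  qed
  finally show "quot_lift (\<lambda>x. FC +>\<^bsub>PT\<^esub> ?v x) q = FC +>\<^bsub>PT\<^esub> vv (tens T (Q n) t q)" unfolding y(2) .
qed

lemma attached_apply:
  assumes "g \<in> carrier G" "f g \<in> carrier (tensor T (Q n))"
  shows "attached_system G N T n \<chi> f g = {binom_mat n (\<chi> (pr g))} \<times> (FC +>\<^bsub>PT\<^esub> vv (f g))"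
  using assms by (simp add: attached_system_def p_tensor_eq)

lemma zero_lift_attached:
  assumes "g \<in> carrier G" "f g \<in> carrier (tensor T (Q n))"
  shows "zero_lift T (attached_system G N T n \<chi> f g) = (binom_mat n (\<chi> (pr g)), vv (f g))"
  unfolding zero_lift_def attached_apply[where f = f, OF assms]
proof (rule the_equality)
  have v: "vv (f g) \<in> carrier PT" by (rule lin_closed[OF vv_lin assms(2)])
  have v0: "vv (f g) $ 0 = \<zero>\<^bsub>T\<^esub>" by (simp add: vv_def)
  show "(binom_mat n (\<chi> (pr g)), vv (f g)) \<in> {binom_mat n (\<chi> (pr g))} \<times> (FC +>\<^bsub>PT\<^esub> vv (f g)) \<and>
      snd (binom_mat n (\<chi> (pr g)), vv (f g)) $ 0 = \<zero>\<^bsub>T\<^esub>"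
    using kquot.in_coset_self[OF T.M.first_coord_kquot v] v0 by simp
  fix u assume u: "u \<in> {binom_mat n (\<chi> (pr g))} \<times> (FC +>\<^bsub>PT\<^esub> vv (f g)) \<and> snd u $ 0 = \<zero>\<^bsub>T\<^esub>"
  then have u2: "snd u \<in> FC +>\<^bsub>PT\<^esub> vv (f g)" and u1: "fst u = binom_mat n (\<chi> (pr g))" by (simp_all add: mem_Times_iff)
  have "snd u = vv (f g)"
  proof (rule eq_vecI)
    show "dim_vec (snd u) = dim_vec (vv (f g))"
      using u2 unfolding T.M.first_coord_coset[OF v] by (simp add: pow_mod_simps vv_def)
    fix i assume "i < dim_vec (vv (f g))"
    then have "i < n + 1" by (simp add: vv_def)
    then show "snd u $ i = vv (f g) $ i"
      using u2 u v0 unfolding T.M.first_coord_coset[OF v] by (cases "i = 0") simp_all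
  qed
  then show "u = (binom_mat n (\<chi> (pr g)), vv (f g))" using u1 by (simp add: prod_eq_iff)
qed

text \<open>Since (1, s) times (P, v) is (P, s + v), the coset of (P, v) is the single matrix P
  paired with a coset of \<open>FC\<close>.\<close>

lemma block_quot_carrier:
  assumes "P \<in> unitriangular (n + 1)" "v \<in> carrier PT"
  shows "{P} \<times> (FC +>\<^bsub>PT\<^esub> v) \<in> carrier (block_quot T n)"
proof -
  have P: "P \<in> carrier_mat (n + 1) (n + 1)" using assms(1) by (simp add: unitriangular_def)
  have "({1\<^sub>m (n + 1)} \<times> FC) #>\<^bsub>block_group T n\<^esub> (P, v) = {P} \<times> (FC +>\<^bsub>PT\<^esub> v)"
    unfolding r_coset_def coset_def block_group_def using P T.M.mat_act_one[OF assms(2)] by auto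
  moreover have "(P, v) \<in> carrier (block_group T n)" using assms by (simp add: block_group_def)
  ultimately show ?thesis
    unfolding block_quot_def FactGroup_def RCOSETS_def by auto
qed

text \<open>Row i of an upper triangular matrix involves only the coordinates i + l of
  \<open>u'\<close>. For i at least 1 these avoid coordinate 0, so the choice of the representative
  \<open>u'\<close> does not matter.\<close>

lemma vv_cocycle:
  assumes g: "g \<in> carrier G" and z: "z \<in> carrier (tensor T (Q n))" and z': "z' \<in> carrier (tensor T (Q n))"
    and i: "i < n + 1" "i \<noteq> 0" and u': "u' \<in> FC +>\<^bsub>PT\<^esub> vv z'"
  shows "vv (z \<oplus>\<^bsub>tensor T (Q n)\<^esub> gact (tensor_gmod T (Q n)) g z') $ i =
    vv z $ i \<oplus>\<^bsub>T\<^esub> mat_act T (binom_mat n (\<chi> (pr g))) (map_vec (gact T g) u') $ i"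
proof -
  interpret TQ: dgtensor G T "Q n" by (rule TQ)
  have v': "vv z' \<in> carrier PT" by (rule lin_closed[OF vv_lin z'])
  have u: "u' \<in> carrier PT" "\<And>j. \<lbrakk>j < n + 1; j \<noteq> 0\<rbrakk> \<Longrightarrow> u' $ j = vv z' $ j"
    using u' unfolding T.M.first_coord_coset[OF v'] by auto
  have gu: "map_vec (gact T g) u' \<in> carrier PT" using u(1) g by (simp add: pow_mod_simps)
  have ni: "n - i < n" "n - i < CARD('p)" "i \<le> n" using i n1 np by auto
  note gz = lin_closed[OF TQ.act_lin[OF g] z']
  have "vv (z \<oplus>\<^bsub>tensor T (Q n)\<^esub> gact (tensor_gmod T (Q n)) g z') $ i =
      ev (n - i) (z \<oplus>\<^bsub>tensor T (Q n)\<^esub> gact (tensor_gmod T (Q n)) g z')" using i by (simp add: vv_def)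
  also have "\<dots> = ev (n - i) z \<oplus>\<^bsub>T\<^esub> ev (n - i) (gact (tensor_gmod T (Q n)) g z')"
    by (rule lin_add[OF ev_lin[OF ni(1,2)] z gz])
  also have "ev (n - i) z = vv z $ i" using i by (simp add: vv_def)
  also have "ev (n - i) (gact (tensor_gmod T (Q n)) g z') =
      (\<Oplus>\<^bsub>T\<^esub>l\<in>{..n - i}. binom l (\<chi> (pr g)) \<odot>\<^bsub>T\<^esub> gact T g (ev (n - i - l) z'))"
    by (rule ev_equiv[OF ni(1,2) g z'])
  also have "\<dots> = (\<Oplus>\<^bsub>T\<^esub>l\<in>{..n - i}. binom l (\<chi> (pr g)) \<odot>\<^bsub>T\<^esub> map_vec (gact T g) u' $ (i + l))"
  proof (rule T.M.finsum_cong')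
    fix l assume l: "l \<in> {..n - i}"
    have il: "i + l < n + 1" "i + l \<noteq> 0" "dim_vec u' = n + 1" using l i u(1) by (auto simp: pow_mod_simps)
    have "map_vec (gact T g) u' $ (i + l) = gact T g (ev (n - i - l) z')"
      using il i(2) by (simp add: u(2)[OF il(1,2)] vv_def)
    then show "binom l (\<chi> (pr g)) \<odot>\<^bsub>T\<^esub> gact T g (ev (n - i - l) z') =
        binom l (\<chi> (pr g)) \<odot>\<^bsub>T\<^esub> map_vec (gact T g) u' $ (i + l)" by simp
  next
    have "map_vec (gact T g) u' $ (i + l) \<in> carrier T" if "l \<le> n - i" for l
      using u(1) g that i by (simp add: pow_mod_simps)
    then show "(\<lambda>l. binom l (\<chi> (pr g)) \<odot>\<^bsub>T\<^esub> map_vec (gact T g) u' $ (i + l)) \<in> {..n - i} \<rightarrow> carrier T" by simp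
  qed simp
  also have "\<dots> = mat_act T (binom_mat n (\<chi> (pr g))) (map_vec (gact T g) u') $ i"
    by (rule mat_act_binom[OF T.M.kmod_axioms' gu ni(3), symmetric])
  finally show ?thesis .
qed

lemma attached_cocycle:
  assumes f: "f \<in> Z1 G (tensor_gmod T (Q n))" and g: "g \<in> carrier G" and h: "h \<in> carrier G"
  shows "attached_system G N T n \<chi> f (g \<otimes>\<^bsub>G\<^esub> h) =
    attached_system G N T n \<chi> f g \<otimes>\<^bsub>block_quot T n\<^esub> block_act T g (attached_system G N T n \<chi> f h)"
proof -
  interpret TQ: dgtensor G T "Q n" by (rule TQ)
  have fc: "f k \<in> carrier (tensor T (Q n))" if "k \<in> carrier G" for k
    using f that by (auto simp: Z1_def C1_def)
  have fgh: "f (g \<otimes>\<^bsub>G\<^esub> h) = f g \<oplus>\<^bsub>tensor T (Q n)\<^esub> gact (tensor_gmod T (Q n)) g (f h)"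
    using f g h by (simp add: Z1_def)
  let ?P = "\<lambda>k. binom_mat n (\<chi> (pr k))"
  have PP: "?P (g \<otimes>\<^bsub>G\<^esub> h) = ?P g * ?P h"
    unfolding binom_mat_mult[OF np] pr_mult[OF g h] X.char_mult[OF pr_closed[OF g] pr_closed[OF h]] ..
  note vg = lin_closed[OF vv_lin fc[OF g]] and vh = lin_closed[OF vv_lin fc[OF h]]
    and vgh = lin_closed[OF vv_lin fc[OF G.m_closed[OF g h]]]
  have uh: "u' \<in> carrier PT" if "u' \<in> FC +>\<^bsub>PT\<^esub> vv (f h)" for u'
    by (rule kquot.coset_carrier[OF T.M.first_coord_kquot vh that])
  have mc: "mat_act T (?P g) (map_vec (gact T g) u') $ i \<in> carrier T"
    if "u' \<in> carrier PT" "i < n + 1" for u' i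
  proof -
    have gu: "map_vec (gact T g) u' \<in> carrier PT" using that(1) g by (simp add: pow_mod_simps)
    have "i \<le> n" using that by simp
    show ?thesis unfolding mat_act_binom[OF T.M.kmod_axioms' gu \<open>i \<le> n\<close>]
      by (rule T.M.finsum_closed) (use gu \<open>i \<le> n\<close> in \<open>auto simp: pow_mod_simps(1)\<close>)
  qed
  have set: "FC +>\<^bsub>PT\<^esub> vv (f (g \<otimes>\<^bsub>G\<^esub> h)) =
      {u \<oplus>\<^bsub>PT\<^esub> mat_act T (?P g) (map_vec (gact T g) u') | u u'. u \<in> FC +>\<^bsub>PT\<^esub> vv (f g) \<and> u' \<in> FC +>\<^bsub>PT\<^esub> vv (f h)}"
  proof (rule subset_antisym; rule subsetI)
    fix x assume "x \<in> FC +>\<^bsub>PT\<^esub> vv (f (g \<otimes>\<^bsub>G\<^esub> h))"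
    then have x: "x \<in> carrier PT" "\<And>i. \<lbrakk>i < n + 1; i \<noteq> 0\<rbrakk> \<Longrightarrow> x $ i = vv (f (g \<otimes>\<^bsub>G\<^esub> h)) $ i"
      unfolding T.M.first_coord_coset[OF vgh] by auto
    let ?m = "mat_act T (?P g) (map_vec (gact T g) (vv (f h)))"
    have vh': "vv (f h) \<in> FC +>\<^bsub>PT\<^esub> vv (f h)" by (rule kquot.in_coset_self[OF T.M.first_coord_kquot vh])
    \<comment> \<open>Coordinate 0 is unconstrained in the coset of \<open>vv (f g)\<close>, so it
      is chosen to absorb whatever \<open>x\<close> has there; the other coordinates are handled by
      \<open>vv_cocycle\<close>.\<close>
    define u where "u = vec (n + 1) (\<lambda>i. if i = 0 then x $ i \<ominus>\<^bsub>T\<^esub> ?m $ i else vv (f g) $ i)"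
    have "u \<in> carrier PT" using x(1) vg mc[OF vh] unfolding u_def pow_mod_simps(1) by simp
    then have "u \<in> FC +>\<^bsub>PT\<^esub> vv (f g)" unfolding T.M.first_coord_coset[OF vg] by (simp add: u_def)
    moreover have "x = u \<oplus>\<^bsub>PT\<^esub> ?m"
    proof (rule eq_vecI)
      fix i assume "i < dim_vec (u \<oplus>\<^bsub>PT\<^esub> ?m)"
      then have i: "i < n + 1" by (simp add: pow_mod_simps)
      show "x $ i = (u \<oplus>\<^bsub>PT\<^esub> ?m) $ i"
      proof (cases "i = 0")
        case True
        have "x $ 0 \<in> carrier T" using x(1) by (simp add: pow_mod_simps)
        then show ?thesis using True mc[OF vh, of 0] by (simp add: u_def pow_mod_simps(3) T.M.minus_add_cancel)
      next
        case False
        have "x $ i = vv (f g) $ i \<oplus>\<^bsub>T\<^esub> ?m $ i"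
          unfolding x(2)[OF i False] fgh by (rule vv_cocycle[OF g fc[OF g] fc[OF h] i False vh'])
        then show ?thesis using i False by (simp add: u_def pow_mod_simps(3))
      qed
    qed (use x(1) in \<open>simp add: pow_mod_simps\<close>)
    ultimately show "x \<in> {u \<oplus>\<^bsub>PT\<^esub> mat_act T (?P g) (map_vec (gact T g) u') | u u'. u \<in> FC +>\<^bsub>PT\<^esub> vv (f g) \<and> u' \<in> FC +>\<^bsub>PT\<^esub> vv (f h)}"
      using vh' by blast
  next
    fix x assume "x \<in> {u \<oplus>\<^bsub>PT\<^esub> mat_act T (?P g) (map_vec (gact T g) u') | u u'. u \<in> FC +>\<^bsub>PT\<^esub> vv (f g) \<and> u' \<in> FC +>\<^bsub>PT\<^esub> vv (f h)}"
    then obtain u u' where x: "x = u \<oplus>\<^bsub>PT\<^esub> mat_act T (?P g) (map_vec (gact T g) u')"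
      and u: "u \<in> FC +>\<^bsub>PT\<^esub> vv (f g)" and u': "u' \<in> FC +>\<^bsub>PT\<^esub> vv (f h)" by blast
    have uc: "u \<in> carrier PT" "\<And>i. \<lbrakk>i < n + 1; i \<noteq> 0\<rbrakk> \<Longrightarrow> u $ i = vv (f g) $ i"
      using u unfolding T.M.first_coord_coset[OF vg] by auto
    have "x \<in> carrier PT" unfolding x pow_mod_simps(1,3) using uc(1) mc[OF uh[OF u']] by (simp add: pow_mod_simps(1))
    moreover have "x $ i = vv (f (g \<otimes>\<^bsub>G\<^esub> h)) $ i" if i: "i < n + 1" "i \<noteq> 0" for i
      unfolding fgh vv_cocycle[OF g fc[OF g] fc[OF h] i u'] x pow_mod_simps(3) using uc(2)[OF i] i by simp
    ultimately show "x \<in> FC +>\<^bsub>PT\<^esub> vv (f (g \<otimes>\<^bsub>G\<^esub> h))" unfolding T.M.first_coord_coset[OF vgh] by simp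
  qed
  show ?thesis
    unfolding attached_apply[where f = f, OF g fc[OF g]] attached_apply[where f = f, OF h fc[OF h]]
      attached_apply[where f = f, OF G.m_closed[OF g h] fc[OF G.m_closed[OF g h]]] set PP
    unfolding block_quot_def FactGroup_def block_act_def set_mult_def block_group_def
    by (auto, blast)
qed

lemma attached_proper:
  assumes f: "f \<in> Z1 G (tensor_gmod T (Q n))"
  shows "proper_defining_system G N T n \<chi> (cocycle_image G T f) (attached_system G N T n \<chi> f)"
  unfolding proper_defining_system_def
proof (intro conjI ballI)
  interpret TQ: dgtensor G T "Q n" by (rule TQ)
  interpret TQm: dgmod G "tensor_gmod T (Q n)" by (rule TQ.tensor_dgmod)
  have fC: "f \<in> C1 G (tensor_gmod T (Q n))" using f by (simp add: Z1_def)
  have fc: "f k \<in> carrier (tensor T (Q n))" if "k \<in> carrier G" for k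
    using TQm.C1_closed[OF fC that] by simp
  have "loc_const (gtop G) f" using fC by (simp add: TQm.C1_iff)
  then have "loc_const (gtop G) (\<lambda>g. {binom_mat n (\<chi> (pr g))} \<times> p_tensor T n \<chi> (f g))"
    by (rule loc_const_comp2[where \<phi> = "\<lambda>k z. {binom_mat n (\<chi> k)} \<times> p_tensor T n \<chi> z", OF coset_loc_const])
  then have "loc_const (gtop G) (attached_system G N T n \<chi> f)"
    by (rule loc_const_cong) (simp add: attached_system_def G.top)
  moreover have "attached_system G N T n \<chi> f k \<in> carrier (block_quot T n)" if "k \<in> carrier G" for k
    unfolding attached_apply[where f = f, OF that fc[OF that]]
    by (rule block_quot_carrier[OF binom_mat_unitriangular lin_closed[OF vv_lin fc[OF that]]])
  ultimately show "continuous_map (gtop G) (discrete_topology (carrier (block_quot T n))) (attached_system G N T n \<chi> f)"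
    unfolding continuous_map_discrete_iff G.top by simp
  fix g assume g: "g \<in> carrier G"
  show "attached_system G N T n \<chi> f (g \<otimes>\<^bsub>G\<^esub> h) =
    attached_system G N T n \<chi> f g \<otimes>\<^bsub>block_quot T n\<^esub> block_act T g (attached_system G N T n \<chi> f h)" if "h \<in> carrier G" for h
    by (rule attached_cocycle[OF f g that])
  note v = lin_closed[OF vv_lin fc[OF g]]
  \<comment> \<open>B_0 is the augmentation, so lambda is \<open>ev 0\<close> of f, and this is
    coordinate n of \<open>vv\<close>, the entry just above the lower right corner.\<close>
  have "cocycle_image G T f g = ev 0 (f g)"
    unfolding cocycle_image_def using g
  proof simp
    have n0: "0 < n" "0 < CARD('p)" using n1 np by auto
    show "tensor_lift T (\<lambda>t q. quot_lift augmentation q \<odot>\<^bsub>T\<^esub> t) (f g) = ev 0 (f g)"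
    proof (rule ktensor.tensor_lift_eq[OF TQ_ktensor ev_lin[OF n0] T.M.kmod_axioms' _ fc[OF g]])
      fix t q assume t: "t \<in> carrier T" and q: "q \<in> carrier (Q n)"
      obtain y where y: "y \<in> carrier Om" "q = cs n y" using q by (rule QE)
      have "quot_lift augmentation (cs n y) = X.bfun 0 y"
        unfolding X.bfun_0[OF y(1), symmetric]
      proof -
        have "quot_lift augmentation (cs n y) = augmentation y"
        proof (rule kquot.quot_lift_coset[OF Om_kquot _ y(1)])
          fix s assume s: "s \<in> Ipow n"
          note sc = H.aug_id_pow_carrier[OF s]
          show "augmentation (s \<oplus>\<^bsub>Om\<^esub> y) = augmentation y"
            unfolding X.bfun_0[OF R.a_closed[OF sc y(1)], symmetric] X.bfun_0[OF y(1), symmetric] X.bfun_add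
            using X.bfun_aug_pow[OF s n0] by simp
        qed
        then show "quot_lift augmentation (cs n y) = X.bfun 0 y" by (simp only: X.bfun_0[OF y(1)])
      qed
      then show "quot_lift augmentation q \<odot>\<^bsub>T\<^esub> t = ev 0 (tens T (Q n) t q)"
        using ev_tens[OF n0 t q] unfolding y(2) bq_cs[OF n0 y(1)] by simp
    qed
  qed
  then have lam: "cocycle_image G T f g = vv (f g) $ n" using n1 by (simp add: vv_def)
  fix Pv assume "Pv \<in> attached_system G N T n \<chi> f g"
  then have "fst Pv = binom_mat n (\<chi> (pr g))" "snd Pv \<in> FC +>\<^bsub>PT\<^esub> vv (f g)"
    unfolding attached_apply[where f = f, OF g fc[OF g]] by (simp_all add: mem_Times_iff)
  then show "case Pv of (P, v) \<Rightarrow> P = binom_mat n (\<chi> (pr g)) \<and> v $ n = cocycle_image G T f g"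
    unfolding lam T.M.first_coord_coset[OF v] using n1 by (simp add: case_prod_unfold)
qed

end

section \<open>The connecting map\<close>

text \<open>The identity tensored with \<open>\<alpha>\<close>, written in the way in which
  \<open>Psi\<close> spells out its two maps, so that \<open>inc\<close> and \<open>prj\<close> can
  be folded into it.\<close>

definition tmap ::
    "('k::field, 'v, 'x) module_scheme \<Rightarrow> ('k, 'u, 'y) module_scheme \<Rightarrow> ('w \<Rightarrow> 'u)
       \<Rightarrow> ('v \<times> 'w \<Rightarrow> 'k) set \<Rightarrow> ('v \<times> 'u \<Rightarrow> 'k) set" where
  "tmap V U \<alpha> = tensor_lift (tensor V U) (\<lambda>v w. tens V U v (\<alpha> w))"

lemma tmap:
  assumes V: "kmod V" and W: "kmod W" and U: "kmod U" and a: "\<alpha> \<in> lin_maps W U"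
  shows tmap_lin: "tmap V U \<alpha> \<in> lin_maps (tensor V W) (tensor V U)"
    and tmap_tens: "\<lbrakk>v \<in> carrier V; w \<in> carrier W\<rbrakk> \<Longrightarrow> tmap V U \<alpha> (tens V W v w) = tens V U v (\<alpha> w)"
proof -
  interpret VW: ktensor V W by (intro ktensor.intro V W)
  interpret VU: ktensor V U by (intro ktensor.intro V U)
  have b: "bilinear_map V W (tensor V U) (\<lambda>v w. tens V U v (\<alpha> w))"
    using lin_closed[OF a] by (intro bilinear_mapI lin_comp[OF a VU.tens_lin_right] VU.tens_lin_left) simp_all
  show "tmap V U \<alpha> \<in> lin_maps (tensor V W) (tensor V U)"
    unfolding tmap_def by (rule VW.tensor_lift_lin[OF b VU.tensor_kmod])
  show "tmap V U \<alpha> (tens V W v w) = tens V U v (\<alpha> w)" if "v \<in> carrier V" "w \<in> carrier W"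
    unfolding tmap_def by (rule VW.tensor_lift_tens[OF b VU.tensor_kmod that])
qed

lemma tmap_equivariant:
  assumes "dgtensor G V W" "dgtensor G V U" and a: "\<alpha> \<in> lin_maps W U"
    and eq: "\<And>g w. \<lbrakk>g \<in> carrier G; w \<in> carrier W\<rbrakk> \<Longrightarrow> \<alpha> (gact W g w) = gact U g (\<alpha> w)"
    and g: "g \<in> carrier G" and z: "z \<in> carrier (tensor V W)"
  shows "tmap V U \<alpha> (gact (tensor_gmod V W) g z) = gact (tensor_gmod V U) g (tmap V U \<alpha> z)"
proof -
  interpret VW: dgtensor G V W by fact
  interpret VU: dgtensor G V U by fact
  note k = VW.V.M.kmod_axioms' VW.W.M.kmod_axioms' VU.W.M.kmod_axioms' a
  show ?thesis
    by (rule VW.K.tensor_lin_eqI[OF lin_comp[OF VW.act_lin[OF g] tmap_lin[OF k]] lin_comp[OF tmap_lin[OF k] VU.act_lin[OF g]] _ z])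
      (simp add: VW.act_tens VU.act_tens g tmap_tens[OF k] eq lin_closed[OF a])
qed

lemma tmap_dghom:
  assumes "dgtensor G V W" "dgtensor G V U" and a: "\<alpha> \<in> lin_maps W U"
    and eq: "\<And>g w. \<lbrakk>g \<in> carrier G; w \<in> carrier W\<rbrakk> \<Longrightarrow> \<alpha> (gact W g w) = gact U g (\<alpha> w)"
  shows "dghom G (tensor_gmod V W) (tensor_gmod V U) (tmap V U \<alpha>)"
proof -
  interpret VW: dgtensor G V W by fact
  interpret VU: dgtensor G V U by fact
  note k = VW.V.M.kmod_axioms' VW.W.M.kmod_axioms' VU.W.M.kmod_axioms' a
  show ?thesis
  proof (intro dghom.intro dghom_axioms.intro VW.tensor_dgmod VU.tensor_dgmod)
    show "tmap V U \<alpha> \<in> lin_maps (tensor_gmod V W) (tensor_gmod V U)"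
      unfolding VU.lin_tensor_gmod VW.lin_tensor_gmod by (rule tmap_lin[OF k])
    show "tmap V U \<alpha> (gact (tensor_gmod V W) g x) = gact (tensor_gmod V U) g (tmap V U \<alpha> x)"
      if "g \<in> carrier G" "x \<in> carrier (tensor_gmod V W)" for g x
      by (rule tmap_equivariant[OF assms that(1)]) (use that(2) in \<open>simp_all only: VW.tensor_gmod_simps(1)\<close>)
  qed
qed

context massey_setting
begin

definition pq :: "('g set \<Rightarrow> 'p mod_ring) set \<Rightarrow> ('g set \<Rightarrow> 'p mod_ring) set" where
  "pq = quot_lift (cs n)"

lemma pq_null: "s \<in> Ipow (Suc n) \<Longrightarrow> cs n s = \<zero>\<^bsub>Q n\<^esub>"
  using H.aug_id_pow_Suc_subset[of n] kquot.coset_of_mem[OF Om_kquot, of s n] kquot.quot_zero[OF Om_kquot, of n]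
    kquot.coset_zero[OF Om_kquot, of n] by auto

lemma pq_cs: "y \<in> carrier Om \<Longrightarrow> pq (cs (Suc n) y) = cs n y"
  unfolding pq_def by (rule kquot.quot_lift_lin_coset[OF Om_kquot cs_lin Q_kmod pq_null])

lemma pq_lin: "pq \<in> lin_maps (Q (Suc n)) (Q n)"
proof -
  have "pq \<in> lin_maps (quot_mod Om (Ipow (Suc n))) (Q n)"
    unfolding pq_def by (rule kquot.quot_lift_lin_maps[OF Om_kquot cs_lin Q_kmod pq_null])
  then show ?thesis by (simp add: module_hom_def)
qed

lemma pq_act: "\<lbrakk>g \<in> carrier G; q \<in> carrier (Q (Suc n))\<rbrakk> \<Longrightarrow> pq (gact (Q (Suc n)) g q) = gact (Q n) g (pq q)"
proof -
  assume g: "g \<in> carrier G" and q: "q \<in> carrier (Q (Suc n))"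
  obtain y where y: "y \<in> carrier Om" "q = cs (Suc n) y" using q by (rule QE)
  show ?thesis unfolding y(2) Q_simps(5) omega_act_coset[OF g y(1)] pq_cs[OF y(1)]
    pq_cs[OF R.m_closed[OF delta_pr_closed[OF g] y(1)]] ..
qed

abbreviation "inc \<equiv> tmap T (Q (Suc n)) (\<lambda>w. w)"
abbreviation "prj \<equiv> tmap T (Q n) pq"

lemmas inc_lin = tmap_lin[OF T.M.kmod_axioms' W_kmod Q_kmod W_incl_lin[of n]]
lemmas inc_tens = tmap_tens[OF T.M.kmod_axioms' W_kmod Q_kmod W_incl_lin[of n]]
lemmas prj_lin = tmap_lin[OF T.M.kmod_axioms' Q_kmod Q_kmod pq_lin]
lemmas prj_tens = tmap_tens[OF T.M.kmod_axioms' Q_kmod Q_kmod pq_lin]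

lemma inc_dghom: "dghom G (tensor_gmod T (W n)) (tensor_gmod T (Q (Suc n))) inc"
  by (rule tmap_dghom[OF TW TQ W_incl_lin]) simp

lemma prj_dghom: "dghom G (tensor_gmod T (Q (Suc n))) (tensor_gmod T (Q n)) prj"
  by (rule tmap_dghom[OF TQ TQ pq_lin pq_act])

text \<open>A coset modulo I^n lifts to the coset modulo I^(n+1) of the same element, which settles
  pure tensors; sums of liftable tensors are liftable.\<close>

lemma prj_surj:
  assumes "z \<in> carrier (tensor T (Q n))"
  shows "\<exists>z'\<in>carrier (tensor T (Q (Suc n))). prj z' = z"
proof (rule ktensor.tensor_induct[OF TQ_ktensor, where P = "\<lambda>z. \<exists>z'\<in>carrier (tensor T (Q (Suc n))). prj z' = z", OF assms])
  fix t q assume t: "t \<in> carrier T" and q: "q \<in> carrier (Q n)"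
  obtain y where y: "y \<in> carrier Om" "q = cs n y" using q by (rule QE)
  have c: "cs (Suc n) y \<in> carrier (Q (Suc n))" using y(1) by simp
  have "prj (tens T (Q (Suc n)) t (cs (Suc n) y)) = tens T (Q n) t q"
    unfolding prj_tens[OF t c] pq_cs[OF y(1)] y(2) ..
  then show "\<exists>z'\<in>carrier (tensor T (Q (Suc n))). prj z' = tens T (Q n) t q"
    using ktensor.tens_closed[OF TQ_ktensor t c] by blast
next
  fix x y assume "\<exists>z'\<in>carrier (tensor T (Q (Suc n))). prj z' = x" "\<exists>z'\<in>carrier (tensor T (Q (Suc n))). prj z' = y"
  then obtain a b where ab: "a \<in> carrier (tensor T (Q (Suc n)))" "prj a = x" "b \<in> carrier (tensor T (Q (Suc n)))" "prj b = y" by blast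
  have "prj (a \<oplus>\<^bsub>tensor T (Q (Suc n))\<^esub> b) = x \<oplus>\<^bsub>tensor T (Q n)\<^esub> y"
    unfolding lin_add[OF prj_lin ab(1,3)] ab(2,4) ..
  moreover interpret K: ktensor T "Q (Suc n)" by (rule TQ_ktensor)
  have "a \<oplus>\<^bsub>tensor T (Q (Suc n))\<^esub> b \<in> carrier (tensor T (Q (Suc n)))" by (rule K.T.a_closed[OF ab(1,3)])
  ultimately show "\<exists>z'\<in>carrier (tensor T (Q (Suc n))). prj z' = x \<oplus>\<^bsub>tensor T (Q n)\<^esub> y" by blast
qed

end

context char_setting
begin

text \<open>For j < n the functional B_j already factors through Omega/I^n. This is why the Massey
  terms see only f and not the chosen lift.\<close>

lemma ev_prj:
  assumes "j < n" "z \<in> carrier (tensor T (Q (Suc n)))" shows "ev j (prj z) = ev j z"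
proof -
  have j: "j < CARD('p)" "j < Suc n" using assms np by auto
  show ?thesis
  proof (rule ktensor.tensor_lin_eqI[OF TQ_ktensor lin_comp[OF prj_lin ev_lin[OF assms(1) j(1)]] ev_lin[OF j(2,1)] _ assms(2)])
    fix t q assume t: "t \<in> carrier T" and q: "q \<in> carrier (Q (Suc n))"
    obtain y where y: "y \<in> carrier Om" "q = cs (Suc n) y" using q by (rule QE)
    show "ev j (prj (tens T (Q (Suc n)) t q)) = ev j (tens T (Q (Suc n)) t q)"
      unfolding prj_tens[OF t q] ev_tens[OF j(2,1) t q] ev_tens[OF assms(1) j(1) t lin_closed[OF pq_lin q]]
      unfolding y(2) pq_cs[OF y(1)] bq_cs[OF j(2,1) y(1)] bq_cs[OF assms(1) j(1) y(1)] ..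
  qed
qed

text \<open>The cocycle inside \<open>massey\<close> with its entries written out: entry (0, i) of
  the binomial matrix is (chi(g) choose i), and coordinate i of the zero lift of the last column is
  B_{n-i} of f(h).\<close>

definition massey_cochain :: "('g \<Rightarrow> ('t \<times> ('g set \<Rightarrow> 'p mod_ring) set \<Rightarrow> 'p mod_ring) set) \<Rightarrow> 'g \<times> 'g \<Rightarrow> 't" where
  "massey_cochain f = (\<lambda>(g, h)\<in>carrier G \<times> carrier G.
     \<Oplus>\<^bsub>T\<^esub>i\<in>{1..n}. binom i (\<chi> (pr g)) \<odot>\<^bsub>T\<^esub> gact T g (ev (n - i) (f h)))"

lemma massey_eq:
  assumes fc: "\<And>g. g \<in> carrier G \<Longrightarrow> f g \<in> carrier (tensor T (Q n))"
  shows "massey G T n (attached_system G N T n \<chi> f) = class2 G T (massey_cochain f)"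
proof -
  have ec: "ev (n - i) (f h) \<in> carrier T" if "h \<in> carrier G" "i \<in> {1..n}" for h i
    using that n1 np by (intro ev_closed[of _ n] fc) auto
  have "(\<lambda>(g, h)\<in>carrier G \<times> carrier G.
        \<Oplus>\<^bsub>T\<^esub>i\<in>{1..n}. fst (zero_lift T (attached_system G N T n \<chi> f g)) $$ (0, i) \<odot>\<^bsub>T\<^esub>
          gact T g (snd (zero_lift T (attached_system G N T n \<chi> f h)) $ i)) = massey_cochain f"
    unfolding massey_cochain_def
  proof (rule restrict_ext, clarify)
    fix g h assume g: "g \<in> carrier G" and h: "h \<in> carrier G"
    show "(\<Oplus>\<^bsub>T\<^esub>i\<in>{1..n}. fst (zero_lift T (attached_system G N T n \<chi> f g)) $$ (0, i) \<odot>\<^bsub>T\<^esub>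
          gact T g (snd (zero_lift T (attached_system G N T n \<chi> f h)) $ i)) =
        (\<Oplus>\<^bsub>T\<^esub>i\<in>{1..n}. binom i (\<chi> (pr g)) \<odot>\<^bsub>T\<^esub> gact T g (ev (n - i) (f h)))"
      unfolding zero_lift_attached[where f = f, OF g fc[OF g]] zero_lift_attached[where f = f, OF h fc[OF h]] fst_conv snd_conv
    proof (rule T.M.finsum_cong')
      show "binom_mat n (\<chi> (pr g)) $$ (0, i) \<odot>\<^bsub>T\<^esub> gact T g (vv (f h) $ i) =
          binom i (\<chi> (pr g)) \<odot>\<^bsub>T\<^esub> gact T g (ev (n - i) (f h))" if "i \<in> {1..n}" for i
        using that by (simp add: binom_mat_index vv_def)
      show "(\<lambda>i. binom i (\<chi> (pr g)) \<odot>\<^bsub>T\<^esub> gact T g (ev (n - i) (f h))) \<in> {1..n} \<rightarrow> carrier T"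
        using ec[OF h] g by (intro Pi_I) simp
    qed simp
  qed
  then show ?thesis unfolding massey_def by (rule arg_cong)
qed

text \<open>\<open>ev_equiv\<close> for j = n, applied to the one term of dF that contains the
  action. Its i = 0 part completes the coboundary of B_n(F), and its parts with i > 0 are the Massey
  sum.\<close>

lemma ev_d1:
  assumes F: "F \<in> carrier G \<rightarrow> carrier (tensor T (Q (Suc n)))"
    and g: "g \<in> carrier G" and h: "h \<in> carrier G"
  shows "ev n (d1 G (tensor_gmod T (Q (Suc n))) F (g, h)) =
    d1 G T (\<lambda>s\<in>carrier G. ev n (F s)) (g, h) \<oplus>\<^bsub>T\<^esub> massey_cochain (\<lambda>s. prj (F s)) (g, h)"
proof -
  interpret TQ: dgtensor G T "Q (Suc n)" by (rule TQ)
  interpret TQm: dgmod G "tensor_gmod T (Q (Suc n))" by (rule TQ.tensor_dgmod)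
  have Fc: "F s \<in> carrier (tensor T (Q (Suc n)))" if "s \<in> carrier G" for s using F that by auto
  have nn: "n < Suc n" by simp
  note L = ev_lin[OF nn np]
  have ec: "ev j (F s) \<in> carrier T" if "s \<in> carrier G" "j \<le> n" for s j
    using that np by (intro ev_closed[of _ "Suc n"] Fc) auto
  let ?gF = "gact (tensor_gmod T (Q (Suc n))) g (F h)"
  have gFc: "?gF \<in> carrier (tensor T (Q (Suc n)))" by (rule lin_closed[OF TQ.act_lin[OF g] Fc[OF h]])
  let ?S = "\<Oplus>\<^bsub>T\<^esub>i\<in>{1..n}. binom i (\<chi> (pr g)) \<odot>\<^bsub>T\<^esub> gact T g (ev (n - i) (F h))"
  have tc: "(\<lambda>i. binom i (\<chi> (pr g)) \<odot>\<^bsub>T\<^esub> gact T g (ev (n - i) (F h))) \<in> A \<rightarrow> carrier T" for A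
    using ec[OF h] g by (intro Pi_I) simp
  have Sc: "?S \<in> carrier T" by (rule T.M.finsum_closed[OF tc])
  \<comment> \<open>Separates the equivariant part i = 0 from the correction terms.\<close>
  have "{..n} = insert 0 {1..n}" by auto
  then have "ev n ?gF = (\<Oplus>\<^bsub>T\<^esub>i\<in>insert 0 {1..n}. binom i (\<chi> (pr g)) \<odot>\<^bsub>T\<^esub> gact T g (ev (n - i) (F h)))"
    using ev_equiv[OF nn np g Fc[OF h]] by simp
  also have "\<dots> = gact T g (ev n (F h)) \<oplus>\<^bsub>T\<^esub> ?S"
    by (subst T.M.finsum_insert[OF _ _ tc]) (use ec[OF h] g in simp_all)
  finally have e1: "ev n ?gF = gact T g (ev n (F h)) \<oplus>\<^bsub>T\<^esub> ?S" .
  have S: "massey_cochain (\<lambda>s. prj (F s)) (g, h) = ?S"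
    unfolding massey_cochain_def using g h
  proof simp
    show "(\<Oplus>\<^bsub>T\<^esub>i\<in>{Suc 0..n}. binom i (\<chi> (pr g)) \<odot>\<^bsub>T\<^esub> gact T g (ev (n - i) (prj (F h)))) =
      (\<Oplus>\<^bsub>T\<^esub>i\<in>{Suc 0..n}. binom i (\<chi> (pr g)) \<odot>\<^bsub>T\<^esub> gact T g (ev (n - i) (F h)))"
      by (rule T.M.finsum_cong'[OF refl tc]) (simp add: ev_prj[OF _ Fc[OF h]])
  qed
  have mc: "?gF \<ominus>\<^bsub>tensor_gmod T (Q (Suc n))\<^esub> F (g \<otimes>\<^bsub>G\<^esub> h) \<in> carrier (tensor_gmod T (Q (Suc n)))"
    using gFc Fc[OF G.m_closed[OF g h]] by (intro TQm.M.minus_closed) simp_all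
  have L': "ev n \<in> lin_maps (tensor_gmod T (Q (Suc n))) T" unfolding TQ.lin_tensor_gmod by (rule L)
  have c: "gact T g (ev n (F h)) \<in> carrier T" "ev n (F (g \<otimes>\<^bsub>G\<^esub> h)) \<in> carrier T" "ev n (F g) \<in> carrier T"
    using ec g h by auto
  have "ev n (d1 G (tensor_gmod T (Q (Suc n))) F (g, h)) =
      ((gact T g (ev n (F h)) \<oplus>\<^bsub>T\<^esub> ?S) \<ominus>\<^bsub>T\<^esub> ev n (F (g \<otimes>\<^bsub>G\<^esub> h))) \<oplus>\<^bsub>T\<^esub> ev n (F g)"
    unfolding TQm.d1_apply[OF g h]
    using gFc Fc[OF G.m_closed[OF g h]] Fc[OF g] mc
    by (simp add: lin_add[OF L'] lin_minus[OF TQm.M.kmod_axioms' T.M.kmod_axioms' L'] e1 del: TQ.tensor_gmod_simps(2,3,4))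
  also have "\<dots> = ((gact T g (ev n (F h)) \<ominus>\<^bsub>T\<^esub> ev n (F (g \<otimes>\<^bsub>G\<^esub> h))) \<oplus>\<^bsub>T\<^esub> ev n (F g)) \<oplus>\<^bsub>T\<^esub> ?S"
    using c Sc by (simp add: T.M.minus_eq_sm T.M.a_ac)
  finally show ?thesis unfolding S T.d1_apply[OF g h] using g h by simp
qed

text \<open>The functional \<open>p\<^bsub>\<chi>,n\<^esub>\<close> tensored with \<open>T\<close>.\<close>

definition ew :: "('t \<times> ('g set \<Rightarrow> 'p mod_ring) set \<Rightarrow> 'p mod_ring) set \<Rightarrow> 't" where
  "ew z = ev n (inc z)"

lemma ew_lin: "ew \<in> lin_maps (tensor T (W n)) T"
proof -
  have "n < Suc n" by simp
  from lin_comp[OF inc_lin ev_lin[OF this np]] show ?thesis unfolding ew_def[abs_def] .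
qed

lemma ev_inc:
  assumes j: "j \<le> n" and t: "t \<in> carrier T" and w: "w \<in> carrier (W n)"
  shows "ev j (inc (tens T (W n) t w)) = (if j = n then p_gr G N n \<chi> w else 0) \<odot>\<^bsub>T\<^esub> t"
proof -
  obtain y where y: "y \<in> Ipow n" "w = cs (Suc n) y" using w by (rule WE)
  note yc = H.aug_id_pow_carrier[OF y(1)]
  have j': "j < Suc n" "j < CARD('p)" using j np by auto
  have "ev j (inc (tens T (W n) t w)) = bq j w \<odot>\<^bsub>T\<^esub> t"
    unfolding inc_tens[OF t w] by (rule ev_tens[OF j' t W_sub_Q[OF w]])
  also have "bq j w = X.bfun j y" unfolding y(2) by (rule bq_cs[OF j' yc])
  also have "X.bfun j y = (if j = n then p_gr G N n \<chi> w else 0)"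
    using X.bfun_aug_pow[OF y(1) _ j'(2)] j unfolding p_gr_eq y(2) X.gr_fun_coset[OF y(1) np] by auto
  finally show ?thesis .
qed

lemma ew_tens:
  assumes "t \<in> carrier T" "w \<in> carrier (W n)"
  shows "ew (tens T (W n) t w) = p_gr G N n \<chi> w \<odot>\<^bsub>T\<^esub> t"
  unfolding ew_def using ev_inc[OF order_refl assms] by simp

text \<open>In general \<open>ev n\<close> is not equivariant, but on T tensor I^n/I^(n+1) it is,
  because G acts trivially on the second factor. Hence it induces a map on H^2.\<close>

lemma ew_dghom: "dghom G (tensor_gmod T (W n)) T ew"
proof (intro dghom.intro dghom_axioms.intro T.dgmod_axioms)
  interpret TW: dgtensor G T "W n" by (rule TW)
  show "dgmod G (tensor_gmod T (W n))" by (rule TW.tensor_dgmod)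
  show "ew \<in> lin_maps (tensor_gmod T (W n)) T" unfolding TW.lin_tensor_gmod by (rule ew_lin)
  fix g z assume g: "g \<in> carrier G" and "z \<in> carrier (tensor_gmod T (W n))"
  then have z: "z \<in> carrier (tensor T (W n))" by simp
  show "ew (gact (tensor_gmod T (W n)) g z) = gact T g (ew z)"
    by (rule TW.K.tensor_lin_eqI[OF lin_comp[OF TW.act_lin[OF g] ew_lin] lin_comp[OF ew_lin T.act_lin[OF g]] _ z])
      (simp only: TW.act_tens[OF g] W_act[OF g] ew_tens T.act_closed[OF g] T.act_smult[OF g])
qed

end

context dgmod
begin

text \<open>Sums in \<open>Z2mod\<close> are formed pointwise, so a cochain that is a pointwise sum
  of cocycles equals their sum in the module, and passing to classes is linear.\<close>

lemma class2_finsum: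
  assumes A: "finite A" and c: "\<And>i. i \<in> A \<Longrightarrow> c i \<in> Z2 G M"
    and d: "d \<in> extensional (carrier G \<times> carrier G)"
    and dc: "\<And>g h. \<lbrakk>g \<in> carrier G; h \<in> carrier G\<rbrakk> \<Longrightarrow> d (g, h) = (\<Oplus>\<^bsub>M\<^esub>i\<in>A. c i (g, h))"
  shows "class2 G M d = (\<Oplus>\<^bsub>H2 G M\<^esub>i\<in>A. class2 G M (c i))"
proof -
  interpret Z: kmod Z2mod by (rule Z2mod_kmod)
  have cZ: "c \<in> A \<rightarrow> carrier Z2mod" using c by (auto simp: Z2mod_simps(1))
  have pt: "(\<Oplus>\<^bsub>Z2mod\<^esub>i\<in>B. c i) s = (\<Oplus>\<^bsub>M\<^esub>i\<in>B. c i s)" if "B \<subseteq> A" "s \<in> carrier G \<times> carrier G" for B s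
  proof -
    have "finite B" using that(1) A finite_subset by blast
    then show ?thesis using that
    proof (induction B rule: finite_induct)
      case empty
      then show ?case by (simp only: Z.finsum_empty M.finsum_empty Z2mod_simps(2) restrict_apply')
    next
      case (insert a B)
      obtain g h where s: "s = (g, h)" "g \<in> carrier G" "h \<in> carrier G" using insert.prems by auto
      have 1: "(\<lambda>i. c i s) \<in> B \<rightarrow> carrier M" "c a s \<in> carrier M"
        using insert.prems c Z2_closed s by auto
      have 2: "c \<in> B \<rightarrow> carrier Z2mod" "c a \<in> carrier Z2mod" using cZ insert.prems by auto
      have IH: "(\<Oplus>\<^bsub>Z2mod\<^esub>i\<in>B. c i) s = (\<Oplus>\<^bsub>M\<^esub>i\<in>B. c i s)" using insert by auto
      show ?case
        unfolding Z.finsum_insert[OF insert.hyps 2] M.finsum_insert[OF insert.hyps 1] Z2mod_simps(3)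
        using IH insert.prems(2) by simp
    qed
  qed
  have "d = (\<Oplus>\<^bsub>Z2mod\<^esub>i\<in>A. c i)"
  proof (rule extensionalityI[OF d])
    have "(\<Oplus>\<^bsub>Z2mod\<^esub>i\<in>A. c i) \<in> Z2 G M" using Z.finsum_closed[OF cZ] by (simp add: Z2mod_simps(1))
    then show "(\<Oplus>\<^bsub>Z2mod\<^esub>i\<in>A. c i) \<in> extensional (carrier G \<times> carrier G)" by (simp add: Z2_def C2_iff PiE_iff)
    show "d s = (\<Oplus>\<^bsub>Z2mod\<^esub>i\<in>A. c i) s" if "s \<in> carrier G \<times> carrier G" for s
      using pt[OF subset_refl that] dc that by auto
  qed
  then show ?thesis using lin_finsum[OF Z2mod_kmod H2_kmod class2_lin cZ] by simp
qed

lemma d0_C1: assumes x: "x \<in> carrier M" shows "d0 G M x \<in> C1 G M"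
proof -
  have "loc_const (gtop G) (\<lambda>g. gact M g x \<ominus>\<^bsub>M\<^esub> x)"
    by (rule loc_const_comp[where \<phi> = "\<lambda>y. y \<ominus>\<^bsub>M\<^esub> x", OF act_loc_const[OF x]])
  then have "loc_const (gtop G) (d0 G M x)" by (rule loc_const_cong) (simp add: d0_def top)
  then show ?thesis using x by (simp add: C1_iff d0_def)
qed

lemma d1_d0:
  assumes x: "x \<in> carrier M" and g: "g \<in> carrier G" and h: "h \<in> carrier G"
  shows "d1 G M (d0 G M x) (g, h) = \<zero>\<^bsub>M\<^esub>"
proof -
  let ?a = "gact M g (gact M h x)" and ?b = "gact M g x"
  have c: "?a \<in> carrier M" "?b \<in> carrier M" using assms by auto
  have "d1 G M (d0 G M x) (g, h) = ((?a \<ominus>\<^bsub>M\<^esub> ?b) \<ominus>\<^bsub>M\<^esub> (?a \<ominus>\<^bsub>M\<^esub> x)) \<oplus>\<^bsub>M\<^esub> (?b \<ominus>\<^bsub>M\<^esub> x)"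
    using assms by (simp add: d1_apply d0_def act_minus act_mult)
  also have "\<dots> = ((?a \<ominus>\<^bsub>M\<^esub> ?b) \<oplus>\<^bsub>M\<^esub> (?b \<ominus>\<^bsub>M\<^esub> x)) \<ominus>\<^bsub>M\<^esub> (?a \<ominus>\<^bsub>M\<^esub> x)"
    using c x by (simp add: M.minus_eq_sm M.a_ac)
  also have "(?a \<ominus>\<^bsub>M\<^esub> ?b) \<oplus>\<^bsub>M\<^esub> (?b \<ominus>\<^bsub>M\<^esub> x) = ((?a \<ominus>\<^bsub>M\<^esub> ?b) \<oplus>\<^bsub>M\<^esub> ?b) \<ominus>\<^bsub>M\<^esub> x"
    using c x by (simp add: M.minus_eq_sm M.a_ac)
  also have "\<dots> = ?a \<ominus>\<^bsub>M\<^esub> x" using c by (simp only: M.minus_add_cancel)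
  finally show ?thesis using c x by (simp add: M.minus_eq M.r_neg)
qed

end

section \<open>Splitting of the exact sequence by means of the dual basis\<close>

locale basis_setting = massey_setting G N dummy T n
  for G :: "'g topgroup" and N and dummy :: "'p::prime_card itself"
    and T :: "('p mod_ring, 'g, 't) gmodule" and n +
  fixes \<chi>s :: "('g set \<Rightarrow> 'p mod_ring) list" and ys :: "('g set \<Rightarrow> 'p mod_ring) set list"
  assumes chis: "set \<chi>s \<subseteq> character_group (G Mod N)"
    and dual: "is_dual_basis (W n) (map (p_gr G N n) \<chi>s) ys"
begin

abbreviation "I \<equiv> {..<length \<chi>s}"
abbreviation "p i \<equiv> p_gr G N n (\<chi>s ! i)"
abbreviation "y i \<equiv> ys ! i"
abbreviation "E i \<equiv> char_setting.ew G N T n (\<chi>s ! i)"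
abbreviation "TW' \<equiv> tensor_gmod T (W n)"
abbreviation "TQ' \<equiv> tensor_gmod T (Q (Suc n))"
abbreviation "TQ0 \<equiv> tensor_gmod T (Q n)"

sublocale Wn: kmod "W n" by (rule W_kmod)
sublocale Wt: ktensor T "W n" by (rule TW_ktensor)
sublocale Wd: dgtensor G T "W n" by (rule TW)
sublocale Wm: dgmod G TW' by (rule Wd.tensor_dgmod)
sublocale Qm: dgmod G TQ' by (rule dgtensor.tensor_dgmod[OF TQ])
sublocale Q0m: dgmod G TQ0 by (rule dgtensor.tensor_dgmod[OF TQ])
sublocale inc: dghom G TW' TQ' inc by (rule inc_dghom)
sublocale prj: dghom G TQ' TQ0 prj by (rule prj_dghom)

lemma cset: "i \<in> I \<Longrightarrow> char_setting G N T n (\<chi>s ! i)"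
  using chis by (intro char_setting.intro char_setting_axioms.intro massey_setting_axioms) auto

lemma W_vs: "vectorspace class_ring (W n)"
  by (intro vectorspace.intro Wn.module_axioms class_field)

lemma y_basis: "length ys = length \<chi>s" "set ys \<subseteq> carrier (W n)" "Wn.span (set ys) = carrier (W n)"
  using dual vectorspace.basis_def[OF W_vs] by (auto simp: is_dual_basis_def ordered_basis_def)

lemma y_closed: "i \<in> I \<Longrightarrow> y i \<in> carrier (W n)"
  using y_basis(1,2) by (metis lessThan_iff nth_mem subsetD)

lemma p_y: "\<lbrakk>i \<in> I; j \<in> I\<rbrakk> \<Longrightarrow> p i (y j) = (if i = j then 1 else 0)"
  using dual by (simp add: is_dual_basis_def)

lemma p_ops:
  assumes i: "i \<in> I" and w: "w \<in> carrier (W n)"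
  shows p_smult: "p i (c \<odot>\<^bsub>W n\<^esub> w) = c * p i w"
    and p_add: "w' \<in> carrier (W n) \<Longrightarrow> p i (w \<oplus>\<^bsub>W n\<^esub> w') = p i w + p i w'"
proof -
  interpret c: char_setting G N dummy T n "\<chi>s ! i" by (rule cset[OF i])
  have "p i \<in> carrier (dual_mod (H.gr n))" unfolding c.p_gr_eq by (rule c.X.gr_fun_dual[OF np])
  then show "p i (c \<odot>\<^bsub>W n\<^esub> w) = c * p i w" "w' \<in> carrier (W n) \<Longrightarrow> p i (w \<oplus>\<^bsub>W n\<^esub> w') = p i w + p i w'"
    using w unfolding dual_mod_simps W_simps by simp_all
qed

text \<open>Both sides are linear in w and agree on the basis vectors y_j by duality.\<close>

lemma W_expand:
  assumes "w \<in> carrier (W n)" shows "(\<Oplus>\<^bsub>W n\<^esub>i\<in>I. p i w \<odot>\<^bsub>W n\<^esub> y i) = w"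
proof -
  have L: "(\<lambda>w. \<Oplus>\<^bsub>W n\<^esub>i\<in>I. p i w \<odot>\<^bsub>W n\<^esub> y i) \<in> lin_maps (W n) (W n)"
  proof (rule lin_finsum_map[OF W_kmod W_kmod])
    fix i assume i: "i \<in> I"
    show "(\<lambda>w. p i w \<odot>\<^bsub>W n\<^esub> y i) \<in> lin_maps (W n) (W n)"
      by (rule lin_mapsI)
        (simp_all only: p_add[OF i] p_smult[OF i] Wn.sm_closed y_closed[OF i] Wn.sm_add_left Wn.sm_assoc)
  qed simp
  let ?K = "{w \<in> carrier (W n). (\<Oplus>\<^bsub>W n\<^esub>i\<in>I. p i w \<odot>\<^bsub>W n\<^esub> y i) = w}"
  have K: "submodule class_ring ?K (W n)" by (rule Wn.eq_on_sub[OF L Wd.id_lin W_kmod])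
  have "set ys \<subseteq> ?K"
  proof
    fix w assume w: "w \<in> set ys"
    then obtain j where j: "j \<in> I" "w = y j" using y_basis(1) by (auto simp: in_set_conv_nth)
    have "(\<Oplus>\<^bsub>W n\<^esub>i\<in>I. p i w \<odot>\<^bsub>W n\<^esub> y i) = (\<Oplus>\<^bsub>W n\<^esub>i\<in>I. if j = i then y i else \<zero>\<^bsub>W n\<^esub>)"
    proof (rule Wn.finsum_cong'[OF refl])
      show "(\<lambda>i. if j = i then y i else \<zero>\<^bsub>W n\<^esub>) \<in> I \<rightarrow> carrier (W n)"
        using y_closed Wn.zero_closed by (simp only: Pi_iff split: if_split) blast
      show "p i w \<odot>\<^bsub>W n\<^esub> y i = (if j = i then y i else \<zero>\<^bsub>W n\<^esub>)" if i: "i \<in> I" for i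
        unfolding j(2) p_y[OF i j(1)] using Wn.sm_one[OF y_closed[OF i]] Wn.sm_zero[OF y_closed[OF i]]
        by (cases "i = j") simp_all
    qed
    also have "\<dots> = y j" by (rule Wn.add.finprod_singleton) (use j y_closed in auto)
    finally show "w \<in> ?K" using y_closed[OF j(1)] j(2) by simp
  qed
  then have "Wn.span (set ys) \<subseteq> ?K" by (rule Wn.span_subset_sub[OF _ K])
  then show ?thesis using assms y_basis(3) by blast
qed

text \<open>A linear retraction of \<open>inc\<close>. It exists because each p_i extends to B_n on
  all of Omega/I^(n+1); the extension is not compatible with the action in general.\<close>

definition ret :: "('t \<times> ('g set \<Rightarrow> 'p mod_ring) set \<Rightarrow> 'p mod_ring) set
    \<Rightarrow> ('t \<times> ('g set \<Rightarrow> 'p mod_ring) set \<Rightarrow> 'p mod_ring) set" where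
  "ret z = (\<Oplus>\<^bsub>tensor T (W n)\<^esub>i\<in>I. tens T (W n) (char_setting.ev G N T (\<chi>s ! i) n z) (y i))"

lemma ret_lin: "ret \<in> lin_maps (tensor T (Q (Suc n))) (tensor T (W n))"
  unfolding ret_def[abs_def]
proof (rule lin_finsum_map[OF ktensor.tensor_kmod[OF TQ_ktensor] Wt.tensor_kmod])
  fix i assume i: "i \<in> I"
  have "n < Suc n" by simp
  then show "(\<lambda>z. tens T (W n) (char_setting.ev G N T (\<chi>s ! i) n z) (y i)) \<in> lin_maps (tensor T (Q (Suc n))) (tensor T (W n))"
    by (intro lin_comp[OF char_setting.ev_lin[OF cset[OF i] _ np] Wt.tens_lin_left[OF y_closed[OF i]]])
qed simp

lemma ew_eq: "i \<in> I \<Longrightarrow> E i z = char_setting.ev G N T (\<chi>s ! i) n (inc z)"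
  by (rule char_setting.ew_def[OF cset])

text \<open>On a pure tensor the scalars p_i(w) move across the tensor sign and
  \<open>W_expand\<close> reassembles w. In particular \<open>inc\<close> is injective.\<close>

lemma ret_inc:
  assumes z: "z \<in> carrier (tensor T (W n))" shows "ret (inc z) = z"
proof (rule Wt.tensor_lin_eqI[OF lin_comp[OF inc_lin ret_lin] Wd.id_lin _ z])
  fix t w assume t: "t \<in> carrier T" and w: "w \<in> carrier (W n)"
  note tl = Wt.tens_lin_right[OF t]
  have "ret (inc (tens T (W n) t w)) = (\<Oplus>\<^bsub>tensor T (W n)\<^esub>i\<in>I. tens T (W n) t (p i w \<odot>\<^bsub>W n\<^esub> y i))"
    unfolding ret_def
  proof (rule Wt.T.finsum_cong'[OF refl])
    show "(\<lambda>i. tens T (W n) t (p i w \<odot>\<^bsub>W n\<^esub> y i)) \<in> I \<rightarrow> carrier (tensor T (W n))"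
      by (intro Pi_I Wt.tens_closed[OF t] Wn.sm_closed y_closed)
    fix i assume i: "i \<in> I"
    show "tens T (W n) (char_setting.ev G N T (\<chi>s ! i) n (inc (tens T (W n) t w))) (y i) = tens T (W n) t (p i w \<odot>\<^bsub>W n\<^esub> y i)"
      unfolding ew_eq[OF i, symmetric] char_setting.ew_tens[OF cset[OF i] t w]
        lin_smult[OF tl y_closed[OF i]] lin_smult[OF Wt.tens_lin_left[OF y_closed[OF i]] t] ..
  qed
  also have "\<dots> = tens T (W n) t (\<Oplus>\<^bsub>W n\<^esub>i\<in>I. p i w \<odot>\<^bsub>W n\<^esub> y i)"
    by (rule lin_finsum[OF W_kmod Wt.tensor_kmod tl, symmetric]) (intro Pi_I Wn.sm_closed y_closed)
  finally show "ret (inc (tens T (W n) t w)) = tens T (W n) t w" unfolding W_expand[OF w] .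
qed

lemma tensor_expand:
  assumes "z \<in> carrier (tensor T (W n))"
  shows "(\<Oplus>\<^bsub>tensor T (W n)\<^esub>i\<in>I. tens T (W n) (E i z) (y i)) = z"
proof -
  have "(\<Oplus>\<^bsub>tensor T (W n)\<^esub>i\<in>I. tens T (W n) (E i z) (y i)) = ret (inc z)"
    unfolding ret_def
  proof (rule Wt.T.finsum_cong'[OF refl])
    show "(\<lambda>i. tens T (W n) (char_setting.ev G N T (\<chi>s ! i) n (inc z)) (y i)) \<in> I \<rightarrow> carrier (tensor T (W n))"
    proof
      fix i assume i: "i \<in> I"
      show "tens T (W n) (char_setting.ev G N T (\<chi>s ! i) n (inc z)) (y i) \<in> carrier (tensor T (W n))"
        unfolding ew_eq[OF i, symmetric]
        by (rule Wt.tens_closed[OF lin_closed[OF char_setting.ew_lin[OF cset[OF i]] assms] y_closed[OF i]])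
    qed
  qed (simp only: ew_eq)
  then show ?thesis using ret_inc[OF assms] by simp
qed

sublocale Q1: kmod "Q (Suc n)" by (rule Q_kmod)
sublocale Q1t: ktensor T "Q (Suc n)" by (rule TQ_ktensor)

lemma y_Q: "i \<in> I \<Longrightarrow> y i \<in> carrier (Q (Suc n))"
  by (rule W_sub_Q[OF y_closed])

text \<open>The component of x along the y_i, as an element of Omega/I^(n+1). On I^n it is the class
  of x itself, so it acts as a projection onto I^n/I^(n+1).\<close>

definition rq :: "('g set \<Rightarrow> 'p mod_ring) \<Rightarrow> ('g set \<Rightarrow> 'p mod_ring) set" where
  "rq x = (\<Oplus>\<^bsub>Q (Suc n)\<^esub>i\<in>I. character.bfun (G Mod N) (\<chi>s ! i) n x \<odot>\<^bsub>Q (Suc n)\<^esub> y i)"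

lemma rq_lin: "rq \<in> lin_maps Om (Q (Suc n))"
  unfolding rq_def[abs_def]
proof (rule lin_finsum_map[OF H.ga_kmod Q_kmod])
  fix i assume i: "i \<in> I"
  interpret c: char_setting G N dummy T n "\<chi>s ! i" by (rule cset[OF i])
  show "(\<lambda>x. c.X.bfun n x \<odot>\<^bsub>Q (Suc n)\<^esub> y i) \<in> lin_maps Om (Q (Suc n))"
    by (rule lin_mapsI)
      (simp_all only: c.X.bfun_add c.X.bfun_smult Q1.sm_closed y_Q[OF i] Q1.sm_add_left Q1.sm_assoc)
qed simp

lemma rq_Ipow: "x \<in> Ipow n \<Longrightarrow> rq x = cs (Suc n) x"
proof -
  assume x: "x \<in> Ipow n"
  have w: "cs (Suc n) x \<in> carrier (W n)" unfolding W_simps by (rule H.gr_coset_closed[OF x])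
  have "rq x = (\<Oplus>\<^bsub>Q (Suc n)\<^esub>i\<in>I. p i (cs (Suc n) x) \<odot>\<^bsub>W n\<^esub> y i)"
    unfolding rq_def
  proof (rule Q1.finsum_cong'[OF refl])
    show "(\<lambda>i. p i (cs (Suc n) x) \<odot>\<^bsub>W n\<^esub> y i) \<in> I \<rightarrow> carrier (Q (Suc n))"
      by (intro Pi_I W_sub_Q Wn.sm_closed y_closed)
    fix i assume i: "i \<in> I"
    interpret c: char_setting G N dummy T n "\<chi>s ! i" by (rule cset[OF i])
    show "c.X.bfun n x \<odot>\<^bsub>Q (Suc n)\<^esub> y i = p i (cs (Suc n) x) \<odot>\<^bsub>W n\<^esub> y i"
      unfolding c.p_gr_eq c.X.gr_fun_coset[OF x np] by (rule W_smult[OF y_closed[OF i], symmetric])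
  qed
  also have "\<dots> = (\<Oplus>\<^bsub>W n\<^esub>i\<in>I. p i (cs (Suc n) x) \<odot>\<^bsub>W n\<^esub> y i)"
    by (rule lin_finsum[OF W_kmod Q_kmod W_incl_lin, symmetric]) (intro Pi_I Wn.sm_closed y_closed)
  finally show ?thesis unfolding W_expand[OF w] .
qed

text \<open>The complementary part: the class of x minus its component \<open>rq x\<close>. It
  vanishes on I^n and therefore descends to Omega/I^n, which provides a linear map back to
  Omega/I^(n+1).\<close>

definition sq :: "('g set \<Rightarrow> 'p mod_ring) set \<Rightarrow> ('g set \<Rightarrow> 'p mod_ring) set" where
  "sq = quot_lift (\<lambda>x. cs (Suc n) x \<oplus>\<^bsub>Q (Suc n)\<^esub> (-1) \<odot>\<^bsub>Q (Suc n)\<^esub> rq x)"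

lemma sq_pre_lin: "(\<lambda>x. cs (Suc n) x \<oplus>\<^bsub>Q (Suc n)\<^esub> (-1) \<odot>\<^bsub>Q (Suc n)\<^esub> rq x) \<in> lin_maps Om (Q (Suc n))"
proof (rule lin_mapsI)
  note a = lin_add[OF cs_lin[of "Suc n"]] lin_add[OF rq_lin] lin_smult[OF cs_lin[of "Suc n"]] lin_smult[OF rq_lin]
  fix x x' c assume x: "x \<in> carrier Om"
  have xc: "cs (Suc n) x \<in> carrier (Q (Suc n))" "rq x \<in> carrier (Q (Suc n))" using x lin_closed[OF cs_lin] lin_closed[OF rq_lin] by blast+
  show "cs (Suc n) x \<oplus>\<^bsub>Q (Suc n)\<^esub> (-1) \<odot>\<^bsub>Q (Suc n)\<^esub> rq x \<in> carrier (Q (Suc n))"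
    by (rule Q1.a_closed[OF xc(1) Q1.sm_closed[OF xc(2)]])
  show "cs (Suc n) (c \<odot>\<^bsub>Om\<^esub> x) \<oplus>\<^bsub>Q (Suc n)\<^esub> (-1) \<odot>\<^bsub>Q (Suc n)\<^esub> rq (c \<odot>\<^bsub>Om\<^esub> x) =
      c \<odot>\<^bsub>Q (Suc n)\<^esub> (cs (Suc n) x \<oplus>\<^bsub>Q (Suc n)\<^esub> (-1) \<odot>\<^bsub>Q (Suc n)\<^esub> rq x)"
    unfolding a(3)[OF x] a(4)[OF x] Q1.sm_add_right[OF xc(1) Q1.sm_closed[OF xc(2)]] Q1.sm_assoc[OF xc(2), symmetric]
    by (simp only: mult.commute)
  assume x': "x' \<in> carrier Om"
  have xc': "cs (Suc n) x' \<in> carrier (Q (Suc n))" "rq x' \<in> carrier (Q (Suc n))" using x' lin_closed[OF cs_lin] lin_closed[OF rq_lin] by blast+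
  show "cs (Suc n) (x \<oplus>\<^bsub>Om\<^esub> x') \<oplus>\<^bsub>Q (Suc n)\<^esub> (-1) \<odot>\<^bsub>Q (Suc n)\<^esub> rq (x \<oplus>\<^bsub>Om\<^esub> x') =
      (cs (Suc n) x \<oplus>\<^bsub>Q (Suc n)\<^esub> (-1) \<odot>\<^bsub>Q (Suc n)\<^esub> rq x) \<oplus>\<^bsub>Q (Suc n)\<^esub> (cs (Suc n) x' \<oplus>\<^bsub>Q (Suc n)\<^esub> (-1) \<odot>\<^bsub>Q (Suc n)\<^esub> rq x')"
    unfolding a(1)[OF x x'] a(2)[OF x x'] Q1.sm_add_right[OF xc(2) xc'(2)]
    by (simp only: Q1.a_ac Q1.a_closed Q1.sm_closed xc xc')
qed

lemma sq_pre_null: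
  assumes x: "x \<in> Ipow n"
  shows "cs (Suc n) x \<oplus>\<^bsub>Q (Suc n)\<^esub> (-1) \<odot>\<^bsub>Q (Suc n)\<^esub> rq x = \<zero>\<^bsub>Q (Suc n)\<^esub>"
proof -
  have "cs (Suc n) x \<in> carrier (Q (Suc n))" by (rule lin_closed[OF cs_lin H.aug_id_pow_carrier[OF x]])
  then show ?thesis unfolding rq_Ipow[OF x] by (simp only: Q1.sm_minus_one Q1.r_neg)
qed

lemma sq_cs: "x \<in> carrier Om \<Longrightarrow> sq (cs n x) = cs (Suc n) x \<oplus>\<^bsub>Q (Suc n)\<^esub> (-1) \<odot>\<^bsub>Q (Suc n)\<^esub> rq x"
  unfolding sq_def by (rule kquot.quot_lift_lin_coset[OF Om_kquot sq_pre_lin Q_kmod sq_pre_null])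

lemma sq_lin: "sq \<in> lin_maps (Q n) (Q (Suc n))"
proof -
  have "sq \<in> lin_maps (quot_mod Om (Ipow n)) (Q (Suc n))"
    unfolding sq_def by (rule kquot.quot_lift_lin_maps[OF Om_kquot sq_pre_lin Q_kmod sq_pre_null])
  then show ?thesis by (simp add: module_hom_def)
qed

abbreviation "sec \<equiv> tmap T (Q (Suc n)) sq"
lemmas sec_lin = tmap_lin[OF T.M.kmod_axioms' Q_kmod Q_kmod sq_lin]
lemmas sec_tens = tmap_tens[OF T.M.kmod_axioms' Q_kmod Q_kmod sq_lin]

text \<open>The splitting identity for the sequence tensored with T. It is checked on pure tensors,
  where it reduces to writing q as q minus \<open>rq x\<close> plus \<open>rq x\<close>; exactness
  in the middle follows from it.\<close>

lemma sec_prj: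
  assumes z: "z \<in> carrier (tensor T (Q (Suc n)))"
  shows "sec (prj z) \<oplus>\<^bsub>tensor T (Q (Suc n))\<^esub> inc (ret z) = z"
proof (rule Q1t.tensor_lin_eqI[OF _ Wd.id_lin _ z])
  show "(\<lambda>z. sec (prj z) \<oplus>\<^bsub>tensor T (Q (Suc n))\<^esub> inc (ret z)) \<in> lin_maps (tensor T (Q (Suc n))) (tensor T (Q (Suc n)))"
  proof (rule lin_mapsI)
    note A = lin_comp[OF prj_lin sec_lin] and B = lin_comp[OF ret_lin inc_lin]
    fix x x' c assume x: "x \<in> carrier (tensor T (Q (Suc n)))"
    note cl = lin_closed[OF A x] lin_closed[OF B x]
    show "sec (prj x) \<oplus>\<^bsub>tensor T (Q (Suc n))\<^esub> inc (ret x) \<in> carrier (tensor T (Q (Suc n)))" by (rule Q1t.T.a_closed[OF cl])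
    show "sec (prj (c \<odot>\<^bsub>tensor T (Q (Suc n))\<^esub> x)) \<oplus>\<^bsub>tensor T (Q (Suc n))\<^esub> inc (ret (c \<odot>\<^bsub>tensor T (Q (Suc n))\<^esub> x)) =
        c \<odot>\<^bsub>tensor T (Q (Suc n))\<^esub> (sec (prj x) \<oplus>\<^bsub>tensor T (Q (Suc n))\<^esub> inc (ret x))"
      unfolding lin_smult[OF A x] lin_smult[OF B x] by (rule Q1t.T.sm_add_right[OF cl, symmetric])
    assume x': "x' \<in> carrier (tensor T (Q (Suc n)))"
    note cl' = lin_closed[OF A x'] lin_closed[OF B x']
    show "sec (prj (x \<oplus>\<^bsub>tensor T (Q (Suc n))\<^esub> x')) \<oplus>\<^bsub>tensor T (Q (Suc n))\<^esub> inc (ret (x \<oplus>\<^bsub>tensor T (Q (Suc n))\<^esub> x')) =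
        (sec (prj x) \<oplus>\<^bsub>tensor T (Q (Suc n))\<^esub> inc (ret x)) \<oplus>\<^bsub>tensor T (Q (Suc n))\<^esub> (sec (prj x') \<oplus>\<^bsub>tensor T (Q (Suc n))\<^esub> inc (ret x'))"
      unfolding lin_add[OF A x x'] lin_add[OF B x x']
      by (simp only: Q1t.T.a_ac Q1t.T.a_closed cl cl')
  qed
  fix t q assume t: "t \<in> carrier T" and q: "q \<in> carrier (Q (Suc n))"
  obtain x where x: "x \<in> carrier Om" "q = cs (Suc n) x" using q by (rule QE)
  note tl = Q1t.tens_lin_right[OF t]
  have rc: "rq x \<in> carrier (Q (Suc n))" by (rule lin_closed[OF rq_lin x(1)])
  have nn: "n < Suc n" by simp
  have ec: "tens T (W n) (char_setting.ev G N T (\<chi>s ! i) n z) (y i) \<in> carrier (tensor T (W n))"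
    if "i \<in> I" "z \<in> carrier (tensor T (Q (Suc n)))" for i z
    by (rule Wt.tens_closed[OF lin_closed[OF char_setting.ev_lin[OF cset[OF that(1)] nn np] that(2)] y_closed[OF that(1)]])
  have "inc (ret (tens T (Q (Suc n)) t q)) =
      (\<Oplus>\<^bsub>tensor T (Q (Suc n))\<^esub>i\<in>I. inc (tens T (W n) (char_setting.ev G N T (\<chi>s ! i) n (tens T (Q (Suc n)) t q)) (y i)))"
    unfolding ret_def by (rule lin_finsum[OF Wt.tensor_kmod Q1t.tensor_kmod inc_lin]) (intro Pi_I ec Q1t.tens_closed t q)
  also have "\<dots> = (\<Oplus>\<^bsub>tensor T (Q (Suc n))\<^esub>i\<in>I. tens T (Q (Suc n)) t (character.bfun (G Mod N) (\<chi>s ! i) n x \<odot>\<^bsub>Q (Suc n)\<^esub> y i))"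
  proof (rule Q1t.T.finsum_cong'[OF refl])
    show "(\<lambda>i. tens T (Q (Suc n)) t (character.bfun (G Mod N) (\<chi>s ! i) n x \<odot>\<^bsub>Q (Suc n)\<^esub> y i)) \<in> I \<rightarrow> carrier (tensor T (Q (Suc n)))"
      by (intro Pi_I Q1t.tens_closed[OF t] Q1.sm_closed y_Q)
    fix i assume i: "i \<in> I"
    interpret c: char_setting G N dummy T n "\<chi>s ! i" by (rule cset[OF i])
    have e: "c.ev n (tens T (Q (Suc n)) t q) = c.X.bfun n x \<odot>\<^bsub>T\<^esub> t"
      using c.ev_tens[OF nn np t q] unfolding x(2) c.bq_cs[OF nn np x(1)] .
    show "inc (tens T (W n) (c.ev n (tens T (Q (Suc n)) t q)) (y i)) = tens T (Q (Suc n)) t (c.X.bfun n x \<odot>\<^bsub>Q (Suc n)\<^esub> y i)"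
      unfolding e inc_tens[OF T.M.sm_closed[OF t] y_closed[OF i]] lin_smult[OF tl y_Q[OF i]]
        lin_smult[OF Q1t.tens_lin_left[OF y_Q[OF i]] t] ..
  qed
  also have "\<dots> = tens T (Q (Suc n)) t (rq x)"
    unfolding rq_def by (rule lin_finsum[OF Q_kmod Q1t.tensor_kmod tl, symmetric]) (intro Pi_I Q1.sm_closed y_Q)
  finally have r: "inc (ret (tens T (Q (Suc n)) t q)) = tens T (Q (Suc n)) t (rq x)" .
  have s: "sec (prj (tens T (Q (Suc n)) t q)) = tens T (Q (Suc n)) t (q \<oplus>\<^bsub>Q (Suc n)\<^esub> (-1) \<odot>\<^bsub>Q (Suc n)\<^esub> rq x)"
    unfolding prj_tens[OF t q] sec_tens[OF t lin_closed[OF pq_lin q]] unfolding x(2) pq_cs[OF x(1)] sq_cs[OF x(1)] ..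
  have "(q \<oplus>\<^bsub>Q (Suc n)\<^esub> (-1) \<odot>\<^bsub>Q (Suc n)\<^esub> rq x) \<oplus>\<^bsub>Q (Suc n)\<^esub> rq x = q"
    unfolding Q1.minus_eq_sm[OF q rc, symmetric] by (rule Q1.minus_add_cancel[OF q rc])
  then show "sec (prj (tens T (Q (Suc n)) t q)) \<oplus>\<^bsub>tensor T (Q (Suc n))\<^esub> inc (ret (tens T (Q (Suc n)) t q)) = tens T (Q (Suc n)) t q"
    unfolding r s lin_add[OF tl Q1.a_closed[OF q Q1.sm_closed[OF rc]] rc, symmetric] by simp
qed

text \<open>Exactness in the middle with an explicit preimage: in \<open>sec_prj\<close> the first
  summand vanishes on the kernel of \<open>prj\<close>.\<close>

lemma inc_ret:
  assumes z: "z \<in> carrier (tensor T (Q (Suc n)))" and "prj z = \<zero>\<^bsub>tensor T (Q n)\<^esub>"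
  shows "inc (ret z) = z"
proof -
  have "sec (prj z) = \<zero>\<^bsub>tensor T (Q (Suc n))\<^esub>"
    unfolding assms(2) by (rule lin_zero[OF ktensor.tensor_kmod[OF TQ_ktensor] Q1t.tensor_kmod sec_lin])
  then show ?thesis using sec_prj[OF z] lin_closed[OF lin_comp[OF ret_lin inc_lin] z] Q1t.T.l_zero by simp
qed

end

section \<open>The natural map from H^2(G,T) tensor I^n/I^(n+1) and its left inverse\<close>

context basis_setting
begin

abbreviation "GG \<equiv> carrier G \<times> carrier G"

sublocale HT: ktensor "H2 G T" "W n"
  by (intro ktensor.intro T.H2_kmod W_kmod)

text \<open>Equivariance holds because G fixes w. It makes c -> c tensor w well defined on
  cohomology classes.\<close>

lemma tens_dghom: "w \<in> carrier (W n) \<Longrightarrow> dghom G T TW' (\<lambda>t. tens T (W n) t w)"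
proof (intro dghom.intro dghom_axioms.intro T.dgmod_axioms Wm.dgmod_axioms)
  assume w: "w \<in> carrier (W n)"
  show "(\<lambda>t. tens T (W n) t w) \<in> lin_maps T TW'" unfolding Wd.lin_tensor_gmod by (rule Wt.tens_lin_left[OF w])
  show "tens T (W n) (gact T g t) w = gact TW' g (tens T (W n) t w)" if "g \<in> carrier G" "t \<in> carrier T" for g t
    unfolding Wd.act_tens[OF that w] W_act[OF that(1) w] ..
qed

abbreviation "bh A w \<equiv> quot_lift (\<lambda>c. class2 G TW' (\<lambda>s\<in>GG. tens T (W n) (c s) w)) A"

lemma bh_class2:
  assumes "w \<in> carrier (W n)" "c \<in> Z2 G T"
  shows "bh (class2 G T c) w = class2 G TW' (\<lambda>s\<in>GG. tens T (W n) (c s) w)"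
  using dghom.H2map_class2[OF tens_dghom[OF assms(1)] assms(2)]
  unfolding dghom.H2map_def[OF tens_dghom[OF assms(1)]] .

lemma bh_bilinear: "bilinear_map (H2 G T) (W n) (H2 G TW') (\<lambda>A w. bh A w)"
proof (rule bilinear_mapI)
  fix w assume w: "w \<in> carrier (W n)"
  show "(\<lambda>A. bh A w) \<in> lin_maps (H2 G T) (H2 G TW')"
    using dghom.H2map_lin[OF tens_dghom[OF w]] unfolding dghom.H2map_def[OF tens_dghom[OF w]] .
next
  fix A assume "A \<in> carrier (H2 G T)"
  then obtain c where c: "c \<in> Z2 G T" "A = class2 G T c" by (rule T.H2E)
  have cc: "c s \<in> carrier T" if "s \<in> GG" for s using that T.Z2_closed[OF c(1)] by auto
  let ?t = "\<lambda>w. \<lambda>s\<in>GG. tens T (W n) (c s) w"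
  have tZ: "?t w \<in> carrier Wm.Z2mod" if "w \<in> carrier (W n)" for w
    unfolding Wm.Z2mod_simps(1) by (rule dghom.map_Z2[OF tens_dghom[OF that] c(1)])
  have "(\<lambda>w. class2 G TW' (?t w)) \<in> lin_maps (W n) (H2 G TW')"
  proof (rule lin_comp[OF lin_mapsI Wm.class2_lin])
    show "?t w \<in> carrier Wm.Z2mod" if "w \<in> carrier (W n)" for w by (rule tZ[OF that])
    show "?t (w \<oplus>\<^bsub>W n\<^esub> w') = ?t w \<oplus>\<^bsub>Wm.Z2mod\<^esub> ?t w'" if "w \<in> carrier (W n)" "w' \<in> carrier (W n)" for w w'
      unfolding Wm.Z2mod_simps(3)
    proof (rule restrict_ext)
      fix s assume s: "s \<in> GG"
      show "tens T (W n) (c s) (w \<oplus>\<^bsub>W n\<^esub> w') = ?t w s \<oplus>\<^bsub>TW'\<^esub> ?t w' s"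
        unfolding restrict_apply'[OF s] lin_add[OF Wt.tens_lin_right[OF cc[OF s]] that] Wd.tensor_gmod_simps ..
    qed
    show "?t (k \<odot>\<^bsub>W n\<^esub> w) = k \<odot>\<^bsub>Wm.Z2mod\<^esub> ?t w" if "w \<in> carrier (W n)" for k w
      unfolding Wm.Z2mod_simps(4)
    proof (rule restrict_ext)
      fix s assume s: "s \<in> GG"
      show "tens T (W n) (c s) (k \<odot>\<^bsub>W n\<^esub> w) = k \<odot>\<^bsub>TW'\<^esub> ?t w s"
        unfolding restrict_apply'[OF s] lin_smult[OF Wt.tens_lin_right[OF cc[OF s]] that] Wd.tensor_gmod_simps ..
    qed
  qed
  note L = this
  show "(\<lambda>w. bh A w) \<in> lin_maps (W n) (H2 G TW')"
  proof (rule lin_mapsI)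
    note e = bh_class2[OF _ c(1), folded c(2)]
    fix w w' k assume w: "w \<in> carrier (W n)"
    show "bh A w \<in> carrier (H2 G TW')" unfolding e[OF w] by (rule lin_closed[OF L w])
    show "bh A (k \<odot>\<^bsub>W n\<^esub> w) = k \<odot>\<^bsub>H2 G TW'\<^esub> bh A w"
      unfolding e[OF w] e[OF Wn.sm_closed[OF w]] by (rule lin_smult[OF L w])
    assume w': "w' \<in> carrier (W n)"
    show "bh A (w \<oplus>\<^bsub>W n\<^esub> w') = bh A w \<oplus>\<^bsub>H2 G TW'\<^esub> bh A w'"
      unfolding e[OF w] e[OF w'] e[OF Wn.a_closed[OF w w']] by (rule lin_add[OF L w w'])
  qed
qed

lemma H2t_lin: "H2_tensor_map G T (W n) \<in> lin_maps (tensor (H2 G T) (W n)) (H2 G TW')"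
  unfolding H2_tensor_map_def by (rule HT.tensor_lift_lin[OF bh_bilinear Wm.H2_kmod])

lemma H2t_tens:
  assumes "c \<in> Z2 G T" "w \<in> carrier (W n)"
  shows "H2_tensor_map G T (W n) (tens (H2 G T) (W n) (class2 G T c) w) = class2 G TW' (\<lambda>s\<in>GG. tens T (W n) (c s) w)"
  unfolding H2_tensor_map_def HT.tensor_lift_tens[OF bh_bilinear Wm.H2_kmod T.class2_closed[OF assms(1)] assms(2)]
  by (rule bh_class2[OF assms(2,1)])

lemma ew_hom: "i \<in> I \<Longrightarrow> dghom G TW' T (E i)"
  by (rule char_setting.ew_dghom[OF cset])

text \<open>Applies the equivariant maps induced by the p_i to a class and attaches the basis
  vectors y_i. Being a left inverse suffices: it gives the injectivity that \<open>inv_into\<close>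
  in \<open>Psi\<close> relies on.\<close>

definition H2inv :: "('g \<times> 'g \<Rightarrow> ('t \<times> ('g set \<Rightarrow> 'p mod_ring) set \<Rightarrow> 'p mod_ring) set) set
    \<Rightarrow> (('g \<times> 'g \<Rightarrow> 't) set \<times> ('g set \<Rightarrow> 'p mod_ring) set \<Rightarrow> 'p mod_ring) set" where
  "H2inv B = (\<Oplus>\<^bsub>tensor (H2 G T) (W n)\<^esub>i\<in>I. tens (H2 G T) (W n) (dghom.H2map G T (E i) B) (y i))"

lemma H2inv_lin: "H2inv \<in> lin_maps (H2 G TW') (tensor (H2 G T) (W n))"
  unfolding H2inv_def[abs_def]
proof (rule lin_finsum_map[OF Wm.H2_kmod HT.tensor_kmod])
  fix i assume i: "i \<in> I"
  show "(\<lambda>B. tens (H2 G T) (W n) (dghom.H2map G T (E i) B) (y i)) \<in> lin_maps (H2 G TW') (tensor (H2 G T) (W n))"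
    by (rule lin_comp[OF dghom.H2map_lin[OF ew_hom[OF i]] HT.tens_lin_left[OF y_closed[OF i]]])
qed simp

text \<open>On cocycles c tensor w, the i-th map produces p_i(w) c. Moving the scalar to the other
  factor leaves the expansion of w in the y_i.\<close>

lemma H2inv_H2t:
  assumes z: "z \<in> carrier (tensor (H2 G T) (W n))"
  shows "H2inv (H2_tensor_map G T (W n) z) = z"
proof (rule HT.tensor_lin_eqI[OF lin_comp[OF H2t_lin H2inv_lin] Wd.id_lin _ z])
  fix A w assume A: "A \<in> carrier (H2 G T)" and w: "w \<in> carrier (W n)"
  obtain c where c: "c \<in> Z2 G T" "A = class2 G T c" using A by (rule T.H2E)
  have cc: "c s \<in> carrier T" if "s \<in> GG" for s using that T.Z2_closed[OF c(1)] by auto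
  have cZ: "(\<lambda>s\<in>GG. tens T (W n) (c s) w) \<in> Z2 G TW'" by (rule dghom.map_Z2[OF tens_dghom[OF w] c(1)])
  note tl = HT.tens_lin_right[OF A]
  have "H2inv (H2_tensor_map G T (W n) (tens (H2 G T) (W n) A w)) =
      (\<Oplus>\<^bsub>tensor (H2 G T) (W n)\<^esub>i\<in>I. tens (H2 G T) (W n) A (p i w \<odot>\<^bsub>W n\<^esub> y i))"
    unfolding H2inv_def
  proof (rule HT.T.finsum_cong'[OF refl])
    show "(\<lambda>i. tens (H2 G T) (W n) A (p i w \<odot>\<^bsub>W n\<^esub> y i)) \<in> I \<rightarrow> carrier (tensor (H2 G T) (W n))"
      by (intro Pi_I HT.tens_closed[OF A] Wn.sm_closed y_closed)
    fix i assume i: "i \<in> I"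
    have "(\<lambda>s\<in>GG. E i ((\<lambda>s\<in>GG. tens T (W n) (c s) w) s)) = p i w \<odot>\<^bsub>T.Z2mod\<^esub> c"
      unfolding T.Z2mod_simps(4)
    proof (rule restrict_ext)
      fix s assume s: "s \<in> GG"
      show "E i ((\<lambda>s\<in>GG. tens T (W n) (c s) w) s) = p i w \<odot>\<^bsub>T\<^esub> c s"
        unfolding restrict_apply'[OF s] by (rule char_setting.ew_tens[OF cset[OF i] cc[OF s] w])
    qed
    then have "dghom.H2map G T (E i) (H2_tensor_map G T (W n) (tens (H2 G T) (W n) A w)) = class2 G T (p i w \<odot>\<^bsub>T.Z2mod\<^esub> c)"
      unfolding c(2) H2t_tens[OF c(1) w] dghom.H2map_class2[OF ew_hom[OF i] cZ] by (rule arg_cong)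
    also have "\<dots> = p i w \<odot>\<^bsub>H2 G T\<^esub> A"
      unfolding c(2) by (rule lin_smult[OF T.class2_lin]) (simp only: T.Z2mod_simps(1) c(1))
    finally have e: "dghom.H2map G T (E i) (H2_tensor_map G T (W n) (tens (H2 G T) (W n) A w)) = p i w \<odot>\<^bsub>H2 G T\<^esub> A" .
    show "tens (H2 G T) (W n) (dghom.H2map G T (E i) (H2_tensor_map G T (W n) (tens (H2 G T) (W n) A w))) (y i) =
        tens (H2 G T) (W n) A (p i w \<odot>\<^bsub>W n\<^esub> y i)"
      unfolding e lin_smult[OF tl y_closed[OF i]] by (rule lin_smult[OF HT.tens_lin_left[OF y_closed[OF i]] A])
  qed
  also have "\<dots> = tens (H2 G T) (W n) A (\<Oplus>\<^bsub>W n\<^esub>i\<in>I. p i w \<odot>\<^bsub>W n\<^esub> y i)"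
    by (rule lin_finsum[OF W_kmod HT.tensor_kmod tl, symmetric]) (intro Pi_I Wn.sm_closed y_closed)
  finally show "H2inv (H2_tensor_map G T (W n) (tens (H2 G T) (W n) A w)) = tens (H2 G T) (W n) A w"
    unfolding W_expand[OF w] .
qed

text \<open>By \<open>ev_d1\<close> the two cocycles differ by the coboundary of B_n composed with
  the lift F; the choice of F thus affects only the cochain, not its class.\<close>

lemma massey_class:
  assumes F: "F \<in> C1 G TQ'" and c: "c \<in> Z2 G TW'"
    and Ff: "\<And>g. g \<in> carrier G \<Longrightarrow> prj (F g) = f g"
    and ic: "\<And>g h. \<lbrakk>g \<in> carrier G; h \<in> carrier G\<rbrakk> \<Longrightarrow> inc (c (g, h)) = d1 G TQ' F (g, h)"
    and i: "i \<in> I"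
  shows "massey G T n (attached_system G N T n (\<chi>s ! i) f) = class2 G T (\<lambda>s\<in>GG. E i (c s))"
proof -
  interpret x: char_setting G N dummy T n "\<chi>s ! i" by (rule cset[OF i])
  have Fc: "F g \<in> carrier (tensor T (Q (Suc n)))" if "g \<in> carrier G" for g
    using Qm.C1_closed[OF F that] unfolding dgtensor.tensor_gmod_simps(1)[OF TQ] .
  have fc: "f g \<in> carrier (tensor T (Q n))" if "g \<in> carrier G" for g
    using lin_closed[OF prj_lin Fc[OF that]] unfolding Ff[OF that] .
  have nn: "n < Suc n" by simp
  let ?u = "\<lambda>s\<in>carrier G. x.ev n (F s)" and ?m = "x.massey_cochain f"
  have uc: "x.ev n (F s) \<in> carrier T" if "s \<in> carrier G" for s by (rule x.ev_closed[OF nn np Fc[OF that]])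
  have lcF: "loc_const (gtop G) F" using F by (simp add: Qm.C1_iff)
  have "loc_const (gtop G) ?u"
    by (rule loc_const_cong[OF loc_const_comp[OF lcF, of "x.ev n"]]) (simp add: G.top)
  then have u: "?u \<in> C1 G T" using uc by (simp add: T.C1_iff)
  have cZ: "(\<lambda>s\<in>GG. E i (c s)) \<in> Z2 G T" by (rule dghom.map_Z2[OF ew_hom[OF i] c])
  have m1: "x.massey_cochain (\<lambda>s. prj (F s)) = ?m"
    unfolding x.massey_cochain_def
  proof (rule restrict_ext, clarify)
    fix g h assume "g \<in> carrier G" and h: "h \<in> carrier G"
    show "(\<Oplus>\<^bsub>T\<^esub>j\<in>{1..n}. binom j ((\<chi>s ! i) (pr g)) \<odot>\<^bsub>T\<^esub> gact T g (x.ev (n - j) (prj (F h)))) =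
        (\<Oplus>\<^bsub>T\<^esub>j\<in>{1..n}. binom j ((\<chi>s ! i) (pr g)) \<odot>\<^bsub>T\<^esub> gact T g (x.ev (n - j) (f h)))"
      unfolding Ff[OF h] ..
  qed
  have mc: "?m (g, h) \<in> carrier T" if "g \<in> carrier G" "h \<in> carrier G" for g h
  proof -
    have "x.ev (n - j) (f h) \<in> carrier T" if "j \<in> {1..n}" for j
      using that n1 np by (intro x.ev_closed[of _ n] fc \<open>h \<in> carrier G\<close>) auto
    then have "(\<lambda>j. binom j ((\<chi>s ! i) (pr g)) \<odot>\<^bsub>T\<^esub> gact T g (x.ev (n - j) (f h))) \<in> {1..n} \<rightarrow> carrier T"
      using that by (intro Pi_I) simp
    from T.M.finsum_closed[OF this] show ?thesis using that by (simp add: x.massey_cochain_def)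
  qed
  have key: "E i (c (g, h)) = d1 G T ?u (g, h) \<oplus>\<^bsub>T\<^esub> ?m (g, h)" if "g \<in> carrier G" "h \<in> carrier G" for g h
    using x.ev_d1[of F g h] Fc that unfolding m1 x.ew_def ic[OF that] by (simp add: Pi_iff)
  \<comment> \<open>\<open>class2_cobound\<close> wants the Massey cochain expressed as a coboundary
    plus E_i(c), so the cochain u enters with the opposite sign.\<close>
  note v = T.d1_smult[OF u, of "- 1"]
  have "class2 G T ?m = class2 G T (\<lambda>s\<in>GG. E i (c s))"
  proof (rule T.class2_cobound(2)[OF cZ v(1)])
    show "?m \<in> extensional GG" by (simp add: x.massey_cochain_def)
    fix g h assume gh: "g \<in> carrier G" "h \<in> carrier G"
    have dc: "d1 G T ?u (g, h) \<in> carrier T" by (rule T.Z2_closed[OF T.d1_Z2[OF u] gh])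
    have "(-1) \<odot>\<^bsub>T\<^esub> d1 G T ?u (g, h) \<oplus>\<^bsub>T\<^esub> (d1 G T ?u (g, h) \<oplus>\<^bsub>T\<^esub> ?m (g, h)) = ?m (g, h)"
      unfolding T.M.sm_minus_one[OF dc] using dc mc[OF gh] by (simp only: T.M.r_neg1)
    moreover have "d1 G T (\<lambda>s\<in>carrier G. (-1) \<odot>\<^bsub>T\<^esub> ?u s) (g, h) = (-1) \<odot>\<^bsub>T\<^esub> d1 G T ?u (g, h)"
      unfolding v(2) using gh by simp
    ultimately show "?m (g, h) = d1 G T (\<lambda>s\<in>carrier G. (-1) \<odot>\<^bsub>T\<^esub> ?u s) (g, h) \<oplus>\<^bsub>T\<^esub> (\<lambda>s\<in>GG. E i (c s)) (g, h)"
      using gh key[OF gh] by simp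
  qed
  then show ?thesis using x.massey_eq[of f] fc by simp
qed

definition msum :: "('g \<Rightarrow> ('t \<times> ('g set \<Rightarrow> 'p mod_ring) set \<Rightarrow> 'p mod_ring) set)
    \<Rightarrow> (('g \<times> 'g \<Rightarrow> 't) set \<times> ('g set \<Rightarrow> 'p mod_ring) set \<Rightarrow> 'p mod_ring) set" where
  "msum f = (\<Oplus>\<^bsub>tensor (H2 G T) (W n)\<^esub>i\<in>I.
     tens (H2 G T) (W n) (massey G T n (attached_system G N T n (\<chi>s ! i) f)) (y i))"

text \<open>Valid for every lift \<open>F\<close> of \<open>f\<close> and every \<open>c\<close>
  above its coboundary, while the right side mentions only \<open>f\<close>. This independence is
  the uniqueness needed for the definite description in \<open>connecting\<close>.\<close>

lemma connecting_class:
  assumes F: "F \<in> C1 G TQ'" and c: "c \<in> Z2 G TW'"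
    and Ff: "\<And>g. g \<in> carrier G \<Longrightarrow> prj (F g) = f g"
    and ic: "\<And>g h. \<lbrakk>g \<in> carrier G; h \<in> carrier G\<rbrakk> \<Longrightarrow> inc (c (g, h)) = d1 G TQ' F (g, h)"
  shows "msum f \<in> carrier (tensor (H2 G T) (W n))" "class2 G TW' c = H2_tensor_map G T (W n) (msum f)"
proof -
  have cZ: "(\<lambda>s\<in>GG. E i (c s)) \<in> Z2 G T" if "i \<in> I" for i by (rule dghom.map_Z2[OF ew_hom[OF that] c])
  let ?a = "\<lambda>i. tens (H2 G T) (W n) (massey G T n (attached_system G N T n (\<chi>s ! i) f)) (y i)"
  have ae: "?a i = tens (H2 G T) (W n) (class2 G T (\<lambda>s\<in>GG. E i (c s))) (y i)" if "i \<in> I" for i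
    by (simp only: massey_class[where f = f, OF assms that])
  have ac: "?a \<in> I \<rightarrow> carrier (tensor (H2 G T) (W n))"
  proof
    fix i assume i: "i \<in> I"
    show "?a i \<in> carrier (tensor (H2 G T) (W n))"
      unfolding ae[OF i] by (rule HT.tens_closed[OF T.class2_closed[OF cZ[OF i]] y_closed[OF i]])
  qed
  show "msum f \<in> carrier (tensor (H2 G T) (W n))" unfolding msum_def by (rule HT.T.finsum_closed[OF ac])
  have cc: "c s \<in> carrier (tensor T (W n))" if "s \<in> GG" for s
    using that Wm.Z2_closed[OF c] unfolding Wd.tensor_gmod_simps(1) by auto
  let ?c = "\<lambda>i. \<lambda>s\<in>GG. tens T (W n) ((\<lambda>s\<in>GG. E i (c s)) s) (y i)"
  have cZ2: "?c i \<in> Z2 G TW'" if "i \<in> I" for i by (rule dghom.map_Z2[OF tens_dghom[OF y_closed[OF that]] cZ[OF that]])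
  have ext: "c \<in> extensional GG" using c by (simp add: Z2_def C2_def PiE_iff)
  \<comment> \<open>The two records have the same carrier, addition and zero, and
    \<open>finsum\<close> depends on nothing else.\<close>
  have fs: "finsum TW' = finsum (tensor T (W n))" by (simp add: finsum_def finprod_def fun_eq_iff)
  have "class2 G TW' c = (\<Oplus>\<^bsub>H2 G TW'\<^esub>i\<in>I. class2 G TW' (?c i))"
  proof (rule Wm.class2_finsum[OF _ cZ2 ext])
    fix g h assume gh: "g \<in> carrier G" "h \<in> carrier G"
    then have s: "(g, h) \<in> GG" by simp
    show "c (g, h) = (\<Oplus>\<^bsub>TW'\<^esub>i\<in>I. ?c i (g, h))"
      unfolding fs restrict_apply'[OF s] by (rule tensor_expand[OF cc[OF s], symmetric])
  qed simp_all
  also have "\<dots> = (\<Oplus>\<^bsub>H2 G TW'\<^esub>i\<in>I. H2_tensor_map G T (W n) (?a i))"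
  proof (rule abelian_monoid.finsum_cong'[OF _ refl])
    interpret HW: kmod "H2 G TW'" by (rule Wm.H2_kmod)
    show "abelian_monoid (H2 G TW')" by (rule HW.abelian_monoid_axioms)
    show "(\<lambda>i. H2_tensor_map G T (W n) (?a i)) \<in> I \<rightarrow> carrier (H2 G TW')"
      using ac lin_closed[OF H2t_lin] by blast
    show "class2 G TW' (?c i) = H2_tensor_map G T (W n) (?a i)" if "i \<in> I" for i
      unfolding ae[OF that] H2t_tens[OF cZ[OF that] y_closed[OF that]] ..
  qed
  also have "\<dots> = H2_tensor_map G T (W n) (msum f)"
    unfolding msum_def by (rule lin_finsum[OF HT.tensor_kmod Wm.H2_kmod H2t_lin ac, symmetric])
  finally show "class2 G TW' c = H2_tensor_map G T (W n) (msum f)" .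
qed

end

section \<open>Evaluation of the connecting map and of \<open>Psi\<close>\<close>

context basis_setting
begin

lemma Q1_gmod: "carrier TQ' = carrier (tensor T (Q (Suc n)))" "add TQ' = add (tensor T (Q (Suc n)))"
    "smult TQ' = smult (tensor T (Q (Suc n)))" "zero TQ' = zero (tensor T (Q (Suc n)))"
  by (rule dgtensor.tensor_gmod_simps[OF TQ])+

lemma Q0_gmod: "carrier TQ0 = carrier (tensor T (Q n))" "add TQ0 = add (tensor T (Q n))"
    "smult TQ0 = smult (tensor T (Q n))" "zero TQ0 = zero (tensor T (Q n))"
  by (rule dgtensor.tensor_gmod_simps[OF TQ])+

lemma lift_exists:
  assumes f: "f \<in> Z1 G TQ0"
  shows "\<exists>F\<in>C1 G TQ'. \<exists>c\<in>Z2 G TW'. (\<forall>g\<in>carrier G. prj (F g) = f g) \<and>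
    (\<forall>g\<in>carrier G. \<forall>h\<in>carrier G. inc (c (g, h)) = d1 G TQ' F (g, h))"
proof -
  have fC: "f \<in> C1 G TQ0" using f by (simp add: Z1_def)
  have fc: "f g \<in> carrier (tensor T (Q n))" if "g \<in> carrier G" for g
    using Q0m.C1_closed[OF fC that] unfolding Q0_gmod .
  \<comment> \<open>A merely set-theoretic choice of preimages. The composite with f is still
    continuous because f is locally constant.\<close>
  define s where "s z = (SOME z'. z' \<in> carrier (tensor T (Q (Suc n))) \<and> prj z' = z)" for z
  have s: "s z \<in> carrier (tensor T (Q (Suc n)))" "prj (s z) = z" if "z \<in> carrier (tensor T (Q n))" for z
  proof -
    have "\<exists>z'. z' \<in> carrier (tensor T (Q (Suc n))) \<and> prj z' = z" using prj_surj[OF that] by blast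
    from someI_ex[OF this] show "s z \<in> carrier (tensor T (Q (Suc n)))" "prj (s z) = z" unfolding s_def by blast+
  qed
  define F where "F = (\<lambda>g\<in>carrier G. s (f g))"
  have "loc_const (gtop G) f" using fC by (simp add: Q0m.C1_iff)
  then have "loc_const (gtop G) (\<lambda>g. s (f g))" by (rule loc_const_comp)
  then have "loc_const (gtop G) F" by (rule loc_const_cong) (simp add: F_def G.top)
  then have F: "F \<in> C1 G TQ'" unfolding Qm.C1_iff Q1_gmod using s(1)[OF fc] by (simp add: F_def)
  have Fc: "F \<in> carrier G \<rightarrow> carrier TQ'" using Qm.C1_closed[OF F] by blast
  have Ff: "prj (F g) = f g" if "g \<in> carrier G" for g using s(2)[OF fc[OF that]] that by (simp add: F_def)
  have dZ: "d1 G TQ' F \<in> Z2 G TQ'" by (rule Qm.d1_Z2[OF F])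
  have dc: "d1 G TQ' F (g, h) \<in> carrier (tensor T (Q (Suc n)))" if "g \<in> carrier G" "h \<in> carrier G" for g h
    using Qm.Z2_closed[OF dZ that] unfolding Q1_gmod .
  have pf: "(\<lambda>s\<in>carrier G. prj (F s)) = f"
  proof (rule extensionalityI[of _ "carrier G"])
    show "f \<in> extensional (carrier G)" using fC by (simp add: Q0m.C1_iff PiE_iff)
  qed (simp_all add: Ff)
  have d0: "prj (d1 G TQ' F (g, h)) = \<zero>\<^bsub>tensor T (Q n)\<^esub>" if g: "g \<in> carrier G" and h: "h \<in> carrier G" for g h
  proof -
    have fh: "f (g \<otimes>\<^bsub>G\<^esub> h) = f g \<oplus>\<^bsub>TQ0\<^esub> gact TQ0 g (f h)" using f g h by (simp add: Z1_def)
    have c: "f g \<in> carrier TQ0" "gact TQ0 g (f h) \<in> carrier TQ0"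
      using Q0m.C1_closed[OF fC] Q0m.act_closed g h by blast+
    have "prj (d1 G TQ' F (g, h)) = d1 G TQ0 f (g, h)" using prj.d1_natural[OF Fc g h] unfolding pf by simp
    also have "\<dots> = (gact TQ0 g (f h) \<ominus>\<^bsub>TQ0\<^esub> (f g \<oplus>\<^bsub>TQ0\<^esub> gact TQ0 g (f h))) \<oplus>\<^bsub>TQ0\<^esub> f g"
      unfolding Q0m.d1_apply[OF g h] fh ..
    also have "\<dots> = (f g \<oplus>\<^bsub>TQ0\<^esub> gact TQ0 g (f h)) \<ominus>\<^bsub>TQ0\<^esub> (f g \<oplus>\<^bsub>TQ0\<^esub> gact TQ0 g (f h))"
      using c by (simp only: a_minus_def Q0m.M.a_ac Q0m.M.a_closed Q0m.M.a_inv_closed)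
    also have "\<dots> = \<zero>\<^bsub>TQ0\<^esub>" using c by (simp only: a_minus_def Q0m.M.r_neg Q0m.M.a_closed)
    finally show ?thesis unfolding Q0_gmod .
  qed
  \<comment> \<open>Since f is a cocycle, dF is annihilated by \<open>prj\<close>, so by
    \<open>inc_ret\<close> it comes from T tensor I^n/I^(n+1), and \<open>ret\<close> names the
    preimage.\<close>
  define c where "c = (\<lambda>s\<in>GG. ret (d1 G TQ' F s))"
  have rc: "ret (d1 G TQ' F (g, h)) \<in> carrier (tensor T (W n))" if "g \<in> carrier G" "h \<in> carrier G" for g h
    by (rule lin_closed[OF ret_lin dc[OF that]])
  have ir: "inc (ret (d1 G TQ' F (g, h))) = d1 G TQ' F (g, h)" if "g \<in> carrier G" "h \<in> carrier G" for g h
    by (rule inc_ret[OF dc[OF that] d0[OF that]])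
  have cZ: "c \<in> Z2 G TW'"
    unfolding c_def
  proof (rule Wm.Z2I)
    show "ret (d1 G TQ' F (g, h)) \<in> carrier TW'" if "g \<in> carrier G" "h \<in> carrier G" for g h
      using rc[OF that] unfolding Wd.tensor_gmod_simps .
    show "loc_const G.G2 (\<lambda>s. ret (d1 G TQ' F s))" by (rule loc_const_comp[OF Qm.Z2_lc[OF dZ]])
    fix g h k assume g: "g \<in> carrier G" and h: "h \<in> carrier G" and k: "k \<in> carrier G"
    note gh = G.m_closed[OF g h] and hk = G.m_closed[OF h k]
    let ?l = "gact TW' g (ret (d1 G TQ' F (h, k))) \<oplus>\<^bsub>TW'\<^esub> ret (d1 G TQ' F (g, h \<otimes>\<^bsub>G\<^esub> k))"
    let ?r = "ret (d1 G TQ' F (g \<otimes>\<^bsub>G\<^esub> h, k)) \<oplus>\<^bsub>TW'\<^esub> ret (d1 G TQ' F (g, h))"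
    have rcm: "ret (d1 G TQ' F (a, b)) \<in> carrier TW'" if "a \<in> carrier G" "b \<in> carrier G" for a b
      using rc[OF that] unfolding Wd.tensor_gmod_simps .
    have lr: "?l \<in> carrier TW'" "?r \<in> carrier TW'"
      by (rule Wm.M.a_closed[OF Wm.act_closed[OF g rcm[OF h k]] rcm[OF g hk]])
        (rule Wm.M.a_closed[OF rcm[OF gh k] rcm[OF g h]])
    \<comment> \<open>\<open>ret\<close> need not commute with the action, so the cocycle identity
      is not pushed through it. Instead both sides are compared after the equivariant map
      \<open>inc\<close>, which \<open>ret_inc\<close> shows to be injective.\<close>
    have "inc ?l = gact TQ' g (d1 G TQ' F (h, k)) \<oplus>\<^bsub>TQ'\<^esub> d1 G TQ' F (g, h \<otimes>\<^bsub>G\<^esub> k)"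
      unfolding lin_add[OF inc.lin Wm.act_closed[OF g rcm[OF h k]] rcm[OF g hk]] inc.equi[OF g rcm[OF h k]]
        ir[OF h k] ir[OF g hk] ..
    also have "\<dots> = d1 G TQ' F (g \<otimes>\<^bsub>G\<^esub> h, k) \<oplus>\<^bsub>TQ'\<^esub> d1 G TQ' F (g, h)" by (rule Qm.Z2_cocycle[OF dZ g h k])
    also have "\<dots> = inc ?r" unfolding lin_add[OF inc.lin rcm[OF gh k] rcm[OF g h]] ir[OF gh k] ir[OF g h] ..
    finally have "inc ?l = inc ?r" .
    then have "ret (inc ?l) = ret (inc ?r)" by (rule arg_cong)
    then show "?l = ?r" using ret_inc lr unfolding Wd.tensor_gmod_simps(1) by simp
  qed
  have "inc (c (g, h)) = d1 G TQ' F (g, h)" if "g \<in> carrier G" "h \<in> carrier G" for g h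
    using ir[OF that] that by (simp add: c_def)
  then show ?thesis using F cZ Ff by blast
qed

lemma connecting_eq:
  assumes f: "f \<in> Z1 G TQ0"
  shows "msum f \<in> carrier (tensor (H2 G T) (W n))"
    and "connecting G TW' TQ' inc prj (class1 G TQ0 f) = H2_tensor_map G T (W n) (msum f)"
proof -
  have fC: "f \<in> C1 G TQ0" using f by (simp add: Z1_def)
  have fc: "f g \<in> carrier TQ0" if "g \<in> carrier G" for g by (rule Q0m.C1_closed[OF fC that])
  obtain F c where F: "F \<in> C1 G TQ'" and c: "c \<in> Z2 G TW'" and Ff: "\<forall>g\<in>carrier G. prj (F g) = f g"
    and ic: "\<forall>g\<in>carrier G. \<forall>h\<in>carrier G. inc (c (g, h)) = d1 G TQ' F (g, h)"
    using lift_exists[OF f] by blast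
  have cl: "msum f \<in> carrier (tensor (H2 G T) (W n))" "class2 G TW' c = H2_tensor_map G T (W n) (msum f)"
    using Ff ic by (auto intro!: connecting_class[OF F c, of f])
  show "msum f \<in> carrier (tensor (H2 G T) (W n))" by (rule cl(1))
  \<comment> \<open>The coboundary of 0 is the zero cochain, so \<open>f\<close> represents its own
    class and the lift obtained above witnesses existence.\<close>
  have ff: "f \<in> class1 G TQ0 f"
  proof -
    have "d0 G TQ0 \<zero>\<^bsub>TQ0\<^esub> \<oplus>\<^bsub>fun_mod (carrier G) TQ0\<^esub> f = f"
      unfolding fun_mod_simps
    proof (rule extensionalityI[of _ "carrier G"])
      show "f \<in> extensional (carrier G)" using fC by (simp add: Q0m.C1_iff PiE_iff)
      fix g assume g: "g \<in> carrier G"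
      show "(\<lambda>s\<in>carrier G. d0 G TQ0 \<zero>\<^bsub>TQ0\<^esub> s \<oplus>\<^bsub>TQ0\<^esub> f s) g = f g"
        unfolding d0_def restrict_apply'[OF g] Q0m.act_zero[OF g] a_minus_def
        by (simp only: Q0m.M.r_neg Q0m.M.zero_closed Q0m.M.l_zero fc[OF g])
    qed simp
    moreover have "d0 G TQ0 \<zero>\<^bsub>TQ0\<^esub> \<in> B1 G TQ0" unfolding B1_def by (rule imageI[OF Q0m.M.zero_closed])
    ultimately show ?thesis unfolding class1_def coset_def by (metis (mono_tags, lifting) mem_Collect_eq)
  qed
  show "connecting G TW' TQ' inc prj (class1 G TQ0 f) = H2_tensor_map G T (W n) (msum f)"
    unfolding connecting_def
  proof (rule the_equality)
    show "\<exists>f'\<in>class1 G TQ0 f. \<exists>F\<in>C1 G TQ'. \<exists>c\<in>Z2 G TW'. (\<forall>g\<in>carrier G. prj (F g) = f' g) \<and>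
        (\<forall>g\<in>carrier G. \<forall>h\<in>carrier G. inc (c (g, h)) = d1 G TQ' F (g, h)) \<and>
        H2_tensor_map G T (W n) (msum f) = class2 G TW' c"
      by (intro bexI[OF _ ff] bexI[OF _ F] bexI[OF _ c] conjI) (use Ff ic cl(2) in simp_all)
    fix B assume "\<exists>f\<in>class1 G TQ0 f. \<exists>F\<in>C1 G TQ'. \<exists>c\<in>Z2 G TW'. (\<forall>g\<in>carrier G. prj (F g) = f g) \<and>
        (\<forall>g\<in>carrier G. \<forall>h\<in>carrier G. inc (c (g, h)) = d1 G TQ' F (g, h)) \<and> B = class2 G TW' c"
    then obtain f' F c where f': "f' \<in> class1 G TQ0 f" and F: "F \<in> C1 G TQ'" and c: "c \<in> Z2 G TW'"
      and Ff: "\<forall>g\<in>carrier G. prj (F g) = f' g"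
      and ic: "\<forall>g\<in>carrier G. \<forall>h\<in>carrier G. inc (c (g, h)) = d1 G TQ' F (g, h)" and B: "B = class2 G TW' c"
      by blast
    obtain b where b: "b \<in> B1 G TQ0" "f' = b \<oplus>\<^bsub>fun_mod (carrier G) TQ0\<^esub> f"
      using f' unfolding class1_def coset_def by blast
    obtain x where x: "x \<in> carrier TQ0" "b = d0 G TQ0 x" using b(1) unfolding B1_def by blast
    obtain x' where x': "x' \<in> carrier TQ'" "prj x' = x" using prj_surj x(1) unfolding Q0_gmod Q1_gmod by blast
    \<comment> \<open>Another representative is f plus the coboundary of x. With x' a lift of x, the
      cochain F minus the coboundary of x' lifts f itself and has the same d1 as F, so
      \<open>connecting_class\<close> applies to it with the same \<open>c\<close>.\<close>
    note v = Qm.d1_smult[OF Qm.d0_C1[OF x'(1)], of "- 1"]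
    note w = Qm.d1_add[OF F v(1)]
    let ?F = "\<lambda>s\<in>carrier G. F s \<oplus>\<^bsub>TQ'\<^esub> (\<lambda>s\<in>carrier G. (-1) \<odot>\<^bsub>TQ'\<^esub> d0 G TQ' x' s) s"
    have "prj (?F g) = f g" if g: "g \<in> carrier G" for g
    proof -
      have dx: "d0 G TQ' x' g = gact TQ' g x' \<ominus>\<^bsub>TQ'\<^esub> x'" using g by (simp add: d0_def)
      have dc: "d0 G TQ' x' g \<in> carrier TQ'" by (rule Qm.C1_closed[OF Qm.d0_C1[OF x'(1)] g])
      let ?d = "d0 G TQ0 x g"
      have dc0: "?d \<in> carrier TQ0" by (rule Q0m.C1_closed[OF Q0m.d0_C1[OF x(1)] g])
      have pd: "prj (d0 G TQ' x' g) = ?d"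
        unfolding dx lin_minus[OF Qm.M.kmod_axioms' Q0m.M.kmod_axioms' prj.lin Qm.act_closed[OF g x'(1)] x'(1)]
          prj.equi[OF g x'(1)] x'(2) using g by (simp add: d0_def)
      have "?F g = F g \<oplus>\<^bsub>TQ'\<^esub> (-1) \<odot>\<^bsub>TQ'\<^esub> d0 G TQ' x' g" using g by simp
      then have "prj (?F g) = prj (F g) \<oplus>\<^bsub>TQ0\<^esub> (-1) \<odot>\<^bsub>TQ0\<^esub> ?d"
        by (simp only: lin_add[OF prj.lin Qm.C1_closed[OF F g] Qm.M.sm_closed[OF dc]] lin_smult[OF prj.lin dc] pd)
      also have "prj (F g) = ?d \<oplus>\<^bsub>TQ0\<^esub> f g"
        using Ff g unfolding b(2) x(2) fun_mod_simps by simp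
      also have "(?d \<oplus>\<^bsub>TQ0\<^esub> f g) \<oplus>\<^bsub>TQ0\<^esub> (-1) \<odot>\<^bsub>TQ0\<^esub> ?d = f g \<oplus>\<^bsub>TQ0\<^esub> (?d \<oplus>\<^bsub>TQ0\<^esub> \<ominus>\<^bsub>TQ0\<^esub> ?d)"
        unfolding Q0m.M.sm_minus_one[OF dc0]
        by (simp only: Q0m.M.a_ac Q0m.M.a_inv_closed Q0m.M.a_closed dc0 fc[OF g])
      also have "\<dots> = f g" by (simp only: Q0m.M.r_neg[OF dc0] Q0m.M.r_zero fc[OF g])
      finally show ?thesis .
    qed
    moreover have "inc (c (g, h)) = d1 G TQ' ?F (g, h)" if gh: "g \<in> carrier G" "h \<in> carrier G" for g h
    proof -
      have "d1 G TQ' ?F (g, h) = d1 G TQ' F (g, h) \<oplus>\<^bsub>TQ'\<^esub> (-1) \<odot>\<^bsub>TQ'\<^esub> d1 G TQ' (d0 G TQ' x') (g, h)"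
        unfolding w(2) v(2) using gh by simp
      also have "\<dots> = d1 G TQ' F (g, h)"
        unfolding Qm.d1_d0[OF x'(1) gh] Qm.M.sm_zero_right by (rule Qm.M.r_zero[OF Qm.Z2_closed[OF Qm.d1_Z2[OF F] gh]])
      finally show ?thesis using ic gh by simp
    qed
    ultimately show "B = H2_tensor_map G T (W n) (msum f)"
      unfolding B by (rule connecting_class(2)[OF w(1) c])
  qed
qed

text \<open>The connecting class is the image of \<open>msum f\<close> under an injective map, so
  \<open>inv_into\<close> returns \<open>msum f\<close>.\<close>

lemma Psi_eq:
  assumes f: "f \<in> Z1 G TQ0" shows "Psi G N T n (class1 G TQ0 f) = msum f"
proof -
  have i: "tensor_lift (tensor T (Q (Suc n))) (\<lambda>t w. tens T (Q (Suc n)) t w) = inc" unfolding tmap_def ..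
  have j: "tensor_lift (tensor T (Q n)) (\<lambda>t q. tens T (Q n) t (quot_lift (\<lambda>x. aug_pow G N n +>\<^bsub>omega G N\<^esub> x) q)) = prj"
    unfolding tmap_def pq_def aug_pow_eq omega_def ..
  have inj: "inj_on (H2_tensor_map G T (W n)) (carrier (tensor (H2 G T) (W n)))"
    by (rule inj_on_inverseI[of _ H2inv]) (rule H2inv_H2t)
  have "Psi G N T n (class1 G TQ0 f) =
      inv_into (carrier (tensor (H2 G T) (W n))) (H2_tensor_map G T (W n)) (connecting G TW' TQ' inc prj (class1 G TQ0 f))"
    unfolding Psi_def Let_def Suc_eq_plus1[symmetric] i j ..
  then show ?thesis unfolding connecting_eq(2)[OF f] inv_into_f_f[OF inj connecting_eq(1)[OF f]] .
qed

end

section \<open>Profinite groups and compact modules\<close>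

text \<open>The generators are the preimages of the unit vectors and the dual characters are the
  coordinates of the isomorphism.\<close>

lemma elem_ab_group_of_iso:
  fixes H :: "('a, 'b) monoid_scheme"
  assumes H: "group H"
    and iso: "H \<cong> product_group {..<r} (\<lambda>_. add_monoid (class_ring :: 'p::prime_card mod_ring ring))"
  shows "\<exists>e (x :: nat \<Rightarrow> 'a \<Rightarrow> 'p mod_ring). elem_ab_group H r e x"
proof -
  let ?P = "product_group {..<r} (\<lambda>_. add_monoid (class_ring :: 'p mod_ring ring))"
  interpret group H by (rule H)
  obtain \<psi> where \<psi>: "\<psi> \<in> iso H ?P" using iso by (auto simp: is_iso_def)
  define \<phi> where "\<phi> = inv_into (carrier H) \<psi>"
  have \<phi>: "\<phi> \<in> iso ?P H" unfolding \<phi>_def by (rule iso_set_sym[OF \<psi>])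
  have bij: "bij_betw \<psi> (carrier H) ({..<r} \<rightarrow>\<^sub>E UNIV)" using \<psi> by (auto simp: iso_def)
  have \<psi>c: "\<psi> h \<in> {..<r} \<rightarrow>\<^sub>E UNIV" if "h \<in> carrier H" for h using bij that by (auto simp: bij_betw_def)
  have \<psi>m: "\<psi> (g \<otimes>\<^bsub>H\<^esub> h) = (\<lambda>i\<in>{..<r}. \<psi> g i + \<psi> h i)" if "g \<in> carrier H" "h \<in> carrier H" for g h
    using \<psi> that by (auto simp: iso_def hom_def)
  have \<phi>c: "\<phi> v \<in> carrier H" if "v \<in> {..<r} \<rightarrow>\<^sub>E UNIV" for v using \<phi> that by (auto simp: iso_def hom_def)
  have \<phi>m: "\<phi> (\<lambda>i\<in>{..<r}. v i + w i) = \<phi> v \<otimes>\<^bsub>H\<^esub> \<phi> w" if "v \<in> {..<r} \<rightarrow>\<^sub>E UNIV" "w \<in> {..<r} \<rightarrow>\<^sub>E UNIV" for v w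
    using \<phi> that by (auto simp: iso_def hom_def)
  have \<psi>\<phi>: "\<psi> (\<phi> v) = v" if "v \<in> {..<r} \<rightarrow>\<^sub>E UNIV" for v
    unfolding \<phi>_def by (rule bij_betw_inv_into_right[OF bij that])
  have \<phi>\<psi>: "\<phi> (\<psi> h) = h" if "h \<in> carrier H" for h
    unfolding \<phi>_def by (rule bij_betw_inv_into_left[OF bij that])
  define u :: "nat \<Rightarrow> nat \<Rightarrow> 'p mod_ring" where "u i = (\<lambda>j\<in>{..<r}. if j = i then 1 else 0)" for i
  have uc: "u i \<in> {..<r} \<rightarrow>\<^sub>E UNIV" for i by (simp add: u_def)
  have comm: "comm_group H"
  proof (rule group_comm_groupI)
    fix g h assume gh: "g \<in> carrier H" "h \<in> carrier H"
    have "\<psi> (g \<otimes>\<^bsub>H\<^esub> h) = \<psi> (h \<otimes>\<^bsub>H\<^esub> g)" unfolding \<psi>m[OF gh] \<psi>m[OF gh(2,1)] by (simp only: add.commute)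
    then show "g \<otimes>\<^bsub>H\<^esub> h = h \<otimes>\<^bsub>H\<^esub> g"
      by (rule inj_onD[OF bij_betw_imp_inj_on[OF bij]]) (use gh in simp_all)
  qed
  have fin: "finite (carrier H)"
    using bij_betw_finite[OF bij] by (simp add: finite_PiE)
  have one0: "\<psi> \<one>\<^bsub>H\<^esub> i = 0" if "i < r" for i
  proof -
    have "\<psi> (\<one>\<^bsub>H\<^esub> \<otimes>\<^bsub>H\<^esub> \<one>\<^bsub>H\<^esub>) i = \<psi> \<one>\<^bsub>H\<^esub> i + \<psi> \<one>\<^bsub>H\<^esub> i" using that by (simp only: \<psi>m one_closed restrict_apply' lessThan_iff)
    then show ?thesis by (metis l_one one_closed add_0_right add_left_cancel)
  qed
  \<comment> \<open>By induction on k for vectors whose coordinates from k on vanish.\<close>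
  have gen: "carrier H \<subseteq> S"
    if S1: "\<one>\<^bsub>H\<^esub> \<in> S" and Se: "\<And>i. i < r \<Longrightarrow> \<phi> (u i) \<in> S"
      and Sm: "\<And>g h. \<lbrakk>g \<in> S; h \<in> S; g \<in> carrier H; h \<in> carrier H\<rbrakk> \<Longrightarrow> g \<otimes>\<^bsub>H\<^esub> h \<in> S" for S
  proof -
    have "v \<in> {..<r} \<rightarrow>\<^sub>E UNIV \<Longrightarrow> (\<And>j. k \<le> j \<Longrightarrow> j < r \<Longrightarrow> v j = 0) \<Longrightarrow> \<phi> v \<in> S" if "k \<le> r" for k v
      using that
    proof (induction k arbitrary: v)
      case 0
      have "\<psi> \<one>\<^bsub>H\<^esub> = v"
        by (rule PiE_ext[OF \<psi>c[OF one_closed] "0.prems"(1)]) (simp add: one0 "0.prems"(2))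
      then show ?case using \<phi>\<psi>[OF one_closed] S1 by simp
    next
      case (Suc k)
      have k: "k < r" using Suc.prems by simp
      \<comment> \<open>Coordinate k is raised from 0 by adding the unit vector m times. Every
        element of the prime field is of the form \<open>of_nat m\<close>, so this reaches the given
        vector.\<close>
      have add: "\<phi> (v(k := of_nat m)) \<in> S" for m
      proof (induction m)
        case 0
        show ?case
        proof (rule Suc.IH)
          show "v(k := of_nat 0) \<in> {..<r} \<rightarrow>\<^sub>E UNIV" using Suc.prems(1) k by (auto simp: PiE_iff extensional_def)
          show "(v(k := of_nat 0)) j = 0" if "k \<le> j" "j < r" for j using that Suc.prems(2)[of j] by (cases "j = k") auto
          show "k \<le> r" using k by simp
        qed
      next
        case (Suc m)
        have vc: "v(k := of_nat m) \<in> {..<r} \<rightarrow>\<^sub>E UNIV" using Suc.prems \<open>v \<in> {..<r} \<rightarrow>\<^sub>E UNIV\<close> k by (auto simp: PiE_iff extensional_def)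
        have vc': "v(k := of_nat (Suc m)) \<in> {..<r} \<rightarrow>\<^sub>E UNIV" using \<open>v \<in> {..<r} \<rightarrow>\<^sub>E UNIV\<close> k by (auto simp: PiE_iff extensional_def)
        have e: "(\<lambda>i\<in>{..<r}. (v(k := of_nat m)) i + u k i) = v(k := of_nat (Suc m))"
          by (rule PiE_ext[of _ "{..<r}" "\<lambda>_. UNIV"]) (use vc' in \<open>auto simp: u_def\<close>)
        have "\<phi> (v(k := of_nat (Suc m))) = \<phi> (v(k := of_nat m)) \<otimes>\<^bsub>H\<^esub> \<phi> (u k)"
          using \<phi>m[OF vc uc[of k]] unfolding e .
        then show ?case using Sm[OF Suc.IH Se[OF k] \<phi>c[OF vc] \<phi>c[OF uc]] by (simp only:)
      qed
      obtain m where "v k = of_nat m" using surj_of_nat_mod_ring[of "v k"] by blast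
      then have "v(k := of_nat m) = v" by auto
      then show ?case using add[of m] by simp
    qed
    from this[of r] have "\<phi> v \<in> S" if "v \<in> {..<r} \<rightarrow>\<^sub>E UNIV" for v using that by simp
    then show ?thesis using \<psi>c \<phi>\<psi> by (metis subsetI)
  qed
  have "elem_ab_group H r (\<lambda>i. \<phi> (u i)) (\<lambda>i. \<lambda>h\<in>carrier H. \<psi> h i)"
  proof (intro elem_ab_group.intro elem_ab_group_axioms.intro fin_ab_group.intro fin_ab_group_axioms.intro comm fin)
    show "\<phi> (u i) \<in> carrier H" for i by (rule \<phi>c[OF uc])
    show "(\<lambda>h\<in>carrier H. \<psi> h i) \<in> character_group H" if "i < r" for i
      using that by (simp add: character_group_def hom_def \<psi>m)
    show "(\<lambda>h\<in>carrier H. \<psi> h i) (\<phi> (u j)) = (if i = j then 1 else 0)" if "i < r" "j < r" for i j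
      using that by (simp add: \<phi>c[OF uc] \<psi>\<phi>[OF uc]) (simp add: u_def)
    show "carrier H \<subseteq> S" if "\<one>\<^bsub>H\<^esub> \<in> S" "\<And>i. i < r \<Longrightarrow> \<phi> (u i) \<in> S"
      "\<And>g h. \<lbrakk>g \<in> S; h \<in> S; g \<in> carrier H; h \<in> carrier H\<rbrakk> \<Longrightarrow> g \<otimes>\<^bsub>H\<^esub> h \<in> S" for S
      using that by (rule gen)
  qed
  then show ?thesis by blast
qed

text \<open>A closed subgroup of finite index is open: the complement of a coset is a finite union
  of translates of N, which are closed because right translation is continuous.\<close>

lemma (in tgroup) coset_loc_const:
  assumes N: "N \<lhd> G" and cl: "closedin (gtop G) N" and fin: "finite (carrier (G Mod N))"
  shows "loc_const (gtop G) (\<lambda>g. N #> g)"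
proof -
  have sub: "subgroup N G" using N by (rule normal_imp_subgroup)
  have trans: "continuous_map (gtop G) (gtop G) (\<lambda>x. x \<otimes> a)" if "a \<in> carrier G" for a
  proof -
    have "continuous_map (gtop G) (prod_topology (gtop G) (gtop G)) (\<lambda>x. (x, a))"
      using that top by (intro continuous_map_pairedI) simp_all
    from continuous_map_compose[OF this cont_mult] show ?thesis by (simp add: o_def)
  qed
  have closed: "closedin (gtop G) (N #> g)" if g: "g \<in> carrier G" for g
  proof -
    have "closedin (gtop G) {x \<in> topspace (gtop G). x \<otimes> inv g \<in> N}"
      using closedin_continuous_map_preimage[OF trans[OF inv_closed[OF g]] cl] .
    moreover have "{x \<in> topspace (gtop G). x \<otimes> inv g \<in> N} = N #> g"
    proof (rule subset_antisym; rule subsetI)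
      fix x assume "x \<in> {x \<in> topspace (gtop G). x \<otimes> inv g \<in> N}"
      then have x: "x \<in> carrier G" "x \<otimes> inv g \<in> N" using top by auto
      then have "x = (x \<otimes> inv g) \<otimes> g" using g by (simp add: m_assoc)
      then show "x \<in> N #> g" unfolding r_coset_def using x(2) by blast
    next
      fix x assume "x \<in> N #> g"
      then obtain h where h: "h \<in> N" "x = h \<otimes> g" unfolding r_coset_def by blast
      have "h \<in> carrier G" using h(1) subgroup.subset[OF sub] by blast
      then show "x \<in> {x \<in> topspace (gtop G). x \<otimes> inv g \<in> N}" using h g top by (simp add: m_assoc)
    qed
    ultimately show ?thesis by simp
  qed
  show ?thesis unfolding loc_const_def
  proof
    fix g assume "g \<in> topspace (gtop G)"
    then have g: "g \<in> carrier G" using top by simp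
    let ?R = "rcosets N - {N #> g}"
    have gR: "N #> g \<in> rcosets N" using g by (auto simp: RCOSETS_def)
    have "closedin (gtop G) (\<Union>?R)"
    proof (rule closedin_Union)
      show "finite ?R" using fin by (simp add: FactGroup_def)
      show "closedin (gtop G) S" if "S \<in> ?R" for S using that closed by (auto simp: RCOSETS_def)
    qed
    moreover have "carrier G - \<Union>?R = N #> g"
    proof (rule subset_antisym; rule subsetI)
      fix x assume "x \<in> carrier G - \<Union>?R"
      then show "x \<in> N #> g" using rcosets_part_G[OF sub] by blast
    next
      fix x assume x: "x \<in> N #> g"
      have "x \<notin> S" if "S \<in> ?R" for S
        using that x gR rcos_disjoint[OF sub] unfolding pairwise_def disjnt_def by blast
      then show "x \<in> carrier G - \<Union>?R" using x rcosets_part_G[OF sub] gR by blast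
    qed
    ultimately have "openin (gtop G) (N #> g)"
      using openin_closedin_eq[of "gtop G" "N #> g"] top rcosets_part_G[OF sub] gR
      by (metis closedin_def top)
    moreover have "g \<in> N #> g" by (rule rcos_self[OF g sub])
    moreover have "\<forall>y\<in>N #> g. N #> y = N #> g" using repr_independence[OF _ g sub] by simp
    ultimately show "\<exists>U. openin (gtop G) U \<and> g \<in> U \<and> (\<forall>y\<in>U. N #> y = N #> g)" by blast
  qed
qed

text \<open>A finite-dimensional space over F_p is finite, and a finite Hausdorff space is discrete.
  Continuity of the orbit map of x is joint continuity restricted to pairs (g, x).\<close>

lemma compact_gmodule_dgmod:
  fixes T :: "('p::prime_card mod_ring, 'g, 't) gmodule"
  assumes G: "tgroup G" and T: "compact_gmodule G T" and fd: "vectorspace.fin_dim class_ring T"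
  shows "dgmod G T"
proof -
  interpret G: tgroup G by fact
  have m: "module class_ring T" using T by (simp add: compact_gmodule_def)
  interpret K: kmod T unfolding kmod_def by (rule m)
  interpret V: vectorspace class_ring T by (intro vectorspace.intro m class_field)
  obtain B where B: "finite B" "B \<subseteq> carrier T" "K.span B = carrier T"
    using fd V.fin_dim_def by auto
  \<comment> \<open>Coefficient functions may be restricted to the finite generating set
    \<open>B\<close>; only finitely many remain, as the field is finite.\<close>
  have "carrier T \<subseteq> (\<lambda>a. K.lincomb a B) ` (B \<rightarrow>\<^sub>E UNIV)"
  proof
    fix t assume "t \<in> carrier T"
    then have "t \<in> {K.lincomb a B | a. a \<in> B \<rightarrow> carrier class_ring}" using K.finite_span[OF B(1,2)] B(3) by simp
    then obtain a where "t = K.lincomb a B" by blast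
    moreover have "K.lincomb a B = K.lincomb (restrict a B) B"
      unfolding K.lincomb_def by (rule K.finsum_cong') (use B(2) in auto)
    ultimately have t: "t = K.lincomb (restrict a B) B" by (rule trans)
    show "t \<in> (\<lambda>a. K.lincomb a B) ` (B \<rightarrow>\<^sub>E UNIV)" unfolding t by (rule imageI, rule restrict_PiE_iff[THEN iffD2]) simp
  qed
  moreover have "finite (B \<rightarrow>\<^sub>E (UNIV :: 'p mod_ring set))" by (rule finite_PiE[OF B(1)]) simp
  ultimately have fin: "finite (carrier T)" using finite_subset finite_imageI by blast
  have disc: "mtop T = discrete_topology (carrier T)"
    using T fin by (intro finite_t1_space_imp_discrete_topology)
      (auto simp: compact_gmodule_def Hausdorff_imp_t1_space)
  show ?thesis
  proof (intro dgmod.intro dgmod_axioms.intro G K.kmod_axioms' disc)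
    fix x assume x: "x \<in> carrier T"
    have top: "topspace (mtop T) = carrier T" using T by (simp add: compact_gmodule_def)
    have "continuous_map (gtop G) (prod_topology (gtop G) (mtop T)) (\<lambda>g. (g, x))"
      using x top by (intro continuous_map_pairedI) simp_all
    moreover have "continuous_map (prod_topology (gtop G) (mtop T)) (mtop T) (\<lambda>(g, x). gact T g x)"
      using T by (simp add: compact_gmodule_def)
    ultimately have "continuous_map (gtop G) (mtop T) ((\<lambda>(g, x). gact T g x) \<circ> (\<lambda>g. (g, x)))"
      by (rule continuous_map_compose)
    then have "continuous_map (gtop G) (mtop T) (\<lambda>g. gact T g x)" by (simp add: o_def)
    then show "loc_const (gtop G) (\<lambda>g. gact T g x)" unfolding disc continuous_map_discrete_iff by simp
  qed (use T in \<open>simp_all add: compact_gmodule_def\<close>)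
qed

theorem theorem4p14:
  fixes G :: "'g topgroup" and N :: "'g set"
    and T :: "('p::prime_card mod_ring, 'g, 't) gmodule"
    and r n :: nat
  assumes "profinite_group G"
    and "N \<lhd> G" and "closedin (gtop G) N"
    and "r \<ge> 1"
    and "G Mod N \<cong> product_group {..<r} (\<lambda>_. add_monoid (class_ring :: 'p mod_ring ring))"
    and "1 \<le> n" and "n < CARD('p)"
    and "compact_gmodule G T" and "vectorspace.fin_dim class_ring T"
  shows "(\<exists>\<chi>s. length \<chi>s \<ge> 1 \<and> set \<chi>s \<subseteq> character_group (G Mod N) \<and>
             ordered_basis (dual_mod (omega_gr G N n :: ('p mod_ring, 'g, _) gmodule))
               (map (p_gr G N n) \<chi>s)) \<and>
         (\<forall>\<chi>s ys f.
            length \<chi>s \<ge> 1 \<longrightarrow> set \<chi>s \<subseteq> character_group (G Mod N) \<longrightarrow>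
            ordered_basis (dual_mod (omega_gr G N n :: ('p mod_ring, 'g, _) gmodule))
              (map (p_gr G N n) \<chi>s) \<longrightarrow>
            is_dual_basis (omega_gr G N n) (map (p_gr G N n) \<chi>s) ys \<longrightarrow>
            f \<in> Z1 G (tensor_gmod T (omega_quot G N n)) \<longrightarrow>
            (\<forall>i<length \<chi>s. proper_defining_system G N T n (\<chi>s ! i) (cocycle_image G T f)
               (attached_system G N T n (\<chi>s ! i) f)) \<and>
            Psi G N T n (class1 G (tensor_gmod T (omega_quot G N n)) f) =
              (\<Oplus>\<^bsub>tensor (H2 G T) (omega_gr G N n)\<^esub>i\<in>{..<length \<chi>s}.
                 tens (H2 G T) (omega_gr G N n)
                   (massey G T n (attached_system G N T n (\<chi>s ! i) f)) (ys ! i)))"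
proof -
  have G: "tgroup G"
    using assms(1) by (intro tgroup.intro tgroup_axioms.intro) (simp_all add: profinite_group_def)
  interpret G: tgroup G by (rule G)
  have HG: "group (G Mod N)" by (rule normal.factorgroup_is_group[OF assms(2)])
  obtain e and x :: "nat \<Rightarrow> 'g set \<Rightarrow> 'p mod_ring" where "elem_ab_group (G Mod N) r e x"
    using elem_ab_group_of_iso[OF HG assms(5)] by blast
  then interpret EA: elem_ab_group "G Mod N" r e x .
  have S: "massey_setting G N T n"
  proof (intro massey_setting.intro omega_setting.intro omega_setting_axioms.intro
      massey_setting_axioms.intro G assms(2,6,7) EA.fin_ab_group_axioms)
    show "loc_const (gtop G) (\<lambda>g. N #>\<^bsub>G\<^esub> g)" by (rule G.coset_loc_const[OF assms(2,3) EA.fin])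
    show "dgmod G T" by (rule compact_gmodule_dgmod[OF G assms(8,9)])
  qed
  interpret S: massey_setting G N "TYPE('p)" T n by (rule S)
  have cs: "char_setting G N T n \<chi>" if "\<chi> \<in> character_group (G Mod N)" for \<chi>
    using that by (intro char_setting.intro char_setting_axioms.intro S)
  \<comment> \<open>The two modules differ as records only in fields that \<open>dual_mod\<close>
    does not read.\<close>
  have dW: "dual_mod (omega_gr G N n :: ('p mod_ring, 'g, _) gmodule) = dual_mod (EA.gr n)"
    unfolding dual_mod_def S.W_simps ..
  show ?thesis
  proof (intro conjI allI impI)
    obtain \<chi>s :: "('g set \<Rightarrow> 'p mod_ring) list" where c: "length \<chi>s \<ge> 1" "set \<chi>s \<subseteq> character_group (G Mod N)"
      "ordered_basis (dual_mod (EA.gr n)) (map (\<lambda>\<chi>. character.gr_fun (G Mod N) \<chi> n) \<chi>s)"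
      using EA.exists_dual_basis[OF assms(7,4)] by blast
    have mapeq: "map (p_gr G N n) \<chi>s = map (\<lambda>\<chi>. character.gr_fun (G Mod N) \<chi> n) \<chi>s"
      using c(2) char_setting.p_gr_eq[OF cs] by (intro map_cong) auto
    show "\<exists>\<chi>s. length \<chi>s \<ge> 1 \<and> set \<chi>s \<subseteq> character_group (G Mod N) \<and>
        ordered_basis (dual_mod (omega_gr G N n :: ('p mod_ring, 'g, _) gmodule)) (map (p_gr G N n) \<chi>s)"
      unfolding dW by (intro exI[of _ \<chi>s] conjI c(1,2)) (unfold mapeq, rule c(3))
  next
    fix \<chi>s :: "('g set \<Rightarrow> 'p mod_ring) list" and ys f i
    assume chi: "set \<chi>s \<subseteq> character_group (G Mod N)" and f: "f \<in> Z1 G (tensor_gmod T (omega_quot G N n))"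
      and i: "i < length \<chi>s"
    have "\<chi>s ! i \<in> character_group (G Mod N)" using chi i by auto
    then show "proper_defining_system G N T n (\<chi>s ! i) (cocycle_image G T f) (attached_system G N T n (\<chi>s ! i) f)"
      by (rule char_setting.attached_proper[OF cs f])
  next
    fix \<chi>s :: "('g set \<Rightarrow> 'p mod_ring) list" and ys f
    assume chi: "set \<chi>s \<subseteq> character_group (G Mod N)" and f: "f \<in> Z1 G (tensor_gmod T (omega_quot G N n))"
      and ys: "is_dual_basis (omega_gr G N n) (map (p_gr G N n) \<chi>s) ys"
    have B: "basis_setting G N T n \<chi>s ys"
      by (intro basis_setting.intro basis_setting_axioms.intro S chi ys)
    show "Psi G N T n (class1 G (tensor_gmod T (omega_quot G N n)) f) =
        (\<Oplus>\<^bsub>tensor (H2 G T) (omega_gr G N n)\<^esub>i\<in>{..<length \<chi>s}.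
           tens (H2 G T) (omega_gr G N n) (massey G T n (attached_system G N T n (\<chi>s ! i) f)) (ys ! i))"
      using basis_setting.Psi_eq[OF B f] unfolding basis_setting.msum_def[OF B] .
  qed
qed

end
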